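(* Let $(M,g,J)$ be a compact fiberwise Kähler toric manifold of cohomogeneity one such that $M$ is a $\mathbb CP^1$-bundle over a coadjoint orbit $G/L$ whose isotropy representation has $m$ distinct summands, or over the product of $m$ Kähler–Einstein manifolds $M_k$. Every such manifold admits, up to scaling, an $m$-parameter family of extremal Kähler metrics.
   Context: A Kähler metric is extremal if it is a critical point of $\int S^2\,d\mathrm{vol}$ among Kähler metrics in its Kähler class; equivalently the gradient of the scalar curvature $S$ is a holomorphic vector field. A fiberwise Kähler toric manifold of cohomogeneity one is a Kähler manifold $(M,g,J)$ of one of two kinds. (Construction One) $M$ is irreducible, not hyperkähler, and of cohomogeneity one (principal orbits of real codimension one) under an isometric action of a compact connected semisimple Lie group $G$ with principal isotropy group $K$; the moment map sends each principal orbit $G/K$ onto a coadjoint orbit $G/L$ with $L/K\cong S^1$, and the isotropy representation of $G/K$ is $\mathfrak t^1\oplus\mathfrak p_1\oplus\dots\oplus\mathfrak p_m$ with $\mathfrak t^1$ trivial one-dimensional and $\mathfrak p_i$ nontrivial, irreducible, pairwise inequivalent, of real dimension $d_i$; $g_i^*$ denotes an invariant background inner product on $\mathfrak p_i$ normalized so that the Ricci tensor $r^*$ of the induced Kähler metric on $G/L$ satisfies $r^*(Y,Y)=1$ for unit $Y\in\mathfrak p_i$. (Construction Two) $(M_i,g_i^* )$, $1\le i\le m$, are compact Kähler–Einstein manifolds of real dimension $d_i$ with Einstein constant $1$ and Kähler forms $\omega_i^*$, and each principal orbit is a principal $S^1$-bundle $\pi:P\to M_1\times\dots\times M_m$ with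 connection form $\theta$, $d\theta=\pi^*\sum_i b_i\omega_i^*$. In both cases, on the open dense union of principal orbits, parametrized by $x$ in an open interval, $$g=\frac1{h}\,dx^2+h\,\theta\otimes\theta+\sum_{i=1}^m A_i\,g_i^*,\qquad h=h(x)>0,\quad A_i=b_ix+a_i>0,$$ with $\theta$ dual to the generator $\partial_\phi$ of the $S^1$-fibres, $J$ mapping the $x$-direction to the $\partial_\phi$-direction and restricting to the lifted complex structure of the base. The constants $b_i$ (not all zero) are determined by the principal orbit type, hence fixed for the given manifold, while the $a_i$ and $h$ vary with the metric. $M$ is a $\mathbb CP^1$-bundle when it has two special orbits at each of which only the $S^1$-fibre collapses and all $A_i\neq0$; by translation and scaling these are at $x=0$ and $x=1$, with $h(0)=h(1)=0$, $h'(0)=2$, $h'(1)=-2$. The metrics asserted are of this same form.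
   Formalization: Over a coadjoint orbit G/L the family is indexed only by those constants a_i for which the induced metrics on G/L are Kähler; this can be fewer than m parameters (e.g. 2 rather than m=3 over SU(3)/T^2, where m is impossible). *)

theory Defs
  imports "HOL-Analysis.Analysis"
begin

section \<open>Calculus in coordinates\<close>

text \<open>
  The dimension of a manifold is the cardinality of an index set \<open>I :: 'n set\<close>, and its charts take
  values in the coordinate subspace \<open>\<real>\<^sup>I\<close> of \<open>real ^ 'n\<close>.  This allows the factors of a product to
  have different dimensions although they share one type.  Components of tensors are meaningful
  only at indices in \<open>I\<close>.
\<close>

definition coord :: "'n::finite set \<Rightarrow> (real ^ 'n) set" where
  "coord I = {y. \<forall>i. i \<notin> I \<longrightarrow> y $ i = 0}"

definition pd :: "'n::finite \<Rightarrow> (real ^ 'n \<Rightarrow> 'a::real_normed_vector) \<Rightarrow> real ^ 'n \<Rightarrow> 'a" where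
  "pd i f y = vector_derivative (\<lambda>t. f (y + t *\<^sub>R axis i 1)) (at 0)"

primrec Ck :: "nat \<Rightarrow> 'n::finite set \<Rightarrow> (real ^ 'n) set \<Rightarrow> (real ^ 'n \<Rightarrow> 'a::real_normed_vector) \<Rightarrow> bool"
where
  "Ck 0 I U f \<longleftrightarrow> continuous_on U f"
| "Ck (Suc r) I U f \<longleftrightarrow> continuous_on U f \<and>
     (\<forall>i\<in>I. (\<forall>y\<in>U. (\<lambda>t. f (y + t *\<^sub>R axis i 1)) differentiable (at 0)) \<and> Ck r I U (pd i f))"

text \<open>Used for \<open>U\<close> relatively open in \<open>coord I\<close>.\<close>

definition smooth :: "'n::finite set \<Rightarrow> (real ^ 'n) set \<Rightarrow> (real ^ 'n \<Rightarrow> 'a::real_normed_vector) \<Rightarrow> bool"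
  where "smooth I U f \<longleftrightarrow> (\<forall>r. Ck r I U f)"

text \<open>\<open>C\<^sup>\<infinity>\<close> up to the boundary of the interval \<open>[l, u]\<close>.\<close>

definition smooth_closed_interval :: "real \<Rightarrow> real \<Rightarrow> (real \<Rightarrow> real) \<Rightarrow> bool" where
  "smooth_closed_interval l u h \<longleftrightarrow>
     (\<exists>S. open S \<and> {l..u} \<subseteq> S \<and> (\<forall>k. ((deriv ^^ k) h) differentiable_on S))"


section \<open>Manifolds and smooth maps\<close>

type_synonym ('p, 'n) chart = "'p set \<times> ('p \<Rightarrow> real ^ 'n)"

record ('p, 'n) mfd =
  mtop :: "'p topology"
  idx :: "'n set"
  atlas :: "('p, 'n) chart set"

abbreviation pts :: "('p, 'n) mfd \<Rightarrow> 'p set" where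
  "pts M \<equiv> topspace (mtop M)"

definition crange :: "('p, 'n) chart \<Rightarrow> (real ^ 'n) set" where
  "crange c = snd c ` fst c"

definition point :: "('p, 'n) chart \<Rightarrow> real ^ 'n \<Rightarrow> 'p" where
  "point c = inv_into (fst c) (snd c)"

definition closed_manifold :: "('p, 'n::finite) mfd \<Rightarrow> bool" where
  "closed_manifold M \<longleftrightarrow>
     Hausdorff_space (mtop M) \<and> second_countable (mtop M) \<and>
     compact_space (mtop M) \<and> connected_space (mtop M) \<and> pts M \<noteq> {} \<and>
     (\<Union>c\<in>atlas M. fst c) = pts M \<and>
     (\<forall>c\<in>atlas M. openin (mtop M) (fst c) \<and>
        openin (top_of_set (coord (idx M))) (crange c) \<and>
        homeomorphic_map (subtopology (mtop M) (fst c)) (top_of_set (crange c)) (snd c)) \<and>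
     (\<forall>c\<in>atlas M. \<forall>c'\<in>atlas M. smooth (idx M) (snd c ` (fst c \<inter> fst c')) (snd c' \<circ> point c))"

text \<open>Differential of \<open>f\<close> at the point with coordinates \<open>y\<close> in the chart \<open>c\<close>, read in the charts \<open>c\<close>
  of the source (with index set \<open>I\<close>) and \<open>c'\<close> of the target.\<close>

definition dmap :: "'n::finite set \<Rightarrow> ('p, 'n) chart \<Rightarrow> ('q, 'k::finite) chart \<Rightarrow> ('p \<Rightarrow> 'q) \<Rightarrow>
    real ^ 'n \<Rightarrow> real ^ 'n \<Rightarrow> real ^ 'k" where
  "dmap I c c' f y v = (\<Sum>i\<in>I. v $ i *\<^sub>R pd i (snd c' \<circ> f \<circ> point c) y)"

definition dfun :: "'n::finite set \<Rightarrow> ('p, 'n) chart \<Rightarrow> ('p \<Rightarrow> real) \<Rightarrow> real ^ 'n \<Rightarrow> real ^ 'n \<Rightarrow> real" where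
  "dfun I c f y v = (\<Sum>i\<in>I. v $ i * pd i (f \<circ> point c) y)"

definition smooth_map :: "('p, 'n::finite) mfd \<Rightarrow> ('q, 'k::finite) mfd \<Rightarrow> ('p \<Rightarrow> 'q) \<Rightarrow> bool" where
  "smooth_map M N f \<longleftrightarrow> continuous_map (mtop M) (mtop N) f \<and>
     (\<forall>c\<in>atlas M. \<forall>c'\<in>atlas N.
        smooth (idx M) (snd c ` {p\<in>fst c. f p \<in> fst c'}) (snd c' \<circ> f \<circ> point c))"

definition smooth_fun :: "('p, 'n::finite) mfd \<Rightarrow> ('p \<Rightarrow> real) \<Rightarrow> bool" where
  "smooth_fun M f \<longleftrightarrow> (\<forall>c\<in>atlas M. smooth (idx M) (crange c) (f \<circ> point c))"


section \<open>Tensor fields\<close>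

text \<open>
  A tensor field assigns to every chart \<open>c\<close> its component functions on \<open>crange c\<close>, subject to the
  usual transformation law on overlaps.  \<open>dmap\<close> of the identity is the Jacobian of a transition map.
\<close>

type_synonym ('p, 'n) vec_field = "('p, 'n) chart \<Rightarrow> real ^ 'n \<Rightarrow> real ^ 'n"
type_synonym ('p, 'n) tensor2 = "('p, 'n) chart \<Rightarrow> real ^ 'n \<Rightarrow> real ^ 'n ^ 'n"

definition bil :: "real ^ 'n::finite ^ 'n \<Rightarrow> real ^ 'n \<Rightarrow> real ^ 'n \<Rightarrow> real" where
  "bil A v w = v \<bullet> (A *v w)"

definition vector_field :: "('p, 'n::finite) mfd \<Rightarrow> ('p, 'n) vec_field \<Rightarrow> bool" where
  "vector_field M V \<longleftrightarrow>
     (\<forall>c\<in>atlas M. smooth (idx M) (crange c) (V c) \<and> V c ` crange c \<subseteq> coord (idx M)) \<and>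
     (\<forall>c\<in>atlas M. \<forall>c'\<in>atlas M. \<forall>p\<in>fst c \<inter> fst c'.
        V c' (snd c' p) = dmap (idx M) c c' id (snd c p) (V c (snd c p)))"

text \<open>A 1-form on the open subset \<open>W\<close> of \<open>M\<close>; its value on \<open>v\<close> is the inner product of the components.\<close>

definition one_form_on :: "('p, 'n::finite) mfd \<Rightarrow> 'p set \<Rightarrow> ('p, 'n) vec_field \<Rightarrow> bool" where
  "one_form_on M W \<theta> \<longleftrightarrow>
     (\<forall>c\<in>atlas M. smooth (idx M) (snd c ` (fst c \<inter> W)) (\<theta> c)) \<and>
     (\<forall>c\<in>atlas M. \<forall>c'\<in>atlas M. \<forall>p\<in>fst c \<inter> fst c' \<inter> W. \<forall>v\<in>coord (idx M).
        \<theta> c (snd c p) \<bullet> v = \<theta> c' (snd c' p) \<bullet> dmap (idx M) c c' id (snd c p) v)"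

text \<open>\<open>T\<close> is the pullback under \<open>f\<close> of the covariant 2-tensor field \<open>T'\<close> on \<open>N\<close>.\<close>

definition is_pullback :: "('p, 'n::finite) mfd \<Rightarrow> ('q, 'k::finite) mfd \<Rightarrow> ('p \<Rightarrow> 'q) \<Rightarrow>
    ('q, 'k) tensor2 \<Rightarrow> ('p, 'n) tensor2 \<Rightarrow> bool" where
  "is_pullback M N f T' T \<longleftrightarrow>
     (\<forall>c\<in>atlas M. \<forall>c'\<in>atlas N. \<forall>p\<in>fst c. f p \<in> fst c' \<longrightarrow>
        (\<forall>v\<in>coord (idx M). \<forall>w\<in>coord (idx M).
           bil (T c (snd c p)) v w =
           bil (T' c' (snd c' (f p))) (dmap (idx M) c c' f (snd c p) v) (dmap (idx M) c c' f (snd c p) w)))"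

definition sym_tensor :: "('p, 'n::finite) mfd \<Rightarrow> ('p, 'n) tensor2 \<Rightarrow> bool" where
  "sym_tensor M T \<longleftrightarrow>
     (\<forall>c\<in>atlas M. smooth (idx M) (crange c) (T c) \<and>
        (\<forall>y\<in>crange c. \<forall>i\<in>idx M. \<forall>j\<in>idx M. T c y $ i $ j = T c y $ j $ i)) \<and>
     is_pullback M M id T T"

text \<open>\<open>f\<close> intertwines the endomorphism fields \<open>T\<close> and \<open>T'\<close>.\<close>

definition intertwines :: "('p, 'n::finite) mfd \<Rightarrow> ('q, 'k::finite) mfd \<Rightarrow> ('p \<Rightarrow> 'q) \<Rightarrow>
    ('p, 'n) tensor2 \<Rightarrow> ('q, 'k) tensor2 \<Rightarrow> bool" where
  "intertwines M N f T T' \<longleftrightarrow>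
     (\<forall>c\<in>atlas M. \<forall>c'\<in>atlas N. \<forall>p\<in>fst c. f p \<in> fst c' \<longrightarrow>
        (\<forall>v\<in>coord (idx M). dmap (idx M) c c' f (snd c p) (T c (snd c p) *v v) =
           T' c' (snd c' (f p)) *v dmap (idx M) c c' f (snd c p) v))"

definition endo_field :: "('p, 'n::finite) mfd \<Rightarrow> ('p, 'n) tensor2 \<Rightarrow> bool" where
  "endo_field M T \<longleftrightarrow>
     (\<forall>c\<in>atlas M. smooth (idx M) (crange c) (T c) \<and>
        (\<forall>y\<in>crange c. \<forall>i j. i \<notin> idx M \<or> j \<notin> idx M \<longrightarrow> T c y $ i $ j = 0)) \<and>
     intertwines M M id T T"


section \<open>Riemannian geometry\<close>

definition riemannian :: "('p, 'n::finite) mfd \<Rightarrow> ('p, 'n) tensor2 \<Rightarrow> bool" where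
  "riemannian M g \<longleftrightarrow> sym_tensor M g \<and>
     (\<forall>c\<in>atlas M. \<forall>y\<in>crange c. \<forall>v\<in>coord (idx M). v \<noteq> 0 \<longrightarrow> bil (g c y) v v > 0)"

text \<open>Inverse of the \<open>I \<times> I\<close> block of a matrix.\<close>

definition ginv :: "'n::finite set \<Rightarrow> real ^ 'n ^ 'n \<Rightarrow> real ^ 'n ^ 'n" where
  "ginv I A = matrix_inv (\<chi> i j. if i \<in> I \<and> j \<in> I then A $ i $ j else if i = j then 1 else 0)"

text \<open>\<open>christoffel I G i j k y\<close> is \<open>\<Gamma>\<^sup>i\<^sub>j\<^sub>k\<close> at \<open>y\<close> of the Levi-Civita connection of the metric with component
  functions \<open>G\<close>.\<close>

definition christoffel :: "'n::finite set \<Rightarrow> (real ^ 'n \<Rightarrow> real ^ 'n ^ 'n) \<Rightarrow> 'n \<Rightarrow> 'n \<Rightarrow> 'n \<Rightarrow> real ^ 'n \<Rightarrow> real"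
where
  "christoffel I G i j k y = (1/2) * (\<Sum>l\<in>I. ginv I (G y) $ i $ l *
     (pd j (\<lambda>z. G z $ k $ l) y + pd k (\<lambda>z. G z $ j $ l) y - pd l (\<lambda>z. G z $ j $ k) y))"

definition ricci :: "'n::finite set \<Rightarrow> (real ^ 'n \<Rightarrow> real ^ 'n ^ 'n) \<Rightarrow> real ^ 'n \<Rightarrow> real ^ 'n ^ 'n" where
  "ricci I G y = (\<chi> j k.
     (\<Sum>i\<in>I. pd i (christoffel I G i j k) y - pd j (christoffel I G i i k) y) +
     (\<Sum>i\<in>I. \<Sum>l\<in>I. christoffel I G i i l y * christoffel I G l j k y
                  - christoffel I G i j l y * christoffel I G l i k y))"

definition scalar_curvature :: "'n::finite set \<Rightarrow> (real ^ 'n \<Rightarrow> real ^ 'n ^ 'n) \<Rightarrow> real ^ 'n \<Rightarrow> real" where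
  "scalar_curvature I G y = (\<Sum>j\<in>I. \<Sum>k\<in>I. ginv I (G y) $ j $ k * ricci I G y $ j $ k)"

definition gradient :: "'n::finite set \<Rightarrow> (real ^ 'n \<Rightarrow> real ^ 'n ^ 'n) \<Rightarrow> (real ^ 'n \<Rightarrow> real) \<Rightarrow>
    real ^ 'n \<Rightarrow> real ^ 'n" where
  "gradient I G f y = (\<chi> i. if i \<in> I then \<Sum>j\<in>I. ginv I (G y) $ i $ j * pd j f y else 0)"

definition parallel_endo :: "('p, 'n::finite) mfd \<Rightarrow> ('p, 'n) tensor2 \<Rightarrow> ('p, 'n) tensor2 \<Rightarrow> bool" where
  "parallel_endo M g T \<longleftrightarrow> endo_field M T \<and>
     (\<forall>c\<in>atlas M. \<forall>y\<in>crange c. \<forall>i\<in>idx M. \<forall>j\<in>idx M. \<forall>k\<in>idx M.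
        pd k (\<lambda>z. T c z $ i $ j) y
        + (\<Sum>l\<in>idx M. christoffel (idx M) (g c) i k l y * T c y $ l $ j)
        - (\<Sum>l\<in>idx M. christoffel (idx M) (g c) l k j y * T c y $ i $ l) = 0)"

text \<open>The holonomy representation is irreducible iff there is no proper nonzero parallel distribution;
  parallel distributions are the images of parallel projections.\<close>

definition irreducible_metric :: "('p, 'n::finite) mfd \<Rightarrow> ('p, 'n) tensor2 \<Rightarrow> bool" where
  "irreducible_metric M g \<longleftrightarrow>
     (\<forall>T. parallel_endo M g T \<and> (\<forall>c\<in>atlas M. \<forall>y\<in>crange c. T c y ** T c y = T c y) \<longrightarrow>
        (\<forall>c\<in>atlas M. \<forall>y\<in>crange c. \<forall>v\<in>coord (idx M). T c y *v v = 0) \<or>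
        (\<forall>c\<in>atlas M. \<forall>y\<in>crange c. \<forall>v\<in>coord (idx M). T c y *v v = v))"

definition einstein :: "('p, 'n::finite) mfd \<Rightarrow> ('p, 'n) tensor2 \<Rightarrow> real \<Rightarrow> bool" where
  "einstein M g \<kappa> \<longleftrightarrow>
     (\<forall>c\<in>atlas M. \<forall>y\<in>crange c. \<forall>j\<in>idx M. \<forall>k\<in>idx M.
        ricci (idx M) (g c) y $ j $ k = \<kappa> * g c y $ j $ k)"


section \<open>Kaehler geometry\<close>

definition almost_complex :: "('p, 'n::finite) mfd \<Rightarrow> ('p, 'n) tensor2 \<Rightarrow> bool" where
  "almost_complex M J \<longleftrightarrow> endo_field M J \<and>
     (\<forall>c\<in>atlas M. \<forall>y\<in>crange c. \<forall>v\<in>coord (idx M). J c y *v (J c y *v v) = - v)"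

text \<open>An integrable almost complex structure: the Nijenhuis tensor vanishes.\<close>

definition complex_structure :: "('p, 'n::finite) mfd \<Rightarrow> ('p, 'n) tensor2 \<Rightarrow> bool" where
  "complex_structure M J \<longleftrightarrow> almost_complex M J \<and>
     (\<forall>c\<in>atlas M. \<forall>y\<in>crange c. \<forall>i\<in>idx M. \<forall>j\<in>idx M. \<forall>k\<in>idx M.
        (\<Sum>l\<in>idx M.
             J c y $ l $ i * pd l (\<lambda>z. J c z $ k $ j) y - J c y $ l $ j * pd l (\<lambda>z. J c z $ k $ i) y
           - J c y $ k $ l * (pd i (\<lambda>z. J c z $ l $ j) y - pd j (\<lambda>z. J c z $ l $ i) y)) = 0)"

text \<open>\<open>\<omega>(v, w) = g(J v, w)\<close>\<close>

definition kform :: "('p, 'n::finite) tensor2 \<Rightarrow> ('p, 'n) tensor2 \<Rightarrow> ('p, 'n) tensor2" where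
  "kform g J c y = transpose (J c y) ** g c y"

definition kaehler :: "('p, 'n::finite) mfd \<Rightarrow> ('p, 'n) tensor2 \<Rightarrow> ('p, 'n) tensor2 \<Rightarrow> bool" where
  "kaehler M g J \<longleftrightarrow> riemannian M g \<and> complex_structure M J \<and>
     (\<forall>c\<in>atlas M. \<forall>y\<in>crange c. \<forall>v\<in>coord (idx M). \<forall>w\<in>coord (idx M).
        bil (g c y) (J c y *v v) (J c y *v w) = bil (g c y) v w) \<and>
     (\<forall>c\<in>atlas M. \<forall>y\<in>crange c. \<forall>i\<in>idx M. \<forall>j\<in>idx M. \<forall>k\<in>idx M.
        pd i (\<lambda>z. kform g J c z $ j $ k) y + pd j (\<lambda>z. kform g J c z $ k $ i) y
        + pd k (\<lambda>z. kform g J c z $ i $ j) y = 0)"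

definition hyperkaehler :: "('p, 'n::finite) mfd \<Rightarrow> ('p, 'n) tensor2 \<Rightarrow> ('p, 'n) tensor2 \<Rightarrow> bool" where
  "hyperkaehler M g J \<longleftrightarrow> kaehler M g J \<and>
     (\<exists>J'. almost_complex M J' \<and> parallel_endo M g J' \<and>
        (\<forall>c\<in>atlas M. \<forall>y\<in>crange c. \<forall>v\<in>coord (idx M). \<forall>w\<in>coord (idx M).
           bil (g c y) (J' c y *v v) (J' c y *v w) = bil (g c y) v w \<and>
           J c y *v (J' c y *v v) = - (J' c y *v (J c y *v v))))"

text \<open>A real vector field \<open>V\<close> is holomorphic iff \<open>L\<^sub>V J = 0\<close>.\<close>

definition holomorphic_at :: "'n::finite set \<Rightarrow> (real ^ 'n \<Rightarrow> real ^ 'n ^ 'n) \<Rightarrow>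
    (real ^ 'n \<Rightarrow> real ^ 'n) \<Rightarrow> real ^ 'n \<Rightarrow> bool" where
  "holomorphic_at I J V y \<longleftrightarrow>
     (\<forall>j\<in>I. \<forall>k\<in>I. (\<Sum>l\<in>I. V y $ l * pd l (\<lambda>z. J z $ k $ j) y
         - J y $ l $ j * pd l (\<lambda>z. V z $ k) y + J y $ k $ l * pd j (\<lambda>z. V z $ l) y) = 0)"

definition extremal :: "('p, 'n::finite) mfd \<Rightarrow> ('p, 'n) tensor2 \<Rightarrow> ('p, 'n) tensor2 \<Rightarrow> bool" where
  "extremal M g J \<longleftrightarrow>
     (\<forall>c\<in>atlas M. \<forall>y\<in>crange c.
        holomorphic_at (idx M) (J c) (gradient (idx M) (g c) (scalar_curvature (idx M) (g c))) y)"


section \<open>The metric ansatz on a CP1-bundle\<close>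

text \<open>\<open>\<rho>\<close> is the flow of the smooth vector field \<open>V\<close>.\<close>

definition is_flow :: "('p, 'n::finite) mfd \<Rightarrow> (real \<Rightarrow> 'p \<Rightarrow> 'p) \<Rightarrow> ('p, 'n) vec_field \<Rightarrow> bool" where
  "is_flow M \<rho> V \<longleftrightarrow> vector_field M V \<and>
     (\<forall>t. smooth_map M M (\<rho> t)) \<and>
     (\<forall>p\<in>pts M. \<rho> 0 p = p \<and> (\<forall>s t. \<rho> (s + t) p = \<rho> s (\<rho> t p)) \<and>
        continuous_map euclideanreal (mtop M) (\<lambda>t. \<rho> t p)) \<and>
     (\<forall>c\<in>atlas M. \<forall>p\<in>fst c. ((\<lambda>t. snd c (\<rho> t p)) has_vector_derivative V c (snd c p)) (at 0))"

text \<open>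
  The part of the structure that is independent of the metric: the bundle projection \<open>proj\<close> to the
  base, the complex structure \<open>bJ\<close> and the tensors \<open>g\<^sub>i\<^sup>*\<close> of the base (extended by zero to all tangent
  vectors), the circle action with its generator \<open>\<partial>\<^sub>\<phi>\<close>, and the 1-form \<open>\<theta>\<close>.
\<close>

record ('p, 'n, 'q, 'k, 'm) circle_bundle =
  base :: "('q, 'k) mfd"
  bJ :: "('q, 'k) tensor2"
  bg :: "'m \<Rightarrow> ('q, 'k) tensor2"
  proj :: "'p \<Rightarrow> 'q"
  rot :: "real \<Rightarrow> 'p \<Rightarrow> 'p"
  gen :: "('p, 'n) vec_field"
  conn :: "('p, 'n) vec_field"

definition principal_part :: "('p, 'n) mfd \<Rightarrow> ('p \<Rightarrow> real) \<Rightarrow> real \<Rightarrow> real \<Rightarrow> 'p set" where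
  "principal_part M x l u = {p\<in>pts M. l < x p \<and> x p < u}"

text \<open>The tensor \<open>\<Sum>\<^sub>i A\<^sub>i g\<^sub>i\<^sup>*\<close> on the base, for \<open>A\<^sub>i = b\<^sub>i t + a\<^sub>i\<close>.\<close>

definition base_metric :: "('p, 'n, 'q, 'k::finite, 'm::finite) circle_bundle \<Rightarrow> real ^ 'm \<Rightarrow> real ^ 'm \<Rightarrow> real \<Rightarrow>
    ('q, 'k) tensor2" where
  "base_metric E a b t c y = (\<Sum>i\<in>UNIV. (b $ i * t + a $ i) *\<^sub>R bg E i c y)"

text \<open>
  The union \<open>M\<^sub>0\<close> of the principal orbits is a principal circle bundle over \<open>(l, u) \<times> base\<close>, so every level set
  of \<open>x\<close> in \<open>M\<^sub>0\<close> is a principal circle bundle \<open>P\<close> over the base, with connection form \<open>\<theta>\<close>.  (The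
  equations for \<open>\<theta>\<close> imply that it is invariant under \<open>\<partial>\<^sub>\<phi>\<close> and does not depend on \<open>x\<close>.)  Over \<open>x = l\<close>
  and \<open>x = u\<close> the circles collapse to points and nothing else collapses.
\<close>

definition cp1_bundle :: "('p, 'n::finite) mfd \<Rightarrow> ('p, 'n, 'q, 'k::finite, 'm::finite) circle_bundle \<Rightarrow>
    real ^ 'm \<Rightarrow> ('p \<Rightarrow> real) \<Rightarrow> real \<Rightarrow> real \<Rightarrow> bool" where
  "cp1_bundle M E b x l u \<longleftrightarrow>
     (let M0 = principal_part M x l u; B = base E in
     l < u \<and> smooth_fun M x \<and> x ` pts M = {l..u} \<and> mtop M closure_of M0 = pts M \<and>
     closed_manifold B \<and> complex_structure B (bJ E) \<and> (\<forall>i. sym_tensor B (bg E i)) \<and>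
     card (idx M) = card (idx B) + 2 \<and> smooth_map M B (proj E) \<and>
     is_flow M (rot E) (gen E) \<and>
     (\<forall>p\<in>pts M. \<forall>t. rot E (t + 2 * pi) p = rot E t p \<and> x (rot E t p) = x p \<and>
        proj E (rot E t p) = proj E p) \<and>
     (\<forall>p\<in>M0. \<forall>t. rot E t p = p \<longrightarrow> (\<exists>n::int. t = 2 * pi * of_int n)) \<and>
     (\<forall>p\<in>M0. \<forall>q\<in>M0. x p = x q \<and> proj E p = proj E q \<longrightarrow> (\<exists>t. q = rot E t p)) \<and>
     (\<forall>t\<in>{l<..<u}. \<forall>q\<in>pts B. \<exists>p\<in>M0. x p = t \<and> proj E p = q) \<and>
     bij_betw (proj E) {p\<in>pts M. x p = l} (pts B) \<and>
     bij_betw (proj E) {p\<in>pts M. x p = u} (pts B) \<and>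
     one_form_on M M0 (conn E) \<and>
     (\<forall>c\<in>atlas M. \<forall>p\<in>fst c \<inter> M0. conn E c (snd c p) \<bullet> gen E c (snd c p) = 1) \<and>
     (\<forall>c\<in>atlas M. \<forall>c'\<in>atlas B. \<forall>p\<in>fst c \<inter> M0. proj E p \<in> fst c' \<longrightarrow>
        (\<forall>j\<in>idx M. \<forall>k\<in>idx M.
           pd j (\<lambda>z. conn E c z $ k) (snd c p) - pd k (\<lambda>z. conn E c z $ j) (snd c p) =
           (\<Sum>i\<in>UNIV. b $ i * bil (kform (bg E i) (bJ E) c' (snd c' (proj E p)))
              (dmap (idx M) c c' (proj E) (snd c p) (axis j 1))
              (dmap (idx M) c c' (proj E) (snd c p) (axis k 1))))))"

text \<open>
  \<open>g = dx\<^sup>2/h + h \<theta>\<^sup>2 + \<Sum>\<^sub>i (b\<^sub>i x + a\<^sub>i) g\<^sub>i\<^sup>*\<close> on \<open>M\<^sub>0\<close>.  The three equations for \<open>J\<close> say that \<open>J \<partial>\<^sub>x = (1/h) \<partial>\<^sub>\<phi>\<close>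
  and that \<open>J\<close> is the lift of \<open>bJ\<close> on the horizontal vectors.
\<close>

definition ansatz :: "('p, 'n::finite) mfd \<Rightarrow> ('p, 'n) tensor2 \<Rightarrow> ('p, 'n) tensor2 \<Rightarrow>
    ('p, 'n, 'q, 'k::finite, 'm::finite) circle_bundle \<Rightarrow> real ^ 'm \<Rightarrow>
    ('p \<Rightarrow> real) \<Rightarrow> real \<Rightarrow> real \<Rightarrow> (real \<Rightarrow> real) \<Rightarrow> real ^ 'm \<Rightarrow> bool" where
  "ansatz M g J E b x l u h a \<longleftrightarrow>
     cp1_bundle M E b x l u \<and> b \<noteq> 0 \<and>
     smooth_closed_interval l u h \<and> (\<forall>t\<in>{l<..<u}. h t > 0) \<and>
     h l = 0 \<and> h u = 0 \<and> deriv h l = 2 \<and> deriv h u = - 2 \<and>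
     (\<forall>i. \<forall>t\<in>{l..u}. b $ i * t + a $ i > 0) \<and>
     (\<forall>c\<in>atlas M. \<forall>c'\<in>atlas (base E). \<forall>p\<in>fst c \<inter> principal_part M x l u. proj E p \<in> fst c' \<longrightarrow>
        (\<forall>v\<in>coord (idx M). \<forall>w\<in>coord (idx M).
          let y = snd c p; y' = snd c' (proj E p); dx = dfun (idx M) c x y;
              \<theta> = (\<lambda>v. conn E c y \<bullet> v); d\<pi> = dmap (idx M) c c' (proj E) y
          in bil (g c y) v w =
               (1 / h (x p)) * dx v * dx w + h (x p) * \<theta> v * \<theta> w
               + bil (base_metric E a b (x p) c' y') (d\<pi> v) (d\<pi> w) \<and>
             \<theta> (J c y *v v) = (1 / h (x p)) * dx v \<and>
             dx (J c y *v v) = - h (x p) * \<theta> v \<and>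
             d\<pi> (J c y *v v) = bJ E c' y' *v d\<pi> v))"


section \<open>Construction Two\<close>

text \<open>The base is the product of the closed Kaehler-Einstein manifolds \<open>N i\<close> via the projections
  \<open>pr i\<close>.\<close>

definition construction_two :: "('p, 'n, 'q, 'k::finite, 'm::finite) circle_bundle \<Rightarrow>
    ('m \<Rightarrow> ('r, 'j::finite) mfd) \<Rightarrow> ('m \<Rightarrow> ('r, 'j) tensor2) \<Rightarrow> ('m \<Rightarrow> ('r, 'j) tensor2) \<Rightarrow>
    ('m \<Rightarrow> 'q \<Rightarrow> 'r) \<Rightarrow> bool" where
  "construction_two E N gN JN pr \<longleftrightarrow>
     (let B = base E in
     (\<forall>i. closed_manifold (N i) \<and> idx (N i) \<noteq> {} \<and> kaehler (N i) (gN i) (JN i) \<and>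
        einstein (N i) (gN i) 1) \<and>
     (\<forall>i. smooth_map B (N i) (pr i)) \<and>
     bij_betw (\<lambda>q i. pr i q) (pts B) (PiE UNIV (\<lambda>i. pts (N i))) \<and>
     card (idx B) = (\<Sum>i\<in>UNIV. card (idx (N i))) \<and>
     (\<forall>c\<in>atlas B. \<forall>q\<in>fst c. \<forall>v\<in>coord (idx B).
        (\<forall>i. \<forall>c'\<in>atlas (N i). pr i q \<in> fst c' \<longrightarrow> dmap (idx B) c c' (pr i) (snd c q) v = 0) \<longrightarrow> v = 0) \<and>
     (\<forall>i. intertwines B (N i) (pr i) (bJ E) (JN i)) \<and>
     (\<forall>i. is_pullback B (N i) (pr i) (gN i) (bg E i)))"


section \<open>Construction One\<close>

text \<open>Compact Lie groups are taken as compact groups of real matrices, which is no restriction up to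
  isomorphism (Peter-Weyl).\<close>

definition mexp :: "real ^ 'r::finite ^ 'r \<Rightarrow> real ^ 'r ^ 'r" where
  "mexp X = (\<Sum>n. (1 / fact n) *\<^sub>R ((((\<lambda>Y. X ** Y) ^^ n) (mat 1))))"

definition matrix_group :: "(real ^ 'r::finite ^ 'r) set \<Rightarrow> bool" where
  "matrix_group G \<longleftrightarrow> mat 1 \<in> G \<and> (\<forall>A\<in>G. invertible A \<and> matrix_inv A \<in> G) \<and>
     (\<forall>A\<in>G. \<forall>B\<in>G. A ** B \<in> G)"

definition lie_alg :: "(real ^ 'r::finite ^ 'r) set \<Rightarrow> (real ^ 'r ^ 'r) set" where
  "lie_alg G = {X. \<forall>t. mexp (t *\<^sub>R X) \<in> G}"

definition Ad :: "real ^ 'r::finite ^ 'r \<Rightarrow> real ^ 'r ^ 'r \<Rightarrow> real ^ 'r ^ 'r" where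
  "Ad A X = A ** X ** matrix_inv A"

text \<open>Semisimplicity: no nonzero abelian ideals.\<close>

definition semisimple_lie_alg :: "(real ^ 'r::finite ^ 'r) set \<Rightarrow> bool" where
  "semisimple_lie_alg L \<longleftrightarrow>
     (\<forall>S. subspace S \<and> S \<subseteq> L \<and> (\<forall>X\<in>L. \<forall>Y\<in>S. X ** Y - Y ** X \<in> S) \<and>
        (\<forall>X\<in>S. \<forall>Y\<in>S. X ** Y = Y ** X) \<longrightarrow> S = {0})"

definition lie_action :: "(real ^ 'r::finite ^ 'r) set \<Rightarrow> (real ^ 'r ^ 'r \<Rightarrow> 'p \<Rightarrow> 'p) \<Rightarrow>
    ('p, 'n::finite) mfd \<Rightarrow> bool" where
  "lie_action G act M \<longleftrightarrow>
     continuous_map (prod_topology (top_of_set G) (mtop M)) (mtop M) (\<lambda>(A, p). act A p) \<and>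
     (\<forall>p\<in>pts M. act (mat 1) p = p \<and> (\<forall>A\<in>G. \<forall>B\<in>G. act (A ** B) p = act A (act B p))) \<and>
     (\<forall>A\<in>G. smooth_map M M (act A)) \<and>
     (\<forall>X\<in>lie_alg G. \<exists>V. is_flow M (\<lambda>t. act (mexp (t *\<^sub>R X))) V)"

definition stab :: "(real ^ 'r::finite ^ 'r) set \<Rightarrow> (real ^ 'r ^ 'r \<Rightarrow> 'p \<Rightarrow> 'p) \<Rightarrow> 'p \<Rightarrow> (real ^ 'r ^ 'r) set"
  where "stab G act p = {A\<in>G. act A p = p}"

text \<open>Elements of the dual of the Lie algebra are functions on matrices, of which only the values on
  \<open>lie_alg G\<close> matter.\<close>

definition moment_map :: "(real ^ 'r::finite ^ 'r) set \<Rightarrow> (real ^ 'r ^ 'r \<Rightarrow> 'p \<Rightarrow> 'p) \<Rightarrow>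
    ('p, 'n::finite) mfd \<Rightarrow> ('p, 'n) tensor2 \<Rightarrow> ('p \<Rightarrow> real ^ 'r ^ 'r \<Rightarrow> real) \<Rightarrow> bool" where
  "moment_map G act M \<omega> \<mu> \<longleftrightarrow>
     (\<forall>p\<in>pts M. \<forall>X\<in>lie_alg G. \<forall>Y\<in>lie_alg G. \<forall>r s.
        \<mu> p (r *\<^sub>R X + s *\<^sub>R Y) = r * \<mu> p X + s * \<mu> p Y) \<and>
     (\<forall>p\<in>pts M. \<forall>A\<in>G. \<forall>X\<in>lie_alg G. \<mu> (act A p) (Ad A X) = \<mu> p X) \<and>
     (\<forall>X\<in>lie_alg G. smooth_fun M (\<lambda>p. \<mu> p X) \<and>
        (\<exists>V. is_flow M (\<lambda>t. act (mexp (t *\<^sub>R X))) V \<and>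
           (\<forall>c\<in>atlas M. \<forall>y\<in>crange c. \<forall>w\<in>coord (idx M).
              dfun (idx M) c (\<lambda>p. \<mu> p X) y w = bil (\<omega> c y) (V c y) w)))"

definition coad_stab :: "(real ^ 'r::finite ^ 'r) set \<Rightarrow> (real ^ 'r ^ 'r \<Rightarrow> real) \<Rightarrow> (real ^ 'r ^ 'r) set" where
  "coad_stab G \<nu> = {A\<in>G. \<forall>X\<in>lie_alg G. \<nu> (Ad (matrix_inv A) X) = \<nu> X}"

text \<open>\<open>L/K \<cong> S\<^sup>1\<close>\<close>

definition quotient_is_circle :: "(real ^ 'r::finite ^ 'r) set \<Rightarrow> (real ^ 'r ^ 'r) set \<Rightarrow> bool" where
  "quotient_is_circle L K \<longleftrightarrow>
     (\<exists>\<eta> :: real ^ 'r ^ 'r \<Rightarrow> complex. continuous_on L \<eta> \<and> (\<forall>A\<in>L. \<forall>B\<in>L. \<eta> (A ** B) = \<eta> A * \<eta> B) \<and>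
        \<eta> ` L = sphere 0 1 \<and> {A\<in>L. \<eta> A = 1} = K)"

text \<open>The isotropy representation of \<open>G/K\<close>, realized on an \<open>Ad K\<close>-invariant complement of the Lie
  algebra of \<open>K\<close>, is the sum of \<open>T\<close> (trivial, one-dimensional) and of the \<open>P i\<close> (nontrivial,
  irreducible, pairwise inequivalent).\<close>

definition isotropy_splitting :: "(real ^ 'r::finite ^ 'r) set \<Rightarrow> (real ^ 'r ^ 'r) set \<Rightarrow>
    (real ^ 'r ^ 'r) set \<Rightarrow> ('m::finite \<Rightarrow> (real ^ 'r ^ 'r) set) \<Rightarrow> bool" where
  "isotropy_splitting G K T P \<longleftrightarrow>
     subspace T \<and> T \<subseteq> lie_alg G \<and> dim T = 1 \<and> (\<forall>A\<in>K. \<forall>X\<in>T. Ad A X = X) \<and>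
     (\<forall>i. subspace (P i) \<and> P i \<subseteq> lie_alg G \<and> P i \<noteq> {0} \<and> (\<forall>A\<in>K. Ad A ` P i \<subseteq> P i)) \<and>
     (\<forall>X\<in>lie_alg G. \<exists>!(Z, Y, f). Z \<in> lie_alg K \<and> Y \<in> T \<and> (\<forall>i. f i \<in> P i) \<and> X = Z + Y + (\<Sum>i\<in>UNIV. f i)) \<and>
     (\<forall>i. \<exists>A\<in>K. \<exists>X\<in>P i. Ad A X \<noteq> X) \<and>
     (\<forall>i S. subspace S \<and> S \<subseteq> P i \<and> (\<forall>A\<in>K. Ad A ` S \<subseteq> S) \<longrightarrow> S = {0} \<or> S = P i) \<and>
     (\<forall>i j. i \<noteq> j \<longrightarrow> \<not> (\<exists>\<phi>. linear \<phi> \<and> bij_betw \<phi> (P i) (P j) \<and>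
        (\<forall>A\<in>K. \<forall>X\<in>P i. \<phi> (Ad A X) = Ad A (\<phi> X))))"

text \<open>Value at \<open>q\<close>, in the chart \<open>c\<close>, of the fundamental vector field of \<open>X\<close>.\<close>

definition fundamental :: "(real ^ 'r::finite ^ 'r \<Rightarrow> 'q \<Rightarrow> 'q) \<Rightarrow> real ^ 'r ^ 'r \<Rightarrow> ('q, 'k::finite) chart \<Rightarrow>
    'q \<Rightarrow> real ^ 'k" where
  "fundamental act X c q = vector_derivative (\<lambda>t. snd c (act (mexp (t *\<^sub>R X)) q)) (at 0)"

text \<open>
  The base is the coadjoint orbit \<open>G/L\<close>: a manifold on which \<open>G\<close> acts transitively (through the
  equivariant projection) with isotropy group the coadjoint isotropy group of the moment map.  The
  tensor \<open>bg E i\<close> is invariant, supported on the \<open>i\<close>-th summand at \<open>proj E p0\<close>, and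
  normalized by the Ricci tensor of the Kaehler metrics that \<open>g\<close> induces on \<open>G/L\<close>.
\<close>

definition construction_one :: "('p, 'n::finite) mfd \<Rightarrow> ('p, 'n) tensor2 \<Rightarrow> ('p, 'n) tensor2 \<Rightarrow>
    ('p, 'n, 'q, 'k::finite, 'm::finite) circle_bundle \<Rightarrow> real ^ 'm \<Rightarrow> ('p \<Rightarrow> real) \<Rightarrow> real \<Rightarrow> real \<Rightarrow> real ^ 'm \<Rightarrow>
    (real ^ 'r::finite ^ 'r) set \<Rightarrow> (real ^ 'r ^ 'r \<Rightarrow> 'p \<Rightarrow> 'p) \<Rightarrow> (real ^ 'r ^ 'r \<Rightarrow> 'q \<Rightarrow> 'q) \<Rightarrow>
    ('p \<Rightarrow> real ^ 'r ^ 'r \<Rightarrow> real) \<Rightarrow> 'p \<Rightarrow> (real ^ 'r ^ 'r) set \<Rightarrow> ('m \<Rightarrow> (real ^ 'r ^ 'r) set) \<Rightarrow> bool" where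
  "construction_one M g J E b x l u a G act actB \<mu> p0 T P \<longleftrightarrow>
     (let M0 = principal_part M x l u; B = base E in
     irreducible_metric M g \<and> \<not> hyperkaehler M g J \<and>
     matrix_group G \<and> compact G \<and> connected G \<and> semisimple_lie_alg (lie_alg G) \<and>
     lie_action G act M \<and> (\<forall>A\<in>G. is_pullback M M (act A) g g) \<and>
     (\<forall>p\<in>pts M. (\<lambda>A. act A p) ` G = {q\<in>pts M. x q = x p}) \<and>
     (\<forall>p\<in>M0. \<forall>q\<in>M0. \<exists>A\<in>G. stab G act q = Ad A ` stab G act p) \<and>
     moment_map G act M (kform g J) \<mu> \<and>
     lie_action G actB B \<and> (\<forall>A\<in>G. \<forall>p\<in>pts M. proj E (act A p) = actB A (proj E p)) \<and>
     (\<forall>A\<in>G. \<forall>t. \<forall>p\<in>pts M. rot E t (act A p) = act A (rot E t p)) \<and>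
     (\<forall>p\<in>M0. stab G actB (proj E p) = coad_stab G (\<mu> p) \<and>
        quotient_is_circle (coad_stab G (\<mu> p)) (stab G act p)) \<and>
     (\<forall>A\<in>G. intertwines B B (actB A) (bJ E) (bJ E) \<and>
        (\<forall>i. is_pullback B B (actB A) (bg E i) (bg E i))) \<and>
     p0 \<in> M0 \<and> isotropy_splitting G (stab G act p0) T P \<and>
     card (idx B) = (\<Sum>i\<in>UNIV. dim (P i)) \<and>
     (\<forall>c\<in>atlas B. proj E p0 \<in> fst c \<longrightarrow>
        (let q = proj E p0; y = snd c q; F = (\<lambda>X. fundamental actB X c q) in
        (\<forall>i j k. \<forall>X\<in>P j. \<forall>Y\<in>P k. \<not> (j = i \<and> k = i) \<longrightarrow> bil (bg E i c y) (F X) (F Y) = 0) \<and>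
        (\<forall>i. \<forall>X\<in>P i. X \<noteq> 0 \<longrightarrow> bil (bg E i c y) (F X) (F X) > 0) \<and>
        (\<forall>t\<in>{l<..<u}. \<forall>i. \<forall>Y\<in>P i. bil (bg E i c y) (F Y) (F Y) = 1 \<longrightarrow>
           bil (ricci (idx B) (base_metric E a b t c) y) (F Y) (F Y) = 1))))"


section \<open>Families of extremal metrics\<close>

text \<open>The parameters \<open>a\<close> for which all \<open>A\<^sub>i = b\<^sub>i x + a\<^sub>i\<close> are positive on \<open>[0, 1]\<close>: a nonempty open
  subset of \<open>\<real>\<^sup>m\<close>.\<close>

definition parameters :: "real ^ 'm::finite \<Rightarrow> (real ^ 'm) set" where
  "parameters b = {a. \<forall>i. \<forall>t\<in>{0..1}. b $ i * t + a $ i > 0}"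

text \<open>On \<open>G/L\<close> the 2-forms of the individual \<open>g\<^sub>i\<^sup>*\<close> need not be closed.  These are the parameters for
  which the induced metrics on the base are Kaehler, as they have to be if the total metric is.\<close>

definition kaehler_parameters :: "('p, 'n, 'q, 'k::finite, 'm::finite) circle_bundle \<Rightarrow> real ^ 'm \<Rightarrow> (real ^ 'm) set"
  where "kaehler_parameters E b =
    {a \<in> parameters b. \<forall>t\<in>{0..1}. kaehler (base E) (base_metric E a b t) (bJ E)}"

text \<open>A family of extremal Kaehler metrics for the fixed complex structure \<open>J\<close>, of the form of the
  ansatz on the normalized interval \<open>[0, 1]\<close> with parameters \<open>a \<in> D\<close>, in which no two distinct
  members agree up to scaling.  The momentum coordinate \<open>x\<close> depends on the metric.\<close>

definition extremal_family :: "('p, 'n::finite) mfd \<Rightarrow> ('p, 'n) tensor2 \<Rightarrow>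
    ('p, 'n, 'q, 'k::finite, 'm::finite) circle_bundle \<Rightarrow> real ^ 'm \<Rightarrow> (real ^ 'm) set \<Rightarrow>
    (real ^ 'm \<Rightarrow> ('p, 'n) tensor2) \<Rightarrow> bool" where
  "extremal_family M J E b D F \<longleftrightarrow>
     (\<forall>a\<in>D. kaehler M (F a) J \<and> extremal M (F a) J \<and> (\<exists>x h. ansatz M (F a) J E b x 0 1 h a)) \<and>
     (\<forall>a\<in>D. \<forall>a'\<in>D. \<forall>s>0.
        (\<forall>c\<in>atlas M. \<forall>y\<in>crange c. \<forall>i\<in>idx M. \<forall>j\<in>idx M. F a c y $ i $ j = s * F a' c y $ i $ j) \<longrightarrow>
        a = a')"

end

theory Submission
  imports Defs
begin

text \<open>
The given metric has momentum coordinate \<open>x\<close> and profile \<open>h\<close>. A diffeomorphism \<open>\<psi>\<close> of the momentum interval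
with \<open>k \<circ> \<psi> = \<psi>' h\<close> replaces them by \<open>\<psi> \<circ> x\<close> and any other admissible profile \<open>k\<close>, keeping \<open>J\<close> and \<open>\<theta>\<close>, and
\<open>\<psi>'(x) g + \<pi>\<^sup>* \<Sum>\<^sub>i (A'\<^sub>i(\<psi>(x)) - \<psi>'(x) A\<^sub>i(x)) g\<^sub>i\<close> is a metric on all of \<open>M\<close> that has the form of the ansatz with data \<open>k\<close>, \<open>a'\<close>.

With \<open>q = (1/2) \<Sum>\<^sub>i b\<^sub>i d\<^sub>i / A'\<^sub>i\<close> and \<open>u = k' + q k\<close>, its scalar curvature is that of the base, \<open>\<Sum>\<^sub>i d\<^sub>i / A'\<^sub>i\<close>, minus
\<open>u' + q u\<close>. In terms of \<open>f = Q k\<close>, \<open>Q = exp \<integral>q\<close>, it is affine in the momentum iff \<open>f'' = Q (\<Sum>\<^sub>i d\<^sub>i / A'\<^sub>i - \<alpha> t - \<beta>)\<close>.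
The four boundary conditions on \<open>f\<close> determine \<open>\<alpha>\<close> and \<open>\<beta>\<close>, and \<open>f > 0\<close> inside because \<open>f'' / Q\<close> is convex.
The gradient of the momentum coordinate is holomorphic on the principal part, hence everywhere by density.

The scalar curvature of the base is \<open>\<Sum>\<^sub>i d\<^sub>i / A'\<^sub>i\<close> because its Ricci form does not depend on \<open>a'\<close>: on a product
by naturality, on a coadjoint orbit since
changing \<open>a'\<close> multiplies the volume form by a constant.
\<close>

text \<open>The obstacle is the special orbits, where the ansatz degenerates and \<theta> is
  undefined. The new metric is therefore not assembled from its own ansatz but obtained from the
  given one, which is already smooth there; the equal boundary slopes of the two profiles are what
  makes the change of momentum coordinate smooth up to the ends.

  The curvature of the total space is not read off Christoffel symbols. A connection with torsion
  that keeps dx/h, \<theta> and the base directions parallel also preserves J, so it differs from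
  the Levi-Civita connection by endomorphisms commuting with J, and the Ricci form sees only their
  complex trace. The torsion is d\<theta> times a vertical vector and drops out of that trace; what
  remains is a logarithmic derivative of volume densities, and the Ricci form is that of the base
  minus d(u \<theta>). Besides being Kaehler, the base then has to provide two facts: the densities
  of its metrics are proportional, and the Ricci tensor is 1 on unit vectors of each
  summand.\<close>

section \<open>Partial derivatives and C^k functions on relatively open subsets of a coordinate
  subspace\<close>

abbreviation ropen :: "'n::finite set \<Rightarrow> (real^'n) set \<Rightarrow> bool" where
 "ropen I U \<equiv> openin (top_of_set (coord I)) U"

lemma subspace_coord: "subspace (coord I)"
 by (auto simp: subspace_def coord_def)

lemma axis_in_coord [simp]: "i \<in> I \<Longrightarrow> axis i a \<in> coord I"
 by (auto simp: coord_def axis_def)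

lemma coord_expand: "v \<in> coord I \<Longrightarrow> v = (\<Sum>i\<in>I. v$i *\<^sub>R axis i 1)"
 by (auto simp: vec_eq_iff coord_def axis_def if_distrib sum.delta cong: if_cong)

lemma ropen_coord: "ropen I U \<Longrightarrow> y \<in> U \<Longrightarrow> y \<in> coord I"
 using openin_imp_subset by blast

lemma ropen_ballE:
 assumes "ropen I U" "y \<in> U"
 obtains e where "e > 0" "ball y e \<inter> coord I \<subseteq> U"
 using assms unfolding openin_contains_ball by blast

abbreviation shift :: "real^'n \<Rightarrow> 'n \<Rightarrow> real \<Rightarrow> real^'n" where
 "shift y i t \<equiv> y + t *\<^sub>R axis i 1"

lemma eventually_ropen_line:
 assumes "ropen I U" "y \<in> U" "i \<in> I"
 shows "\<forall>\<^sub>F t in nhds 0. shift y i t \<in> U"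
proof -
 obtain e where e: "e > 0" "ball y e \<inter> coord I \<subseteq> U" using assms ropen_ballE by blast
 have "\<forall>\<^sub>F t::real in nhds 0. \<bar>t\<bar> < e"
  using e unfolding eventually_nhds_metric by (auto simp: dist_norm)
 then show ?thesis
 proof eventually_elim
  case (elim t)
  have "shift y i t \<in> ball y e" using elim by (simp add: dist_norm)
  moreover have "shift y i t \<in> coord I"
   using assms ropen_coord subspace_coord by (intro subspace_add subspace_scale) auto
  ultimately show ?case using e by auto
 qed
qed

text \<open>\<open>pds\<close> avoids the junk value of \<^const>\<open>pd\<close> at points of non-differentiability.\<close>

definition pds :: "'n::finite \<Rightarrow> (real^'n \<Rightarrow> 'a::real_normed_vector) \<Rightarrow> 'a \<Rightarrow> real^'n \<Rightarrow> bool" where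
 "pds i f D y \<longleftrightarrow> ((\<lambda>t. f (shift y i t)) has_vector_derivative D) (at 0)"

lemma pds_pd: "pds i f D y \<Longrightarrow> pd i f y = D"
 unfolding pds_def pd_def by (rule vector_derivative_at)

lemma differentiable_pds:
 "(\<lambda>t. f (shift y i t)) differentiable (at 0) \<longleftrightarrow> pds i f (pd i f y) y"
 unfolding pds_def pd_def using vector_derivative_works by blast

lemma pds_shift:
 assumes "pds i f D (shift y i t)"
 shows "((\<lambda>s. f (shift y i s)) has_vector_derivative D) (at t)"
proof -
 have "(((\<lambda>s. f (shift y i t + s *\<^sub>R axis i 1)) \<circ> (\<lambda>s. s - t)) has_vector_derivative 1 *\<^sub>R D) (at t)"
  using assms unfolding pds_def
  by (intro vector_diff_chain_at) (auto intro!: derivative_eq_intros)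
 then show ?thesis by (simp add: o_def scaleR_left_diff_distrib)
qed

lemma pds_cong:
 assumes "ropen I U" "y \<in> U" "i \<in> I" "\<And>z. z \<in> U \<Longrightarrow> f z = g z" "pds i f D y"
 shows "pds i g D y"
proof -
 obtain S where S: "open S" "0 \<in> S" "\<And>t. t \<in> S \<Longrightarrow> shift y i t \<in> U"
  using eventually_ropen_line[OF assms(1-3)] unfolding eventually_nhds by auto
 show ?thesis
  unfolding pds_def
 proof (rule has_vector_derivative_transform_within_open)
  show "((\<lambda>t. f (shift y i t)) has_vector_derivative D) (at 0)" using assms(5) unfolding pds_def .
  show "open S" "0 \<in> S" using S by auto
  show "\<And>t. t \<in> S \<Longrightarrow> f (shift y i t) = g (shift y i t)"
   using S assms(4) by auto
 qed
qed

text \<open>Near \<open>y\<close> the two functions agree along every axis of \<open>I\<close>, so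
  they have the same derivatives, if any; even the default value of \<open>vector_derivative\<close>
  is then the same.\<close>

lemma pd_cong:
 assumes "ropen I U" "y \<in> U" "i \<in> I" "\<And>z. z \<in> U \<Longrightarrow> f z = g z"
 shows "pd i f y = pd i g y"
proof -
 have *: "\<And>D. pds i f D y \<longleftrightarrow> pds i g D y"
  using assms pds_cong[OF assms(1-3)] by metis
 then show ?thesis unfolding pd_def vector_derivative_def pds_def by simp
qed

lemma Ck_cong:
 assumes "ropen I U" "\<And>y. y \<in> U \<Longrightarrow> f y = g y" "Ck r I U f"
 shows "Ck r I U g"
 using assms(2,3)
proof (induction r arbitrary: f g)
 case 0
 then show ?case using continuous_on_cong[of U U f g] by simp
next
 case (Suc r)
 have "continuous_on U g" using Suc continuous_on_cong[of U U f g] by simp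
 moreover have "pds i g (pd i g y) y" if "i \<in> I" "y \<in> U" for i y
  using Suc.prems that pds_cong[OF assms(1) that(2,1)] pd_cong[OF assms(1) that(2,1)]
  by (metis Ck.simps(2) differentiable_pds)
 moreover have "Ck r I U (pd i g)" if "i \<in> I" for i
 proof (rule Suc.IH)
  show "Ck r I U (pd i f)" using Suc.prems that by simp
  show "pd i f y = pd i g y" if "y \<in> U" for y
   by (rule pd_cong[OF assms(1) that \<open>i \<in> I\<close>]) (use Suc.prems in blast)
 qed
 ultimately show ?case by (auto simp: differentiable_pds)
qed

lemma Ck_Suc:
 assumes "continuous_on U f" "\<And>i y. i \<in> I \<Longrightarrow> y \<in> U \<Longrightarrow> pds i f (f' i y) y"
  "\<And>i. i \<in> I \<Longrightarrow> Ck r I U (f' i)" "ropen I U"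
 shows "Ck (Suc r) I U f"
proof -
 have e: "pd i f y = f' i y" if "i \<in> I" "y \<in> U" for i y using assms(2)[OF that] pds_pd by blast
 then have "pds i f (pd i f y) y" if "i \<in> I" "y \<in> U" for i y using assms(2) that by simp
 moreover have "Ck r I U (pd i f)" if "i \<in> I" for i
  using e that by (intro Ck_cong[OF assms(4) _ assms(3)]) auto
 ultimately show ?thesis using assms(1) by (auto simp: differentiable_pds)
qed

lemma Ck_pds: "\<lbrakk>Ck (Suc r) I U f; i \<in> I; y \<in> U\<rbrakk> \<Longrightarrow> pds i f (pd i f y) y"
 by (auto simp: differentiable_pds)

lemma Ck_SucD: "Ck (Suc r) I U f \<Longrightarrow> Ck r I U f"
 by (induction r arbitrary: f) auto

lemma Ck_cont: "Ck r I U f \<Longrightarrow> continuous_on U f"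
 by (cases r) auto

lemma Ck_subset: "Ck r I U f \<Longrightarrow> V \<subseteq> U \<Longrightarrow> Ck r I V f"
 by (induction r arbitrary: f) (auto intro: continuous_on_subset)

text \<open>Pulled-back tensors are written in charts of the base that exist only near each point,
  so their smoothness can only be verified locally.\<close>

lemma Ck_local:
 assumes "\<And>y. y \<in> U \<Longrightarrow> \<exists>V. ropen I V \<and> y \<in> V \<and> V \<subseteq> U \<and> Ck r I V f"
 shows "Ck r I U f"
proof -
 have c: "continuous_on U f" if V0: "\<And>y. y \<in> U \<Longrightarrow> \<exists>V. ropen I V \<and> y \<in> V \<and> V \<subseteq> U \<and> continuous_on V f"
  and U: "U \<subseteq> coord I" for f :: "_ \<Rightarrow> 'b"
  unfolding continuous_on_eq_continuous_within
 proof
  fix y assume y: "y \<in> U"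
  obtain V where V: "ropen I V" "y \<in> V" "V \<subseteq> U" "continuous_on V f" using V0[OF y] by blast
  obtain S where S: "open S" "V = coord I \<inter> S" using V(1) by (auto simp: openin_open)
  have "at y within V = at y within U"
  proof (rule at_within_nhd)
   show "y \<in> S" "open S" using S V(2) by auto
   show "V \<inter> S - {y} = U \<inter> S - {y}" using S V(3) U by blast
  qed
  moreover have "continuous (at y within V) f"
   using V(2,4) continuous_on_eq_continuous_within by blast
  ultimately show "continuous (at y within U) f" by simp
 qed
 have U: "U \<subseteq> coord I" using assms openin_imp_subset by blast
 show ?thesis using assms
 proof (induction r arbitrary: f)
  case 0
  then show ?case using U by (auto intro!: c)
 next
  case (Suc r)
  have "continuous_on U f"
  proof (rule c[OF _ U])
   fix y assume "y \<in> U"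
   then obtain V where V: "ropen I V" "y \<in> V" "V \<subseteq> U" "Ck (Suc r) I V f" using Suc.prems by blast
   then show "\<exists>V. ropen I V \<and> y \<in> V \<and> V \<subseteq> U \<and> continuous_on V f" using Ck_cont[OF V(4)] by blast
  qed
  moreover have "pds i f (pd i f y) y" if i: "i \<in> I" and y: "y \<in> U" for i y
  proof -
   obtain V where V: "ropen I V" "y \<in> V" "V \<subseteq> U" "Ck (Suc r) I V f" using Suc.prems[OF y] by blast
   show ?thesis by (rule Ck_pds[OF V(4) i V(2)])
  qed
  moreover have "Ck r I U (pd i f)" if "i \<in> I" for i
  proof (rule Suc.IH)
   fix y assume "y \<in> U"
   then obtain V where "ropen I V" "y \<in> V" "V \<subseteq> U" "Ck (Suc r) I V f" using Suc.prems by blast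
   then show "\<exists>V. ropen I V \<and> y \<in> V \<and> V \<subseteq> U \<and> Ck r I V (pd i f)" using that by auto
  qed
  ultimately show ?case by (auto simp: differentiable_pds)
 qed
qed

section \<open>Linearity, product rule and chain rule\<close>

lemma pds_bounded_linear:
 assumes "bounded_linear L" "pds i f D y"
 shows "pds i (\<lambda>y. L (f y)) (L D) y"
 using bounded_linear.has_vector_derivative[OF assms(1) assms(2)[unfolded pds_def]] unfolding pds_def .

lemma pds_bilinear:
 assumes "bounded_bilinear B" "pds i f D y" "pds i g E y"
 shows "pds i (\<lambda>y. B (f y) (g y)) (B (f y) E + B D (g y)) y"
 using bounded_bilinear.has_vector_derivative[OF assms(1) assms(2,3)[unfolded pds_def]]
 unfolding pds_def by simp

lemma pds_add: "pds i f D y \<Longrightarrow> pds i g E y \<Longrightarrow> pds i (\<lambda>y. f y + g y) (D + E) y"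
 unfolding pds_def by (rule has_vector_derivative_add)

lemma pds_diff: "pds i f D y \<Longrightarrow> pds i g E y \<Longrightarrow> pds i (\<lambda>y. f y - g y) (D - E) y"
 unfolding pds_def by (rule has_vector_derivative_diff)

lemma pds_sum: "(\<And>s. s \<in> S \<Longrightarrow> pds i (f s) (D s) y) \<Longrightarrow> pds i (\<lambda>y. \<Sum>s\<in>S. f s y) (\<Sum>s\<in>S. D s) y"
 unfolding pds_def by (rule has_vector_derivative_sum)

lemma pds_const: "pds i (\<lambda>y. c) 0 y"
 unfolding pds_def by (rule has_vector_derivative_const)

lemma Ck_const: "ropen I U \<Longrightarrow> Ck r I U (\<lambda>y. c)"
proof (induction r arbitrary: c)
 case (Suc r)
 show ?case by (rule Ck_Suc[OF _ _ _ Suc.prems, where f' = "\<lambda>_ _. 0"]) (simp_all add: pds_const Suc)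
qed simp

lemma Ck_add:
 assumes "ropen I U" "Ck r I U f" "Ck r I U g"
 shows "Ck r I U (\<lambda>y. f y + g y)"
 using assms(2,3)
proof (induction r arbitrary: f g)
 case (Suc r)
 show ?case
 proof (rule Ck_Suc[OF _ _ _ assms(1)])
  show "continuous_on U (\<lambda>y. f y + g y)" using Suc.prems by (simp add: continuous_on_add)
  show "pds i (\<lambda>y. f y + g y) (pd i f y + pd i g y) y" if "i \<in> I" "y \<in> U" for i y
   by (rule pds_add[OF Ck_pds[OF Suc.prems(1) that] Ck_pds[OF Suc.prems(2) that]])
  show "Ck r I U (\<lambda>y. pd i f y + pd i g y)" if "i \<in> I" for i
   by (rule Suc.IH) (use Suc.prems that in simp_all)
 qed
qed (simp add: continuous_on_add)

lemma Ck_sum: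
 assumes "ropen I U" "\<And>s. s \<in> S \<Longrightarrow> Ck r I U (f s)"
 shows "Ck r I U (\<lambda>y. \<Sum>s\<in>S. f s y)"
 using assms(2) by (induction S rule: infinite_finite_induct) (simp_all add: Ck_const Ck_add assms(1))

lemma Ck_bilinear:
 assumes "bounded_bilinear B" "ropen I U" "Ck r I U f" "Ck r I U g"
 shows "Ck r I U (\<lambda>y. B (f y) (g y))"
 using assms(3,4)
proof (induction r arbitrary: f g)
 case 0
 then show ?case using bounded_bilinear.continuous_on[OF assms(1)] by simp
next
 case (Suc r)
 show ?case
 proof (rule Ck_Suc[OF _ _ _ assms(2)])
  show "continuous_on U (\<lambda>y. B (f y) (g y))" by (rule bounded_bilinear.continuous_on[OF assms(1)]) (use Suc.prems in simp_all)
  show "pds i (\<lambda>y. B (f y) (g y)) (B (f y) (pd i g y) + B (pd i f y) (g y)) y" if "i \<in> I" "y \<in> U" for i y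
   by (rule pds_bilinear[OF assms(1) Ck_pds[OF Suc.prems(1) that] Ck_pds[OF Suc.prems(2) that]])
  show "Ck r I U (\<lambda>y. B (f y) (pd i g y) + B (pd i f y) (g y))" if "i \<in> I" for i
   by (rule Ck_add[OF assms(2)]; rule Suc.IH) (use Suc.prems Suc.prems[THEN Ck_SucD] that in simp_all)
 qed
qed

lemma Ck_bounded_linear:
 assumes "bounded_linear L" "ropen I U" "Ck r I U f"
 shows "Ck r I U (\<lambda>y. L (f y))"
 using Ck_bilinear[OF bounded_bilinear.comp[OF bounded_bilinear_scaleR bounded_linear_ident assms(1)] assms(2) Ck_const[OF assms(2), of r "1::real"] assms(3)] by simp

lemma Ck_vec_nth: "ropen I U \<Longrightarrow> Ck r I U f \<Longrightarrow> Ck r I U (\<lambda>y. f y$k)"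
 by (rule Ck_bounded_linear[OF bounded_linear_vec_nth])

lemma bounded_linear_axis: "bounded_linear (axis k :: 'a::real_normed_vector \<Rightarrow> 'a^'n)"
proof (rule bounded_linear_intro[where K=1])
 show "norm (axis k x :: 'a^'n) \<le> norm x * 1" for x :: 'a
  using L2_set_le_sum[of UNIV "\<lambda>i. norm ((axis k x :: 'a^'n)$i)"]
  by (simp add: norm_vec_def axis_def if_distrib[of norm] sum.delta cong: if_cong)
qed (auto simp: axis_def vec_eq_iff)
lemma vec_eq_sum_axis: "(\<chi> k. f k) = (\<Sum>k\<in>UNIV. axis k (f k))"
 by (auto simp: vec_eq_iff axis_def if_distrib if_distribR sum.delta cong: if_cong)

lemma Ck_vec_lambda:
 fixes f :: "'m::finite \<Rightarrow> real^'n \<Rightarrow> 'a::real_normed_vector"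
 assumes "ropen I U" "\<And>k. Ck r I U (f k)"
 shows "Ck r I U (\<lambda>y. \<chi> k. f k y)"
 unfolding vec_eq_sum_axis
 by (rule Ck_sum[OF assms(1)], rule Ck_bounded_linear[OF bounded_linear_axis assms])

subsection \<open>Total derivative\<close>

text \<open>The increment is travelled one coordinate at a time. On each leg the mean value
  inequality bounds the error by the oscillation of a single partial derivative, which is small by
  continuity.\<close>

lemma Ck_has_derivative:
 fixes f :: "real^'n \<Rightarrow> 'a::real_normed_vector"
 assumes U: "ropen I U" and f: "Ck (Suc 0) I U f" and y: "y \<in> U"
 shows "(f has_derivative (\<lambda>v. \<Sum>i\<in>I. v$i *\<^sub>R pd i f y)) (at y within U)"
 unfolding has_derivative_within_alt
proof (intro conjI allI impI)
 show "bounded_linear (\<lambda>v. \<Sum>i\<in>I. v$i *\<^sub>R pd i f y)"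
  by (intro bounded_linear_sum bounded_linear_compose[OF bounded_linear_scaleR_left] bounded_linear_vec_nth)
 fix e :: real assume "e > 0"
 \<comment> \<open>One share of the error for each leg; the 1 in the denominator covers empty
   \<open>I\<close>.\<close>
 define \<epsilon> where "\<epsilon> = e / (real (card I) + 1)"
 have \<epsilon>: "\<epsilon> > 0" "real (card I) * \<epsilon> \<le> e" using \<open>e > 0\<close> by (simp_all add: \<epsilon>_def field_simps)
 obtain d0 where d0: "d0 > 0" "ball y d0 \<inter> coord I \<subseteq> U" using ropen_ballE[OF U y] .
 have "\<forall>i\<in>I. \<exists>d>0. \<forall>z\<in>U. dist z y < d \<longrightarrow> dist (pd i f z) (pd i f y) < \<epsilon>"
  using f y \<epsilon>(1) unfolding Ck.simps continuous_on_iff by blast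
 then obtain dd where dd: "\<And>i. i \<in> I \<Longrightarrow> dd i > 0"
  "\<And>i z. \<lbrakk>i \<in> I; z \<in> U; dist z y < dd i\<rbrakk> \<Longrightarrow> dist (pd i f z) (pd i f y) < \<epsilon>" by metis
 define d where "d = Min (insert d0 (dd ` I))"
 have d: "d > 0" "d \<le> d0" "\<And>i. i \<in> I \<Longrightarrow> d \<le> dd i" unfolding d_def using d0 dd by auto
 have "norm (f z - f y - (\<Sum>i\<in>I. (z - y)$i *\<^sub>R pd i f y)) \<le> e * norm (z - y)" if z: "z \<in> U" "norm (z - y) < d" for z
 proof -
  define v where "v = z - y"
  \<comment> \<open>The displacement after the coordinates in \<open>S\<close> have been
    travelled.\<close>
  define w where "w S = (\<Sum>i\<in>S. v$i *\<^sub>R axis i (1::real))" for S :: "'n set"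
  have wn: "w S$i = (if i \<in> S then v$i else 0)" for S i
   unfolding w_def by (auto simp: axis_def if_distrib if_distribR sum.delta cong: if_cong)
  have v: "v \<in> coord I" unfolding v_def by (intro subspace_diff subspace_coord ropen_coord[OF U] z y)
  have "norm (f (y + w S) - f y - (\<Sum>i\<in>S. v$i *\<^sub>R pd i f y)) \<le> real (card S) * (\<epsilon> * norm v)" if "S \<subseteq> I" for S
   using finite_subset[OF that finite] that
  proof (induction S rule: finite_induct)
   case (insert k S)
   define p where "p = shift (y + w S) k"
   define T where "T = closed_segment 0 (v$k)"
   have pU: "p t \<in> U" "dist (p t) y < d" if "t \<in> T" for t
   proof -
    have "\<bar>(p t - y)$i\<bar> \<le> \<bar>v$i\<bar>" for i
     using segment_bound1[of t 0 "v$k"] that insert.hyps by (auto simp: p_def wn axis_def T_def)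
    then have "norm (p t - y) \<le> norm v" by (intro norm_le_componentwise_cart) simp
    then show n: "dist (p t) y < d" using z unfolding v_def dist_norm by simp
    have "p t \<in> coord I" using ropen_coord[OF U y] v insert.prems by (auto simp: p_def coord_def wn axis_def)
    then show "p t \<in> U" using d0 n d(2) by (auto simp: dist_commute)
   qed
   \<comment> \<open>Subtracting the linear term turns the derivative along the leg into a
     difference of two values of \<open>pd k f\<close>.\<close>
   have "norm ((f (p (v$k)) - v$k *\<^sub>R pd k f y) - (f (p 0) - 0 *\<^sub>R pd k f y)) \<le> \<epsilon> * norm (v$k - 0)"
   proof (rule differentiable_bound[where S = T])
    fix t assume t: "t \<in> T"
    have "((\<lambda>s. f (p s)) has_vector_derivative pd k f (p t)) (at t)"
     using Ck_pds[OF f _ pU(1)[OF t], of k] insert.prems unfolding p_def by (intro pds_shift) simp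
    then have "((\<lambda>s. f (p s) - s *\<^sub>R pd k f y) has_vector_derivative (pd k f (p t) - pd k f y)) (at t)"
     by (auto intro!: derivative_eq_intros)
    then show "((\<lambda>s. f (p s) - s *\<^sub>R pd k f y) has_derivative (\<lambda>s. s *\<^sub>R (pd k f (p t) - pd k f y))) (at t within T)"
     unfolding has_vector_derivative_def by (rule has_derivative_at_withinI)
    have "norm (pd k f (p t) - pd k f y) < \<epsilon>"
     using dd(2)[OF _ pU(1)[OF t], of k] pU(2)[OF t] d(3)[of k] insert.prems by (simp add: dist_norm)
    then show "onorm (\<lambda>s. s *\<^sub>R (pd k f (p t) - pd k f y)) \<le> \<epsilon>"
     by (intro onorm_le) (simp add: mult.commute[of \<epsilon>] mult_left_mono)
   qed (auto simp: T_def)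
   moreover have "\<epsilon> * \<bar>v$k\<bar> \<le> \<epsilon> * norm v" using \<epsilon> component_le_norm_cart by (intro mult_left_mono) auto
   moreover have "p (v$k) = y + w (insert k S)" "p 0 = y + w S" using insert.hyps by (auto simp: p_def w_def)
   ultimately have "norm ((f (y + w (insert k S)) - v$k *\<^sub>R pd k f y - f (y + w S)) + (f (y + w S) - f y - (\<Sum>i\<in>S. v$i *\<^sub>R pd i f y)))
     \<le> \<epsilon> * norm v + real (card S) * (\<epsilon> * norm v)"
    using insert by (intro norm_triangle_mono) auto
   then show ?case using insert.hyps by (simp add: algebra_simps)
  qed (simp add: w_def)
  from this[of I] have "norm (f (y + w I) - f y - (\<Sum>i\<in>I. v$i *\<^sub>R pd i f y)) \<le> real (card I) * \<epsilon> * norm v" by simp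
  also have "\<dots> \<le> e * norm v" using \<epsilon>(2) by (rule mult_right_mono) simp
  finally have "norm (f (y + w I) - f y - (\<Sum>i\<in>I. v$i *\<^sub>R pd i f y)) \<le> e * norm v" .
  moreover have "y + w I = z" using coord_expand[OF v, folded w_def] v_def by (metis add.commute diff_add_cancel)
  ultimately show ?thesis by (simp only: v_def)
 qed
 with d(1) show "\<exists>d>0. \<forall>z\<in>U. norm (z - y) < d \<longrightarrow> norm (f z - f y - (\<Sum>i\<in>I. (z - y)$i *\<^sub>R pd i f y)) \<le> e * norm (z - y)" by blast
qed

lemma has_derivative_pds:
 assumes "ropen I U" "y \<in> U" "i \<in> I" "(f has_derivative f') (at y within U)"
 shows "pds i f (f' (axis i 1)) y"
proof -
 define S where "S = {t. shift y i t \<in> U}"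
 obtain T where T: "open T" "0 \<in> T" "\<And>t. t \<in> T \<Longrightarrow> shift y i t \<in> U"
  using eventually_ropen_line[OF assms(1-3)] unfolding eventually_nhds by auto
 have l: "((\<lambda>t. shift y i t) has_derivative (\<lambda>t. t *\<^sub>R axis i 1)) (at 0 within T)"
  by (auto intro!: derivative_eq_intros)
 have "((\<lambda>t. f (shift y i t)) has_derivative (\<lambda>t. f' (t *\<^sub>R axis i 1))) (at 0 within T)"
 proof (rule has_derivative_in_compose[OF l])
  show "(f has_derivative f') (at (shift y i 0) within (\<lambda>t. shift y i t) ` T)"
   using T has_derivative_subset[OF assms(4)] by (simp add: image_subset_iff)
 qed
 then have "((\<lambda>t. f (shift y i t)) has_derivative (\<lambda>t. f' (t *\<^sub>R axis i 1))) (at 0)"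
  using at_within_open[OF T(2,1)] by simp
 moreover have "(\<lambda>t. f' (t *\<^sub>R axis i 1)) = (\<lambda>t. t *\<^sub>R f' (axis i 1))"
  by (simp add: linear_cmul[OF has_derivative_linear[OF assms(4)]])
 ultimately show ?thesis unfolding pds_def has_vector_derivative_def by simp
qed

lemma Ck_le: "r \<le> s \<Longrightarrow> Ck s I U f \<Longrightarrow> Ck r I U f"
 by (induction s rule: nat_induct_at_least) (auto dest: Ck_SucD simp del: Ck.simps)

lemma Ck_Suc0: "Ck (Suc r) I U f \<Longrightarrow> Ck (Suc 0) I U f"
 by (rule Ck_le[of "Suc 0" "Suc r"]) (simp_all del: Ck.simps)

lemma pds_compose:
 fixes f :: "real^'n \<Rightarrow> real^'k" and g :: "real^'k \<Rightarrow> 'a::real_normed_vector"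
 assumes U: "ropen I U" and V: "ropen K V" and f: "Ck (Suc 0) I U f" and g: "Ck (Suc 0) K V g"
  and fU: "f ` U \<subseteq> V" and y: "y \<in> U" and i: "i \<in> I"
 shows "pds i (\<lambda>y. g (f y)) (\<Sum>k\<in>K. pd i f y$k *\<^sub>R pd k g (f y)) y"
proof -
 have "((\<lambda>y. g (f y)) has_derivative (\<lambda>v. \<Sum>k\<in>K. (\<Sum>j\<in>I. v$j *\<^sub>R pd j f y)$k *\<^sub>R pd k g (f y))) (at y within U)"
  by (rule has_derivative_in_compose2[OF _ fU y Ck_has_derivative[OF U f y]])
   (rule Ck_has_derivative[OF V g], use fU in auto)
 from has_derivative_pds[OF U y i this] show ?thesis
  using i by (simp add: axis_def if_distrib if_distribR sum.delta cong: if_cong)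
qed

lemma pd_in_coord:
 fixes f :: "real^'n \<Rightarrow> real^'k"
 assumes U: "ropen I U" and f: "Ck (Suc 0) I U f" and fU: "f ` U \<subseteq> coord K" and y: "y \<in> U" and i: "i \<in> I"
 shows "pd i f y \<in> coord K"
proof -
 have "pd i f y$k = 0" if k: "k \<notin> K" for k
 proof -
  have p: "pds i (\<lambda>y. f y$k) (pd i f y$k) y"
   by (rule pds_bounded_linear[OF bounded_linear_vec_nth Ck_pds[OF f i y]])
  have "pds i (\<lambda>y. f y$k) 0 y"
   by (rule pds_cong[OF U y i _ pds_const[of _ 0]]) (use fU k in \<open>auto simp: coord_def image_subset_iff\<close>)
  then show ?thesis using pds_pd[OF p] pds_pd[of i "\<lambda>y. f y$k" 0 y] by simp
 qed
 then show ?thesis by (auto simp: coord_def)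
qed

lemma Ck_compose:
 fixes f :: "real^'n \<Rightarrow> real^'k" and g :: "real^'k \<Rightarrow> 'a::real_normed_vector"
 assumes U: "ropen I U" and V: "ropen K V" and fU: "f ` U \<subseteq> V" and f: "Ck r I U f" and g: "Ck r K V g"
 shows "Ck r I U (\<lambda>y. g (f y))"
 using f g
proof (induction r arbitrary: g)
 case 0
 then show ?case using fU continuous_on_compose2[of V g U f] by simp
next
 case (Suc r)
 show ?case
 proof (rule Ck_Suc[OF _ _ _ U])
  show "continuous_on U (\<lambda>y. g (f y))" using Suc.prems fU continuous_on_compose2[of V g U f] by simp
  show "pds i (\<lambda>y. g (f y)) (\<Sum>k\<in>K. pd i f y$k *\<^sub>R pd k g (f y)) y" if "i \<in> I" "y \<in> U" for i y
   by (rule pds_compose[OF U V Ck_Suc0[OF Suc.prems(1)] Ck_Suc0[OF Suc.prems(2)] fU that(2,1)])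
  show "Ck r I U (\<lambda>y. \<Sum>k\<in>K. pd i f y$k *\<^sub>R pd k g (f y))" if "i \<in> I" for i
  proof (rule Ck_sum[OF U], rule Ck_bilinear[OF bounded_bilinear_scaleR U])
   fix k assume k: "k \<in> K"
   show "Ck r I U (\<lambda>y. pd i f y$k)" by (rule Ck_vec_nth[OF U]) (use Suc.prems that in simp)
   show "Ck r I U (\<lambda>y. pd k g (f y))" by (rule Suc.IH[OF Ck_SucD[OF Suc.prems(1)]]) (use Suc.prems(2) k in simp)
  qed
 qed
qed

lemma pds_real_compose:
 fixes f :: "real^'n \<Rightarrow> real" and g :: "real \<Rightarrow> 'a::real_normed_vector"
 assumes "pds i f D y" "(g has_vector_derivative D') (at (f y))"
 shows "pds i (\<lambda>y. g (f y)) (D *\<^sub>R D') y"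
 using vector_diff_chain_at[of "\<lambda>t. f (shift y i t)" D 0 g D'] assms
 unfolding pds_def o_def by simp

section \<open>Smooth functions of one real variable, substituted into C^k functions\<close>

definition smooth1 :: "real set \<Rightarrow> (real \<Rightarrow> real) \<Rightarrow> bool" where
 "smooth1 S \<phi> \<longleftrightarrow> (\<forall>k. (deriv ^^ k) \<phi> differentiable_on S)"

lemma smooth1_deriv: "smooth1 S \<phi> \<Longrightarrow> smooth1 S (deriv \<phi>)"
 unfolding smooth1_def by (metis funpow_Suc_right o_apply)

lemma smooth1_has_derivative:
 assumes "smooth1 S \<phi>" "open S" "t \<in> S"
 shows "(\<phi> has_real_derivative deriv \<phi> t) (at t)"
proof -
 have "\<phi> differentiable_on S" using assms(1) unfolding smooth1_def by (metis funpow_0)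
 then have "\<phi> differentiable (at t)" using assms by (simp add: differentiable_on_eq_differentiable_at)
 then show ?thesis by (simp add: DERIV_deriv_iff_real_differentiable)
qed

lemma smooth1_continuous_on: "smooth1 S \<phi> \<Longrightarrow> continuous_on S \<phi>"
 unfolding smooth1_def by (metis funpow_0 differentiable_imp_continuous_on)

text \<open>Membership in \<open>R\<close> passes to all derivatives. Since \<open>deriv\<close> is
  controlled only on \<open>S\<close>, the induction runs over functions \<open>\<psi>\<close> that
  agree on \<open>S\<close> with a member of \<open>R\<close>.\<close>

lemma smooth1_coinduct:
 assumes S: "open S" and R: "R \<phi>"
  and step: "\<And>\<phi>. R \<phi> \<Longrightarrow> \<exists>\<phi>'. R \<phi>' \<and> (\<forall>t\<in>S. (\<phi> has_real_derivative \<phi>' t) (at t))"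
 shows "smooth1 S \<phi>"
proof -
 have D: "\<exists>\<phi>'. R \<phi>' \<and> (\<forall>t\<in>S. (\<psi> has_real_derivative \<phi>' t) (at t))" if "R \<phi>" "\<forall>t\<in>S. \<psi> t = \<phi> t" for \<phi> \<psi>
  using step[OF that(1)] that(2) has_field_derivative_transform_within_open[OF _ S, of \<phi> _ _ \<psi>] by metis
 have "(deriv ^^ k) \<psi> differentiable_on S" if "R \<phi>" "\<forall>t\<in>S. \<psi> t = \<phi> t" for k \<phi> \<psi>
  using that
 proof (induction k arbitrary: \<phi> \<psi>)
  case (0 \<phi> \<psi>)
  show ?case using D[OF 0] by simp (meson differentiable_at_imp_differentiable_on real_differentiable_def)
 next
  case (Suc k \<phi> \<psi>)
  obtain \<phi>' where \<phi>': "R \<phi>'" "\<forall>t\<in>S. (\<psi> has_real_derivative \<phi>' t) (at t)" using D[OF Suc.prems] by blast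
  then have "\<forall>t\<in>S. deriv \<psi> t = \<phi>' t" by (simp add: DERIV_imp_deriv)
  then show ?case using Suc.IH[OF \<phi>'(1)] by (simp add: funpow_swap1)
 qed
 then show ?thesis using R unfolding smooth1_def by blast
qed

lemma Ck_real_compose:
 fixes f :: "real^'n \<Rightarrow> real"
 assumes U: "ropen I U" and S: "open S" and f: "Ck r I U f" and fU: "f ` U \<subseteq> S" and g: "smooth1 S \<phi>"
 shows "Ck r I U (\<lambda>y. \<phi> (f y))"
 using f g
proof (induction r arbitrary: \<phi>)
 case 0
 then show ?case using fU continuous_on_compose2[of S \<phi> U f] smooth1_continuous_on by simp
next
 case (Suc r)
 show ?case
 proof (rule Ck_Suc[OF _ _ _ U])
  show "continuous_on U (\<lambda>y. \<phi> (f y))" using Suc.prems fU continuous_on_compose2[of S \<phi> U f] smooth1_continuous_on by simp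
  show "pds i (\<lambda>y. \<phi> (f y)) (pd i f y *\<^sub>R deriv \<phi> (f y)) y" if iy: "i \<in> I" "y \<in> U" for i y
  proof (rule pds_real_compose[OF Ck_pds[OF Suc.prems(1) iy]])
   have "f y \<in> S" using fU iy by auto
   then show "(\<phi> has_vector_derivative deriv \<phi> (f y)) (at (f y))"
    using smooth1_has_derivative[OF Suc.prems(2) S] by (simp add: has_real_derivative_iff_has_vector_derivative)
  qed
  show "Ck r I U (\<lambda>y. pd i f y *\<^sub>R deriv \<phi> (f y))" if "i \<in> I" for i
  proof (rule Ck_bilinear[OF bounded_bilinear_scaleR U])
   show "Ck r I U (pd i f)" using Suc.prems that by simp
   show "Ck r I U (\<lambda>y. deriv \<phi> (f y))" by (rule Suc.IH[OF Ck_SucD[OF Suc.prems(1)] smooth1_deriv[OF Suc.prems(2)]])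
  qed
 qed
qed

subsection \<open>Symmetry of second derivatives\<close>

text \<open>The mean value theorem is applied in direction \<open>i\<close> to a difference taken in
  direction \<open>j\<close>, and then in direction \<open>j\<close>. The square of side h has
  points at distance up to 2h from \<open>y\<close>; the radius 3h leaves room.\<close>

lemma mixed_difference:
 fixes f :: "real^'n \<Rightarrow> real"
 assumes U: "ropen I U" and f: "Ck 2 I U f" and ij: "i \<in> I" "j \<in> I" and y: "y \<in> U"
  and h: "h > 0" and B: "ball y (3*h) \<inter> coord I \<subseteq> U"
 shows "\<exists>z\<in>U. dist z y < 3*h \<and>
  f (shift (shift y i h) j h) - f (shift y i h) - f (shift y j h) + f y = h*h*pd j (pd i f) z"
proof -
 have f1: "Ck (Suc 0) I U f" and f2: "Ck (Suc 0) I U (pd i f)" using f ij by (auto simp: numeral_2_eq_2)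
 have n: "dist (shift (shift y i s) j t) y < 3*h" and S: "shift (shift y i s) j t \<in> U"
  if "0 \<le> s" "s \<le> h" "0 \<le> t" "t \<le> h" for s t
 proof -
  show n: "dist (shift (shift y i s) j t) y < 3*h"
   using norm_triangle_ineq[of "s *\<^sub>R axis i (1::real)" "t *\<^sub>R axis j (1::real)"] that h by (simp add: dist_norm add_ac)
  have "shift (shift y i s) j t \<in> coord I"
   using ropen_coord[OF U y] ij by (intro subspace_add subspace_coord subspace_scale axis_in_coord)
  then show "shift (shift y i s) j t \<in> U" using B n by (auto simp: dist_commute)
 qed
 define \<phi> where "\<phi> s = f (shift (shift y i s) j h) - f (shift y i s)" for s
 have d: "(\<phi> has_real_derivative pd i f (shift (shift y i s) j h) - pd i f (shift y i s)) (at s)" if "0 \<le> s" "s \<le> h" for s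
 proof -
  have c: "shift (shift y i s) j h = shift (shift y j h) i s" for s by (simp add: add_ac)
  show ?thesis using pds_shift[OF Ck_pds[OF f1 ij(1) S[of s h, unfolded c]]] pds_shift[OF Ck_pds[OF f1 ij(1)], of y s] S[of s 0] that h
   unfolding \<phi>_def c has_real_derivative_iff_has_vector_derivative by (auto intro: has_vector_derivative_diff)
 qed
 obtain s where s: "0 < s" "s < h" "\<phi> h - \<phi> 0 = (h - 0) * (pd i f (shift (shift y i s) j h) - pd i f (shift y i s))"
  using MVT2[OF h d] by blast
 have "((\<lambda>t. pd i f (shift (shift y i s) j t)) has_real_derivative pd j (pd i f) (shift (shift y i s) j t)) (at t)" if "0 \<le> t" "t \<le> h" for t
  unfolding has_real_derivative_iff_has_vector_derivative using S s that by (intro pds_shift Ck_pds[OF f2 ij(2)]) simp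
 from MVT2[OF h this] obtain t where t: "0 < t" "t < h"
  "pd i f (shift (shift y i s) j h) - pd i f (shift (shift y i s) j 0) = (h - 0) * pd j (pd i f) (shift (shift y i s) j t)" by blast
 have "\<phi> h - \<phi> 0 = h*h*pd j (pd i f) (shift (shift y i s) j t)" using s(3) t(3) by simp
 then show ?thesis using s t n[of s t] S[of s t] by (auto simp: \<phi>_def)
qed

text \<open>The second difference is symmetric in \<open>i\<close> and \<open>j\<close>. Hence the
  two mixed derivatives take equal values at points arbitrarily near \<open>y\<close>, and
  continuity does the rest.\<close>

lemma pd_commute_real:
 fixes f :: "real^'n \<Rightarrow> real"
 assumes U: "ropen I U" and f: "Ck 2 I U f" and ij: "i \<in> I" "j \<in> I" and y: "y \<in> U"
 shows "pd i (pd j f) y = pd j (pd i f) y"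
proof (rule ccontr)
 define e where "e = \<bar>pd i (pd j f) y - pd j (pd i f) y\<bar> / 2"
 assume "pd i (pd j f) y \<noteq> pd j (pd i f) y"
 then have e: "e > 0" by (simp add: e_def)
 have c: "continuous_on U (pd i (pd j f))" "continuous_on U (pd j (pd i f))"
  using f ij by (auto simp: numeral_2_eq_2)
 obtain d1 where d1: "d1 > 0" "\<And>z. z \<in> U \<Longrightarrow> dist z y < d1 \<Longrightarrow> dist (pd i (pd j f) z) (pd i (pd j f) y) < e"
  using c(1) e y unfolding continuous_on_iff by metis
 obtain d2 where d2: "d2 > 0" "\<And>z. z \<in> U \<Longrightarrow> dist z y < d2 \<Longrightarrow> dist (pd j (pd i f) z) (pd j (pd i f) y) < e"
  using c(2) e y unfolding continuous_on_iff by metis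
 obtain d0 where d0: "d0 > 0" "ball y d0 \<inter> coord I \<subseteq> U" using ropen_ballE[OF U y] .
 define h where "h = min d0 (min d1 d2) / 3"
 have h: "h > 0" "3*h \<le> d1" "3*h \<le> d2" using d0 d1 d2 by (simp_all add: h_def)
 have B: "ball y (3*h) \<inter> coord I \<subseteq> U" using d0 by (auto simp: h_def)
 obtain z where z: "z \<in> U" "dist z y < 3*h"
  "f (shift (shift y i h) j h) - f (shift y i h) - f (shift y j h) + f y = h*h*pd j (pd i f) z"
  using mixed_difference[OF U f ij y h(1) B] by blast
 obtain z' where z': "z' \<in> U" "dist z' y < 3*h"
  "f (shift (shift y j h) i h) - f (shift y j h) - f (shift y i h) + f y = h*h*pd i (pd j f) z'"
  using mixed_difference[OF U f ij(2,1) y h(1) B] by blast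
 have "f (shift (shift y j h) i h) = f (shift (shift y i h) j h)" by (simp add: add_ac)
 then have "h*h*pd j (pd i f) z = h*h*pd i (pd j f) z'" using z(3) z'(3) by linarith
 then have "pd j (pd i f) z = pd i (pd j f) z'" using h by simp
 moreover have "\<bar>pd i (pd j f) z' - pd i (pd j f) y\<bar> < e" "\<bar>pd j (pd i f) z - pd j (pd i f) y\<bar> < e"
  using d1(2)[OF z'(1)] d2(2)[OF z(1)] z z' h by (auto simp: dist_real_def)
 ultimately show False unfolding e_def by argo
qed

lemma pd_bounded_linear:
 assumes "bounded_linear L" "Ck (Suc r) I U f" "i \<in> I" "y \<in> U"
 shows "pd i (\<lambda>y. L (f y)) y = L (pd i f y)"
 by (rule pds_pd[OF pds_bounded_linear[OF assms(1) Ck_pds[OF assms(2-4)]]])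

lemma pd_commute:
 fixes f :: "real^'n \<Rightarrow> 'a::euclidean_space"
 assumes U: "ropen I U" and f: "Ck 2 I U f" and ij: "i \<in> I" "j \<in> I" and y: "y \<in> U"
 shows "pd i (pd j f) y = pd j (pd i f) y"
proof (rule euclidean_eqI)
 fix b :: 'a
 let ?L = "\<lambda>x::'a. x \<bullet> b"
 have L: "bounded_linear ?L" by (rule bounded_linear_inner_left)
 have f1: "Ck (Suc 1) I U f" and f2: "Ck (Suc 0) I U (pd i f)" "Ck (Suc 0) I U (pd j f)" using f ij by (auto simp: numeral_2_eq_2)
 have *: "?L (pd a (pd c f) y) = pd a (pd c (\<lambda>y. ?L (f y))) y" if "a \<in> I" "c \<in> I" "Ck (Suc 0) I U (pd c f)" for a c
 proof -
  have "pd a (pd c (\<lambda>y. ?L (f y))) y = pd a (\<lambda>y. ?L (pd c f y)) y"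
   by (rule pd_cong[OF U y that(1)]) (rule pd_bounded_linear[OF L f1 that(2)])
  also have "\<dots> = ?L (pd a (pd c f) y)"
   by (rule pd_bounded_linear[OF L that(3) that(1) y])
  finally show ?thesis by simp
 qed
 show "pd i (pd j f) y \<bullet> b = pd j (pd i f) y \<bullet> b"
  using *[OF ij f2(2)] *[OF ij(2,1) f2(1)] pd_commute_real[OF U Ck_bounded_linear[OF L U f] ij y] by simp
qed

subsection \<open>Smooth functions\<close>

lemma smooth_Ck: "smooth I U f \<Longrightarrow> Ck r I U f"
 by (simp add: smooth_def)

lemma smooth_continuous: "smooth I U f \<Longrightarrow> continuous_on U f"
 by (rule Ck_cont[OF smooth_Ck])

lemma smooth_pds: "\<lbrakk>smooth I U f; i \<in> I; y \<in> U\<rbrakk> \<Longrightarrow> pds i f (pd i f y) y"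
 by (rule Ck_pds[OF smooth_Ck])

lemma smooth_pd:
 assumes "smooth I U f" "i \<in> I"
 shows "smooth I U (pd i f)"
 unfolding smooth_def
proof
 fix r show "Ck r I U (pd i f)" using smooth_Ck[OF assms(1), of "Suc r"] assms(2) by simp
qed

lemma smooth_subset: "smooth I U f \<Longrightarrow> V \<subseteq> U \<Longrightarrow> smooth I V f"
 unfolding smooth_def by (rule allI, rule Ck_subset) simp_all

context
 fixes I :: "'n::finite set" and U
 assumes U: "ropen I U"
begin

lemma smooth_cong: "smooth I U f \<Longrightarrow> (\<And>y. y \<in> U \<Longrightarrow> f y = g y) \<Longrightarrow> smooth I U g"
 unfolding smooth_def by (rule allI, rule Ck_cong[OF U, of f]) simp_all

lemma smooth_const: "smooth I U (\<lambda>y. c)"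
 unfolding smooth_def by (rule allI, rule Ck_const[OF U])

lemma smooth_add: "smooth I U f \<Longrightarrow> smooth I U g \<Longrightarrow> smooth I U (\<lambda>y. f y + g y)"
 unfolding smooth_def by (rule allI, rule Ck_add[OF U]) simp_all

lemma smooth_sum: "(\<And>s. s \<in> S \<Longrightarrow> smooth I U (f s)) \<Longrightarrow> smooth I U (\<lambda>y. \<Sum>s\<in>S. f s y)"
 unfolding smooth_def by (rule allI, rule Ck_sum[OF U]) simp

lemma smooth_bounded_linear: "bounded_linear L \<Longrightarrow> smooth I U f \<Longrightarrow> smooth I U (\<lambda>y. L (f y))"
 unfolding smooth_def by (rule allI, rule Ck_bounded_linear[OF _ U]) simp_all

lemma smooth_bilinear: "\<lbrakk>bounded_bilinear B; smooth I U f; smooth I U g\<rbrakk> \<Longrightarrow> smooth I U (\<lambda>y. B (f y) (g y))"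
 unfolding smooth_def by (rule allI, rule Ck_bilinear[OF _ U]) simp_all

lemma smooth_minus: "smooth I U f \<Longrightarrow> smooth I U (\<lambda>y. - f y)"
 by (rule smooth_bounded_linear[OF bounded_linear_minus[OF bounded_linear_ident]])

lemma smooth_diff: "smooth I U f \<Longrightarrow> smooth I U g \<Longrightarrow> smooth I U (\<lambda>y. f y - g y)"
 using smooth_add[OF _ smooth_minus, of f g] by simp

lemma smooth_scaleR: "smooth I U f \<Longrightarrow> smooth I U g \<Longrightarrow> smooth I U (\<lambda>y. f y *\<^sub>R g y)"
 by (rule smooth_bilinear[OF bounded_bilinear_scaleR])

lemma smooth_mult: "smooth I U f \<Longrightarrow> smooth I U g \<Longrightarrow> smooth I U (\<lambda>y. f y * g y :: real)"
 by (rule smooth_bilinear[OF bounded_bilinear_mult])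

lemma smooth_nth: "smooth I U f \<Longrightarrow> smooth I U (\<lambda>y. f y$k)"
 by (rule smooth_bounded_linear[OF bounded_linear_vec_nth])

lemma smooth_vec_lambda:
 "(\<And>k. smooth I U (f k)) \<Longrightarrow> smooth I U (\<lambda>y. \<chi> k. (f k y :: 'a::real_normed_vector))"
 unfolding smooth_def by (rule allI, rule Ck_vec_lambda[OF U]) simp

lemma smooth_compose:
 assumes "ropen K V" "f ` U \<subseteq> V" "smooth I U f" "smooth K V g"
 shows "smooth I U (\<lambda>y. g (f y))"
 unfolding smooth_def by (rule allI, rule Ck_compose[OF U assms(1,2)]) (rule smooth_Ck assms)+

lemma smooth_real_compose:
 assumes "open S" "smooth I U f" "f ` U \<subseteq> S" "smooth1 S \<phi>"
 shows "smooth I U (\<lambda>y. \<phi> (f y))"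
 unfolding smooth_def by (rule allI, rule Ck_real_compose[OF U assms(1)]) (rule smooth_Ck assms)+

lemma smooth_prod: "finite S \<Longrightarrow> (\<And>s. s \<in> S \<Longrightarrow> smooth I U (f s)) \<Longrightarrow> smooth I U (\<lambda>y. \<Prod>s\<in>S. f s y :: real)"
 by (induction S rule: finite_induct) (simp_all add: smooth_const smooth_mult)

lemma smooth_inverse:
 assumes f: "smooth I U f" and nz: "\<And>y. y \<in> U \<Longrightarrow> f y \<noteq> 0"
 shows "smooth I U (\<lambda>y. inverse (f y) :: real)"
proof (rule smooth_real_compose[OF _ f])
 \<comment> \<open>Away from 0 the multiples of integer powers of t are closed under
   differentiation.\<close>
 show "smooth1 (- {0}) (inverse :: real \<Rightarrow> real)"
 proof (rule smooth1_coinduct[where R = "\<lambda>\<phi>. \<exists>c n. \<phi> = (\<lambda>t. c * t powi n)"])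
  show "\<exists>c n. inverse = (\<lambda>t. c * t powi n :: real)" by (intro exI[of _ 1] exI[of _ "-1"]) (simp add: power_int_minus fun_eq_iff)
  fix \<phi> :: "real \<Rightarrow> real" assume "\<exists>c n. \<phi> = (\<lambda>t. c * t powi n)"
  then obtain c n where \<phi>: "\<phi> = (\<lambda>t. c * t powi n)" by blast
  have "(\<phi> has_real_derivative (c * of_int n) * t powi (n - 1)) (at t)" if "t \<in> - {0}" for t
   unfolding \<phi> using that by (auto intro!: derivative_eq_intros simp: field_simps)
  then show "\<exists>\<phi>'. (\<exists>c n. \<phi>' = (\<lambda>t. c * t powi n)) \<and> (\<forall>t\<in>- {0}. (\<phi> has_real_derivative \<phi>' t) (at t))" by blast
 qed auto
qed (use nz in auto)

lemma smooth_divide: "smooth I U f \<Longrightarrow> smooth I U g \<Longrightarrow> (\<And>y. y \<in> U \<Longrightarrow> g y \<noteq> 0) \<Longrightarrow> smooth I U (\<lambda>y. f y / g y :: real)"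
 unfolding divide_inverse by (intro smooth_mult smooth_inverse)

lemma pd_bilinear:
 assumes "bounded_bilinear B" "smooth I U f" "smooth I U g" "i \<in> I" "y \<in> U"
 shows "pd i (\<lambda>y. B (f y) (g y)) y = B (f y) (pd i g y) + B (pd i f y) (g y)"
 by (rule pds_pd[OF pds_bilinear[OF assms(1) smooth_pds[OF assms(2,4,5)] smooth_pds[OF assms(3-5)]]])

lemma pd_blinear:
 assumes "bounded_linear L" "smooth I U f" "i \<in> I" "y \<in> U"
 shows "pd i (\<lambda>y. L (f y)) y = L (pd i f y)"
 by (rule pds_pd[OF pds_bounded_linear[OF assms(1) smooth_pds[OF assms(2-4)]]])

lemma pd_add:
 assumes "smooth I U f" "smooth I U g" "i \<in> I" "y \<in> U"
 shows "pd i (\<lambda>y. f y + g y) y = pd i f y + pd i g y"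
 by (rule pds_pd[OF pds_add[OF smooth_pds[OF assms(1,3,4)] smooth_pds[OF assms(2-4)]]])

lemma pd_diff:
 assumes "smooth I U f" "smooth I U g" "i \<in> I" "y \<in> U"
 shows "pd i (\<lambda>y. f y - g y) y = pd i f y - pd i g y"
 by (rule pds_pd[OF pds_diff[OF smooth_pds[OF assms(1,3,4)] smooth_pds[OF assms(2-4)]]])

lemma pd_sum:
 assumes "\<And>s. s \<in> S \<Longrightarrow> smooth I U (f s)" "i \<in> I" "y \<in> U"
 shows "pd i (\<lambda>y. \<Sum>s\<in>S. f s y) y = (\<Sum>s\<in>S. pd i (f s) y)"
 by (rule pds_pd[OF pds_sum[OF smooth_pds[OF assms]]])

lemma pd_nth:
 assumes "smooth I U f" "i \<in> I" "y \<in> U"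
 shows "pd i (\<lambda>y. f y$k) y = pd i f y$k"
 by (rule pd_blinear[OF bounded_linear_vec_nth assms])

lemma pd_nth2:
 assumes "smooth I U f" "i \<in> I" "y \<in> U"
 shows "pd i (\<lambda>y. f y$k$l) y = pd i f y$k$l"
 by (simp add: pd_nth[OF smooth_nth[OF assms(1)] assms(2,3)] pd_nth[OF assms])

lemma pd_compose:
 assumes "ropen K V" "f ` U \<subseteq> V" "smooth I U f" "smooth K V g" "i \<in> I" "y \<in> U"
 shows "pd i (\<lambda>y. g (f y)) y = (\<Sum>k\<in>K. pd i f y$k *\<^sub>R pd k g (f y))"
 by (rule pds_pd[OF pds_compose[OF U assms(1) smooth_Ck[OF assms(3)] smooth_Ck[OF assms(4)] assms(2,6,5)]])

lemma pd_real_compose: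
 assumes "open S" "smooth I U f" "f ` U \<subseteq> S" "smooth1 S \<phi>" "i \<in> I" "y \<in> U"
 shows "pd i (\<lambda>y. \<phi> (f y)) y = deriv \<phi> (f y) * pd i f y"
proof -
 have "f y \<in> S" using assms(3,6) by auto
 then have "(\<phi> has_vector_derivative deriv \<phi> (f y)) (at (f y))"
  using smooth1_has_derivative[OF assms(4,1)] by (simp add: has_real_derivative_iff_has_vector_derivative)
 from pds_pd[OF pds_real_compose[OF smooth_pds[OF assms(2,5,6)] this]] show ?thesis by simp
qed

lemma smooth_pd_commute:
 fixes f :: "real^'n \<Rightarrow> 'a::euclidean_space"
 shows "\<lbrakk>smooth I U f; i \<in> I; j \<in> I; y \<in> U\<rbrakk> \<Longrightarrow> pd i (pd j f) y = pd j (pd i f) y"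
 by (rule pd_commute[OF U smooth_Ck])

end

subsection \<open>Matrix-valued functions\<close>

lemma bounded_bilinear_mm: "bounded_bilinear ((**) :: real^'m^'n \<Rightarrow> real^'k^'m \<Rightarrow> real^'k^'n)"
 unfolding bilinear_conv_bounded_bilinear[symmetric] bilinear_def linear_iff
 by (simp add: matrix_matrix_mult_def vec_eq_iff distrib_left distrib_right sum.distrib sum_distrib_left mult_ac)

lemma bounded_bilinear_mv: "bounded_bilinear ((*v) :: real^'m^'n \<Rightarrow> real^'m \<Rightarrow> real^'n)"
 unfolding bilinear_conv_bounded_bilinear[symmetric] bilinear_def linear_iff
 by (simp add: matrix_vector_mult_def vec_eq_iff distrib_left distrib_right sum.distrib sum_distrib_left mult_ac)

lemma bounded_linear_transpose: "bounded_linear (transpose :: real^'m^'n \<Rightarrow> real^'n^'m)"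
 unfolding linear_conv_bounded_linear[symmetric] linear_iff by (simp add: transpose_def vec_eq_iff)

lemma bounded_linear_trace: "bounded_linear (trace :: real^'n^'n \<Rightarrow> real)"
 unfolding linear_conv_bounded_linear[symmetric] linear_iff by (simp add: trace_def sum.distrib sum_distrib_left)

lemmas mm_ring = bounded_bilinear.add_left[OF bounded_bilinear_mm] bounded_bilinear.add_right[OF bounded_bilinear_mm]
 bounded_bilinear.diff_left[OF bounded_bilinear_mm] bounded_bilinear.diff_right[OF bounded_bilinear_mm]
 bounded_bilinear.minus_left[OF bounded_bilinear_mm] bounded_bilinear.minus_right[OF bounded_bilinear_mm]
 bounded_bilinear.scaleR_left[OF bounded_bilinear_mm] bounded_bilinear.scaleR_right[OF bounded_bilinear_mm]
 bounded_bilinear.zero_left[OF bounded_bilinear_mm] bounded_bilinear.zero_right[OF bounded_bilinear_mm]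
 matrix_mul_assoc[symmetric]

lemmas mm_sum_left = bounded_bilinear.sum_left[OF bounded_bilinear_mm]
lemmas mm_sum_right = bounded_bilinear.sum_right[OF bounded_bilinear_mm]

lemmas transpose_linear = bounded_linear.linear[OF bounded_linear_transpose, THEN linear_add]
 bounded_linear.linear[OF bounded_linear_transpose, THEN linear_diff]
 bounded_linear.linear[OF bounded_linear_transpose, THEN linear_neg]
 bounded_linear.linear[OF bounded_linear_transpose, THEN linear_cmul]
 bounded_linear.linear[OF bounded_linear_transpose, THEN linear_sum]

lemmas trace_linear = bounded_linear.linear[OF bounded_linear_trace, THEN linear_add]
 bounded_linear.linear[OF bounded_linear_trace, THEN linear_diff]
 bounded_linear.linear[OF bounded_linear_trace, THEN linear_neg]
 bounded_linear.linear[OF bounded_linear_trace, THEN linear_cmul]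
 bounded_linear.linear[OF bounded_linear_trace, THEN linear_sum]
 bounded_linear.linear[OF bounded_linear_trace, THEN linear_0]

lemma trace_transpose: "trace (transpose A) = trace (A :: real^'n^'n)"
 by (simp add: trace_def transpose_def)

lemma mm_nth: "(A**B)$i$j = (\<Sum>k\<in>UNIV. A$i$k * B$k$j)"
 by (simp add: matrix_matrix_mult_def)

lemma mv_nth: "(A *v v)$i = (\<Sum>k\<in>UNIV. A$i$k * v$k)"
 by (simp add: matrix_vector_mult_def)

lemma inner_mv: "(x::real^'n::finite) \<bullet> (A *v y) = (transpose A *v x) \<bullet> y"
 by (simp add: dot_lmul_matrix transpose_matrix_vector)

lemma bil_sum: "bil A v w = (\<Sum>i\<in>UNIV. \<Sum>j\<in>UNIV. v$i * A$i$j * w$j)"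
 by (simp add: bil_def inner_vec_def matrix_vector_mult_def sum_distrib_left mult_ac)

lemma bil_axis: "bil A (axis i 1) (axis j 1) = A$i$j"
 by (simp add: bil_def inner_axis' matrix_vector_mult_basis column_def)

lemma bil_sum_scale: "bil (\<Sum>i\<in>S. r i *\<^sub>R A i) v w = (\<Sum>i\<in>S. r i * bil (A i) v w)"
 unfolding bil_def by (simp add: bounded_bilinear.sum_left[OF bounded_bilinear_mv] bounded_bilinear.scaleR_left[OF bounded_bilinear_mv] inner_sum_right)

lemma bil_add: "bil (A + B) v w = bil A v w + bil B v w" "bil (r *\<^sub>R A) v w = r * bil A v w"
 unfolding bil_def by (simp_all add: bounded_bilinear.add_left[OF bounded_bilinear_mv] bounded_bilinear.scaleR_left[OF bounded_bilinear_mv] inner_add_right)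

lemma bil_congruence: "bil (transpose P**A**Q) v w = bil A (P *v v) (Q *v w)"
 unfolding bil_def
 by (metis inner_mv matrix_vector_mul_assoc transpose_transpose)

section \<open>Matrices supported on blocks of indices\<close>

definition PI :: "'n::finite set \<Rightarrow> real^'n^'n" where
 "PI I = (\<chi> i j. if i = j \<and> i \<in> I then 1 else 0)"

definition blk :: "'m::finite set \<Rightarrow> 'n::finite set \<Rightarrow> real^'n^'m \<Rightarrow> bool" where
 "blk I J A \<longleftrightarrow> (\<forall>i j. i \<notin> I \<or> j \<notin> J \<longrightarrow> A$i$j = 0)"

lemma PI_nth_mult: "PI I$i$k * x = (if k = i then (if i \<in> I then x else 0) else 0)"
  "x * PI I$k$j = (if k = j then (if j \<in> I then x else 0) else 0)"
 by (auto simp: PI_def)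

lemma PI_mult: "PI I**A = (\<chi> i j. if i \<in> I then A$i$j else 0)"
 by (simp add: vec_eq_iff mm_nth PI_nth_mult sum.delta)

lemma mult_PI: "A**PI I = (\<chi> i j. if j \<in> I then A$i$j else 0)"
 by (simp add: vec_eq_iff mm_nth PI_nth_mult sum.delta)

lemma blk_PI: "blk I J A \<longleftrightarrow> PI I**A = A \<and> A**PI J = A"
 by (auto simp: blk_def PI_mult mult_PI vec_eq_iff)

lemma blk_left: "blk I J A \<Longrightarrow> PI I**A = A" and blk_right: "blk I J A \<Longrightarrow> A**PI J = A"
 by (auto simp: blk_PI)

lemma PI_mv_nth: "(PI I *v v)$i = (if i \<in> I then v$i else 0)"
 by (simp add: mv_nth PI_nth_mult sum.delta)

lemma PI_mv: "v \<in> coord I \<Longrightarrow> PI I *v v = v"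
 by (auto simp: vec_eq_iff PI_mv_nth coord_def)

lemma PI_mv_coord: "PI I *v v \<in> coord I"
 by (simp add: PI_mv_nth coord_def)

lemma transpose_PI [simp]: "transpose (PI I) = PI I"
 by (auto simp: transpose_def PI_def vec_eq_iff)

lemma blk_transpose: "blk I J A \<Longrightarrow> blk J I (transpose A)"
 by (auto simp: blk_def transpose_def)

lemma blk_mm: "blk I J A \<Longrightarrow> blk J' K B \<Longrightarrow> blk I K (A**B)"
 by (auto simp: blk_def mm_nth)

lemma blk_mv_coord: "blk I J A \<Longrightarrow> A *v v \<in> coord I"
 by (auto simp: blk_def coord_def mv_nth)

lemma blk_add: "blk I J A \<Longrightarrow> blk I J B \<Longrightarrow> blk I J (A + B)"
 by (auto simp: blk_def)

lemma blk_diff: "blk I J A \<Longrightarrow> blk I J B \<Longrightarrow> blk I J (A - B)"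
 by (auto simp: blk_def)

lemma blk_scaleR: "blk I J A \<Longrightarrow> blk I J (r *\<^sub>R A)"
 by (auto simp: blk_def)

lemma blk_sum: "(\<And>s. s \<in> S \<Longrightarrow> blk I J (A s)) \<Longrightarrow> blk I J (\<Sum>s\<in>S. A s)"
 by (auto simp: blk_def sum_component intro!: sum.neutral)

lemma blk_UNIV [simp]: "blk UNIV UNIV A"
 by (simp add: blk_def)

text \<open>The matrix that \<open>ginv\<close> inverts. The identity outside the block allows
  metrics on \<open>coord I\<close> to be handled by the algebra of full square matrices.\<close>

definition hat :: "'n::finite set \<Rightarrow> real^'n^'n \<Rightarrow> real^'n^'n" where
 "hat I A = (\<chi> i j. if i \<in> I \<and> j \<in> I then A$i$j else if i = j then 1 else 0)"

lemma ginv_hat: "ginv I A = matrix_inv (hat I A)"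
 by (simp add: ginv_def hat_def)

lemma matrix_inv_unique:
 fixes A B :: "real^'n^'n"
 assumes "A**B = mat 1"
 shows "matrix_inv A = B" "B**A = mat 1" "matrix_inv A**A = mat 1" "A**matrix_inv A = mat 1"
proof -
 show BA: "B**A = mat 1" using assms by (simp add: matrix_left_right_inverse)
 have "A**matrix_inv A = mat 1 \<and> matrix_inv A**A = mat 1"
  unfolding matrix_inv_def by (rule someI[of "\<lambda>A'. A**A' = mat 1 \<and> A'**A = mat 1" B]) (use assms BA in simp)
 then show "matrix_inv A**A = mat 1" "A**matrix_inv A = mat 1" by auto
 then show "matrix_inv A = B" using assms by (metis matrix_mul_assoc matrix_mul_lid matrix_mul_rid)
qed

text \<open>Cramer's rule; it exhibits the entries of the inverse as quotients of determinants and
  thereby as smooth functions of the entries of \<open>A\<close>.\<close>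

lemma matrix_inv_entry:
 fixes A :: "real^'n^'n"
 assumes "det A \<noteq> 0"
 shows "matrix_inv A$k$l = det (\<chi> i j. if j = k then axis l 1$i else A$i$j) / det A"
proof -
 obtain B where AB: "A**B = mat 1" using assms invertible_det_nz[of A] unfolding invertible_def by blast
 have "A *v (matrix_inv A *v axis l 1) = axis l 1"
  by (simp add: matrix_vector_mul_assoc matrix_inv_unique(4)[OF AB])
 then have "matrix_inv A *v axis l 1 = (\<chi> k. det (\<chi> i j. if j = k then axis l 1$i else A$i$j) / det A)"
  using cramer[OF assms] by blast
 then have "(matrix_inv A *v axis l 1)$k = det (\<chi> i j. if j = k then axis l 1$i else A$i$j) / det A" by simp
 moreover have "(matrix_inv A *v axis l 1)$k = matrix_inv A$k$l"
  by (simp add: matrix_vector_mult_basis column_def)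
 ultimately show ?thesis by simp
qed

context
 fixes I :: "'n::finite set" and U
 assumes U: "ropen I U"
begin

lemma smooth_mm:
 fixes A :: "real^'n \<Rightarrow> real^'b^'a" and B :: "real^'n \<Rightarrow> real^'c^'b"
 shows "smooth I U A \<Longrightarrow> smooth I U B \<Longrightarrow> smooth I U (\<lambda>y. A y**B y)"
 by (rule smooth_bilinear[OF U bounded_bilinear_mm])

lemma smooth_mv:
 fixes A :: "real^'n \<Rightarrow> real^'b^'a" and B :: "real^'n \<Rightarrow> real^'b"
 shows "smooth I U A \<Longrightarrow> smooth I U B \<Longrightarrow> smooth I U (\<lambda>y. A y *v B y)"
 by (rule smooth_bilinear[OF U bounded_bilinear_mv])

lemma smooth_transpose:
 fixes A :: "real^'n \<Rightarrow> real^'b^'a"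
 shows "smooth I U A \<Longrightarrow> smooth I U (\<lambda>y. transpose (A y))"
 by (rule smooth_bounded_linear[OF U bounded_linear_transpose])

lemma pd_mm:
 fixes A :: "real^'n \<Rightarrow> real^'b^'a" and B :: "real^'n \<Rightarrow> real^'c^'b"
 shows "\<lbrakk>smooth I U A; smooth I U B; i \<in> I; y \<in> U\<rbrakk> \<Longrightarrow>
  pd i (\<lambda>y. A y**B y) y = A y**pd i B y + pd i A y**B y"
 by (rule pd_bilinear[OF U bounded_bilinear_mm])

lemma pd_mv:
 fixes A :: "real^'n \<Rightarrow> real^'b^'a" and B :: "real^'n \<Rightarrow> real^'b"
 shows "\<lbrakk>smooth I U A; smooth I U B; i \<in> I; y \<in> U\<rbrakk> \<Longrightarrow>
  pd i (\<lambda>y. A y *v B y) y = A y *v pd i B y + pd i A y *v B y"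
 by (rule pd_bilinear[OF U bounded_bilinear_mv])

lemma pd_scaleR: "\<lbrakk>smooth I U A; smooth I U B; i \<in> I; y \<in> U\<rbrakk> \<Longrightarrow>
  pd i (\<lambda>y. A y *\<^sub>R B y) y = A y *\<^sub>R pd i B y + pd i A y *\<^sub>R B y"
 by (rule pd_bilinear[OF U bounded_bilinear_scaleR])

lemma pd_mult: "\<lbrakk>smooth I U A; smooth I U B; i \<in> I; y \<in> U\<rbrakk> \<Longrightarrow>
  pd i (\<lambda>y. A y * B y :: real) y = A y * pd i B y + pd i A y * B y"
 by (rule pd_bilinear[OF U bounded_bilinear_mult])

lemma pd_transpose:
 fixes A :: "real^'n \<Rightarrow> real^'b^'a"
 shows "\<lbrakk>smooth I U A; i \<in> I; y \<in> U\<rbrakk> \<Longrightarrow> pd i (\<lambda>y. transpose (A y)) y = transpose (pd i A y)"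
 by (rule pd_blinear[OF U bounded_linear_transpose])

lemma pd_trace:
 fixes A :: "real^'n \<Rightarrow> real^'a^'a"
 shows "\<lbrakk>smooth I U A; i \<in> I; y \<in> U\<rbrakk> \<Longrightarrow> pd i (\<lambda>y. trace (A y)) y = trace (pd i A y)"
 by (rule pd_blinear[OF U bounded_linear_trace])

lemma pd_blk:
 fixes A :: "real^'n \<Rightarrow> real^'b^'a"
 assumes "\<And>y. y \<in> U \<Longrightarrow> blk K L (A y)" "smooth I U A" "i \<in> I" "y \<in> U"
 shows "blk K L (pd i A y)"
 unfolding blk_def
proof (intro allI impI)
 fix k l assume kl: "k \<notin> K \<or> l \<notin> L"
 have "pd i A y$k$l = pd i (\<lambda>y. A y$k$l) y" by (rule pd_nth2[OF U assms(2-4), symmetric])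
 also have "\<dots> = pd i (\<lambda>y. 0) y"
  by (rule pd_cong[OF U assms(4,3)]) (use assms(1) kl in \<open>auto simp: blk_def\<close>)
 also have "\<dots> = 0" by (rule pds_pd[OF pds_const])
 finally show "pd i A y$k$l = 0" .
qed

lemma smooth_matrix:
 fixes A :: "real^'n \<Rightarrow> real^'a^'b"
 assumes "\<And>i j. smooth I U (\<lambda>y. A y$i$j)"
 shows "smooth I U A"
proof -
 have "smooth I U (\<lambda>y. \<chi> i. \<chi> j. A y$i$j)"
  by (rule smooth_vec_lambda[OF U], rule smooth_vec_lambda[OF U], rule assms)
 then show ?thesis by simp
qed

lemma smooth_det:
 fixes A :: "real^'n \<Rightarrow> real^'a^'a"
 assumes "\<And>i j. smooth I U (\<lambda>y. A y$i$j)"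
 shows "smooth I U (\<lambda>y. det (A y))"
 unfolding det_def
 by (rule smooth_sum[OF U], rule smooth_mult[OF U smooth_const[OF U]], rule smooth_prod[OF U]) (simp_all add: assms)

lemma smooth_matrix_inv:
 fixes A :: "real^'n \<Rightarrow> real^'a^'a"
 assumes A: "smooth I U A" and nz: "\<And>y. y \<in> U \<Longrightarrow> invertible (A y)"
 shows "smooth I U (\<lambda>y. matrix_inv (A y))"
proof (rule smooth_matrix)
 fix k l
 have e: "smooth I U (\<lambda>y. A y$i$j)" for i j by (intro smooth_nth[OF U] A)
 have d: "det (A y) \<noteq> 0" if "y \<in> U" for y using nz[OF that] invertible_det_nz by blast
 have "smooth I U (\<lambda>y. det (\<chi> i j. if j = k then axis l 1$i else A y$i$j) / det (A y))"
 proof (rule smooth_divide[OF U smooth_det smooth_det d])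
  fix i j
  show "smooth I U (\<lambda>y. (\<chi> i j. if j = k then axis l 1$i else A y$i$j)$i$j)"
   using e smooth_const[OF U] by (cases "j = k") simp_all
 qed (use e in auto)
 then show "smooth I U (\<lambda>y. matrix_inv (A y)$k$l)"
  by (rule smooth_cong[OF U]) (simp add: matrix_inv_entry[OF d])
qed

text \<open>Differentiate the identity \<open>A y ** matrix_inv (A y) = mat 1\<close>.\<close>

lemma pd_matrix_inv:
 fixes A :: "real^'n \<Rightarrow> real^'a^'a"
 assumes A: "smooth I U A" and nz: "\<And>y. y \<in> U \<Longrightarrow> invertible (A y)" and y: "y \<in> U" and i: "i \<in> I"
 shows "pd i (\<lambda>y. matrix_inv (A y)) y = - (matrix_inv (A y)**pd i A y**matrix_inv (A y))"
proof -
 have inv: "A y**matrix_inv (A y) = mat 1" "matrix_inv (A y)**A y = mat 1" if "y \<in> U" for y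
  using nz[OF that] matrix_inv_unique unfolding invertible_def by blast+
 have "pd i (\<lambda>y. A y**matrix_inv (A y)) y = pd i (\<lambda>y. mat 1 :: real^'a^'a) y"
  by (rule pd_cong[OF U y i]) (use inv in auto)
 also have "\<dots> = 0" by (rule pds_pd[OF pds_const])
 finally have "A y**pd i (\<lambda>y. matrix_inv (A y)) y + pd i A y**matrix_inv (A y) = 0"
  using pd_mm[OF A smooth_matrix_inv[OF A nz] i y] by simp
 then have "matrix_inv (A y)**(A y**pd i (\<lambda>y. matrix_inv (A y)) y + pd i A y**matrix_inv (A y)) = 0"
  by (simp add: mm_ring)
 then have "pd i (\<lambda>y. matrix_inv (A y)) y + matrix_inv (A y)**pd i A y**matrix_inv (A y) = 0"
  by (simp add: matrix_add_ldistrib matrix_mul_assoc inv[OF y])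
 then show ?thesis by (simp add: eq_neg_iff_add_eq_0)
qed

end

lemmas smooth_intros = smooth_const smooth_add smooth_sum smooth_minus smooth_diff smooth_scaleR smooth_mult smooth_nth smooth_mm smooth_mv smooth_transpose

subsection \<open>Curvature of a connection\<close>

text \<open>The curvature of the connection d + \<Gamma>. The rank of the bundle is independent of
  the dimension of the domain, so pulled-back bundles and flat bundles are covered as well.\<close>

definition riem :: "('n::finite \<Rightarrow> real^'n \<Rightarrow> real^'c^'c) \<Rightarrow> 'n \<Rightarrow> 'n \<Rightarrow> real^'n \<Rightarrow> real^'c^'c" where
 "riem \<Gamma> j k y = pd j (\<Gamma> k) y - pd k (\<Gamma> j) y + \<Gamma> j y**\<Gamma> k y - \<Gamma> k y**\<Gamma> j y"

lemma riem_antisym: "riem \<Gamma> j k y = - riem \<Gamma> k j y"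
 by (simp add: riem_def)

text \<open>\<open>\<Phi>\<close> is a parallel bundle map from \<open>\<Gamma>\<close> to \<open>\<omega>\<close>, so it intertwines the curvatures.\<close>

lemma riem_intertwine:
 fixes \<Phi> :: "real^'n \<Rightarrow> real^'a^'c"
 assumes U: "ropen I U" and \<Phi>: "smooth I U \<Phi>"
  and \<Gamma>: "\<And>j. j \<in> I \<Longrightarrow> smooth I U (\<Gamma> j)" and \<omega>: "\<And>j. j \<in> I \<Longrightarrow> smooth I U (\<omega> j)"
  and par: "\<And>j y. j \<in> I \<Longrightarrow> y \<in> U \<Longrightarrow> pd j \<Phi> y = \<Phi> y**\<Gamma> j y - \<omega> j y**\<Phi> y"
  and y: "y \<in> U" and j: "j \<in> I" and k: "k \<in> I"
 shows "\<Phi> y**riem \<Gamma> j k y = riem \<omega> j k y**\<Phi> y"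
proof -
 have d: "pd j (pd k \<Phi>) y = \<Phi> y**pd j (\<Gamma> k) y + (\<Phi> y**\<Gamma> j y - \<omega> j y**\<Phi> y)**\<Gamma> k y
   - (\<omega> k y**(\<Phi> y**\<Gamma> j y - \<omega> j y**\<Phi> y) + pd j (\<omega> k) y**\<Phi> y)" if "j \<in> I" "k \<in> I" for j k
 proof -
  have "pd j (pd k \<Phi>) y = pd j (\<lambda>y. \<Phi> y**\<Gamma> k y - \<omega> k y**\<Phi> y) y"
   by (rule pd_cong[OF U y that(1)]) (rule par[OF that(2)])
  also have "\<dots> = pd j (\<lambda>y. \<Phi> y**\<Gamma> k y) y - pd j (\<lambda>y. \<omega> k y**\<Phi> y) y"
   by (rule pd_diff[OF U smooth_mm[OF U \<Phi> \<Gamma>[OF that(2)]] smooth_mm[OF U \<omega>[OF that(2)] \<Phi>] that(1) y])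
  finally show ?thesis
   using pd_mm[OF U \<Phi> \<Gamma>[OF that(2)] that(1) y] pd_mm[OF U \<omega>[OF that(2)] \<Phi> that(1) y] par[OF that(1) y] by simp
 qed
 have "pd j (pd k \<Phi>) y = pd k (pd j \<Phi>) y" by (rule smooth_pd_commute[OF U \<Phi> j k y])
 then have "pd j (pd k \<Phi>) y - pd k (pd j \<Phi>) y = 0" by simp
 then show ?thesis
  unfolding d[OF j k] d[OF k j] riem_def by (simp add: mm_ring algebra_simps)
qed

text \<open>The terms containing second derivatives of \<open>f\<close> are symmetric in
  \<open>j\<close> and \<open>k\<close> and cancel.\<close>

lemma riem_pullback:
 fixes f :: "real^'n \<Rightarrow> real^'k" and \<Gamma> :: "'k \<Rightarrow> real^'k \<Rightarrow> real^'c^'c"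
 assumes U: "ropen I U" and V: "ropen K V" and f: "smooth I U f" and fU: "f ` U \<subseteq> V"
  and \<Gamma>: "\<And>a. a \<in> K \<Longrightarrow> smooth K V (\<Gamma> a)"
  and y: "y \<in> U" and j: "j \<in> I" and k: "k \<in> I"
  and \<omega>_def: "\<And>j y. \<omega> j y = (\<Sum>a\<in>K. pd j f y$a *\<^sub>R \<Gamma> a (f y))"
 shows "riem \<omega> j k y = (\<Sum>a\<in>K. \<Sum>b\<in>K. (pd j f y$a * pd k f y$b) *\<^sub>R riem \<Gamma> a b (f y))"
proof -
 have s1: "smooth I U (\<lambda>y. pd j f y$a)" if "j \<in> I" for j a by (intro smooth_intros U smooth_pd f that)
 have s2: "smooth I U (\<lambda>y. \<Gamma> a (f y))" if "a \<in> K" for a by (rule smooth_compose[OF U V fU f \<Gamma>[OF that]])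
 have d: "pd j (\<omega> k) y = (\<Sum>a\<in>K. (pd j f y$a) *\<^sub>R (\<Sum>b\<in>K. pd k f y$b *\<^sub>R pd a (\<Gamma> b) (f y))) + (\<Sum>a\<in>K. pd j (pd k f) y$a *\<^sub>R \<Gamma> a (f y))"
  if jk: "j \<in> I" "k \<in> I" for j k
 proof -
  have e: "pd j (\<lambda>y. pd k f y$a *\<^sub>R \<Gamma> a (f y)) y = (\<Sum>b\<in>K. (pd k f y$a * pd j f y$b) *\<^sub>R pd b (\<Gamma> a) (f y)) + pd j (pd k f) y$a *\<^sub>R \<Gamma> a (f y)"
   if a: "a \<in> K" for a
   using pd_scaleR[OF U s1[OF jk(2)] s2[OF a] jk(1) y] pd_compose[OF U V fU f \<Gamma>[OF a] jk(1) y]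
    pd_nth[OF U smooth_pd[OF f jk(2)] jk(1) y]
   by (simp add: scaleR_sum_right)
  have "pd j (\<omega> k) y = (\<Sum>a\<in>K. pd j (\<lambda>y. pd k f y$a *\<^sub>R \<Gamma> a (f y)) y)"
   unfolding \<omega>_def by (rule pd_sum[OF U smooth_scaleR[OF U s1[OF jk(2)] s2] jk(1) y])
  also have "\<dots> = (\<Sum>a\<in>K. (\<Sum>b\<in>K. (pd k f y$a * pd j f y$b) *\<^sub>R pd b (\<Gamma> a) (f y)) + pd j (pd k f) y$a *\<^sub>R \<Gamma> a (f y))"
   by (rule sum.cong[OF refl e])
  also have "\<dots> = (\<Sum>a\<in>K. \<Sum>b\<in>K. (pd k f y$a * pd j f y$b) *\<^sub>R pd b (\<Gamma> a) (f y)) + (\<Sum>a\<in>K. pd j (pd k f) y$a *\<^sub>R \<Gamma> a (f y))"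
   by (rule sum.distrib)
  also have "(\<Sum>a\<in>K. \<Sum>b\<in>K. (pd k f y$a * pd j f y$b) *\<^sub>R pd b (\<Gamma> a) (f y)) = (\<Sum>b\<in>K. \<Sum>a\<in>K. (pd k f y$a * pd j f y$b) *\<^sub>R pd b (\<Gamma> a) (f y))"
   by (rule sum.swap)
  finally show ?thesis by (simp add: scaleR_sum_right mult.commute)
 qed
 have p: "\<omega> j y**\<omega> k y = (\<Sum>a\<in>K. \<Sum>b\<in>K. (pd j f y$a * pd k f y$b) *\<^sub>R (\<Gamma> a (f y)**\<Gamma> b (f y)))" for j k
  unfolding \<omega>_def by (simp add: mm_sum_left mm_sum_right mm_ring scaleR_sum_right) (subst sum.swap, simp add: mult.commute)
 have p': "\<omega> k y**\<omega> j y = (\<Sum>a\<in>K. \<Sum>b\<in>K. (pd j f y$a * pd k f y$b) *\<^sub>R (\<Gamma> b (f y)**\<Gamma> a (f y)))" for j k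
  unfolding p by (subst sum.swap, rule sum.cong[OF refl], rule sum.cong[OF refl]) (simp add: mult.commute)
 have q: "(\<Sum>a\<in>K. (pd k f y$a) *\<^sub>R (\<Sum>b\<in>K. pd j f y$b *\<^sub>R pd a (\<Gamma> b) (f y))) = (\<Sum>a\<in>K. \<Sum>b\<in>K. (pd j f y$a * pd k f y$b) *\<^sub>R pd b (\<Gamma> a) (f y))"
  unfolding scaleR_sum_right by (subst sum.swap) (simp add: mult.commute)
 have c: "pd j (pd k f) y = pd k (pd j f) y" by (rule smooth_pd_commute[OF U f j k y])
 show ?thesis
  unfolding riem_def p[of j k] p'[where j = j and k = k] d[OF j k] d[OF k j] q c
  by (simp add: scaleR_sum_right scaleR_add_right scaleR_diff_right sum.distrib sum_subtractf)
qed

subsection \<open>The Levi-Civita connection in a chart\<close>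

definition Gam :: "'n::finite set \<Rightarrow> (real^'n \<Rightarrow> real^'n^'n) \<Rightarrow> 'n \<Rightarrow> real^'n \<Rightarrow> real^'n^'n" where
 "Gam I G j y = (\<chi> i k. if i \<in> I \<and> j \<in> I \<and> k \<in> I then christoffel I G i j k y else 0)"

lemma sum_if_subset: "(\<Sum>i\<in>UNIV. if i \<in> I then f i else 0) = (\<Sum>i\<in>(I::'n::finite set). f i)"
 by (simp add: sum.If_cases)

lemma hat_nth: "i \<in> I \<Longrightarrow> j \<in> I \<Longrightarrow> hat I A$i$j = A$i$j"
 by (simp add: hat_def)

lemma hat_PI: "hat I A = PI I**A**PI I + (mat 1 - PI I)"
 by (simp add: vec_eq_iff hat_def PI_mult mult_PI) (simp add: PI_def mat_def)

lemma PI_PI [simp]: "PI I**PI I = PI I"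
 by (simp add: PI_mult) (simp add: PI_def vec_eq_iff)

lemma hat_blk: "PI I**hat I A = hat I A**PI I" "blk I I (PI I**hat I A)"
 by (auto simp: vec_eq_iff hat_def PI_mult mult_PI blk_def)

lemma bil_coord: "v \<in> coord I \<Longrightarrow> w \<in> coord I \<Longrightarrow> bil A v w = (\<Sum>i\<in>I. \<Sum>j\<in>I. v$i * A$i$j * w$j)"
 unfolding bil_sum by (rule sum.mono_neutral_cong_right) (auto simp: coord_def intro!: sum.mono_neutral_cong_right)

lemma bil_hat: "v \<in> coord I \<Longrightarrow> w \<in> coord I \<Longrightarrow> bil (hat I A) v w = bil A v w"
 by (simp add: bil_coord hat_nth)

locale metric_chart =
 fixes I :: "'n::finite set" and U :: "(real^'n) set" and G :: "real^'n \<Rightarrow> real^'n^'n"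
 assumes U: "ropen I U" and smooth_G: "smooth I U G"
  and sym_G: "\<lbrakk>y \<in> U; i \<in> I; j \<in> I\<rbrakk> \<Longrightarrow> G y$i$j = G y$j$i"
  and pos_G: "\<lbrakk>y \<in> U; v \<in> coord I; v \<noteq> 0\<rbrakk> \<Longrightarrow> bil (G y) v v > 0"
begin

abbreviation H where "H y \<equiv> hat I (G y)"
abbreviation Hi where "Hi y \<equiv> ginv I (G y)"
abbreviation \<Gamma> where "\<Gamma> \<equiv> Gam I G"

lemma smooth_H: "smooth I U H"
 unfolding hat_PI
 by (rule smooth_add[OF U smooth_mm[OF U smooth_mm[OF U smooth_const[OF U] smooth_G] smooth_const[OF U]] smooth_const[OF U]])

lemma sym_H: "y \<in> U \<Longrightarrow> transpose (H y) = H y"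
 using sym_G by (auto simp: vec_eq_iff transpose_def hat_def)

text \<open>By positivity a kernel vector has no component in \<open>coord I\<close>, and on the
  remaining coordinates \<open>H y\<close> is the identity.\<close>

lemma invertible_H: assumes y: "y \<in> U" shows "invertible (H y)"
proof -
 have "v = 0" if "H y *v v = 0" for v
 proof -
  have a: "H y *v v = PI I *v (G y *v (PI I *v v)) + (v - PI I *v v)"
   unfolding hat_PI by (simp add: matrix_vector_mult_add_rdistrib matrix_vector_mult_diff_rdistrib matrix_vector_mul_assoc matrix_mul_assoc)
  have "PI I *v v = 0"
  proof (rule ccontr)
   assume "PI I *v v \<noteq> 0"
   then have "0 < bil (G y) (PI I *v v) (PI I *v v)" by (intro pos_G[OF y] PI_mv_coord)
   also have "\<dots> = v \<bullet> (PI I *v (G y *v (PI I *v v)))"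
    by (simp only: bil_def inner_mv[of v "PI I"] transpose_PI)
   also have "\<dots> = (PI I *v v) \<bullet> (PI I *v (G y *v (PI I *v v)))"
   proof -
    have "(PI I *v v) \<bullet> (PI I *v w) = v \<bullet> (PI I *v w)" for w
     using inner_mv[of v "PI I" "PI I *v w"] by (simp add: matrix_vector_mul_assoc)
    then show ?thesis by (simp only:)
   qed
   also have "PI I *v (G y *v (PI I *v v)) = PI I *v v - v"
   proof -
    have "PI I *v (G y *v (PI I *v v)) = H y *v v - (v - PI I *v v)" unfolding a by simp
    then show ?thesis using that by simp
   qed
   also have "(PI I *v v) \<bullet> (PI I *v v - v) = 0"
    unfolding inner_vec_def by (rule sum.neutral) (simp add: PI_mv_nth)
   finally show False by simp
  qed
  moreover have "v = H y *v v - PI I *v (G y *v (PI I *v v)) + PI I *v v" unfolding a by simp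
  ultimately show "v = 0" using that by simp
 qed
 then have "\<exists>B. B**H y = mat 1" using matrix_left_invertible_ker by blast
 then show ?thesis using invertible_left_inverse by blast
qed

lemma Hi: assumes "y \<in> U" shows "Hi y**H y = mat 1" "H y**Hi y = mat 1"
 using invertible_H[OF assms] matrix_inv_unique unfolding invertible_def ginv_hat by blast+

lemma smooth_Hi: "smooth I U Hi"
 unfolding ginv_hat by (rule smooth_matrix_inv[OF U smooth_H invertible_H])

lemma sym_Hi: assumes y: "y \<in> U" shows "transpose (Hi y) = Hi y"
proof -
 have "H y**transpose (Hi y) = mat 1"
  using arg_cong[OF Hi(1)[OF y], of transpose] by (simp add: matrix_transpose_mul sym_H[OF y] transpose_mat)
 then show ?thesis using matrix_inv_unique(1) unfolding ginv_hat by metis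
qed

lemma Hi_PI: assumes y: "y \<in> U" shows "PI I**Hi y = Hi y**PI I"
proof -
 have "Hi y**(PI I**H y)**Hi y = Hi y**(H y**PI I)**Hi y" by (simp add: hat_blk)
 then have "Hi y**PI I**(H y**Hi y) = (Hi y**H y)**PI I**Hi y" by (simp add: mm_ring)
 then show ?thesis by (simp add: Hi[OF y])
qed

lemma blk_PI_Hi: assumes y: "y \<in> U" shows "blk I I (PI I**Hi y)"
 unfolding blk_PI using Hi_PI[OF y] by (simp add: matrix_mul_assoc) (metis PI_PI matrix_mul_assoc)

text \<open>The Christoffel symbols of the first kind, as matrices.\<close>

definition low :: "'n \<Rightarrow> real^'n \<Rightarrow> real^'n^'n" where
 "low j y = (\<chi> l k. if l \<in> I \<and> j \<in> I \<and> k \<in> I then (1/2) * (pd j G y$k$l + pd k G y$j$l - pd l G y$j$k) else 0)"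

lemma pd_G_nth: "y \<in> U \<Longrightarrow> j \<in> I \<Longrightarrow> pd j (\<lambda>z. G z$k$l) y = pd j G y$k$l"
 by (rule pd_nth2[OF U smooth_G])

lemma pd_G_sym:
 assumes "y \<in> U" "j \<in> I" "k \<in> I" "l \<in> I"
 shows "pd j G y$k$l = pd j G y$l$k"
 unfolding pd_G_nth[OF assms(1,2), symmetric]
 by (rule pd_cong[OF U assms(1,2)]) (rule sym_G[OF _ assms(3,4)])

lemma Gam_low: assumes y: "y \<in> U" shows "\<Gamma> j y = Hi y**low j y"
proof -
 have "\<Gamma> j y$i$k = (Hi y**low j y)$i$k" for i k
 proof (cases "j \<in> I \<and> k \<in> I")
  case jk: True
  have l: "low j y$l$k = (if l \<in> I then (1/2) * (pd j G y$k$l + pd k G y$j$l - pd l G y$j$k) else 0)" for l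
   using jk by (simp add: low_def)
  show ?thesis
  proof (cases "i \<in> I")
   case True
   have "(Hi y**low j y)$i$k = (\<Sum>l\<in>UNIV. if l \<in> I then Hi y$i$l * ((1/2) * (pd j G y$k$l + pd k G y$j$l - pd l G y$j$k)) else 0)"
    unfolding mm_nth l by (rule sum.cong) auto
   then show ?thesis using True jk y
    by (simp add: sum_if_subset Gam_def christoffel_def pd_G_nth sum_distrib_left mult_ac)
  next
   case False
   have "blk I I (low j y)" by (auto simp: blk_def low_def)
   then have "Hi y**low j y = PI I**(Hi y**low j y)"
    using Hi_PI[OF y] blk_left by (metis matrix_mul_assoc)
   then have "(Hi y**low j y)$i$k = (PI I**(Hi y**low j y))$i$k" by simp
   then show ?thesis using False by (simp add: Gam_def PI_mult)
  qed
 qed (auto simp: Gam_def mm_nth low_def)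
 then show ?thesis by (simp add: vec_eq_iff)
qed

lemma low_sym: "y \<in> U \<Longrightarrow> low j y$l$k = low k y$l$j"
 by (auto simp: low_def pd_G_sym)

lemma blk_Gam [simp]: "blk I I (\<Gamma> j y)"
 by (auto simp: blk_def Gam_def)

lemma Gam_sym: "y \<in> U \<Longrightarrow> \<Gamma> j y$i$k = \<Gamma> k y$i$j"
 unfolding Gam_low mm_nth by (intro sum.cong) (auto simp: low_sym)

lemma smooth_Gam: assumes j: "j \<in> I" shows "smooth I U (\<Gamma> j)"
proof -
 have "smooth I U (\<lambda>y. low j y$l$k)" for l k
 proof (cases "l \<in> I \<and> k \<in> I")
  case True
  have "smooth I U (\<lambda>y. (1/2) * (pd j G y$k$l + pd k G y$j$l - pd l G y$j$k))"
   by (intro smooth_intros U smooth_pd smooth_G j) (use True in auto)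
  then show ?thesis using True j by (simp add: low_def)
 qed (auto simp: low_def smooth_const[OF U])
 then have "smooth I U (low j)" by (rule smooth_matrix[OF U])
 then have "smooth I U (\<lambda>y. Hi y**low j y)" by (rule smooth_mm[OF U smooth_Hi])
 then show ?thesis by (rule smooth_cong[OF U]) (simp add: Gam_low)
qed

lemma pd_H: assumes y: "y \<in> U" and j: "j \<in> I" shows "pd j H y = PI I**pd j G y**PI I"
proof -
 have s: "smooth I U (\<lambda>y. PI I**G y)" by (rule smooth_mm[OF U smooth_const[OF U] smooth_G])
 have s': "smooth I U (\<lambda>y. PI I**G y**PI I)" by (rule smooth_mm[OF U s smooth_const[OF U]])
 have z: "pd j (\<lambda>y. c) y = 0" for c :: "real^'n^'n" by (rule pds_pd[OF pds_const])
 show ?thesis unfolding hat_PI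
  using pd_add[OF U s' smooth_const[OF U] j y, of "mat 1 - PI I"] pd_mm[OF U s smooth_const[OF U] j y, of "PI I"]
   pd_mm[OF U smooth_const[OF U] smooth_G j y, of "PI I"]
  by (simp add: z mm_ring)
qed

text \<open>This is \<nabla>g = 0. In \<open>low j\<close> plus its transpose the derivatives in the
  other two directions cancel.\<close>

lemma compatible: assumes y: "y \<in> U" and j: "j \<in> I"
 shows "pd j H y = transpose (\<Gamma> j y)**H y + H y**\<Gamma> j y"
proof -
 have 1: "H y**\<Gamma> j y = low j y" unfolding Gam_low[OF y] by (simp add: matrix_mul_assoc Hi[OF y])
 have 2: "transpose (\<Gamma> j y)**H y = transpose (low j y)"
  using arg_cong[OF 1, of transpose] by (simp add: matrix_transpose_mul sym_H[OF y])
 have "pd j H y$k$l = low j y$l$k + low j y$k$l" for k l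
  unfolding pd_H[OF y j] using j y by (auto simp: PI_mult mult_PI low_def pd_G_sym field_simps)
 then show ?thesis unfolding 1 2 by (simp add: vec_eq_iff transpose_def)
qed

text \<open>The Koszul argument: after lowering the upper index, symmetry and compatibility leave
  \<open>low\<close> as the only possibility. It serves to recognise a guessed connection as the
  Levi-Civita connection.\<close>

lemma Gam_unique:
 assumes y: "y \<in> U" and blk: "\<And>j. j \<in> I \<Longrightarrow> blk I I (L j)"
  and sym: "\<And>i j k. j \<in> I \<Longrightarrow> k \<in> I \<Longrightarrow> L j$i$k = L k$i$j"
  and comp: "\<And>j. j \<in> I \<Longrightarrow> pd j H y = transpose (L j)**H y + H y**L j"
  and j: "j \<in> I"
 shows "L j = \<Gamma> j y"
proof -
 define M where "M j = H y**L j" for j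
 have blkM: "blk I I (M j)" if "j \<in> I" for j
 proof -
  have "M j = PI I**H y**L j" unfolding M_def using blk_left[OF blk[OF that]] hat_blk(1) by (metis matrix_mul_assoc)
  then show ?thesis using blk_mm[OF hat_blk(2) blk[OF that]] by simp
 qed
 have Msym: "M j$l$k = M k$l$j" if "j \<in> I" "k \<in> I" for j k l
  unfolding M_def mm_nth using sym[OF that] by simp
 have tM: "transpose (L j)**H y = transpose (M j)" for j
  by (simp add: M_def matrix_transpose_mul sym_H[OF y])
 have c: "pd j G y$k$l = M j$l$k + M j$k$l" if "j \<in> I" "k \<in> I" "l \<in> I" for j k l
 proof -
  have "pd j G y$k$l = pd j H y$k$l" unfolding pd_H[OF y that(1)] using that by (simp add: PI_mult mult_PI)
  then show ?thesis unfolding comp[OF that(1)] tM by (simp add: M_def[symmetric] transpose_def)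
 qed
 have "M j$l$k = low j y$l$k" for l k
 proof (cases "l \<in> I \<and> k \<in> I")
  case True
  then show ?thesis using j by (simp add: low_def c Msym[of l j] Msym[of l k] Msym[of k j])
 next
  case False
  then show ?thesis using blkM[OF j] by (auto simp: low_def blk_def)
 qed
 then have "M j = low j y" by (simp add: vec_eq_iff)
 then have "Hi y**(H y**L j) = Hi y**low j y" by (simp add: M_def)
 then show ?thesis by (simp add: matrix_mul_assoc Hi[OF y] Gam_low[OF y])
qed

text \<open>Both sides are the logarithmic derivative of the determinant of the metric. This is the
  door through which volume forms enter the computation of curvature.\<close>

lemma trace_Gam: assumes y: "y \<in> U" and j: "j \<in> I"
 shows "trace (Hi y**pd j H y) = 2 * trace (\<Gamma> j y)"
proof -
 have "trace (Hi y**(transpose (\<Gamma> j y)**H y)) = trace (transpose (\<Gamma> j y)**(H y**Hi y))"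
  by (metis matrix_mul_assoc trace_mul_sym)
 then show ?thesis unfolding compatible[OF y j]
  by (simp add: mm_ring trace_linear Hi[OF y] trace_transpose) (simp add: matrix_mul_assoc Hi[OF y])
qed

abbreviation R where "R \<equiv> riem \<Gamma>"

lemma riem_Gam_nth:
 assumes y: "y \<in> U" and j: "j \<in> I" and k: "k \<in> I"
 shows "R j k y$a$l = pd j (\<lambda>z. \<Gamma> k z$a$l) y - pd k (\<lambda>z. \<Gamma> j z$a$l) y
  + (\<Sum>m\<in>UNIV. \<Gamma> j y$a$m * \<Gamma> k y$m$l) - (\<Sum>m\<in>UNIV. \<Gamma> k y$a$m * \<Gamma> j y$m$l)"
 unfolding pd_nth2[OF U smooth_Gam[OF k] j y] pd_nth2[OF U smooth_Gam[OF j] k y] riem_def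
 by (simp add: mm_nth)

lemma blk_R:
 assumes y: "y \<in> U" and j: "j \<in> I" and k: "k \<in> I"
 shows "blk I I (R j k y)"
 unfolding riem_def
 by (intro blk_diff blk_add blk_mm[OF blk_Gam blk_Gam] pd_blk[OF U _ smooth_Gam] blk_Gam j k y)

text \<open>Symmetry of \<Gamma> in its lower indices makes the derivative terms and the quadratic
  terms cancel in the cyclic sum.\<close>

lemma bianchi:
 assumes y: "y \<in> U" and jkl: "j \<in> I" "k \<in> I" "l \<in> I"
 shows "R j k y$a$l + R k l y$a$j + R l j y$a$k = 0"
proof -
 have s: "pd j (\<lambda>z. \<Gamma> k z$a$l) y = pd j (\<lambda>z. \<Gamma> l z$a$k) y" if "j \<in> I" for j k l
  by (rule pd_cong[OF U y that]) (rule Gam_sym)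
 have p: "(\<Sum>m\<in>UNIV. \<Gamma> j y$a$m * \<Gamma> k y$m$l) = (\<Sum>m\<in>UNIV. \<Gamma> j y$a$m * \<Gamma> l y$m$k)" for j k l
  by (simp add: Gam_sym[OF y, of k _ l])
 show ?thesis
  unfolding riem_Gam_nth[OF y jkl(1,2)] riem_Gam_nth[OF y jkl(2,3)] riem_Gam_nth[OF y jkl(3,1)]
   s[OF jkl(1), of k l] s[OF jkl(2), of j l] s[OF jkl(3), of j k] p[of j k l] p[of k j l] p[of l j k] by simp
qed

lemma ricci_R:
 assumes y: "y \<in> U" and jk: "j \<in> I" "k \<in> I"
 shows "ricci I G y$j$k = (\<Sum>i\<in>I. R i j y$i$k)"
proof -
 have e: "R i j y$i$k = pd i (christoffel I G i j k) y - pd j (christoffel I G i i k) y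
   + (\<Sum>l\<in>I. christoffel I G i i l y * christoffel I G l j k y - christoffel I G i j l y * christoffel I G l i k y)"
  if i: "i \<in> I" for i
 proof -
  have 1: "pd i (\<lambda>z. \<Gamma> j z$i$k) y = pd i (christoffel I G i j k) y"
   "pd j (\<lambda>z. \<Gamma> i z$i$k) y = pd j (christoffel I G i i k) y"
   using i jk by (auto simp: Gam_def)
  have 2: "(\<Sum>m\<in>UNIV. \<Gamma> a y$i$m * \<Gamma> b y$m$k) = (\<Sum>l\<in>I. christoffel I G i a l y * christoffel I G l b k y)"
   if "a \<in> I" "b \<in> I" for a b
   unfolding sum_if_subset[of I, symmetric] by (rule sum.cong) (use i jk that in \<open>auto simp: Gam_def\<close>)
  show ?thesis unfolding riem_Gam_nth[OF y i jk(1)] 1 2[OF i jk(1)] 2[OF jk(1) i] by (simp add: sum_subtractf)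
 qed
 show ?thesis unfolding ricci_def by (simp add: e sum.distrib)
qed

lemma scalar_curvature_trace:
 assumes y: "y \<in> U"
 shows "scalar_curvature I G y = trace (Hi y**(PI I**ricci I G y**PI I))"
proof -
 have "trace (Hi y**(PI I**ricci I G y**PI I)) = trace (transpose (Hi y)**(PI I**ricci I G y**PI I))"
  by (simp add: sym_Hi[OF y])
 also have "\<dots> = (\<Sum>k\<in>UNIV. if k \<in> I then (\<Sum>j\<in>UNIV. if j \<in> I then Hi y$j$k * ricci I G y$j$k else 0) else 0)"
  unfolding trace_def unfolding mm_nth[of "transpose (Hi y)"]
  by (intro sum.cong refl) (auto simp: transpose_def PI_mult mult_PI intro!: sum.cong)
 also have "\<dots> = (\<Sum>k\<in>I. \<Sum>j\<in>I. Hi y$j$k * ricci I G y$j$k)" by (simp add: sum_if_subset)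
 also have "\<dots> = scalar_curvature I G y" unfolding scalar_curvature_def by (rule sum.swap)
 finally show ?thesis by simp
qed

end

subsection \<open>Kaehler metrics in a chart\<close>

lemma sum_blk: "(\<And>i. i \<notin> I \<Longrightarrow> f i = 0) \<Longrightarrow> (\<Sum>i\<in>UNIV. f i) = (\<Sum>i\<in>(I::'n::finite set). f i)"
 by (rule sum.mono_neutral_right) auto

text \<open>With \<open>D\<close> a difference of two connections that preserve \<open>J\<close>, this computes the complex trace of
 \<open>D\<close>; \<open>\<tau>\<close> is the difference of the torsions.\<close>

lemma trace_J_torsion:
 fixes J :: "real^'n^'n"
 assumes J: "blk I I J" and D: "\<And>j. j \<in> I \<Longrightarrow> blk I I (D j)" and com: "\<And>j. j \<in> I \<Longrightarrow> J**D j = D j**J"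
  and tor: "\<And>j k a. j \<in> I \<Longrightarrow> k \<in> I \<Longrightarrow> D j$a$k - D k$a$j = \<tau> j k a"
  and t1: "\<And>k. k \<in> I \<Longrightarrow> (\<Sum>i\<in>I. \<Sum>l\<in>I. J$i$l * \<tau> k i l) = 0"
  and t2: "\<And>k. k \<in> I \<Longrightarrow> (\<Sum>i\<in>I. \<Sum>l\<in>I. \<tau> i l i * J$l$k) = 0"
  and k: "k \<in> I"
 shows "trace (J**D k) = (\<Sum>l\<in>I. J$l$k * trace (D l))"
proof -
 have mm: "(A**B)$i$j = (\<Sum>l\<in>I. A$i$l * B$l$j)" if "blk I I A" for A B :: "real^'n^'n" and i j
  unfolding mm_nth by (rule sum_blk) (use that in \<open>auto simp: blk_def\<close>)
 have tr: "trace A = (\<Sum>i\<in>I. A$i$i)" if "blk I I A" for A :: "real^'n^'n"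
  unfolding trace_def by (rule sum_blk) (use that in \<open>auto simp: blk_def\<close>)
 have "trace (J**D k) = (\<Sum>i\<in>I. \<Sum>l\<in>I. J$i$l * D k$l$i)"
  unfolding tr[OF blk_mm[OF J D[OF k]]] mm[OF J] ..
 also have "\<dots> = (\<Sum>i\<in>I. \<Sum>l\<in>I. J$i$l * D i$l$k + J$i$l * \<tau> k i l)"
  by (intro sum.cong refl) (simp add: tor[OF k, symmetric] algebra_simps)
 also have "\<dots> = (\<Sum>i\<in>I. (J**D i)$i$k)"
  unfolding mm[OF J] by (simp add: sum.distrib t1[OF k])
 also have "\<dots> = (\<Sum>i\<in>I. (D i**J)$i$k)" by (simp add: com)
 also have "\<dots> = (\<Sum>i\<in>I. \<Sum>l\<in>I. D l$i$i * J$l$k + \<tau> i l i * J$l$k)"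
  by (intro sum.cong refl) (simp add: mm[OF D] tor[symmetric] algebra_simps)
 also have "\<dots> = (\<Sum>i\<in>I. \<Sum>l\<in>I. D l$i$i * J$l$k)"
  by (simp add: sum.distrib t2[OF k])
 also have "\<dots> = (\<Sum>l\<in>I. \<Sum>i\<in>I. D l$i$i * J$l$k)" by (rule sum.swap)
 also have "\<dots> = (\<Sum>l\<in>I. J$l$k * trace (D l))" by (simp add: tr[OF D] sum_distrib_left mult.commute)
 finally show ?thesis .
qed

locale kaehler_chart = metric_chart I U G for I :: "'n::finite set" and U G +
 fixes J :: "real^'n \<Rightarrow> real^'n^'n"
 assumes smooth_J: "smooth I U J" and blk_J: "y \<in> U \<Longrightarrow> blk I I (J y)"
  and J_sq: "y \<in> U \<Longrightarrow> J y**J y = - PI I"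
  and J_orth: "\<lbrakk>y \<in> U; v \<in> coord I; w \<in> coord I\<rbrakk> \<Longrightarrow> bil (G y) (J y *v v) (J y *v w) = bil (G y) v w"
  and nijenhuis: "\<lbrakk>y \<in> U; i \<in> I; j \<in> I; k \<in> I\<rbrakk> \<Longrightarrow> (\<Sum>l\<in>I.
       J y$l$i * pd l (\<lambda>z. J z$k$j) y - J y$l$j * pd l (\<lambda>z. J z$k$i) y
      - J y$k$l * (pd i (\<lambda>z. J z$l$j) y - pd j (\<lambda>z. J z$l$i) y)) = 0"
  and closed: "\<lbrakk>y \<in> U; i \<in> I; j \<in> I; k \<in> I\<rbrakk> \<Longrightarrow>
    pd i (\<lambda>z. (transpose (J z)**G z)$j$k) y + pd j (\<lambda>z. (transpose (J z)**G z)$k$i) y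
    + pd k (\<lambda>z. (transpose (J z)**G z)$i$j) y = 0"
begin

abbreviation Jt where "Jt y \<equiv> transpose (J y)"

lemma JHJ: assumes y: "y \<in> U" shows "Jt y**H y**J y = PI I**H y"
proof -
 have "(Jt y**H y**J y)$i$j = (PI I**H y)$i$j" for i j
 proof (cases "i \<in> I \<and> j \<in> I")
  case True
  have "(Jt y**H y**J y)$i$j = bil (H y) (J y *v axis i 1) (J y *v axis j 1)"
   by (simp add: bil_congruence[symmetric] bil_axis)
  also have "\<dots> = bil (G y) (axis i 1) (axis j 1)"
   using True by (simp add: bil_hat blk_mv_coord[OF blk_J[OF y]] J_orth[OF y])
  finally show ?thesis using True by (simp add: bil_axis PI_mult hat_nth)
 next
  case False
  have "blk I I (Jt y**H y**J y)"
  proof -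
   have "Jt y**H y**J y = Jt y**(PI I**H y)**J y"
    using blk_right[OF blk_transpose[OF blk_J[OF y]]] by (simp add: matrix_mul_assoc)
   then show ?thesis using blk_mm blk_transpose blk_J[OF y] hat_blk(2) by metis
  qed
  then show ?thesis using False hat_blk(2)[of I "G y"] unfolding blk_def by auto
 qed
 then show ?thesis by (simp add: vec_eq_iff)
qed

lemma HJ: assumes y: "y \<in> U" shows "H y**J y = - (Jt y**H y)"
proof -
 have "PI I**H y**J y = Jt y**H y**J y**J y" by (simp add: JHJ[OF y])
 also have "\<dots> = - (Jt y**(H y**PI I))" by (simp add: mm_ring J_sq[OF y])
 also have "\<dots> = - (Jt y**PI I**H y)" by (simp add: hat_blk mm_ring)
 also have "\<dots> = - (Jt y**H y)" using blk_right[OF blk_transpose[OF blk_J[OF y]]] by simp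
 also have "PI I**H y**J y = H y**(PI I**J y)" by (simp add: hat_blk mm_ring)
 also have "PI I**J y = J y" by (rule blk_left[OF blk_J[OF y]])
 finally show ?thesis .
qed

lemma HJ': "y \<in> U \<Longrightarrow> H y**(J y**A) = - (Jt y**(H y**A))"
 using HJ[of y] by (simp add: matrix_mul_assoc mm_ring(5))

text \<open>The covariant derivative \<nabla>J in direction \<open>i\<close>, which
  \<open>nabla_J\<close> shows to vanish.\<close>

definition Nb where "Nb i y = (if i \<in> I then pd i J y + \<Gamma> i y**J y - J y**\<Gamma> i y else 0)"

lemma pd_JtH: assumes y: "y \<in> U" and i: "i \<in> I"
 shows "pd i (\<lambda>y. Jt y**H y) y = Jt y**(transpose (\<Gamma> i y)**H y + H y**\<Gamma> i y) + transpose (pd i J y)**H y"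
 using pd_mm[OF U smooth_transpose[OF U smooth_J] smooth_H i y] pd_transpose[OF U smooth_J i y] compatible[OF y i] by simp

text \<open>Covariant differentiation of \<open>HJ\<close>, the skewness of J, with H parallel by
  \<open>compatible\<close>.\<close>

lemma Nb_skew: assumes y: "y \<in> U" shows "transpose (Nb i y)**H y = - (H y**Nb i y)"
proof (cases "i \<in> I")
 case i: True
 have z: "pd i (\<lambda>y. - (Jt y**H y)) y = - pd i (\<lambda>y. Jt y**H y) y"
  by (rule pd_blinear[OF U bounded_linear_minus[OF bounded_linear_ident] smooth_mm[OF U smooth_transpose[OF U smooth_J] smooth_H] i y])
 have "pd i (\<lambda>y. H y**J y) y = pd i (\<lambda>y. - (Jt y**H y)) y"
  by (rule pd_cong[OF U y i HJ])
 then have e: "H y**pd i J y + (transpose (\<Gamma> i y)**H y + H y**\<Gamma> i y)**J y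
   = - (Jt y**(transpose (\<Gamma> i y)**H y + H y**\<Gamma> i y) + transpose (pd i J y)**H y)"
  unfolding z pd_JtH[OF y i] pd_mm[OF U smooth_H smooth_J i y] compatible[OF y i] .
 show ?thesis using e i
  by (simp add: Nb_def mm_ring transpose_linear matrix_transpose_mul HJ[OF y] HJ'[OF y] algebra_simps)
qed (simp add: Nb_def mm_ring transpose_linear transpose_def vec_eq_iff mm_nth)

lemma blk_Nb: assumes y: "y \<in> U" shows "blk I I (Nb i y)"
 unfolding Nb_def using blk_J[OF y] pd_blk[OF U blk_J smooth_J _ y]
 by (auto intro!: blk_add blk_diff blk_mm[of I I _ I I] simp: blk_def[of I I 0])

text \<open>The number g((\<nabla>_i J) e_j, e_k), that is, the covariant derivative of the Kaehler
  form.\<close>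

definition nn where "nn y i j k = (transpose (Nb i y)**H y)$j$k"

lemma nn_skew: assumes y: "y \<in> U" shows "nn y i j k = - nn y i k j"
proof -
 have "transpose (transpose (Nb i y)**H y) = H y**Nb i y" by (simp add: matrix_transpose_mul sym_H[OF y])
 also have "\<dots> = - (transpose (Nb i y)**H y)" by (simp add: Nb_skew[OF y])
 finally have "transpose (transpose (Nb i y)**H y)$k$j = (- (transpose (Nb i y)**H y))$k$j" by simp
 then show ?thesis unfolding nn_def by (simp add: transpose_def)
qed

lemma nn_zero: assumes y: "y \<in> U" shows "i \<notin> I \<or> j \<notin> I \<or> k \<notin> I \<Longrightarrow> nn y i j k = 0"
proof -
 have *: "j \<notin> I \<Longrightarrow> nn y i j k = 0" for j k
  using blk_Nb[OF y] by (simp add: nn_def mm_nth transpose_def blk_def)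
 show "i \<notin> I \<or> j \<notin> I \<or> k \<notin> I \<Longrightarrow> nn y i j k = 0"
  using *[of j k] *[of k j] nn_skew[OF y, of i j k] by (auto simp: nn_def Nb_def mm_nth transpose_def)
qed

lemma JtG: "y \<in> U \<Longrightarrow> k \<in> I \<Longrightarrow> (Jt y**G y)$j$k = (Jt y**H y)$j$k"
 unfolding mm_nth using blk_J[of y] by (intro sum.cong) (auto simp: blk_def hat_def transpose_def)

text \<open>Closedness of the Kaehler form: in the cyclic sum the Christoffel terms cancel by their
  symmetry, so partial derivatives may be replaced by covariant ones.\<close>

lemma nn_cyclic: assumes y: "y \<in> U" shows "nn y i j k + nn y j k i + nn y k i j = 0"
proof (cases "i \<in> I \<and> j \<in> I \<and> k \<in> I")
 case True
 define w where "w = Jt y**H y"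
 have wt: "transpose w = - w" by (simp add: w_def matrix_transpose_mul sym_H[OF y] HJ[OF y])
 have s: "smooth I U (\<lambda>y. Jt y**H y)" by (rule smooth_mm[OF U smooth_transpose[OF U smooth_J] smooth_H])
 have d: "pd i (\<lambda>z. (Jt z**G z)$j$k) y = nn y i j k - (w**\<Gamma> i y)$k$j + (w**\<Gamma> i y)$j$k"
  if ijk: "i \<in> I" "j \<in> I" "k \<in> I" for i j k
 proof -
  have "pd i (\<lambda>z. (Jt z**G z)$j$k) y = pd i (\<lambda>z. (Jt z**H z)$j$k) y"
   by (rule pd_cong[OF U y ijk(1)]) (rule JtG[OF _ ijk(3)])
  also have "\<dots> = pd i (\<lambda>y. Jt y**H y) y$j$k" by (rule pd_nth2[OF U s ijk(1) y])
  also have "pd i (\<lambda>y. Jt y**H y) y = transpose (Nb i y)**H y + transpose (\<Gamma> i y)**w + w**\<Gamma> i y"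
   unfolding pd_JtH[OF y ijk(1)] using ijk by (simp add: Nb_def w_def mm_ring transpose_linear matrix_transpose_mul)
  also have "transpose (\<Gamma> i y)**w = - transpose (w**\<Gamma> i y)" by (simp add: matrix_transpose_mul wt mm_ring)
  finally show ?thesis by (simp add: nn_def transpose_def)
 qed
 have sy: "(w**\<Gamma> i y)$j$k = (w**\<Gamma> k y)$j$i" for i j k
  unfolding mm_nth by (simp add: Gam_sym[OF y, of i])
 show ?thesis using closed[OF y, of i j k] True sy[of i j k] sy[of j k i] sy[of k i j]
  by (simp add: d)
qed (auto simp: nn_zero[OF y])

text \<open>In the Nijenhuis tensor, too, the Christoffel terms cancel, so that integrability
  becomes a linear equation for \<nabla>J.\<close>

lemma nijenhuis_Nb:
 assumes y: "y \<in> U" and ijk: "i \<in> I" "j \<in> I" "k \<in> I"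
 shows "(\<Sum>l\<in>UNIV. J y$l$i * Nb l y$k$j) - (\<Sum>l\<in>UNIV. J y$l$j * Nb l y$k$i)
   - (J y**Nb i y)$k$j + (J y**Nb j y)$k$i = 0"
proof -
 let ?J = "J y"
 have pdJ: "pd l (\<lambda>z. J z$a$b) y = Nb l y$a$b - (\<Gamma> l y**?J)$a$b + (?J**\<Gamma> l y)$a$b" if "l \<in> I" for l a b
  using pd_nth2[OF U smooth_J that y] that by (simp add: Nb_def)
 have s1: "(\<Sum>l\<in>I. ?J$l$i * (B**\<Gamma> l y)$k$j) = (B**\<Gamma> j y**?J)$k$i" for B i j k
 proof -
  have "(\<Sum>l\<in>I. ?J$l$i * (B**\<Gamma> l y)$k$j) = (\<Sum>l\<in>UNIV. ?J$l$i * (B**\<Gamma> l y)$k$j)"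
   by (rule sum_blk[symmetric]) (use blk_J[OF y] in \<open>auto simp: blk_def\<close>)
  moreover have "(B**\<Gamma> l y)$k$j = (B**\<Gamma> j y)$k$l" for l
   unfolding mm_nth by (simp add: Gam_sym[OF y, of l])
  ultimately show ?thesis unfolding mm_nth[of "B**\<Gamma> j y"] by (simp add: mult.commute)
 qed
 have s2: "(\<Sum>l\<in>I. ?J$l$i * (\<Gamma> l y**?J)$k$j) = (\<Sum>l\<in>I. ?J$l$j * (\<Gamma> l y**?J)$k$i)" for i j k
 proof -
  have "(\<Sum>l\<in>I. ?J$l$i * (\<Gamma> l y**?J)$k$j) = (\<Sum>l\<in>UNIV. ?J$l$i * (\<Gamma> l y**?J)$k$j)" for i j
   by (rule sum_blk[symmetric]) (use blk_J[OF y] in \<open>auto simp: blk_def\<close>)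
  also have "\<dots> i j = (\<Sum>l\<in>UNIV. \<Sum>m\<in>UNIV. ?J$l$i * \<Gamma> l y$k$m * ?J$m$j)" for i j
   by (simp add: mm_nth sum_distrib_left mult_ac)
  finally have e: "(\<Sum>l\<in>I. ?J$l$i * (\<Gamma> l y**?J)$k$j) = (\<Sum>l\<in>UNIV. \<Sum>m\<in>UNIV. ?J$l$i * \<Gamma> l y$k$m * ?J$m$j)" for i j .
  show ?thesis unfolding e by (subst sum.swap) (simp add: Gam_sym[OF y, of _ k] mult_ac)
 qed
 have "(\<Sum>l\<in>I. ?J$l$i * Nb l y$k$j - ?J$l$i * (\<Gamma> l y**?J)$k$j + ?J$l$i * (?J**\<Gamma> l y)$k$j
   - (?J$l$j * Nb l y$k$i - ?J$l$j * (\<Gamma> l y**?J)$k$i + ?J$l$j * (?J**\<Gamma> l y)$k$i)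
   - (?J$k$l * (Nb i y - \<Gamma> i y**?J + ?J**\<Gamma> i y)$l$j - ?J$k$l * (Nb j y - \<Gamma> j y**?J + ?J**\<Gamma> j y)$l$i)) = 0"
  using nijenhuis[OF y ijk] ijk by (simp add: pdJ algebra_simps)
 then have f1: "(\<Sum>l\<in>I. ?J$l$i * Nb l y$k$j) - (\<Sum>l\<in>I. ?J$l$j * Nb l y$k$i)
   + (?J**\<Gamma> j y**?J)$k$i - (?J**\<Gamma> i y**?J)$k$j
   - (\<Sum>l\<in>I. ?J$k$l * (Nb i y - \<Gamma> i y**?J + ?J**\<Gamma> i y)$l$j) + (\<Sum>l\<in>I. ?J$k$l * (Nb j y - \<Gamma> j y**?J + ?J**\<Gamma> j y)$l$i) = 0"
  using s2[of i k j] unfolding sum.distrib sum_subtractf s1 by simp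
 have f2: "(\<Sum>l\<in>I. ?J$k$l * A$l$j) = (?J**A)$k$j" for A :: "real^'n^'n" and j
  unfolding mm_nth by (rule sum_blk[symmetric]) (use blk_J[OF y] in \<open>auto simp: blk_def\<close>)
 have f3: "(\<Sum>l\<in>I. ?J$l$i * Nb l y$k$j) = (\<Sum>l\<in>UNIV. ?J$l$i * Nb l y$k$j)" for i j
   by (rule sum_blk[symmetric]) (simp add: Nb_def)
 have f4: "(?J**(?J**\<Gamma> i y))$k$j = - (\<Gamma> j y$k$i)" for i j
  using blk_left[OF blk_Gam] Gam_sym[OF y, of i] by (simp add: matrix_mul_assoc J_sq[OF y] mm_ring(5))
 show ?thesis using f1 Gam_sym[OF y, of i k j] unfolding f2 f3 by (simp add: mm_ring f4)
qed

text \<open>\<open>nn\<close> with J applied to the direction of differentiation.\<close>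

definition cc where "cc y i j k = (\<Sum>l\<in>UNIV. J y$l$i * nn y l j k)"

text \<open>Integrability and closedness combine to \<open>cc i j k = cc j i k + cc k i j\<close>.
  Together with skewness in the last two indices, the three cyclic instances of this form a linear
  system whose only solution is zero.\<close>

lemma cc_zero: assumes y: "y \<in> U" and ijk: "i \<in> I" "j \<in> I" "k \<in> I" shows "cc y i j k = 0"
proof -
 have J1: "(\<Sum>k'\<in>UNIV. A$k'$j * H y$k'$k) = (transpose A**H y)$j$k" for A :: "real^'n^'n" and j k
  by (simp add: mm_nth transpose_def)
 have c: "cc y i j k - cc y j i k - cc y k i j = 0" if ijk: "i \<in> I" "j \<in> I" "k \<in> I" for i j k
 proof -
  have z: "((\<Sum>l\<in>UNIV. J y$l$i * Nb l y$k'$j) - (\<Sum>l\<in>UNIV. J y$l$j * Nb l y$k'$i)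
   - (J y**Nb i y)$k'$j + (J y**Nb j y)$k'$i) * H y$k'$k = 0" for k'
  proof (cases "k' \<in> I")
   case True then show ?thesis using nijenhuis_Nb[OF y ijk(1,2) True] by simp
  next
   case False then have "H y$k'$k = 0" using ijk by (auto simp: hat_def)
   then show ?thesis by simp
  qed
  have s: "(\<Sum>k'\<in>UNIV. (\<Sum>l\<in>UNIV. J y$l$i * Nb l y$k'$j) * H y$k'$k) = cc y i j k" for i j
  proof -
   have "(\<Sum>k'\<in>UNIV. (\<Sum>l\<in>UNIV. J y$l$i * Nb l y$k'$j) * H y$k'$k)
    = (\<Sum>l\<in>UNIV. \<Sum>k'\<in>UNIV. J y$l$i * (Nb l y$k'$j * H y$k'$k))"
    unfolding sum_distrib_right by (subst sum.swap) (simp add: mult_ac)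
   then show ?thesis by (simp add: sum_distrib_left[symmetric] J1 cc_def nn_def)
  qed
  have "(\<Sum>k'\<in>UNIV. ((\<Sum>l\<in>UNIV. J y$l$i * Nb l y$k'$j) - (\<Sum>l\<in>UNIV. J y$l$j * Nb l y$k'$i)
   - (J y**Nb i y)$k'$j + (J y**Nb j y)$k'$i) * H y$k'$k) = 0"
   by (simp only: z sum.neutral_const)
  then have "cc y i j k - cc y j i k - (transpose (J y**Nb i y)**H y)$j$k + (transpose (J y**Nb j y)**H y)$i$k = 0"
   unfolding distrib_right left_diff_distrib sum.distrib sum_subtractf s J1 by simp
  moreover have "(transpose (J y**Nb i y)**H y)$j$k = - (\<Sum>l\<in>UNIV. nn y i j l * J y$l$k)" for i j
  proof -
   have "transpose (J y**Nb i y)**H y = - ((transpose (Nb i y)**H y)**J y)"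
    by (simp add: matrix_transpose_mul mm_ring HJ[OF y])
   then show ?thesis by (simp add: mm_nth[of "transpose (Nb i y)**H y"] nn_def)
  qed
  moreover have "(\<Sum>l\<in>UNIV. nn y i j l * J y$l$k) - (\<Sum>l\<in>UNIV. nn y j i l * J y$l$k) = - cc y k i j"
  proof -
   have "nn y i j l - nn y j i l = - nn y l i j" for l
    using nn_cyclic[OF y, of i j l] nn_skew[OF y, of j i l] by linarith
   then show ?thesis unfolding sum_subtractf[symmetric] left_diff_distrib[symmetric] cc_def
    by (simp add: sum_negf[symmetric] mult.commute)
  qed
  ultimately show ?thesis by simp
 qed
 have sk: "cc y i j k = - cc y i k j" for i j k
  unfolding cc_def sum_negf[symmetric] by (rule sum.cong) (simp_all add: nn_skew[OF y, of _ j])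
 show ?thesis
  using c[OF ijk] c[OF ijk(2,3,1)] c[OF ijk(3,1,2)] sk[of j i k] sk[of k j i] sk[of i k j] by linarith
qed

lemma nabla_J: assumes y: "y \<in> U" and i: "i \<in> I" shows "pd i J y = J y**\<Gamma> i y - \<Gamma> i y**J y"
proof -
 have n: "nn y m j k = 0" for m j k
 proof (cases "m \<in> I \<and> j \<in> I \<and> k \<in> I")
  case True
  \<comment> \<open>Applying J to the first index once more recovers \<open>nn\<close> up to
    sign.\<close>
  have "0 = (\<Sum>i\<in>UNIV. J y$i$m * cc y i j k)"
  proof (rule sum.neutral[symmetric], rule ballI)
   fix i show "J y$i$m * cc y i j k = 0"
    using cc_zero[OF y, of i j k] True blk_J[OF y] by (cases "i \<in> I") (auto simp: blk_def)
  qed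
  also have "\<dots> = (\<Sum>l\<in>UNIV. (\<Sum>i\<in>UNIV. J y$l$i * J y$i$m) * nn y l j k)"
   unfolding cc_def sum_distrib_left sum_distrib_right by (subst sum.swap) (simp add: mult_ac)
  also have "\<dots> = (\<Sum>l\<in>UNIV. - (PI I$l$m * nn y l j k))"
   unfolding mm_nth[symmetric] J_sq[OF y] by simp
  also have "\<dots> = - nn y m j k" using True by (simp add: PI_nth_mult sum_negf)
  finally show ?thesis by simp
 qed (use nn_zero[OF y] in blast)
 have "transpose (Nb i y)**H y = 0" using n unfolding nn_def by (simp add: vec_eq_iff)
 then have "transpose (Nb i y)**(H y**Hi y) = 0" by (simp only: matrix_mul_assoc) (simp add: mm_ring)
 then have "transpose (Nb i y) = 0" by (simp add: Hi[OF y])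
 then have "Nb i y = 0" by (simp add: transpose_def vec_eq_iff)
 then show ?thesis using i by (simp add: Nb_def algebra_simps)
qed

section \<open>The Ricci form\<close>

lemma R_J: assumes "y \<in> U" "j \<in> I" "k \<in> I" shows "J y**R j k y = R j k y**J y"
 by (rule riem_intertwine[OF U smooth_J smooth_Gam smooth_Gam nabla_J assms])

text \<open>Twice the Ricci form, because the trace is taken over the real tangent space.\<close>

definition rform :: "real^'n \<Rightarrow> real^'n^'n" where
 "rform y = (\<chi> j k. if j \<in> I \<and> k \<in> I then trace (J y**R j k y) else 0)"

definition Rc :: "real^'n \<Rightarrow> real^'n^'n" where
 "Rc y = PI I**ricci I G y**PI I"

lemma Rc_nth: "\<lbrakk>y \<in> U; j \<in> I; k \<in> I\<rbrakk> \<Longrightarrow> Rc y$j$k = (\<Sum>i\<in>I. R i j y$i$k)"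
 by (simp add: Rc_def PI_mult mult_PI ricci_R)

lemma blk_Rc: "blk I I (Rc y)"
 by (auto simp: Rc_def PI_mult mult_PI blk_def)

text \<open>The Bianchi identity splits \<open>R j k\<close> into two terms; each of their traces
  against J becomes a Ricci contraction once J has been moved to the other side of the curvature by
  \<open>R_J\<close>.\<close>

lemma rform_Rc: assumes y: "y \<in> U" shows "rform y = transpose (Rc y**J y) - Rc y**J y"
proof -
 have RJ: "(Rc y**J y)$k$j = (\<Sum>a\<in>I. (J y**R a k y)$a$j)" if jk: "j \<in> I" "k \<in> I" for j k
 proof -
  have "(Rc y**J y)$k$j = (\<Sum>l\<in>I. Rc y$k$l * J y$l$j)"
   unfolding mm_nth by (rule sum_blk) (use blk_Rc in \<open>auto simp: blk_def\<close>)
  also have "\<dots> = (\<Sum>l\<in>I. \<Sum>a\<in>I. R a k y$a$l * J y$l$j)"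
   by (simp add: Rc_nth[OF y] jk sum_distrib_right)
  also have "\<dots> = (\<Sum>a\<in>I. \<Sum>l\<in>I. R a k y$a$l * J y$l$j)" by (rule sum.swap)
  also have "\<dots> = (\<Sum>a\<in>I. (R a k y**J y)$a$j)"
  proof (rule sum.cong[OF refl])
   fix a assume a: "a \<in> I"
   show "(\<Sum>l\<in>I. R a k y$a$l * J y$l$j) = (R a k y**J y)$a$j"
    unfolding mm_nth by (rule sum_blk[symmetric]) (use blk_R[OF y a jk(2)] in \<open>auto simp: blk_def\<close>)
  qed
  also have "\<dots> = (\<Sum>a\<in>I. (J y**R a k y)$a$j)" using R_J[OF y _ jk(2)] by simp
  finally show ?thesis .
 qed
 have "rform y$j$k = (Rc y**J y)$k$j - (Rc y**J y)$j$k" if jk: "j \<in> I" "k \<in> I" for j k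
 proof -
  have "trace (J y**R j k y) = (\<Sum>a\<in>I. (J y**R j k y)$a$a)"
   unfolding trace_def by (rule sum_blk) (use blk_J[OF y] in \<open>auto simp: blk_def mm_nth\<close>)
  also have "\<dots> = (\<Sum>a\<in>I. (J y**R a k y)$a$j - (J y**R a j y)$a$k)"
  proof (rule sum.cong[OF refl])
   fix a assume a: "a \<in> I"
   have e: "R j k y$c$a = R a k y$c$j - R a j y$c$k" for c
    using bianchi[OF y jk a, of c] riem_antisym[of \<Gamma> k a y] by (simp add: vec_eq_iff)
   show "(J y**R j k y)$a$a = (J y**R a k y)$a$j - (J y**R a j y)$a$k"
    unfolding mm_nth sum_subtractf[symmetric] by (simp only: e right_diff_distrib)
  qed
  finally show ?thesis using jk by (simp add: rform_def RJ sum_subtractf)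
 qed
 moreover have "blk I I (rform y)" "blk I I (transpose (Rc y**J y) - Rc y**J y)"
  using blk_Rc blk_J[OF y] by (auto intro!: blk_diff blk_transpose blk_mm[of I I _ I I]) (auto simp: rform_def blk_def)
 ultimately show ?thesis unfolding blk_def vec_eq_iff by (metis (no_types, lifting) transpose_def vec_lambda_beta vector_minus_component)
qed

lemma J_Hi: assumes y: "y \<in> U" shows "J y**Hi y**Jt y = PI I**Hi y"
proof -
 have "Hi y**(Jt y**H y) = - J y"
  using HJ[OF y] Hi(1)[OF y] by (simp add: matrix_mul_assoc equation_minus_iff[of "H y**J y"] mm_ring(5,6) flip: mm_ring(6))
   (metis HJ Hi(1) matrix_mul_assoc matrix_mul_lid mm_ring(6) minus_minus y)
 then have "Hi y**(Jt y**H y)**Hi y = - (J y**Hi y)" by (simp add: mm_ring)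
 then have "Hi y**Jt y = - (J y**Hi y)" by (simp add: mm_ring Hi[OF y])
 then have "J y**(Hi y**Jt y) = - (J y**J y**Hi y)" by (simp add: mm_ring)
 then show ?thesis by (simp add: J_sq[OF y] mm_ring)
qed

text \<open>Conjugating the inverse metric by J gives it back, see \<open>J_Hi\<close>; hence both
  terms contribute the same metric trace of \<open>X\<close>.\<close>

lemma trace_J_form:
 assumes y: "y \<in> U" and X: "blk I I X"
 shows "trace ((transpose (X**J y) - X**J y)**J y**Hi y) = 2 * trace (Hi y**X)"
proof -
 have "X**J y**J y = - X" by (simp add: mm_ring J_sq[OF y] blk_right[OF X])
 then have "(transpose (X**J y) - X**J y)**J y = Jt y**transpose X**J y + X"
  by (simp add: mm_ring matrix_transpose_mul)
 then have e: "(transpose (X**J y) - X**J y)**J y**Hi y = Jt y**transpose X**J y**Hi y + X**Hi y"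
  by (simp only: mm_ring(1))
 have "trace (Jt y**transpose X**J y**Hi y) = trace (transpose X**(J y**Hi y**Jt y))"
  by (metis matrix_mul_assoc trace_mul_sym)
 also have "\<dots> = trace ((transpose X**PI I)**Hi y)" by (simp add: J_Hi[OF y] matrix_mul_assoc)
 also have "\<dots> = trace (transpose X**Hi y)" using blk_right[OF blk_transpose[OF X]] by simp
 also have "\<dots> = trace (transpose (Hi y**X))" by (simp add: matrix_transpose_mul sym_Hi[OF y])
 finally have "trace (Jt y**transpose X**J y**Hi y) = trace (Hi y**X)" by (simp add: trace_transpose)
 then show ?thesis unfolding e by (simp add: trace_linear trace_mul_sym[of X])
qed

text \<open>It makes the scalar curvature accessible through traces against J, which change in a
  controlled way when the connection is replaced by another one preserving J.\<close>

lemma scalar_curvature_rform: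
 assumes y: "y \<in> U"
 shows "2 * scalar_curvature I G y = trace (rform y**J y**Hi y)"
 unfolding rform_Rc[OF y] trace_J_form[OF y blk_Rc] using scalar_curvature_trace[OF y] by (simp add: Rc_def)

end

subsection \<open>Pullback metrics\<close>

lemma dim_coord: "dim (coord I) = card (I :: 'n::finite set)"
proof -
 let ?d = "(\<lambda>i. axis i (1::real)) ` I"
 have "coord I = {x :: real^'n. \<forall>i\<in>Basis. i \<notin> ?d \<longrightarrow> x \<bullet> i = 0}"
  by (auto simp: coord_def Basis_vec_def inner_axis axis_eq_axis image_iff)
 moreover have "card ?d = card I" by (rule card_image) (auto simp: inj_on_def axis_eq_axis)
 ultimately show ?thesis using dim_substandard[of ?d] by (auto simp: Basis_vec_def)
qed

lemma coord_surj:
 fixes Q :: "real^'n^'c"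
 assumes Q: "blk L I Q" and inj: "\<And>v. v \<in> coord I \<Longrightarrow> Q *v v = 0 \<Longrightarrow> v = 0" and card: "card I = card L" and w: "w \<in> coord L"
 shows "\<exists>v\<in>coord I. Q *v v = w"
proof -
 have lin: "linear ((*v) Q)" by simp
 have "inj_on ((*v) Q) (span (coord I))"
 proof (rule inj_onI)
  fix x y assume "x \<in> span (coord I)" "y \<in> span (coord I)" and e: "Q *v x = Q *v y"
  then have "x \<in> coord I" "y \<in> coord I" by (simp_all add: span_eq_iff[THEN iffD2, OF subspace_coord])
  then show "x = y" using inj[OF subspace_diff[OF subspace_coord, of x I y]] e by (simp add: matrix_vector_mult_diff_distrib)
 qed
 then have d: "dim ((*v) Q ` coord I) = dim (coord L)" using dim_image_eq[OF lin] card by (simp add: dim_coord)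
 have "(*v) Q ` coord I \<subseteq> coord L" using blk_mv_coord[OF Q] by blast
 then have "(*v) Q ` coord I = coord L"
  by (rule subspace_dim_equal[OF linear_subspace_image[OF lin subspace_coord] subspace_coord]) (simp add: d)
 then show ?thesis using w by (metis imageE)
qed

text \<open>The matrices \<open>P i\<close> are stacked into one system with rows indexed by pairs.
  It is injective between spaces of equal dimension, hence onto.\<close>

lemma product_frame:
 fixes P :: "'m::finite \<Rightarrow> real^'n^'j"
 assumes P: "\<And>i. blk (K i) I (P i)" and inj: "\<And>v. v \<in> coord I \<Longrightarrow> (\<And>i. P i *v v = 0) \<Longrightarrow> v = 0"
  and card: "card I = (\<Sum>i\<in>UNIV. card (K i))" and e: "e \<in> coord (K l)"
 shows "\<exists>w\<in>coord I. \<forall>i. P i *v w = (if i = l then e else 0)"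
proof -
 define Q :: "real^'n ^ ('m \<times> 'j)" where "Q = (\<chi> p. P (fst p)$(snd p))"
 have Q: "(Q *v v)$(i, r) = (P i *v v)$r" for v i r by (simp add: Q_def mv_nth)
 have "\<exists>w\<in>coord I. Q *v w = (\<chi> p. if fst p = l then e$(snd p) else 0)"
 proof (rule coord_surj[of "SIGMA i:UNIV. K i"])
  show "blk (SIGMA i:UNIV. K i) I Q" using P by (auto simp: blk_def Q_def)
  show "v = 0" if "v \<in> coord I" "Q *v v = 0" for v using inj[OF that(1)] Q[of v] that(2) by (simp add: vec_eq_iff)
 qed (use e card in \<open>auto simp: coord_def card_SigmaI\<close>)
 then obtain w where w: "w \<in> coord I" "Q *v w = (\<chi> p. if fst p = l then e$(snd p) else 0)" by blast
 have "P i *v w = (if i = l then e else 0)" for i unfolding vec_eq_iff Q[symmetric] w(2) by simp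
 then show ?thesis using w(1) by blast
qed

lemma matrix_eq_coord:
 assumes "A**PI I = A" "B**PI I = B" "\<And>v. v \<in> coord I \<Longrightarrow> A *v v = B *v v"
 shows "A = B"
proof -
 have "A *v v = B *v v" for v
  using assms(3)[OF PI_mv_coord[of I v]] assms(1,2) by (simp add: matrix_vector_mul_assoc)
 then show ?thesis by (simp add: matrix_eq)
qed

text \<open>The hypothesis \<open>one\<close> says that the \<open>\<Psi> i\<close> form a left
  inverse of the stacked \<open>\<Phi> i\<close>; equality of dimensions makes it a right
  inverse.\<close>

lemma dual_frame_family:
 fixes \<Phi> :: "'m::finite \<Rightarrow> real^'n^'j" and \<Psi> :: "'m \<Rightarrow> real^'j^'n"
 assumes \<Phi>: "\<And>i. blk (K i) I (\<Phi> i)" and \<Psi>: "\<And>i. blk I (K i) (\<Psi> i)"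
  and one: "(\<Sum>i\<in>UNIV. \<Psi> i**\<Phi> i) = PI I" and card: "card I = (\<Sum>i\<in>UNIV. card (K i))"
 shows "\<Phi> i**\<Psi> l = (if i = l then PI (K i) else 0)"
proof (rule matrix_eq_coord[of _ "K l"])
 have v: "(\<Sum>i\<in>UNIV. \<Psi> i *v (\<Phi> i *v v)) = v" if "v \<in> coord I" for v
  using PI_mv[OF that] unfolding one[symmetric]
  by (simp add: bounded_bilinear.sum_left[OF bounded_bilinear_mv] matrix_vector_mul_assoc)
 fix e :: "real^'j" assume e: "e \<in> coord (K l)"
 obtain w where w: "w \<in> coord I" "\<forall>i. \<Phi> i *v w = (if i = l then e else 0)"
  using product_frame[OF \<Phi> _ card e] v by fastforce
 have "\<Psi> l *v e = w" using v[OF w(1)] w(2) by (simp add: if_distrib[of "(*v) _"] cong: if_cong)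
 then show "\<Phi> i**\<Psi> l *v e = (if i = l then PI (K i) else 0) *v e"
  using w(2) PI_mv[OF e] by (simp add: matrix_vector_mul_assoc[symmetric])
qed (use blk_right[OF \<Psi>[of l]] in \<open>auto simp: matrix_mul_assoc[symmetric] mm_ring\<close>)

text \<open>The same argument for a coframe consisting of two blocks of different kinds, stacked
  along a sum type. It is applied with \<open>'b\<close> = \<open>bool\<close>, for the two
  covectors dx/h and \<theta>.\<close>

lemma dual_frame:
 fixes \<Phi> :: "real^'n^'b" and P :: "real^'n^'k" and \<Psi> :: "real^'b^'n" and \<Lambda> :: "real^'k^'n"
 assumes \<Phi>: "blk UNIV I \<Phi>" and P: "blk K I P" and \<Psi>: "blk I UNIV \<Psi>" and \<Lambda>: "blk I K \<Lambda>"
  and one: "\<Psi>**\<Phi> + \<Lambda>**P = PI I" and card: "card I = card K + CARD('b)"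
 shows "\<Phi>**\<Psi> = mat 1" "\<Phi>**\<Lambda> = 0" "P**\<Psi> = 0" "P**\<Lambda> = PI K"
proof -
 define Q :: "real^'n ^ ('b + 'k)" where "Q = (\<chi> s. case s of Inl r \<Rightarrow> \<Phi>$r | Inr r \<Rightarrow> P$r)"
 have Q: "(Q *v v)$Inl r = (\<Phi> *v v)$r" "(Q *v v)$Inr r' = (P *v v)$r'" for v r r' by (simp_all add: Q_def mv_nth)
 have v: "\<Psi> *v (\<Phi> *v v) + \<Lambda> *v (P *v v) = v" if "v \<in> coord I" for v
  using PI_mv[OF that] unfolding one[symmetric] by (simp add: bounded_bilinear.add_left[OF bounded_bilinear_mv] matrix_vector_mul_assoc)
 have D: "\<Phi> *v (\<Psi> *v e + \<Lambda> *v w) = e" "P *v (\<Psi> *v e + \<Lambda> *v w) = w" if w: "w \<in> coord K" for e w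
 proof -
  have "\<exists>v\<in>coord I. Q *v v = (\<chi> s. case s of Inl r \<Rightarrow> e$r | Inr r \<Rightarrow> w$r)"
  proof (rule coord_surj[of "UNIV <+> K"])
   show "blk (UNIV <+> K) I Q" using \<Phi> P by (auto simp: blk_def Q_def split: sum.split)
   show "v' = 0" if "v' \<in> coord I" "Q *v v' = 0" for v'
   proof -
    have "\<Phi> *v v' = 0" "P *v v' = 0" using Q[of v'] that(2) by (simp_all add: vec_eq_iff)
    then show ?thesis using v[OF that(1)] by simp
   qed
  qed (use w card in \<open>auto simp: coord_def card_Plus split: sum.split\<close>)
  then obtain z where z: "z \<in> coord I" "Q *v z = (\<chi> s. case s of Inl r \<Rightarrow> e$r | Inr r \<Rightarrow> w$r)" by blast
  have "\<Phi> *v z = e" "P *v z = w" unfolding vec_eq_iff Q[symmetric] z(2) by simp_all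
  then show "\<Phi> *v (\<Psi> *v e + \<Lambda> *v w) = e" "P *v (\<Psi> *v e + \<Lambda> *v w) = w" using v[OF z(1)] by simp_all
 qed
 have 0: "(0 :: real^'k) \<in> coord K" by (simp add: coord_def)
 show "\<Phi>**\<Psi> = mat 1" "P**\<Psi> = 0" using D[OF 0] by (simp_all add: matrix_eq matrix_vector_mul_assoc[symmetric])
 have "\<Lambda> *v (PI K *v w) = \<Lambda> *v w" for w using blk_right[OF \<Lambda>] by (simp add: matrix_vector_mul_assoc)
 then show "\<Phi>**\<Lambda> = 0" "P**\<Lambda> = PI K"
  using D[OF PI_mv_coord, of 0] by (simp_all add: matrix_eq matrix_vector_mul_assoc[symmetric])
qed

section \<open>Jacobians and pulled-back connections\<close>

definition jac :: "'n::finite set \<Rightarrow> (real^'n \<Rightarrow> real^'k) \<Rightarrow> real^'n \<Rightarrow> real^'n^'k" where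
 "jac I f y = (\<chi> a j. if j \<in> I then pd j f y$a else 0)"

lemma jac_nth: "jac I f y$a$j = (if j \<in> I then pd j f y$a else 0)"
 by (simp add: jac_def)

lemma smooth_jac:
 assumes U: "ropen I U" and f: "smooth I U f"
 shows "smooth I U (jac I f)"
proof (rule smooth_matrix[OF U])
 fix a j show "smooth I U (\<lambda>y. jac I f y$a$j)"
  by (cases "j \<in> I") (simp_all add: jac_nth smooth_const[OF U] smooth_nth[OF U smooth_pd[OF f]])
qed

lemma blk_jac:
 assumes U: "ropen I U" and f: "smooth I U f" and fU: "f ` U \<subseteq> coord K" and y: "y \<in> U"
 shows "blk K I (jac I f y)"
 using pd_in_coord[OF U smooth_Ck[OF f] fU y] by (auto simp: blk_def jac_nth coord_def)

lemma pd_jac_sym: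
 assumes U: "ropen I U" and f: "smooth I U f" and y: "y \<in> U" and j: "j \<in> I" and k: "k \<in> I"
 shows "pd j (jac I f) y$a$k = pd k (jac I f) y$a$j"
proof -
 have e: "pd j (jac I f) y$a$k = pd j (pd k f) y$a" if "j \<in> I" "k \<in> I" for j k
  unfolding pd_nth2[OF U smooth_jac[OF U f] that(1) y, symmetric]
  using pd_nth[OF U smooth_pd[OF f that(2)] that(1) y] that by (simp add: jac_nth)
 show ?thesis unfolding e[OF j k] e[OF k j] using smooth_pd_commute[OF U f j k y] by simp
qed

context metric_chart
begin

text \<open>The connection of the target pulled back along \<open>f\<close>; it acts on vectors of
  the target.\<close>

definition pb :: "'m::finite set \<Rightarrow> (real^'m \<Rightarrow> real^'n) \<Rightarrow> 'm \<Rightarrow> real^'m \<Rightarrow> real^'n^'n" where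
 "pb D f j y = (\<Sum>a\<in>I. pd j f y$a *\<^sub>R \<Gamma> a (f y))"

context
 fixes D :: "'m::finite set" and W and f :: "real^'m \<Rightarrow> real^'n"
 assumes W: "ropen D W" and f: "smooth D W f" and fW: "f ` W \<subseteq> U"
begin

lemma fW_coord: "f ` W \<subseteq> coord I"
 using fW openin_imp_subset[OF U] by blast

lemma smooth_pb: "j \<in> D \<Longrightarrow> smooth D W (pb D f j)"
 unfolding pb_def
 by (intro smooth_intros W smooth_pd f smooth_compose[OF W U fW f] smooth_Gam)

lemma riem_pb: "\<lbrakk>y \<in> W; j \<in> D; k \<in> D\<rbrakk> \<Longrightarrow>
  riem (pb D f) j k y = (\<Sum>a\<in>I. \<Sum>b\<in>I. (pd j f y$a * pd k f y$b) *\<^sub>R R a b (f y))"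
 by (rule riem_pullback[OF W U f fW smooth_Gam _ _ _ pb_def])

lemma blk_pb: "blk I I (pb D f j y)"
 unfolding pb_def by (intro blk_sum blk_scaleR blk_Gam)

lemma pd_H_comp: assumes y: "y \<in> W" and j: "j \<in> D"
 shows "pd j (\<lambda>y. H (f y)) y = transpose (pb D f j y)**H (f y) + H (f y)**pb D f j y"
proof -
 have fy: "f y \<in> U" using fW y by auto
 have "pd j (\<lambda>y. H (f y)) y = (\<Sum>a\<in>I. pd j f y$a *\<^sub>R pd a H (f y))"
  by (rule pd_compose[OF W U fW f smooth_H j y])
 then show ?thesis
  by (simp add: pb_def compatible[OF fy] transpose_linear mm_sum_left mm_sum_right mm_ring sum.distrib scaleR_add_right)
qed

text \<open>The pulled-back connection inherits the vanishing torsion of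
  \<open>\<Gamma>\<close>.\<close>

lemma pb_jac_sym: assumes y: "y \<in> W" and j: "j \<in> D" and k: "k \<in> D"
 shows "(pb D f j y**jac D f y)$a$k = (pb D f k y**jac D f y)$a$j"
proof -
 have fy: "f y \<in> U" using fW y by auto
 have e: "(pb D f j y**jac D f y)$a$k = (\<Sum>b\<in>I. \<Sum>c\<in>I. pd j f y$b * \<Gamma> b (f y)$a$c * pd k f y$c)"
  if k: "k \<in> D" for j k
 proof -
  have "(pb D f j y**jac D f y)$a$k = (\<Sum>b\<in>I. (pd j f y$b *\<^sub>R \<Gamma> b (f y)**jac D f y)$a$k)"
   by (simp add: pb_def mm_sum_left sum_component)
  also have "\<dots> = (\<Sum>b\<in>I. \<Sum>c\<in>I. pd j f y$b * \<Gamma> b (f y)$a$c * pd k f y$c)"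
  proof (rule sum.cong[OF refl])
   fix b
   have "(pd j f y$b *\<^sub>R \<Gamma> b (f y)**jac D f y)$a$k = (\<Sum>c\<in>UNIV. pd j f y$b * \<Gamma> b (f y)$a$c * pd k f y$c)"
    using k by (simp add: mm_nth jac_nth)
   also have "\<dots> = (\<Sum>c\<in>I. pd j f y$b * \<Gamma> b (f y)$a$c * pd k f y$c)"
    by (rule sum_blk) (use blk_Gam[of b "f y"] in \<open>auto simp: blk_def\<close>)
   finally show "(pd j f y$b *\<^sub>R \<Gamma> b (f y)**jac D f y)$a$k = \<dots>" .
  qed
  finally show ?thesis .
 qed
 show ?thesis unfolding e[OF j] e[OF k]
  by (subst sum.swap) (simp add: Gam_sym[OF fy, of _ a] mult_ac)
qed

end

end

text \<open>A candidate \<open>L\<close> is guessed for which all Jacobians \<open>\<Phi> i\<close>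
  are parallel. It is symmetric and compatible with the metric, so it is the Levi-Civita connection,
  and parallelism carries the curvatures of the factors over. The weights \<open>A i\<close> sit in
  \<open>\<Psi>\<close> and disappear because \<open>\<Phi> i ** \<Psi> i\<close> is a
  projection.\<close>

lemma pullback_ricci:
 fixes G :: "real^'n \<Rightarrow> real^'n^'n" and g :: "'m::finite \<Rightarrow> real^'j \<Rightarrow> real^'j^'j"
  and f :: "'m \<Rightarrow> real^'n \<Rightarrow> real^'j" and A :: "'m \<Rightarrow> real"
 assumes G: "metric_chart I U G" and g: "\<And>i. metric_chart (K i) (V i) (g i)"
  and f: "\<And>i. smooth I U (f i)" and fU: "\<And>i. f i ` U \<subseteq> V i"
  and met: "\<And>y. y \<in> U \<Longrightarrow> PI I**hat I (G y) = (\<Sum>i\<in>UNIV. A i *\<^sub>R (transpose (jac I (f i) y)**hat (K i) (g i (f i y))**jac I (f i) y))"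
  and card: "card I = (\<Sum>i\<in>UNIV. card (K i))" and y: "y \<in> U" and j: "j \<in> I" and k: "k \<in> I"
 shows "ricci I G y$j$k = (\<Sum>i\<in>UNIV. \<Sum>b\<in>K i. \<Sum>c\<in>K i. pd j (f i) y$b * ricci (K i) (g i) (f i y)$b$c * pd k (f i) y$c)"
proof -
 interpret G: metric_chart I U G by (rule G)
 interpret g: metric_chart "K i" "V i" "g i" for i by (rule g)
 note U = G.U
 define \<Phi> where "\<Phi> i = jac I (f i)" for i
 define h where "h i y = hat (K i) (g i (f i y))" for i y
 define \<omega> where "\<omega> i = g.pb i I (f i)" for i
 \<comment> \<open>The frame dual to the Jacobians, obtained by raising an index; \<open>one\<close>
   and \<open>dual\<close> below confirm it.\<close>
 define \<Psi> where "\<Psi> i y = A i *\<^sub>R (G.Hi y**transpose (\<Phi> i y)**h i y)" for i y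
 define L where "L j y = (\<Sum>i\<in>UNIV. \<Psi> i y**(pd j (\<Phi> i) y + \<omega> i j y**\<Phi> i y))" for j y
 have fc: "f i ` U \<subseteq> coord (K i)" for i by (rule g.fW_coord[OF U f fU])
 have s\<Phi>: "smooth I U (\<Phi> i)" for i unfolding \<Phi>_def by (rule smooth_jac[OF U f])
 have sh: "smooth I U (h i)" for i unfolding h_def by (rule smooth_compose[OF U g.U fU f g.smooth_H])
 have s\<omega>: "smooth I U (\<omega> i j)" if "j \<in> I" for i j unfolding \<omega>_def by (rule g.smooth_pb[OF U f fU that])
 have met': "PI I**G.H y = (\<Sum>i\<in>UNIV. A i *\<^sub>R (transpose (\<Phi> i y)**h i y**\<Phi> i y))" if "y \<in> U" for y
  using met[OF that] by (simp add: \<Phi>_def h_def)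
 have bl\<Phi>: "blk (K i) I (\<Phi> i y)" if "y \<in> U" for i y unfolding \<Phi>_def by (rule blk_jac[OF U f fc that])
 have bl\<omega>: "blk (K i) (K i) (\<omega> i j y)" for i j y unfolding \<omega>_def by (rule g.blk_pb[OF U f fU])
 have bl\<Psi>: "blk I (K i) (\<Psi> i y)" if "y \<in> U" for i y
 proof -
  have "G.Hi y**transpose (\<Phi> i y)**h i y = (PI I**G.Hi y)**transpose (\<Phi> i y)**(PI (K i)**h i y)"
   using blk_left[OF blk_transpose[OF bl\<Phi>[OF that]]] blk_right[OF blk_transpose[OF bl\<Phi>[OF that]]]
   by (simp add: G.Hi_PI[OF that] matrix_mul_assoc) (simp add: matrix_mul_assoc[symmetric])
  then show ?thesis
   unfolding \<Psi>_def h_def using blk_mm[OF blk_mm[OF G.blk_PI_Hi[OF that] blk_transpose[OF bl\<Phi>[OF that]]] hat_blk(2)]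
   by (metis blk_scaleR)
 qed
 have H\<Psi>: "G.H y**\<Psi> i y = A i *\<^sub>R (transpose (\<Phi> i y)**h i y)" if "y \<in> U" for i y
  unfolding \<Psi>_def by (simp add: mm_ring) (simp add: matrix_mul_assoc G.Hi[OF that])
 have one: "(\<Sum>i\<in>UNIV. \<Psi> i y**\<Phi> i y) = PI I" if "y \<in> U" for y
 proof -
  have "G.H y**(\<Sum>i\<in>UNIV. \<Psi> i y**\<Phi> i y) = G.H y**PI I"
   unfolding hat_blk(1)[symmetric] met'[OF that] mm_sum_right
   by (simp add: matrix_mul_assoc H\<Psi>[OF that] mm_ring(7))
  then have "G.Hi y**(G.H y**(\<Sum>i\<in>UNIV. \<Psi> i y**\<Phi> i y)) = G.Hi y**(G.H y**PI I)" by simp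
  then show ?thesis by (simp add: matrix_mul_assoc G.Hi[OF that])
 qed
 have dual: "\<Phi> i y**\<Psi> l y = (if i = l then PI (K i) else 0)" if "y \<in> U" for i l y
  by (rule dual_frame_family[OF bl\<Phi>[OF that] bl\<Psi>[OF that] one[OF that] card])
 have L: "L j y = Gam I G j y" if y: "y \<in> U" and j: "j \<in> I" for y j
 proof (rule G.Gam_unique[OF y _ _ _ j, of "\<lambda>j. L j y"])
  have blX: "blk (K i) I (pd j (\<Phi> i) y + \<omega> i j y**\<Phi> i y)" if "j \<in> I" for i j
   by (intro blk_add pd_blk[OF U bl\<Phi> s\<Phi> that y] blk_mm[OF bl\<omega> bl\<Phi>[OF y]])
  show "blk I I (L j y)" if "j \<in> I" for j
   unfolding L_def by (intro blk_sum blk_mm[OF bl\<Psi>[OF y] blX[OF that]])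
  show "L j y$a$k = L k y$a$j" if jk: "j \<in> I" "k \<in> I" for a j k
  proof -
   have "(pd j (\<Phi> i) y + \<omega> i j y**\<Phi> i y)$b$k = (pd k (\<Phi> i) y + \<omega> i k y**\<Phi> i y)$b$j" for i b
    unfolding \<Phi>_def \<omega>_def using pd_jac_sym[OF U f y jk] g.pb_jac_sym[OF U f fU y jk] by simp
   then show ?thesis unfolding L_def by (simp add: sum_component mm_nth)
  qed
  fix j assume j: "j \<in> I"
  have HL: "G.H y**L j y = (\<Sum>i\<in>UNIV. A i *\<^sub>R (transpose (\<Phi> i y)**h i y**(pd j (\<Phi> i) y + \<omega> i j y**\<Phi> i y)))"
   unfolding L_def mm_sum_right by (simp add: matrix_mul_assoc H\<Psi>[OF y]) (simp add: mm_ring scaleR_add_right)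
  have LtH: "transpose (L j y)**G.H y = transpose (G.H y**L j y)"
   by (simp add: matrix_transpose_mul G.sym_H[OF y])
  have hs: "transpose (h i y) = h i y" for i unfolding h_def using fU[of i] y by (intro g.sym_H) auto
  have dh: "pd j (h i) y = transpose (\<omega> i j y)**h i y + h i y**\<omega> i j y" for i
   unfolding h_def \<omega>_def by (rule g.pd_H_comp[OF U f fU y j])
  have "pd j G.H y = PI I**pd j G.H y" unfolding G.pd_H[OF y j] by (simp add: matrix_mul_assoc)
  also have "\<dots> = pd j (\<lambda>y. PI I**G.H y) y"
   using pd_mm[OF U smooth_const[OF U] G.smooth_H j y, of "PI I"] by (simp add: pds_pd[OF pds_const] mm_ring)
  also have "\<dots> = pd j (\<lambda>y. \<Sum>i\<in>UNIV. A i *\<^sub>R (transpose (\<Phi> i y)**h i y**\<Phi> i y)) y"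
   by (rule pd_cong[OF U y j met'])
  also have "\<dots> = (\<Sum>i\<in>UNIV. pd j (\<lambda>y. A i *\<^sub>R (transpose (\<Phi> i y)**h i y**\<Phi> i y)) y)"
   by (rule pd_sum[OF U _ j y]) (intro smooth_intros U s\<Phi> sh)
  also have "\<dots> = (\<Sum>i\<in>UNIV. A i *\<^sub>R (transpose (\<Phi> i y)**h i y**pd j (\<Phi> i) y
    + (transpose (\<Phi> i y)**(transpose (\<omega> i j y)**h i y + h i y**\<omega> i j y) + transpose (pd j (\<Phi> i) y)**h i y)**\<Phi> i y))"
  proof (rule sum.cong[OF refl])
   fix i
   have s1: "smooth I U (\<lambda>y. transpose (\<Phi> i y))" by (rule smooth_transpose[OF U s\<Phi>])
   have s2: "smooth I U (\<lambda>y. transpose (\<Phi> i y)**h i y)" by (rule smooth_mm[OF U s1 sh])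
   show "pd j (\<lambda>y. A i *\<^sub>R (transpose (\<Phi> i y)**h i y**\<Phi> i y)) y = A i *\<^sub>R (transpose (\<Phi> i y)**h i y**pd j (\<Phi> i) y
    + (transpose (\<Phi> i y)**(transpose (\<omega> i j y)**h i y + h i y**\<omega> i j y) + transpose (pd j (\<Phi> i) y)**h i y)**\<Phi> i y)"
    using pd_scaleR[OF U smooth_const[OF U] smooth_mm[OF U s2 s\<Phi>] j y, of "A i"] pd_mm[OF U s2 s\<Phi> j y] pd_mm[OF U s1 sh j y] pd_transpose[OF U s\<Phi> j y]
    by (simp add: pds_pd[OF pds_const] dh)
  qed
  also have "\<dots> = transpose (L j y)**G.H y + G.H y**L j y"
   unfolding LtH HL by (simp add: transpose_linear matrix_transpose_mul hs mm_ring sum.distrib[symmetric] scaleR_add_right[symmetric] add_ac)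
  finally show "pd j G.H y = transpose (L j y)**G.H y + G.H y**L j y" .
 qed
 have par: "pd j (\<Phi> i) y = \<Phi> i y**Gam I G j y - \<omega> i j y**\<Phi> i y" if "j \<in> I" "y \<in> U" for i j y
 proof -
  have "\<Phi> i y**L j y = (\<Sum>l\<in>UNIV. if i = l then PI (K i)**(pd j (\<Phi> i) y + \<omega> i j y**\<Phi> i y) else 0)"
   unfolding L_def mm_sum_right matrix_mul_assoc dual[OF that(2)] by (rule sum.cong) (auto simp: mm_ring)
  also have "\<dots> = pd j (\<Phi> i) y + \<omega> i j y**\<Phi> i y"
   using blk_left[OF pd_blk[OF U bl\<Phi> s\<Phi> that]] blk_left[OF bl\<omega>] by (simp add: mm_ring) (simp add: matrix_mul_assoc)
  finally show ?thesis using L[OF that(2,1)] by simp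
 qed
 have \<Phi>R: "\<Phi> i y**G.R j k y = riem (\<omega> i) j k y**\<Phi> i y" if "j \<in> I" "k \<in> I" for i j k
  by (rule riem_intertwine[OF U s\<Phi> G.smooth_Gam s\<omega> par y that])
 have F: "riem (\<omega> i) j k y = (\<Sum>a\<in>K i. \<Sum>b\<in>K i. (pd j (f i) y$a * pd k (f i) y$b) *\<^sub>R g.R i a b (f i y))"
  if "j \<in> I" "k \<in> I" for i j k
  unfolding \<omega>_def by (rule g.riem_pb[OF U f fU y that])
 have fy: "f i y \<in> V i" for i using fU[of i] y by auto
 define Y where "Y i a = (\<Sum>b\<in>K i. pd j (f i) y$b *\<^sub>R g.R i a b (f i y))" for i a
 have bY: "blk (K i) (K i) (Y i a)" if "a \<in> K i" for i a unfolding Y_def by (intro blk_sum blk_scaleR g.blk_R[OF fy that])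
 have R: "G.R l j y = (\<Sum>i\<in>UNIV. \<Sum>a\<in>K i. pd l (f i) y$a *\<^sub>R (\<Psi> i y**Y i a**\<Phi> i y))" if "l \<in> I" for l
 proof -
  have "G.R l j y = (\<Sum>i\<in>UNIV. \<Psi> i y**\<Phi> i y)**G.R l j y"
   using one[OF y] blk_left[OF G.blk_R[OF y that j]] by simp
  also have "\<dots> = (\<Sum>i\<in>UNIV. \<Psi> i y**riem (\<omega> i) l j y**\<Phi> i y)"
   unfolding mm_sum_left matrix_mul_assoc[symmetric] \<Phi>R[OF that j] ..
  finally show ?thesis unfolding F[OF that j] Y_def by (simp add: mm_sum_left mm_sum_right mm_ring scaleR_sum_right)
 qed
 have tr: "(\<Sum>l\<in>I. pd l (f i) y$a * (\<Psi> i y**Y i a**\<Phi> i y)$l$k) = (\<Sum>b\<in>K i. \<Sum>c\<in>K i. pd j (f i) y$b * g.R i a b (f i y)$a$c * pd k (f i) y$c)"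
  if a: "a \<in> K i" for i a
 proof -
  have "(\<Sum>l\<in>I. pd l (f i) y$a * (\<Psi> i y**Y i a**\<Phi> i y)$l$k) = (\<Sum>l\<in>I. \<Phi> i y$a$l * (\<Psi> i y**Y i a**\<Phi> i y)$l$k)"
   by (rule sum.cong) (auto simp: \<Phi>_def jac_nth)
  also have "\<dots> = (\<Phi> i y**(\<Psi> i y**Y i a**\<Phi> i y))$a$k"
   unfolding mm_nth[of "\<Phi> i y" "\<Psi> i y**Y i a**\<Phi> i y"] by (rule sum_blk[symmetric]) (use bl\<Phi>[OF y, of i] in \<open>auto simp: blk_def\<close>)
  also have "\<Phi> i y**(\<Psi> i y**Y i a**\<Phi> i y) = Y i a**\<Phi> i y"
   by (simp add: matrix_mul_assoc dual[OF y] blk_left[OF bY[OF a]])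
  also have "(Y i a**\<Phi> i y)$a$k = (\<Sum>c\<in>K i. Y i a$a$c * \<Phi> i y$c$k)"
   unfolding mm_nth by (rule sum_blk) (use bY[OF a] in \<open>auto simp: blk_def\<close>)
  also have "\<dots> = (\<Sum>c\<in>K i. \<Sum>b\<in>K i. pd j (f i) y$b * g.R i a b (f i y)$a$c * pd k (f i) y$c)"
   using k by (simp add: Y_def \<Phi>_def jac_nth sum_component sum_distrib_right)
  finally show ?thesis by (subst sum.swap)
 qed
 have "ricci I G y$j$k = (\<Sum>l\<in>I. \<Sum>i\<in>UNIV. \<Sum>a\<in>K i. pd l (f i) y$a * (\<Psi> i y**Y i a**\<Phi> i y)$l$k)"
  unfolding G.ricci_R[OF y j k] by (simp add: R sum_component)
 also have "\<dots> = (\<Sum>i\<in>UNIV. \<Sum>a\<in>K i. \<Sum>l\<in>I. pd l (f i) y$a * (\<Psi> i y**Y i a**\<Phi> i y)$l$k)"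
  by (subst sum.swap, rule sum.cong[OF refl sum.swap])
 also have "\<dots> = (\<Sum>i\<in>UNIV. \<Sum>a\<in>K i. \<Sum>b\<in>K i. \<Sum>c\<in>K i. pd j (f i) y$b * g.R i a b (f i y)$a$c * pd k (f i) y$c)"
  by (intro sum.cong refl tr)
 also have "\<dots> = (\<Sum>i\<in>UNIV. \<Sum>b\<in>K i. \<Sum>c\<in>K i. \<Sum>a\<in>K i. pd j (f i) y$b * g.R i a b (f i y)$a$c * pd k (f i) y$c)"
  by (rule sum.cong[OF refl], subst sum.swap, rule sum.cong[OF refl sum.swap])
 finally show ?thesis by (simp add: g.ricci_R[OF fy] sum_distrib_left sum_distrib_right)
qed

subsection \<open>Scalar curvature of the ansatz\<close>

lemma sum_bool: "(\<Sum>s\<in>UNIV. f s) = f True + f (False :: bool)"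
 by (simp add: UNIV_bool add.commute)

text \<open>On endomorphisms that commute with J the functional tr(J .) is again a trace.
  Commutators therefore drop out, and adding \<open>D\<close> to the connection changes the traced
  curvature by the exterior derivative of tr(J D).\<close>

lemma trace_riem_difference:
 fixes J :: "real^'n \<Rightarrow> real^'c^'c"
 assumes U: "ropen I U" and J: "smooth I U J" and \<Gamma>': "\<And>j. j \<in> I \<Longrightarrow> smooth I U (\<Gamma>' j)" and D: "\<And>j. j \<in> I \<Longrightarrow> smooth I U (D j)"
  and \<Gamma>: "\<And>j y. j \<in> I \<Longrightarrow> y \<in> U \<Longrightarrow> \<Gamma> j y = \<Gamma>' j y + D j y"
  and par: "\<And>j y. j \<in> I \<Longrightarrow> y \<in> U \<Longrightarrow> pd j J y = J y**\<Gamma>' j y - \<Gamma>' j y**J y"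
  and com: "\<And>j y. j \<in> I \<Longrightarrow> y \<in> U \<Longrightarrow> J y**D j y = D j y**J y"
  and y: "y \<in> U" and j: "j \<in> I" and k: "k \<in> I"
 shows "trace (J y**riem \<Gamma> j k y) = trace (J y**riem \<Gamma>' j k y) + pd j (\<lambda>y. trace (J y**D k y)) y - pd k (\<lambda>y. trace (J y**D j y)) y"
proof -
 have d: "pd j (\<Gamma> k) y = pd j (\<Gamma>' k) y + pd j (D k) y" if "j \<in> I" "k \<in> I" for j k
  using pd_cong[OF U y that(1) \<Gamma>[OF that(2)]] pd_add[OF U \<Gamma>'[OF that(2)] D[OF that(2)] that(1) y] by simp
 have t: "pd j (\<lambda>y. trace (J y**D k y)) y = trace (J y**pd j (D k) y) + trace (J y**\<Gamma>' j y**D k y) - trace (\<Gamma>' j y**J y**D k y)"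
  if "j \<in> I" "k \<in> I" for j k
  using pd_trace[OF U smooth_mm[OF U J D[OF that(2)]] that(1) y] pd_mm[OF U J D[OF that(2)] that(1) y] par[OF that(1) y]
  by (simp add: trace_linear mm_ring)
 have c1: "trace (J y**(D a y**\<Gamma>' b y)) = trace (\<Gamma>' b y**(J y**D a y))" for a b
  using trace_mul_sym[of "J y**D a y" "\<Gamma>' b y"] by (simp add: mm_ring)
 have c2: "trace (J y**(D j y**D k y)) = trace (J y**(D k y**D j y))"
 proof -
  have "trace (J y**(D j y**D k y)) = trace (D j y**(J y**D k y))" using com[OF j y] by (simp add: matrix_mul_assoc)
  also have "\<dots> = trace (J y**D k y**D j y)" by (rule trace_mul_sym)
  finally show ?thesis by (simp add: mm_ring)
 qed
 show ?thesis unfolding riem_def d[OF j k] d[OF k j] \<Gamma>[OF j y] \<Gamma>[OF k y] t[OF j k] t[OF k j]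
  using c2 by (simp add: mm_ring trace_linear c1)
qed

text \<open>\<open>S\<close> is the range of momentum values on the principal part.
  \<open>indep\<close> says that the volume densities of the metrics \<open>\<gamma> t\<close> are
  proportional, and by \<open>trace_gb\<close> the factor is the product of the powers A_i^(d_i/2).
  With \<open>u_eq\<close>, u/h is the logarithmic derivative in x of h times this product.\<close>

locale ansatz_chart = kaehler_chart I U G J for I :: "'n::finite set" and U G J +
 fixes K :: "'k::finite set" and V :: "(real^'k) set" and gb :: "'m::finite \<Rightarrow> real^'k \<Rightarrow> real^'k^'k"
  and Jb :: "real^'k \<Rightarrow> real^'k^'k" and a b :: "real^'m" and x :: "real^'n \<Rightarrow> real" and \<theta> :: "real^'n \<Rightarrow> real^'n"
  and f :: "real^'n \<Rightarrow> real^'k" and h :: "real \<Rightarrow> real" and S :: "real set" and d :: "'m \<Rightarrow> real" and u :: "real \<Rightarrow> real" and \<gamma>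
 defines \<gamma>_def: "\<gamma> t z \<equiv> \<Sum>i\<in>UNIV. (b$i * t + a$i) *\<^sub>R gb i z"
 assumes base: "t \<in> S \<Longrightarrow> kaehler_chart K V (\<gamma> t) Jb"
  and smooth_gb: "smooth K V (gb i)" and V: "ropen K V"
  and smooth_x: "smooth I U x" and xU: "x ` U \<subseteq> S" and S: "open S" and smooth_h: "smooth1 S h" and h_pos: "t \<in> S \<Longrightarrow> h t > 0"
  and smooth_\<theta>: "smooth I U \<theta>" and smooth_f: "smooth I U f" and fU: "f ` U \<subseteq> V"
  and metric: "\<lbrakk>y \<in> U; v \<in> coord I; w \<in> coord I\<rbrakk> \<Longrightarrow> bil (G y) v w =
   (1 / h (x y)) * (\<Sum>i\<in>I. v$i * pd i x y) * (\<Sum>i\<in>I. w$i * pd i x y) + h (x y) * (\<theta> y \<bullet> v) * (\<theta> y \<bullet> w)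
   + bil (\<gamma> (x y) (f y)) (\<Sum>i\<in>I. v$i *\<^sub>R pd i f y) (\<Sum>i\<in>I. w$i *\<^sub>R pd i f y)"
  and J_theta: "y \<in> U \<Longrightarrow> v \<in> coord I \<Longrightarrow> \<theta> y \<bullet> (J y *v v) = (1 / h (x y)) * (\<Sum>i\<in>I. v$i * pd i x y)"
  and J_dx: "y \<in> U \<Longrightarrow> v \<in> coord I \<Longrightarrow> (\<Sum>i\<in>I. (J y *v v)$i * pd i x y) = - h (x y) * (\<theta> y \<bullet> v)"
  and J_df: "y \<in> U \<Longrightarrow> v \<in> coord I \<Longrightarrow> (\<Sum>i\<in>I. (J y *v v)$i *\<^sub>R pd i f y) = Jb (f y) *v (\<Sum>i\<in>I. v$i *\<^sub>R pd i f y)"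
  and d\<theta>: "\<lbrakk>y \<in> U; j \<in> I; k \<in> I\<rbrakk> \<Longrightarrow> pd j (\<lambda>z. \<theta> z$k) y - pd k (\<lambda>z. \<theta> z$j) y =
   (\<Sum>i\<in>UNIV. b$i * bil (transpose (Jb (f y))**gb i (f y)) (\<Sum>l\<in>I. axis j 1$l *\<^sub>R pd l f y) (\<Sum>l\<in>I. axis k 1$l *\<^sub>R pd l f y))"
  and card: "card I = card K + 2"
  and trace_gb: "z \<in> V \<Longrightarrow> t \<in> S \<Longrightarrow> trace (ginv K (\<gamma> t z)**(PI K**gb i z**PI K)) = d i / (b$i * t + a$i)"
  and indep: "\<lbrakk>z \<in> V; t \<in> S; s \<in> S; l \<in> K\<rbrakk> \<Longrightarrow>
    trace (ginv K (\<gamma> t z)**pd l (\<lambda>z. hat K (\<gamma> t z)) z) = trace (ginv K (\<gamma> s z)**pd l (\<lambda>z. hat K (\<gamma> s z)) z)"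
  and smooth_u: "smooth1 S u" and u_eq: "t \<in> S \<Longrightarrow> u t = deriv h t + h t * ((1/2) * (\<Sum>i\<in>UNIV. b$i * d i / (b$i * t + a$i)))"
begin

section \<open>The coframe dx/h, \<theta>, df and its dual frame\<close>

definition P where "P = jac I f"
definition X where "X y = (\<chi> i. if i \<in> I then pd i x y else 0)"
text \<open>The covectors dx/h (index \<open>True\<close>) and \<theta> (index
  \<open>False\<close>). With this scaling J acts on them by the constant matrix \<open>J0\<close>;
  with dx in place of dx/h its coefficients would vary with h.\<close>

definition \<Phi> :: "real^'n \<Rightarrow> real^'n ^ bool" where "\<Phi> y = (\<chi> s. if s then (1 / h (x y)) *\<^sub>R X y else PI I *v \<theta> y)"
definition J0 :: "real ^ bool ^ bool" where "J0 = (\<chi> s t. if s = t then 0 else if s then -1 else 1)"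
definition gh where "gh y = hat K (\<gamma> (x y) (f y))"
definition \<Psi> where "\<Psi> y = h (x y) *\<^sub>R (Hi y**transpose (\<Phi> y))"
definition \<Lambda> where "\<Lambda> y = Hi y**transpose (P y)**gh y"
text \<open>The curvature d\<theta> as a 2-form on the base; \<open>dth\<close> is its
  pullback.\<close>

definition W where "W y = (\<Sum>i\<in>UNIV. b$i *\<^sub>R (transpose (Jb (f y))**gb i (f y)))"

lemma x_S: "y \<in> U \<Longrightarrow> x y \<in> S" using xU by auto
lemma f_V: "y \<in> U \<Longrightarrow> f y \<in> V" using fU by auto
lemma hx: "y \<in> U \<Longrightarrow> h (x y) > 0" using h_pos x_S by auto

lemma f_coord: "f ` U \<subseteq> coord K" using fU openin_imp_subset[OF V] by blast

lemma smooth_hx: "smooth I U (\<lambda>y. h (x y))"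
 by (rule smooth_real_compose[OF U S smooth_x xU smooth_h])

lemma smooth_X: "smooth I U X"
 unfolding X_def
proof (rule smooth_vec_lambda[OF U])
 fix k show "smooth I U (\<lambda>y. if k \<in> I then pd k x y else 0)"
  by (cases "k \<in> I") (simp_all add: smooth_const[OF U] smooth_pd[OF smooth_x])
qed

lemma \<Phi>_nth: "\<Phi> y$True = (1 / h (x y)) *\<^sub>R X y" "\<Phi> y$False = PI I *v \<theta> y"
 by (simp_all add: \<Phi>_def)

lemma smooth_\<Phi>: "smooth I U \<Phi>"
proof -
 have "smooth I U (\<lambda>y. \<Phi> y$s)" for s
  by (cases s) (simp_all only: \<Phi>_nth smooth_scaleR[OF U smooth_divide[OF U smooth_const[OF U] smooth_hx] smooth_X]
    hx less_imp_neq[THEN not_sym] smooth_mv[OF U smooth_const[OF U] smooth_\<theta>] simp_thms)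
 then have "smooth I U (\<lambda>y. \<chi> s. \<Phi> y$s)" by (rule smooth_vec_lambda[OF U])
 then show ?thesis by simp
qed

lemma smooth_P: "smooth I U P"
 unfolding P_def by (rule smooth_jac[OF U smooth_f])

lemma blk_P: "y \<in> U \<Longrightarrow> blk K I (P y)"
 unfolding P_def by (rule blk_jac[OF U smooth_f f_coord])

lemma blk_\<Phi>: "blk UNIV I (\<Phi> y)"
 unfolding blk_def by (auto simp: \<Phi>_def X_def PI_mv_nth)

lemma smooth_gbf: "smooth I U (\<lambda>y. gb i (f y))"
 by (rule smooth_compose[OF U V fU smooth_f smooth_gb])

lemma smooth_Ax: "smooth I U (\<lambda>y. b$i * x y + a$i)"
 by (intro smooth_intros U smooth_x)

lemma smooth_gxf: "smooth I U (\<lambda>y. \<gamma> (x y) (f y))"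
 unfolding \<gamma>_def by (intro smooth_intros U smooth_Ax smooth_gbf)

lemma smooth_gh: "smooth I U gh"
 unfolding gh_def hat_PI by (intro smooth_intros U smooth_gxf)

lemma smooth_\<Psi>: "smooth I U \<Psi>"
 unfolding \<Psi>_def by (intro smooth_intros U smooth_hx smooth_Hi smooth_\<Phi>)

lemma smooth_\<Lambda>: "smooth I U \<Lambda>"
 unfolding \<Lambda>_def by (intro smooth_intros U smooth_Hi smooth_P smooth_gh)

lemma X_inner: "v \<in> coord I \<Longrightarrow> X y \<bullet> v = (\<Sum>i\<in>I. v$i * pd i x y)"
 unfolding inner_vec_def X_def by (rule sum.mono_neutral_cong_right) (auto simp: coord_def)

lemma P_mv: "v \<in> coord I \<Longrightarrow> P y *v v = (\<Sum>i\<in>I. v$i *\<^sub>R pd i f y)"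
 unfolding vec_eq_iff mv_nth sum_component P_def
 by (intro allI sum.mono_neutral_cong_right) (auto simp: coord_def jac_nth)

lemma PI_inner: "v \<in> coord I \<Longrightarrow> (PI I *v w) \<bullet> v = w \<bullet> v"
 using inner_mv[of w "PI I" v] by (simp add: PI_mv)

lemma P_axis: "j \<in> I \<Longrightarrow> P y *v axis j 1 = (\<Sum>l\<in>I. axis j 1$l *\<^sub>R pd l f y)"
 by (rule P_mv) simp

lemma \<Phi>_mv: "v \<in> coord I \<Longrightarrow> (\<Phi> y *v v)$True = (1 / h (x y)) * (\<Sum>i\<in>I. v$i * pd i x y)"
 "v \<in> coord I \<Longrightarrow> (\<Phi> y *v v)$False = \<theta> y \<bullet> v"
 using X_inner[of v y] PI_inner[of v "\<theta> y"] by (simp_all add: matrix_mult_dot \<Phi>_def)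

lemma J_coord: "y \<in> U \<Longrightarrow> J y *v v \<in> coord I"
 by (rule blk_mv_coord[OF blk_J])

lemma \<Phi>J: assumes y: "y \<in> U" shows "\<Phi> y**J y = J0**\<Phi> y"
proof (rule matrix_eq_coord)
 show "\<Phi> y**J y**PI I = \<Phi> y**J y" using blk_right[OF blk_J[OF y]] by (simp add: mm_ring)
 show "J0**\<Phi> y**PI I = J0**\<Phi> y" using blk_right[OF blk_\<Phi>] by (simp add: mm_ring)
 fix v :: "real^'n" assume v: "v \<in> coord I"
 have h: "h (x y) \<noteq> 0" using hx[OF y] by simp
 have "(\<Phi> y *v (J y *v v))$s = (J0 *v (\<Phi> y *v v))$s" for s
  unfolding mv_nth[of J0] sum_bool using h
  by (cases s) (simp_all add: \<Phi>_mv[OF v] \<Phi>_mv[OF J_coord[OF y]] J_theta[OF y v] J_dx[OF y v] J0_def)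
 then show "\<Phi> y**J y *v v = J0**\<Phi> y *v v" by (simp add: vec_eq_iff matrix_vector_mul_assoc[symmetric])
qed

lemma PJ: assumes y: "y \<in> U" shows "P y**J y = Jb (f y)**P y"
proof (rule matrix_eq_coord)
 show "P y**J y**PI I = P y**J y" using blk_right[OF blk_J[OF y]] by (simp add: mm_ring)
 show "Jb (f y)**P y**PI I = Jb (f y)**P y" using blk_right[OF blk_P[OF y]] by (simp add: mm_ring)
 fix v :: "real^'n" assume v: "v \<in> coord I"
 show "P y**J y *v v = Jb (f y)**P y *v v"
  using J_df[OF y v] by (simp add: P_mv[OF v] P_mv[OF J_coord[OF y]] matrix_vector_mul_assoc[symmetric])
qed

lemma PH: assumes y: "y \<in> U" shows "PI I**H y = h (x y) *\<^sub>R (transpose (\<Phi> y)**\<Phi> y) + transpose (P y)**gh y**P y" (is "?L = ?R")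
proof -
 have hnz: "h (x y) \<noteq> 0" using hx[OF y] by simp
 have "?L$i$j = ?R$i$j" for i j
 proof (cases "i \<in> I \<and> j \<in> I")
  case True
  then have c: "axis i 1 \<in> coord I" "axis j 1 \<in> coord I" by auto
  have Pc: "P y *v v \<in> coord K" for v by (rule blk_mv_coord[OF blk_P[OF y]])
  have T: "(transpose (\<Phi> y)**\<Phi> y)$i$j = (\<Phi> y *v axis i 1)$True * (\<Phi> y *v axis j 1)$True + (\<Phi> y *v axis i 1)$False * (\<Phi> y *v axis j 1)$False"
   by (simp add: mm_nth sum_bool transpose_def matrix_vector_mult_basis column_def)
  have "?L$i$j = bil (G y) (axis i 1) (axis j 1)" using True by (simp add: PI_mult hat_nth bil_axis)
  also have "\<dots> = h (x y) * (transpose (\<Phi> y)**\<Phi> y)$i$j + bil (\<gamma> (x y) (f y)) (P y *v axis i 1) (P y *v axis j 1)"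
   unfolding metric[OF y c] T \<Phi>_mv[OF c(1)] \<Phi>_mv[OF c(2)] P_mv[OF c(1)] P_mv[OF c(2)] using hnz by (simp add: field_simps)
  also have "bil (\<gamma> (x y) (f y)) (P y *v axis i 1) (P y *v axis j 1) = (transpose (P y)**gh y**P y)$i$j"
  proof -
   have "bil (\<gamma> (x y) (f y)) (P y *v axis i 1) (P y *v axis j 1) = bil (gh y) (P y *v axis i 1) (P y *v axis j 1)"
    unfolding gh_def by (rule bil_hat[OF Pc Pc, symmetric])
   then show ?thesis by (simp add: bil_congruence[symmetric] bil_axis)
  qed
  finally show ?thesis by simp
 next
  case False
  have "blk I I (transpose (P y)**(PI K**gh y)**P y)"
   unfolding gh_def by (intro blk_mm[OF blk_mm[OF blk_transpose[OF blk_P[OF y]] hat_blk(2)] blk_P[OF y]])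
  then have "blk I I (transpose (P y)**gh y**P y)"
   using blk_right[OF blk_transpose[OF blk_P[OF y]]] by (simp add: matrix_mul_assoc)
  then have "blk I I ?R" by (intro blk_add blk_scaleR blk_mm[OF blk_transpose[OF blk_\<Phi>] blk_\<Phi>])
  then show ?thesis using False hat_blk(2)[of I "G y"] unfolding blk_def by auto
 qed
 then show ?thesis by (simp add: vec_eq_iff)
qed

lemma blk_\<Psi>: assumes y: "y \<in> U" shows "blk I UNIV (\<Psi> y)"
proof -
 have "Hi y**transpose (\<Phi> y) = (PI I**Hi y)**transpose (\<Phi> y)"
  using blk_left[OF blk_transpose[OF blk_\<Phi>]] by (simp add: Hi_PI[OF y] mm_ring)
 then show ?thesis unfolding \<Psi>_def using blk_mm[OF blk_PI_Hi[OF y] blk_transpose[OF blk_\<Phi>]] blk_scaleR by metis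
qed

lemma blk_\<Lambda>: assumes y: "y \<in> U" shows "blk I K (\<Lambda> y)"
proof -
 have "Hi y**transpose (P y)**gh y = (PI I**Hi y)**transpose (P y)**(PI K**gh y)"
  using blk_left[OF blk_transpose[OF blk_P[OF y]]] blk_right[OF blk_transpose[OF blk_P[OF y]]]
  by (simp add: Hi_PI[OF y] matrix_mul_assoc) (simp add: matrix_mul_assoc[symmetric])
 then show ?thesis unfolding \<Lambda>_def gh_def
  using blk_mm[OF blk_mm[OF blk_PI_Hi[OF y] blk_transpose[OF blk_P[OF y]]] hat_blk(2)] by metis
qed

lemma one: assumes y: "y \<in> U" shows "\<Psi> y**\<Phi> y + \<Lambda> y**P y = PI I"
proof -
 have "\<Psi> y**\<Phi> y + \<Lambda> y**P y = Hi y**(PI I**H y)"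
  unfolding PH[OF y] \<Psi>_def \<Lambda>_def by (simp add: mm_ring)
 also have "\<dots> = PI I" by (simp add: matrix_mul_assoc Hi_PI[OF y, symmetric]) (simp add: matrix_mul_assoc[symmetric] Hi[OF y])
 finally show ?thesis .
qed

lemma dual: assumes y: "y \<in> U"
 shows "\<Phi> y**\<Psi> y = mat 1" "\<Phi> y**\<Lambda> y = 0" "P y**\<Psi> y = 0" "P y**\<Lambda> y = PI K"
 using dual_frame[OF blk_\<Phi> blk_P[OF y] blk_\<Psi>[OF y] blk_\<Lambda>[OF y] one[OF y]] card by simp_all

lemma dual': assumes y: "y \<in> U"
 shows "\<Phi> y**(\<Psi> y**A) = A" "\<Phi> y**(\<Lambda> y**B) = 0" "P y**(\<Psi> y**A) = 0" "P y**(\<Lambda> y**B) = PI K**B"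
 by (simp_all only: matrix_mul_assoc dual[OF y] matrix_mul_lid) (simp_all add: mm_ring)

lemma PI_decomp: assumes y: "y \<in> U" and "PI I**A = A"
 shows "A = \<Psi> y**(\<Phi> y**A) + \<Lambda> y**(P y**A)"
 using assms(2) unfolding one[OF y, symmetric] by (simp add: mm_ring)

lemma Bm: "t \<in> S \<Longrightarrow> metric_chart K V (\<gamma> t)"
 using base kaehler_chart.axioms(1) by blast

section \<open>The frame connection and its difference from the Levi-Civita connection\<close>

definition om where "om t = metric_chart.pb K (\<gamma> t) I f"
text \<open>The connection that makes both covectors in \<open>\<Phi>\<close> parallel and
  \<open>P\<close> parallel with respect to \<open>om\<close>. The base metric is frozen at a value
  \<open>t\<close>: then \<open>om\<close> is the pullback of a single connection and its curvature
  is pulled back from the base.\<close>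

definition Gp where "Gp t j y = \<Psi> y**pd j \<Phi> y + \<Lambda> y**(pd j P y + om t j y**P y)"

context
 fixes t assumes t: "t \<in> S"
begin

interpretation B: kaehler_chart K V "\<gamma> t" Jb by (rule base[OF t])

lemma smooth_om: "j \<in> I \<Longrightarrow> smooth I U (om t j)"
 unfolding om_def by (rule B.smooth_pb[OF U smooth_f fU])

lemma blk_om: "blk K K (om t j y)"
 unfolding om_def by (rule B.blk_pb[OF U smooth_f fU])

lemma smooth_Gp: "j \<in> I \<Longrightarrow> smooth I U (Gp t j)"
 unfolding Gp_def by (intro smooth_intros U smooth_\<Psi> smooth_\<Lambda> smooth_pd[OF smooth_\<Phi>] smooth_pd[OF smooth_P] smooth_om smooth_P)

lemma blk_pdP: "y \<in> U \<Longrightarrow> j \<in> I \<Longrightarrow> blk K I (pd j P y)"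
 by (rule pd_blk[OF U blk_P smooth_P])

lemma blk_pd\<Phi>: "y \<in> U \<Longrightarrow> j \<in> I \<Longrightarrow> blk UNIV I (pd j \<Phi> y)"
 by (rule pd_blk[OF U blk_\<Phi> smooth_\<Phi>])

lemma blk_Gp: "y \<in> U \<Longrightarrow> j \<in> I \<Longrightarrow> blk I I (Gp t j y)"
 unfolding Gp_def by (intro blk_add blk_mm[OF blk_\<Psi> blk_pd\<Phi>] blk_mm[OF blk_\<Lambda> blk_add[OF blk_pdP blk_mm[OF blk_om blk_P]]])

lemma par_\<Phi>: assumes "j \<in> I" "y \<in> U" shows "pd j \<Phi> y = \<Phi> y**Gp t j y"
 unfolding Gp_def by (simp add: mm_ring dual'[OF assms(2)])

lemma par_P: assumes "j \<in> I" "y \<in> U" shows "pd j P y = P y**Gp t j y - om t j y**P y"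
proof -
 have "P y**Gp t j y = PI K**pd j P y + PI K**om t j y**P y"
  unfolding Gp_def by (simp add: mm_ring dual'[OF assms(2)])
 then show ?thesis using blk_left[OF blk_pdP[OF assms(2,1)]] blk_left[OF blk_om] by simp
qed

lemma smooth_Jbf: "smooth I U (\<lambda>y. Jb (f y))"
 by (rule smooth_compose[OF U V fU smooth_f B.smooth_J])

lemma pd_Jbf: assumes j: "j \<in> I" and y: "y \<in> U"
 shows "pd j (\<lambda>y. Jb (f y)) y = Jb (f y)**om t j y - om t j y**Jb (f y)"
proof -
 have "pd j (\<lambda>y. Jb (f y)) y = (\<Sum>k\<in>K. pd j f y$k *\<^sub>R pd k Jb (f y))"
  by (rule pd_compose[OF U V fU smooth_f B.smooth_J j y])
 also have "\<dots> = (\<Sum>k\<in>K. pd j f y$k *\<^sub>R (Jb (f y)**Gam K (\<gamma> t) k (f y) - Gam K (\<gamma> t) k (f y)**Jb (f y)))"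
  by (intro sum.cong refl) (simp add: B.nabla_J[OF f_V[OF y]])
 finally show ?thesis
  by (simp add: om_def B.pb_def mm_sum_left mm_sum_right mm_ring sum_subtractf scaleR_diff_right)
qed

text \<open>In the frame J consists of the constant \<open>J0\<close> and of the pullback of
  \<open>Jb\<close>, and both are parallel. So the defect \<open>E\<close> is killed by
  \<open>\<Phi>\<close> and by \<open>P\<close>, hence zero.\<close>

lemma par_J: assumes j: "j \<in> I" and y: "y \<in> U" shows "pd j J y = J y**Gp t j y - Gp t j y**J y"
proof -
 define E where "E = pd j J y + Gp t j y**J y - J y**Gp t j y"
 have c0: "pd j (\<lambda>y. J0 :: real^bool^bool) y = 0" by (rule pds_pd[OF pds_const])
 have "pd j (\<lambda>y. \<Phi> y**J y) y = pd j (\<lambda>y. J0**\<Phi> y) y" by (rule pd_cong[OF U y j \<Phi>J])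
 then have e1: "\<Phi> y**pd j J y + pd j \<Phi> y**J y = J0**pd j \<Phi> y"
  using pd_mm[OF U smooth_\<Phi> smooth_J j y] pd_mm[OF U smooth_const[OF U] smooth_\<Phi> j y, of J0] by (simp add: c0 mm_ring)
 have "pd j (\<lambda>y. P y**J y) y = pd j (\<lambda>y. Jb (f y)**P y) y" by (rule pd_cong[OF U y j PJ])
 then have e2: "P y**pd j J y + pd j P y**J y = Jb (f y)**pd j P y + (Jb (f y)**om t j y - om t j y**Jb (f y))**P y"
  using pd_mm[OF U smooth_P smooth_J j y] pd_mm[OF U smooth_Jbf smooth_P j y] pd_Jbf[OF j y] by simp
 have "\<Phi> y**E = \<Phi> y**pd j J y + (\<Phi> y**Gp t j y)**J y - (\<Phi> y**J y)**Gp t j y"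
  unfolding E_def by (simp add: mm_ring)
 also have "\<dots> = \<Phi> y**pd j J y + pd j \<Phi> y**J y - J0**pd j \<Phi> y"
  unfolding \<Phi>J[OF y] par_\<Phi>[OF j y] by (simp add: mm_ring)
 finally have E1: "\<Phi> y**E = 0" using e1 by simp
 have PG: "P y**Gp t j y = pd j P y + om t j y**P y" using par_P[OF j y] by simp
 have "P y**E = P y**pd j J y + (P y**Gp t j y)**J y - (P y**J y)**Gp t j y"
  unfolding E_def by (simp add: mm_ring)
 also have "\<dots> = P y**pd j J y + (pd j P y + om t j y**P y)**J y - Jb (f y)**(pd j P y + om t j y**P y)"
  unfolding PJ[OF y] PG[symmetric] by (simp add: mm_ring)
 also have "\<dots> = (P y**pd j J y + pd j P y**J y) + om t j y**(P y**J y) - Jb (f y)**(pd j P y + om t j y**P y)"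
  by (simp add: mm_ring)
 also have "\<dots> = 0" unfolding e2 PJ[OF y] by (simp add: mm_ring)
 finally have E2: "P y**E = 0" .
 have "blk I I E" unfolding E_def
  by (intro blk_add blk_diff blk_mm[OF blk_Gp blk_J] blk_mm[OF blk_J blk_Gp] pd_blk[OF U blk_J smooth_J] j y)
 then have "E = 0" using PI_decomp[OF y blk_left, of I E] E1 E2 by (simp add: mm_ring)
 then show ?thesis unfolding E_def by (simp add: algebra_simps)
qed

definition DD where "DD j y = \<Gamma> j y - Gp t j y"

lemma smooth_DD: "j \<in> I \<Longrightarrow> smooth I U (DD j)"
 unfolding DD_def by (intro smooth_intros U smooth_Gam smooth_Gp)

lemma blk_DD: "y \<in> U \<Longrightarrow> j \<in> I \<Longrightarrow> blk I I (DD j y)"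
 unfolding DD_def by (intro blk_diff blk_Gam blk_Gp)

lemma J_DD: assumes j: "j \<in> I" and y: "y \<in> U" shows "J y**DD j y = DD j y**J y"
proof -
 have "J y**\<Gamma> j y - \<Gamma> j y**J y = J y**Gp t j y - Gp t j y**J y" using par_J[OF j y] nabla_J[OF y j] by simp
 then show ?thesis unfolding DD_def by (simp add: mm_ring algebra_simps)
qed

definition dth where "dth y = transpose (P y)**W y**P y"

lemma dth_nth: assumes y: "y \<in> U" and jk: "j \<in> I" "k \<in> I"
 shows "pd j (\<lambda>z. \<theta> z$k) y - pd k (\<lambda>z. \<theta> z$j) y = dth y$j$k"
proof -
 have "dth y$j$k = bil (W y) (P y *v axis j 1) (P y *v axis k 1)"
  by (simp add: dth_def bil_congruence[symmetric] bil_axis)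
 also have "\<dots> = (\<Sum>i\<in>UNIV. b$i * bil (transpose (Jb (f y))**gb i (f y)) (P y *v axis j 1) (P y *v axis k 1))"
  unfolding W_def bil_def
  by (simp add: bounded_bilinear.sum_left[OF bounded_bilinear_mv] bounded_bilinear.scaleR_left[OF bounded_bilinear_mv] inner_sum_right)
 finally show ?thesis unfolding d\<theta>[OF y jk] P_axis[OF jk(1)] P_axis[OF jk(2)] by simp
qed

lemma pd_\<Phi>_antisym: assumes y: "y \<in> U" and jk: "j \<in> I" "k \<in> I"
 shows "pd j \<Phi> y$True$k = pd k \<Phi> y$True$j" "pd j \<Phi> y$False$k - pd k \<Phi> y$False$j = dth y$j$k"
proof -
 have hi: "smooth I U (\<lambda>y. 1 / h (x y))" by (rule smooth_divide[OF U smooth_const[OF U] smooth_hx]) (use hx in force)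
 have hv: "1 / h (x y) = (\<lambda>y. inverse (h (x y))) y" for y by (simp add: inverse_eq_divide)
 have e1: "pd j \<Phi> y$True$k = (1 / h (x y)) * pd j (pd k x) y + pd j (\<lambda>y. 1 / h (x y)) y * pd k x y" if jk: "j \<in> I" "k \<in> I" for j k
 proof -
  have "pd j \<Phi> y$True$k = pd j (\<lambda>z. \<Phi> z$True$k) y" by (rule pd_nth2[OF U smooth_\<Phi> jk(1) y, symmetric])
  also have "\<dots> = pd j (\<lambda>z. (1 / h (x z)) * pd k x z) y" using jk by (simp add: \<Phi>_nth X_def)
  finally show ?thesis using pd_mult[OF U hi smooth_pd[OF smooth_x jk(2)] jk(1) y] by simp
 qed
 have e2: "pd j (\<lambda>y. 1 / h (x y)) y = - deriv h (x y) / (h (x y) * h (x y)) * pd j x y" if j: "j \<in> I" for j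
 proof -
  have "pd j (\<lambda>y. h (x y) * (1 / h (x y))) y = pd j (\<lambda>y. 1) y"
   by (rule pd_cong[OF U y j]) (use hx in force)
  then have "h (x y) * pd j (\<lambda>y. 1 / h (x y)) y + pd j (\<lambda>y. h (x y)) y * (1 / h (x y)) = 0"
   using pd_mult[OF U smooth_hx hi j y] by (simp add: pds_pd[OF pds_const])
  then show ?thesis unfolding pd_real_compose[OF U S smooth_x xU smooth_h j y] using hx[OF y]
   by (simp add: field_simps)
 qed
 show "pd j \<Phi> y$True$k = pd k \<Phi> y$True$j"
  unfolding e1[OF jk] e1[OF jk(2,1)] e2[OF jk(1)] e2[OF jk(2)] using smooth_pd_commute[OF U smooth_x jk y] by simp
 have e3: "pd j \<Phi> y$False$k = pd j (\<lambda>z. \<theta> z$k) y" if jk: "j \<in> I" "k \<in> I" for j k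
 proof -
  have "pd j \<Phi> y$False$k = pd j (\<lambda>z. \<Phi> z$False$k) y" by (rule pd_nth2[OF U smooth_\<Phi> jk(1) y, symmetric])
  then show ?thesis using jk by (simp add: \<Phi>_nth PI_mv_nth)
 qed
 show "pd j \<Phi> y$False$k - pd k \<Phi> y$False$j = dth y$j$k"
  unfolding e3[OF jk] e3[OF jk(2,1)] dth_nth[OF y jk] ..
qed

text \<open>dx/h is closed and the connection of the base is torsion-free, so only d\<theta>
  contributes, in the direction dual to \<theta>.\<close>

lemma torsion: assumes y: "y \<in> U" and jk: "j \<in> I" "k \<in> I"
 shows "DD j y$c$k - DD k y$c$j = - (\<Psi> y$c$False * dth y$j$k)"
proof -
 have "(pd j P y + om t j y**P y)$e$k = (pd k P y + om t k y**P y)$e$j" for e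
  unfolding P_def om_def using pd_jac_sym[OF U smooth_f y jk] B.pb_jac_sym[OF U smooth_f fU y jk] by simp
 then have "(\<Lambda> y**(pd j P y + om t j y**P y))$c$k = (\<Lambda> y**(pd k P y + om t k y**P y))$c$j"
  unfolding mm_nth[of "\<Lambda> y"] by simp
 moreover have "(\<Psi> y**pd j \<Phi> y)$c$k - (\<Psi> y**pd k \<Phi> y)$c$j = \<Psi> y$c$False * dth y$j$k"
  using pd_\<Phi>_antisym[OF y jk] by (simp add: mm_nth sum_bool algebra_simps)
 ultimately show ?thesis unfolding DD_def Gp_def using Gam_sym[OF y, of j c k] by simp
qed

lemma blk_dth: "y \<in> U \<Longrightarrow> blk I I (dth y)"
 unfolding dth_def blk_PI using blk_right[OF blk_P] blk_left[OF blk_transpose[OF blk_P]] by (simp add: mm_ring) (simp add: matrix_mul_assoc)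

text \<open>\<open>dth\<close> is pulled back from the base, and J preserves the kernel of
  \<open>P\<close>, where the columns of \<open>\<Psi>\<close> lie. Both torsion contractions
  demanded by \<open>trace_J_torsion\<close> therefore vanish.\<close>

lemma trace_J_DD: assumes y: "y \<in> U" and k: "k \<in> I"
 shows "trace (J y**DD k y) = (\<Sum>l\<in>I. J y$l$k * trace (DD l y))"
proof (rule trace_J_torsion[OF blk_J[OF y] blk_DD[OF y] J_DD[OF _ y] torsion[OF y] _ _ k])
 have sI: "(\<Sum>i\<in>UNIV. \<Sum>l\<in>UNIV. F i l) = (\<Sum>i\<in>I. \<Sum>l\<in>I. F i l)" if "\<And>i l. i \<notin> I \<or> l \<notin> I \<Longrightarrow> F i l = 0" for F :: "'n \<Rightarrow> 'n \<Rightarrow> real"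
  using that by (subst sum_blk[of I]) (auto intro!: sum.cong sum_blk sum.neutral)
 have bl: "dth y$i$j = 0" if "i \<notin> I \<or> j \<notin> I" for i j using blk_dth[OF y] that by (auto simp: blk_def)
 have bJ: "J y$i$j = 0" if "i \<notin> I \<or> j \<notin> I" for i j using blk_J[OF y] that by (auto simp: blk_def)
 fix k assume "k \<in> I"
 have "dth y**(J y**\<Psi> y) = transpose (P y)**W y**Jb (f y)**(P y**\<Psi> y)"
  using PJ[OF y] by (simp add: dth_def matrix_mul_assoc) (metis matrix_mul_assoc)
 then have "dth y**(J y**\<Psi> y) = 0" by (simp add: dual[OF y] mm_ring)
 then have "(\<Sum>i\<in>UNIV. dth y$k$i * (\<Sum>l\<in>UNIV. J y$i$l * \<Psi> y$l$False)) = 0"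
  unfolding mm_nth[symmetric] by simp
 then have "(\<Sum>i\<in>UNIV. \<Sum>l\<in>UNIV. J y$i$l * - (\<Psi> y$l$False * dth y$k$i)) = 0"
  by (simp add: sum_distrib_left sum_negf mult_ac)
 then show "(\<Sum>i\<in>I. \<Sum>l\<in>I. J y$i$l * - (\<Psi> y$l$False * dth y$k$i)) = 0"
  by (subst (asm) sI) (auto simp: bJ)
 have "transpose (\<Psi> y)**dth y**J y = transpose (P y**\<Psi> y)**W y**P y**J y"
  by (simp add: dth_def matrix_transpose_mul matrix_mul_assoc)
 then have "transpose (\<Psi> y)**dth y**J y = 0" by (simp add: dual[OF y] mm_ring transpose_def) (simp add: vec_eq_iff mm_nth)
 then have "(\<Sum>l\<in>UNIV. (\<Sum>i\<in>UNIV. transpose (\<Psi> y)$False$i * dth y$i$l) * J y$l$k) = 0"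
  unfolding mm_nth[symmetric] by simp
 then have "(\<Sum>l\<in>UNIV. \<Sum>i\<in>UNIV. - (\<Psi> y$i$False * dth y$i$l) * J y$l$k) = 0"
  by (simp add: sum_distrib_right sum_negf transpose_def)
 then have "(\<Sum>i\<in>UNIV. \<Sum>l\<in>UNIV. - (\<Psi> y$i$False * dth y$i$l) * J y$l$k) = 0"
  by (subst sum.swap)
 then show "(\<Sum>i\<in>I. \<Sum>l\<in>I. - (\<Psi> y$i$False * dth y$i$l) * J y$l$k) = 0"
  by (subst (asm) sI) (auto simp: bl)
qed

lemma pd_gxf: assumes y: "y \<in> U" and j: "j \<in> I"
 shows "pd j (\<lambda>y. \<gamma> (x y) (f y)) y = (\<Sum>i\<in>UNIV. (b$i * pd j x y) *\<^sub>R gb i (f y)) + (\<Sum>k\<in>K. pd j f y$k *\<^sub>R pd k (\<gamma> (x y)) (f y))"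
proof -
 have s: "smooth I U (\<lambda>y. b$i * x y)" for i by (intro smooth_intros U smooth_x)
 have A: "pd j (\<lambda>y. b$i * x y + a$i) y = b$i * pd j x y" for i
  using pd_add[OF U s[of i] smooth_const[OF U] j y, of "a$i"] pd_mult[OF U smooth_const[OF U] smooth_x j y, of "b$i"]
  by (simp add: pds_pd[OF pds_const])
 have G: "pd k (\<gamma> t) z = (\<Sum>i\<in>UNIV. (b$i * t + a$i) *\<^sub>R pd k (gb i) z)" if "k \<in> K" "z \<in> V" for k t z
 proof -
  have "pd k (\<gamma> t) z = (\<Sum>i\<in>UNIV. pd k (\<lambda>z. (b$i * t + a$i) *\<^sub>R gb i z) z)"
   unfolding \<gamma>_def by (rule pd_sum[OF V smooth_scaleR[OF V smooth_const[OF V] smooth_gb] that])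
  then show ?thesis using pd_scaleR[OF V smooth_const[OF V] smooth_gb that] by (simp add: pds_pd[OF pds_const])
 qed
 have "pd j (\<lambda>y. \<gamma> (x y) (f y)) y = (\<Sum>i\<in>UNIV. pd j (\<lambda>y. (b$i * x y + a$i) *\<^sub>R gb i (f y)) y)"
  unfolding \<gamma>_def by (rule pd_sum[OF U smooth_scaleR[OF U smooth_Ax smooth_gbf] j y])
 also have "\<dots> = (\<Sum>i\<in>UNIV. (b$i * x y + a$i) *\<^sub>R (\<Sum>k\<in>K. pd j f y$k *\<^sub>R pd k (gb i) (f y)) + (b$i * pd j x y) *\<^sub>R gb i (f y))"
  using pd_scaleR[OF U smooth_Ax smooth_gbf j y] by (simp add: A pd_compose[OF U V fU smooth_f smooth_gb j y])
 also have "(\<Sum>i\<in>UNIV. (b$i * x y + a$i) *\<^sub>R (\<Sum>k\<in>K. pd j f y$k *\<^sub>R pd k (gb i) (f y)) + (b$i * pd j x y) *\<^sub>R gb i (f y))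
   = (\<Sum>i\<in>UNIV. \<Sum>k\<in>K. pd j f y$k *\<^sub>R (b$i * x y + a$i) *\<^sub>R pd k (gb i) (f y)) + (\<Sum>i\<in>UNIV. (b$i * pd j x y) *\<^sub>R gb i (f y))"
  by (simp add: sum.distrib scaleR_sum_right mult.commute)
 also have "(\<Sum>i\<in>UNIV. \<Sum>k\<in>K. pd j f y$k *\<^sub>R (b$i * x y + a$i) *\<^sub>R pd k (gb i) (f y)) = (\<Sum>k\<in>K. pd j f y$k *\<^sub>R pd k (\<gamma> (x y)) (f y))"
  by (subst sum.swap) (simp add: G f_V[OF y] scaleR_sum_right)
 finally show ?thesis by simp
qed

lemma trace_gh: assumes y: "y \<in> U" and j: "j \<in> I"
 shows "trace (ginv K (\<gamma> (x y) (f y))**pd j gh y) = pd j x y * (\<Sum>i\<in>UNIV. b$i * d i / (b$i * x y + a$i)) + 2 * trace (om t j y)"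
proof -
 let ?gi = "ginv K (\<gamma> (x y) (f y))"
 have z: "pd j (\<lambda>y. c) y = 0" for c :: "real^'k^'k" by (rule pds_pd[OF pds_const])
 have s1: "smooth I U (\<lambda>y. PI K**\<gamma> (x y) (f y))" by (rule smooth_mm[OF U smooth_const[OF U] smooth_gxf])
 have "pd j gh y = PI K**pd j (\<lambda>y. \<gamma> (x y) (f y)) y**PI K"
  unfolding gh_def hat_PI
  using pd_add[OF U smooth_mm[OF U s1 smooth_const[OF U]] smooth_const[OF U] j y, of "PI K" "mat 1 - PI K"]
   pd_mm[OF U s1 smooth_const[OF U] j y, of "PI K"] pd_mm[OF U smooth_const[OF U] smooth_gxf j y, of "PI K"]
  by (simp add: z mm_ring)
 also have "\<dots> = (\<Sum>i\<in>UNIV. (b$i * pd j x y) *\<^sub>R (PI K**gb i (f y)**PI K)) + (\<Sum>k\<in>K. pd j f y$k *\<^sub>R (PI K**pd k (\<gamma> (x y)) (f y)**PI K))"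
  unfolding pd_gxf[OF y j] by (simp add: mm_ring mm_sum_left mm_sum_right)
 also have "(\<Sum>k\<in>K. pd j f y$k *\<^sub>R (PI K**pd k (\<gamma> (x y)) (f y)**PI K)) = (\<Sum>k\<in>K. pd j f y$k *\<^sub>R pd k (\<lambda>z. hat K (\<gamma> (x y) z)) (f y))"
  using metric_chart.pd_H[OF Bm[OF x_S[OF y]] f_V[OF y]] by simp
 finally have "trace (?gi**pd j gh y) = (\<Sum>i\<in>UNIV. (b$i * pd j x y) * trace (?gi**(PI K**gb i (f y)**PI K)))
   + (\<Sum>k\<in>K. pd j f y$k * trace (?gi**pd k (\<lambda>z. hat K (\<gamma> (x y) z)) (f y)))"
  by (simp add: mm_ring mm_sum_right trace_linear)
 also have "(\<Sum>i\<in>UNIV. (b$i * pd j x y) * trace (?gi**(PI K**gb i (f y)**PI K))) = pd j x y * (\<Sum>i\<in>UNIV. b$i * d i / (b$i * x y + a$i))"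
  by (simp add: trace_gb[OF f_V[OF y] x_S[OF y]] sum_distrib_left mult_ac)
 also have "(\<Sum>k\<in>K. pd j f y$k * trace (?gi**pd k (\<lambda>z. hat K (\<gamma> (x y) z)) (f y))) = (\<Sum>k\<in>K. pd j f y$k * (2 * trace (Gam K (\<gamma> t) k (f y))))"
  by (intro sum.cong refl) (simp add: indep[OF f_V[OF y] x_S[OF y] t] B.trace_Gam[OF f_V[OF y]])
 also have "\<dots> = 2 * trace (om t j y)" by (simp add: om_def B.pb_def trace_linear sum_distrib_left mult_ac)
 finally show ?thesis .
qed

text \<open>The derivatives of \<open>\<Phi>\<close> and \<open>P\<close> and the trace of
  \<open>om\<close> occur in both connections and cancel. There remains the logarithmic derivative
  in x of h times the volume density of the base, which is u/h.\<close>

lemma trace_DD: assumes y: "y \<in> U" and j: "j \<in> I" shows "trace (DD j y) = u (x y) * \<Phi> y$True$j"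
proof -
 let ?gi = "ginv K (\<gamma> (x y) (f y))"
 interpret C: metric_chart K V "\<gamma> (x y)" by (rule Bm[OF x_S[OF y]])
 have hnz: "h (x y) \<noteq> 0" using hx[OF y] by simp
 have ghs: "transpose (gh y) = gh y" unfolding gh_def by (rule C.sym_H[OF f_V[OF y]])
 have ghi: "gh y**?gi = mat 1" unfolding gh_def by (rule C.Hi[OF f_V[OF y]])
 have st: "smooth I U (\<lambda>y. transpose (\<Phi> y))" by (rule smooth_transpose[OF U smooth_\<Phi>])
 have stt: "smooth I U (\<lambda>y. transpose (\<Phi> y)**\<Phi> y)" by (rule smooth_mm[OF U st smooth_\<Phi>])
 have sp: "smooth I U (\<lambda>y. transpose (P y))" by (rule smooth_transpose[OF U smooth_P])
 have spg: "smooth I U (\<lambda>y. transpose (P y)**gh y)" by (rule smooth_mm[OF U sp smooth_gh])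
 have "pd j H y = PI I**pd j H y" unfolding pd_H[OF y j] by (simp add: matrix_mul_assoc)
 also have "\<dots> = pd j (\<lambda>y. PI I**H y) y"
  using pd_mm[OF U smooth_const[OF U] smooth_H j y, of "PI I"] by (simp add: pds_pd[OF pds_const] mm_ring)
 also have "\<dots> = pd j (\<lambda>y. h (x y) *\<^sub>R (transpose (\<Phi> y)**\<Phi> y) + transpose (P y)**gh y**P y) y"
  by (rule pd_cong[OF U y j PH])
 also have "\<dots> = h (x y) *\<^sub>R (transpose (\<Phi> y)**pd j \<Phi> y + transpose (pd j \<Phi> y)**\<Phi> y) + (deriv h (x y) * pd j x y) *\<^sub>R (transpose (\<Phi> y)**\<Phi> y)
   + (transpose (P y)**gh y**pd j P y + (transpose (P y)**pd j gh y + transpose (pd j P y)**gh y)**P y)"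
  using pd_add[OF U smooth_scaleR[OF U smooth_hx stt] smooth_mm[OF U spg smooth_P] j y]
   pd_scaleR[OF U smooth_hx stt j y] pd_mm[OF U st smooth_\<Phi> j y] pd_transpose[OF U smooth_\<Phi> j y]
   pd_real_compose[OF U S smooth_x xU smooth_h j y] pd_mm[OF U spg smooth_P j y] pd_mm[OF U sp smooth_gh j y]
   pd_transpose[OF U smooth_P j y] by simp
 finally have dH: "pd j H y = h (x y) *\<^sub>R (transpose (\<Phi> y)**pd j \<Phi> y + transpose (pd j \<Phi> y)**\<Phi> y) + (deriv h (x y) * pd j x y) *\<^sub>R (transpose (\<Phi> y)**\<Phi> y)
   + (transpose (P y)**gh y**pd j P y + (transpose (P y)**pd j gh y + transpose (pd j P y)**gh y)**P y)" .
 have sw: "trace (Hi y**transpose A) = trace (A**Hi y)" for A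
  using trace_transpose[of "A**Hi y"] by (simp add: matrix_transpose_mul sym_Hi[OF y])
 have p1: "h (x y) * trace (Hi y**(transpose (\<Phi> y)**pd j \<Phi> y)) = trace (\<Psi> y**pd j \<Phi> y)"
  by (simp add: \<Psi>_def mm_ring trace_linear)
 have p2: "h (x y) * trace (Hi y**(transpose (pd j \<Phi> y)**\<Phi> y)) = trace (\<Psi> y**pd j \<Phi> y)"
  unfolding p1[symmetric] using sw[of "transpose (\<Phi> y)**pd j \<Phi> y"] trace_mul_sym[of "transpose (\<Phi> y)**pd j \<Phi> y" "Hi y"]
  by (simp add: matrix_transpose_mul)
 have p3: "h (x y) * trace (Hi y**(transpose (\<Phi> y)**\<Phi> y)) = 2"
 proof -
  have "h (x y) * trace (Hi y**(transpose (\<Phi> y)**\<Phi> y)) = trace (\<Psi> y**\<Phi> y)" by (simp add: \<Psi>_def mm_ring trace_linear)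
  also have "\<dots> = trace (\<Phi> y**\<Psi> y)" by (rule trace_mul_sym)
  finally show ?thesis by (simp add: dual[OF y] trace_I)
 qed
 have p4: "trace (Hi y**(transpose (P y)**gh y**pd j P y)) = trace (\<Lambda> y**pd j P y)"
  by (simp add: \<Lambda>_def mm_ring)
 have p5: "trace (Hi y**(transpose (pd j P y)**gh y**P y)) = trace (\<Lambda> y**pd j P y)"
  unfolding p4[symmetric] using sw[of "transpose (P y)**gh y**pd j P y"] trace_mul_sym[of "transpose (P y)**gh y**pd j P y" "Hi y"]
  by (simp add: matrix_transpose_mul ghs mm_ring)
 have bgh: "PI K**pd j gh y = pd j gh y"
 proof -
  have "pd j gh y = pd j (\<lambda>y. PI K**gh y + (mat 1 - PI K)) y"
  proof -
   have "PI K**(PI K**A) = PI K**A" for A :: "real^'k^'k" by (simp only: matrix_mul_assoc PI_PI)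
   then have "gh y = PI K**gh y + (mat 1 - PI K)" for y by (simp add: gh_def hat_PI mm_ring)
   then show ?thesis by metis
  qed
  also have "\<dots> = PI K**pd j gh y"
   using pd_add[OF U smooth_mm[OF U smooth_const[OF U] smooth_gh] smooth_const[OF U] j y, of "PI K" "mat 1 - PI K"]
    pd_mm[OF U smooth_const[OF U] smooth_gh j y, of "PI K"] by (simp add: pds_pd[OF pds_const] mm_ring)
  finally show ?thesis by simp
 qed
 have p6: "trace (Hi y**(transpose (P y)**pd j gh y**P y)) = trace (?gi**pd j gh y)"
 proof -
  have "Hi y**transpose (P y) = \<Lambda> y**?gi" unfolding \<Lambda>_def by (simp add: mm_ring ghi)
  then have "Hi y**(transpose (P y)**pd j gh y**P y) = \<Lambda> y**(?gi**pd j gh y**P y)"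
   by (simp add: matrix_mul_assoc)
  then have "trace (Hi y**(transpose (P y)**pd j gh y**P y)) = trace (?gi**pd j gh y**P y**\<Lambda> y)"
   using trace_mul_sym[of "\<Lambda> y"] by simp
  also have "\<dots> = trace (?gi**pd j gh y**PI K)" by (simp add: dual[OF y] mm_ring)
  also have "\<dots> = trace ((PI K**?gi)**pd j gh y)" by (subst trace_mul_sym) (simp add: mm_ring)
  also have "\<dots> = trace (?gi**(PI K**pd j gh y))" by (simp add: C.Hi_PI[OF f_V[OF y]] mm_ring)
  finally show ?thesis by (simp add: bgh)
 qed
 have "2 * trace (\<Gamma> j y) = trace (Hi y**pd j H y)" by (rule trace_Gam[OF y j, symmetric])
 also have "\<dots> = h (x y) * trace (Hi y**(transpose (\<Phi> y)**pd j \<Phi> y)) + h (x y) * trace (Hi y**(transpose (pd j \<Phi> y)**\<Phi> y))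
   + (deriv h (x y) * pd j x y) * trace (Hi y**(transpose (\<Phi> y)**\<Phi> y)) + trace (Hi y**(transpose (P y)**gh y**pd j P y))
   + trace (Hi y**(transpose (P y)**pd j gh y**P y)) + trace (Hi y**(transpose (pd j P y)**gh y**P y))"
  unfolding dH by (simp add: mm_ring trace_linear scaleR_add_right distrib_left)
 also have "\<dots> = 2 * trace (\<Psi> y**pd j \<Phi> y) + 2 * trace (\<Lambda> y**pd j P y) + 2 * trace (om t j y)
   + (deriv h (x y) * pd j x y) * (2 / h (x y)) + pd j x y * (\<Sum>i\<in>UNIV. b$i * d i / (b$i * x y + a$i))"
  unfolding p1 p2 p4 p5 p6 trace_gh[OF y j] using p3 hnz by (simp add: field_simps)
 finally have tG: "2 * trace (\<Gamma> j y) = 2 * trace (\<Psi> y**pd j \<Phi> y) + 2 * trace (\<Lambda> y**pd j P y) + 2 * trace (om t j y)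
   + (deriv h (x y) * pd j x y) * (2 / h (x y)) + pd j x y * (\<Sum>i\<in>UNIV. b$i * d i / (b$i * x y + a$i))" .
 have "trace (\<Lambda> y**(om t j y**P y)) = trace (om t j y**(P y**\<Lambda> y))"
  using trace_mul_sym[of "\<Lambda> y" "om t j y**P y"] by (simp add: mm_ring)
 also have "\<dots> = trace (om t j y)" by (simp add: dual[OF y] blk_right[OF blk_om])
 finally have "trace (Gp t j y) = trace (\<Psi> y**pd j \<Phi> y) + trace (\<Lambda> y**pd j P y) + trace (om t j y)"
  unfolding Gp_def by (simp add: mm_ring trace_linear)
 then have "2 * trace (DD j y) = (deriv h (x y) * pd j x y) * (2 / h (x y)) + pd j x y * (\<Sum>i\<in>UNIV. b$i * d i / (b$i * x y + a$i))"
  using tG by (simp add: DD_def trace_linear)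
 also have "\<dots> = 2 * (u (x y) * \<Phi> y$True$j)"
  using hnz j by (simp add: u_eq[OF x_S[OF y]] \<Phi>_nth X_def field_simps)
 finally show ?thesis by simp
qed

lemma trace_J_DD_eq: assumes y: "y \<in> U" and k: "k \<in> I" shows "trace (J y**DD k y) = - (u (x y) * \<theta> y$k)"
proof -
 have "trace (J y**DD k y) = (\<Sum>l\<in>I. \<Phi> y$True$l * J y$l$k) * u (x y)"
  unfolding trace_J_DD[OF y k] by (simp add: trace_DD[OF y] sum_distrib_left mult_ac)
 also have "(\<Sum>l\<in>I. \<Phi> y$True$l * J y$l$k) = (\<Phi> y**J y)$True$k"
  unfolding mm_nth by (rule sum_blk[symmetric]) (use blk_J[OF y] in \<open>auto simp: blk_def\<close>)
 also have "\<dots> = - (\<theta> y$k)" unfolding \<Phi>J[OF y] using k by (simp add: mm_nth sum_bool J0_def \<Phi>_nth PI_mv_nth)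
 finally show ?thesis by (simp add: mult.commute)
qed

section \<open>Ricci form and scalar curvature of the total metric\<close>

lemma riem_zero: "riem (\<lambda>j y. 0) j k y = (0 :: real^'c^'c)"
 by (simp add: riem_def pds_pd[OF pds_const] mm_ring)

text \<open>The frame connection contributes the Ricci form of the base, since its curvature
  vanishes on the covectors in \<open>\<Phi>\<close>. The difference contributes the exterior
  derivative of -u \<theta>; the two pieces of that are the term with \<open>W\<close> and the term
  with \<open>deriv u\<close>.\<close>

lemma rform_eq: assumes y: "y \<in> U"
 shows "rform y = transpose (P y)**(B.rform (f y) - u (x y) *\<^sub>R W y)**P y + (deriv u (x y) * h (x y)) *\<^sub>R (transpose (\<Phi> y)**J0**\<Phi> y)"
  (is "_ = ?R")
proof -
 have hnz: "h (x y) \<noteq> 0" using hx[OF y] by simp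
 have e: "trace (J y**R j k y) = ?R$j$k" if jk: "j \<in> I" "k \<in> I" for j k
 proof -
  have G: "\<Gamma> j y = Gp t j y + DD j y" for j y by (simp add: DD_def)
  have 1: "trace (J y**R j k y) = trace (J y**riem (Gp t) j k y) + pd j (\<lambda>y. trace (J y**DD k y)) y - pd k (\<lambda>y. trace (J y**DD j y)) y"
   by (rule trace_riem_difference[OF U smooth_J smooth_Gp smooth_DD G par_J J_DD y jk])
  have z: "\<Phi> y**riem (Gp t) j k y = riem (\<lambda>j y. 0) j k y**\<Phi> y"
   by (rule riem_intertwine[OF U smooth_\<Phi> smooth_Gp smooth_const[OF U] _ y jk]) (simp_all add: par_\<Phi> mm_ring)
  have F: "P y**riem (Gp t) j k y = riem (om t) j k y**P y"
   by (rule riem_intertwine[OF U smooth_P smooth_Gp smooth_om par_P y jk])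
  have "blk I I (riem (Gp t) j k y)"
   unfolding riem_def
   by (intro blk_diff blk_add blk_mm[OF blk_Gp blk_Gp] pd_blk[OF U _ smooth_Gp] blk_Gp jk y)
  from PI_decomp[OF y blk_left[OF this]] have "riem (Gp t) j k y = \<Lambda> y**(riem (om t) j k y**P y)"
   unfolding F z riem_zero by (simp add: mm_ring)
  then have "trace (J y**riem (Gp t) j k y) = trace ((P y**J y)**\<Lambda> y**riem (om t) j k y)"
   using trace_mul_sym[of "J y**\<Lambda> y**riem (om t) j k y" "P y"] by (simp add: mm_ring)
  also have "\<dots> = trace (Jb (f y)**riem (om t) j k y)"
   unfolding PJ[OF y] using blk_right[OF B.blk_J[OF f_V[OF y]]]
   by (simp add: mm_ring dual'[OF y]) (simp add: matrix_mul_assoc)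
  also have "\<dots> = (\<Sum>c\<in>K. \<Sum>e\<in>K. (pd j f y$c * pd k f y$e) * trace (Jb (f y)**B.R c e (f y)))"
   unfolding om_def B.riem_pb[OF U smooth_f fU y jk] by (simp add: mm_sum_right mm_ring trace_linear)
  also have "\<dots> = (transpose (P y)**B.rform (f y)**P y)$j$k"
  proof -
   have "(transpose (P y)**B.rform (f y)**P y)$j$k = bil (B.rform (f y)) (P y *v axis j 1) (P y *v axis k 1)"
    by (simp add: bil_congruence[symmetric] bil_axis)
   also have "\<dots> = (\<Sum>c\<in>K. \<Sum>e\<in>K. (P y *v axis j 1)$c * B.rform (f y)$c$e * (P y *v axis k 1)$e)"
    by (rule bil_coord) (rule blk_mv_coord[OF blk_P[OF y]])+
   also have "\<dots> = (\<Sum>c\<in>K. \<Sum>e\<in>K. (pd j f y$c * pd k f y$e) * trace (Jb (f y)**B.R c e (f y)))"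
    using jk by (intro sum.cong refl) (simp add: matrix_vector_mult_basis column_def P_def jac_nth B.rform_def)
   finally show ?thesis by simp
  qed
  finally have 2: "trace (J y**riem (Gp t) j k y) = (transpose (P y)**B.rform (f y)**P y)$j$k" .
  have st: "smooth I U (\<lambda>z. \<theta> z$k)" for k by (rule smooth_nth[OF U smooth_\<theta>])
  have su: "smooth I U (\<lambda>z. u (x z))" by (rule smooth_real_compose[OF U S smooth_x xU smooth_u])
  have 3: "pd j (\<lambda>y. trace (J y**DD k y)) y = - (u (x y) * pd j (\<lambda>z. \<theta> z$k) y + deriv u (x y) * pd j x y * \<theta> y$k)"
   if jk: "j \<in> I" "k \<in> I" for j k
  proof -
   have "pd j (\<lambda>y. trace (J y**DD k y)) y = pd j (\<lambda>y. - (u (x y) * \<theta> y$k)) y"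
    by (rule pd_cong[OF U y jk(1) trace_J_DD_eq[OF _ jk(2)]])
   also have "\<dots> = - pd j (\<lambda>y. u (x y) * \<theta> y$k) y"
    by (rule pd_blinear[OF U bounded_linear_minus[OF bounded_linear_ident] smooth_mult[OF U su st] jk(1) y])
   finally show ?thesis using pd_mult[OF U su st jk(1) y] pd_real_compose[OF U S smooth_x xU smooth_u jk(1) y] by simp
  qed
  have 4: "h (x y) * (transpose (\<Phi> y)**J0**\<Phi> y)$j$k = - (pd j x y * \<theta> y$k - pd k x y * \<theta> y$j)"
   using jk hnz by (simp add: mm_nth sum_bool transpose_def J0_def \<Phi>_nth X_def PI_mv_nth field_simps)
  have 5: "(deriv u (x y) * h (x y)) * (transpose (\<Phi> y)**J0**\<Phi> y)$j$k = - (deriv u (x y) * (pd j x y * \<theta> y$k - pd k x y * \<theta> y$j))"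
   unfolding mult.assoc 4 by (simp add: algebra_simps)
  have 6: "transpose (P y)**(B.rform (f y) - u (x y) *\<^sub>R W y)**P y = transpose (P y)**B.rform (f y)**P y - u (x y) *\<^sub>R dth y"
   by (simp add: dth_def mm_ring)
  show ?thesis unfolding 1 2 3[OF jk] 3[OF jk(2,1)] 6 using 5 dth_nth[OF y jk] by (simp add: algebra_simps)
 qed
 have "blk I I ?R"
 proof (intro blk_add blk_scaleR)
  show "blk I I (transpose (P y)**(B.rform (f y) - u (x y) *\<^sub>R W y)**P y)" for A
   unfolding blk_PI using blk_right[OF blk_P[OF y]] blk_left[OF blk_transpose[OF blk_P[OF y]]] by (simp add: mm_ring) (simp add: matrix_mul_assoc)
  show "blk I I (transpose (\<Phi> y)**J0**\<Phi> y)"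
   by (rule blk_mm[OF blk_mm[OF blk_transpose[OF blk_\<Phi>], of UNIV UNIV J0] blk_\<Phi>]) simp
 qed
 moreover have "blk I I (rform y)" by (auto simp: blk_def rform_def)
 ultimately have "rform y$j$k = ?R$j$k" for j k
  using e[of j k] by (cases "j \<in> I \<and> k \<in> I") (auto simp: blk_def rform_def)
 then show ?thesis by (simp add: vec_eq_iff)
qed

end

lemma scalar_curvature_ansatz:
 assumes y: "y \<in> U"
 shows "scalar_curvature I G y = scalar_curvature K (\<gamma> (x y)) (f y) - deriv u (x y)
   - u (x y) * ((1/2) * (\<Sum>i\<in>UNIV. b$i * d i / (b$i * x y + a$i)))"
proof -
 note t = x_S[OF y]
 interpret B: kaehler_chart K V "\<gamma> (x y)" Jb by (rule base[OF t])
 note fy = f_V[OF y]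
 let ?gi = "ginv K (\<gamma> (x y) (f y))"
 let ?q = "\<Sum>i\<in>UNIV. b$i * d i / (b$i * x y + a$i)"
 have ghi: "gh y**?gi = mat 1" unfolding gh_def by (rule B.Hi[OF fy])
 have HPt: "Hi y**transpose (P y) = \<Lambda> y**?gi" unfolding \<Lambda>_def by (simp add: mm_ring ghi)
 have PHP: "P y**(Hi y**transpose (P y)) = PI K**?gi" unfolding HPt by (rule dual'[OF y])
 have 1: "trace (transpose (P y)**M**P y**J y**Hi y) = trace (M**Jb (f y)**?gi)" for M
 proof -
  have "trace (transpose (P y)**M**P y**J y**Hi y) = trace (M**(P y**J y)**(Hi y**transpose (P y)))"
   using trace_mul_sym[of "transpose (P y)" "M**P y**J y**Hi y"] by (simp add: mm_ring)
  also have "\<dots> = trace (M**(Jb (f y)**PI K)**?gi)" unfolding PJ[OF y] using PHP by (simp add: mm_ring)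
  finally show ?thesis using blk_right[OF B.blk_J[OF fy]] by simp
 qed
 have 2: "trace (W y**Jb (f y)**?gi) = ?q"
 proof -
  have "trace (transpose (Jb (f y))**gb i (f y)**Jb (f y)**?gi) = d i / (b$i * x y + a$i)" for i
  proof -
   have "trace (transpose (Jb (f y))**gb i (f y)**Jb (f y)**?gi) = trace (gb i (f y)**(Jb (f y)**?gi**transpose (Jb (f y))))"
    using trace_mul_sym[of "transpose (Jb (f y))" "gb i (f y)**Jb (f y)**?gi"] by (simp add: mm_ring)
   also have "\<dots> = trace (gb i (f y)**(PI K**PI K**?gi))" unfolding B.J_Hi[OF fy] by simp
   also have "\<dots> = trace (gb i (f y)**(PI K**?gi**PI K))"
    using B.Hi_PI[OF fy] by (metis matrix_mul_assoc)
   also have "\<dots> = trace (?gi**(PI K**gb i (f y)**PI K))"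
    using trace_mul_sym[of "gb i (f y)**PI K" "?gi**PI K"] trace_mul_sym[of "?gi**PI K**gb i (f y)" "PI K"] B.Hi_PI[OF fy]
    by (simp add: mm_ring) (metis PI_PI matrix_mul_assoc trace_mul_sym)
   finally show ?thesis using trace_gb[OF fy t] by simp
  qed
  then show ?thesis unfolding W_def by (simp add: mm_sum_left mm_ring trace_linear)
 qed
 have J0J0: "J0**J0 = - mat 1" by (simp add: vec_eq_iff mm_nth sum_bool J0_def mat_def)
 have 3: "h (x y) * trace (transpose (\<Phi> y)**J0**\<Phi> y**J y**Hi y) = - 2"
 proof -
  have "h (x y) * trace (transpose (\<Phi> y)**J0**\<Phi> y**J y**Hi y) = h (x y) * trace (J0**(\<Phi> y**J y)**(Hi y**transpose (\<Phi> y)))"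
   using trace_mul_sym[of "transpose (\<Phi> y)" "J0**\<Phi> y**J y**Hi y"] by (simp add: mm_ring)
  also have "\<dots> = trace ((J0**J0)**(\<Phi> y**\<Psi> y))" unfolding \<Phi>J[OF y] by (simp add: \<Psi>_def mm_ring trace_linear)
  finally show ?thesis by (simp add: J0J0 dual[OF y] mm_ring trace_linear trace_I)
 qed
 have "2 * scalar_curvature I G y = trace (rform y**J y**Hi y)" by (rule scalar_curvature_rform[OF y])
 also have "\<dots> = trace (transpose (P y)**(B.rform (f y) - u (x y) *\<^sub>R W y)**P y**J y**Hi y)
   + deriv u (x y) * (h (x y) * trace (transpose (\<Phi> y)**J0**\<Phi> y**J y**Hi y))"
  unfolding rform_eq[OF t y] by (simp add: mm_ring trace_linear)
 also have "\<dots> = trace (B.rform (f y)**Jb (f y)**?gi) - u (x y) * ?q - 2 * deriv u (x y)"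
  unfolding 1 3 using 2 by (simp add: mm_ring trace_linear)
 also have "trace (B.rform (f y)**Jb (f y)**?gi) = 2 * scalar_curvature K (\<gamma> (x y)) (f y)"
  by (rule B.scalar_curvature_rform[OF fy, symmetric])
 finally show ?thesis by simp
qed

end

subsection \<open>Simultaneous diagonalization of the base tensors\<close>

abbreviation (input) "ind \<sigma> i \<equiv> \<lambda>\<alpha>. if \<sigma> \<alpha> = i then 1 else 0 :: real"
abbreviation (input) "comb A g \<equiv> \<Sum>i\<in>UNIV. A i *\<^sub>R g i"
abbreviation (input) "combz A g z \<equiv> \<Sum>i\<in>UNIV. A i *\<^sub>R g i z"

definition dg :: "'k::finite set \<Rightarrow> ('k \<Rightarrow> real) \<Rightarrow> real^'k^'k" where
 "dg K c = (\<chi> i j. if i = j \<and> i \<in> K then c i else 0)"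

lemma dg_nth_mult: "dg K c$i$k * x = (if k = i then (if i \<in> K then c i * x else 0) else 0)"
  "x * dg K c$k$j = (if k = j then (if j \<in> K then x * c j else 0) else 0)"
 by (auto simp: dg_def)

lemma dg_mult: "dg K c**dg K e = dg K (\<lambda>i. c i * e i)"
 by (simp add: vec_eq_iff mm_nth dg_nth_mult sum.delta) (auto simp: dg_def)

lemma blk_dg: "blk K K (dg K c)"
 by (auto simp: blk_def dg_def)

lemma dg_1: "dg K (\<lambda>i. 1) = PI K"
 by (simp add: dg_def PI_def)

lemma dg_cong: "(\<And>i. i \<in> K \<Longrightarrow> c i = e i) \<Longrightarrow> dg K c = dg K e"
 by (auto simp: dg_def vec_eq_iff)

lemma trace_dg_mult: "trace (dg K c**A) = (\<Sum>i\<in>K. c i * A$i$i)"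
proof -
 have "(dg K c**A)$i$i = (if i \<in> K then c i * A$i$i else 0)" for i
  by (simp add: mm_nth dg_nth_mult sum.delta)
 then show ?thesis unfolding trace_def by (simp add: sum_if_subset)
qed

lemma dg_sum: "(\<Sum>s\<in>S. A s *\<^sub>R dg K (c s)) = dg K (\<lambda>i. \<Sum>s\<in>S. A s * c s i)"
 by (auto simp: vec_eq_iff dg_def sum_component intro!: sum.neutral)

lemma sum_ind: "(\<Sum>j\<in>UNIV. B j * (if (c :: 'm::finite) = j then 1 else 0)) = (B c :: real)"
 by (simp add: if_distrib[of "(*) _"] cong: if_cong)

text \<open>A common orthonormal frame at a single point, with \<open>\<sigma>\<close> assigning its
  vectors to the summands. No smooth dependence on the point is asked for; the derivatives below are
  taken only of the tensors and of traces formed from them.\<close>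

definition adapted :: "'k::finite set \<Rightarrow> ('m::finite \<Rightarrow> real^'k^'k) \<Rightarrow> real^'k^'k \<Rightarrow> ('k \<Rightarrow> 'm) \<Rightarrow> bool" where
 "adapted K g T \<sigma> \<longleftrightarrow> blk K K T \<and> (\<forall>i. transpose T**g i**T = dg K (ind \<sigma> i))"

text \<open>Completed by \<open>mat 1 - PI K\<close> the blocks become full square matrices, for
  which one-sided inverses are two-sided.\<close>

lemma matrix_inv_blk:
 assumes A: "blk K K A" and B: "blk K K B" and AB: "A**B = PI K"
 shows "B**A = PI K"
proof -
 let ?C = "mat 1 - PI K"
 have z: "A**?C = 0" "?C**B = 0" "?C**A = 0" "B**?C = 0"
  using blk_left[OF A] blk_left[OF B] blk_right[OF A] blk_right[OF B] by (simp_all add: mm_ring)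
 have "(A + ?C)**(B + ?C) = mat 1"
  by (simp add: mm_ring(1,2) z AB) (simp add: mm_ring)
 then have "(B + ?C)**(A + ?C) = mat 1" by (simp add: matrix_left_right_inverse)
 then show ?thesis by (simp add: mm_ring(1,2) z) (simp add: mm_ring algebra_simps)
qed

context
 fixes K :: "'k::finite set" and g :: "'m::finite \<Rightarrow> real^'k^'k" and T \<sigma>
 assumes ad: "adapted K g T \<sigma>"
begin

lemma T_blk: "blk K K T" and T_g: "transpose T**g i**T = dg K (ind \<sigma> i)"
 using ad by (auto simp: adapted_def)

lemma T_sum: "transpose T**(comb A g)**T = dg K (\<lambda>\<alpha>. A (\<sigma> \<alpha>))"
proof -
 have "transpose T**(comb A g)**T = (\<Sum>i\<in>UNIV. A i *\<^sub>R (transpose T**g i**T))"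
  by (simp add: mm_sum_left mm_sum_right mm_ring)
 then show ?thesis unfolding T_g dg_sum sum_ind .
qed

text \<open>The inverse metric of the i-th summand, extended by zero to the other summands.\<close>

definition eigp where "eigp i = T**dg K (ind \<sigma> i)**transpose T"

lemma ginv_adapted:
 assumes A: "\<And>i. A i > 0"
 shows "ginv K (comb A g) = (\<Sum>i\<in>UNIV. (1 / A i) *\<^sub>R eigp i) + (mat 1 - PI K)"
  and "hat K (comb A g)**ginv K (comb A g) = mat 1"
  and "invertible (hat K (comb A g))"
proof -
 define G where "G = (comb A g)"
 define N where "N = T**dg K (\<lambda>\<alpha>. 1 / A (\<sigma> \<alpha>))**transpose T"
 have N: "N = (\<Sum>i\<in>UNIV. (1 / A i) *\<^sub>R eigp i)"
 proof -
  have "(\<Sum>i\<in>UNIV. (1 / A i) *\<^sub>R eigp i) = T**(\<Sum>i\<in>UNIV. (1 / A i) *\<^sub>R dg K (ind \<sigma> i))**transpose T"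
   by (simp add: eigp_def mm_sum_left mm_sum_right mm_ring)
  then show ?thesis unfolding dg_sum sum_ind N_def by simp
 qed
 have bN: "blk K K N" unfolding N_def by (intro blk_mm[OF blk_mm[OF T_blk blk_dg] blk_transpose[OF T_blk]])
 have bX: "blk K K (PI K**G**PI K)" by (auto simp: blk_def PI_mult mult_PI)
 have bY: "blk K K (dg K (\<lambda>\<alpha>. 1 / A (\<sigma> \<alpha>))**transpose T**(PI K**G**PI K))"
  by (intro blk_mm[OF blk_mm[OF blk_dg blk_transpose[OF T_blk]] bX])
 have "(dg K (\<lambda>\<alpha>. 1 / A (\<sigma> \<alpha>))**transpose T**(PI K**G**PI K))**T = dg K (\<lambda>\<alpha>. 1 / A (\<sigma> \<alpha>))**(transpose T**G**T)"
  using blk_left[OF T_blk] blk_right[OF blk_transpose[OF T_blk]]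
  by (simp add: mm_ring) (simp add: matrix_mul_assoc)
 also have "\<dots> = dg K (\<lambda>\<alpha>. 1)"
  unfolding G_def T_sum dg_mult using A by (intro dg_cong) (simp add: less_imp_neq[THEN not_sym])
 finally have "T**(dg K (\<lambda>\<alpha>. 1 / A (\<sigma> \<alpha>))**transpose T**(PI K**G**PI K)) = PI K"
  unfolding dg_1 by (rule matrix_inv_blk[OF bY T_blk])
 then have NX: "N**(PI K**G**PI K) = PI K" by (simp add: N_def mm_ring)
 have "(N + (mat 1 - PI K))**hat K G = N**(PI K**G**PI K) + (mat 1 - PI K)"
  unfolding hat_PI using blk_right[OF bN] by (simp add: mm_ring) (simp add: matrix_mul_assoc)
 then have 1: "(N + (mat 1 - PI K))**hat K G = mat 1" unfolding NX by simp
 then have 2: "hat K G**(N + (mat 1 - PI K)) = mat 1" by (simp add: matrix_left_right_inverse)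
 show "ginv K G = (\<Sum>i\<in>UNIV. (1 / A i) *\<^sub>R eigp i) + (mat 1 - PI K)"
  unfolding ginv_hat N[symmetric] by (rule matrix_inv_unique(1)[OF 2])
 show "hat K G**ginv K G = mat 1" unfolding ginv_hat by (rule matrix_inv_unique(4)[OF 2])
 show "invertible (hat K G)" unfolding invertible_def using 1 2 by blast
qed

lemma trace_ginv_adapted:
 assumes A: "\<And>i. A i > 0" and X: "blk K K X"
 shows "trace (ginv K (comb A g)**X) = (\<Sum>\<alpha>\<in>K. (transpose T**X**T)$\<alpha>$\<alpha> / A (\<sigma> \<alpha>))"
proof -
 have q: "trace (eigp i**X) = (\<Sum>\<alpha>\<in>K. (if \<sigma> \<alpha> = i then 1 else 0) * (transpose T**X**T)$\<alpha>$\<alpha>)" for i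
 proof -
  have "trace (eigp i**X) = trace (dg K (ind \<sigma> i)**(transpose T**X**T))"
   unfolding eigp_def using trace_mul_sym[of T "dg K (ind \<sigma> i)**transpose T**X"] by (simp add: mm_ring)
  then show ?thesis unfolding trace_dg_mult .
 qed
 have "trace (ginv K (comb A g)**X) = (\<Sum>i\<in>UNIV. (1 / A i) * trace (eigp i**X))"
  unfolding ginv_adapted(1)[OF A] using blk_left[OF X] by (simp add: mm_ring mm_sum_left trace_linear)
 also have "\<dots> = (\<Sum>i\<in>UNIV. \<Sum>\<alpha>\<in>K. (if \<sigma> \<alpha> = i then (transpose T**X**T)$\<alpha>$\<alpha> / A i else 0))"
  unfolding q sum_distrib_left by (intro sum.cong refl) auto
 also have "\<dots> = (\<Sum>\<alpha>\<in>K. \<Sum>i\<in>UNIV. (if \<sigma> \<alpha> = i then (transpose T**X**T)$\<alpha>$\<alpha> / A i else 0))" by (rule sum.swap)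
 finally show ?thesis by simp
qed

lemma trace_ginv_g:
 assumes A: "\<And>i. A i > 0"
 shows "trace (ginv K (comb A g)**(PI K**g i**PI K)) = card {\<alpha>\<in>K. \<sigma> \<alpha> = i} / A i"
proof -
 have "transpose T**(PI K**g i**PI K)**T = transpose T**g i**T"
  using blk_left[OF T_blk] blk_right[OF blk_transpose[OF T_blk]]
  by (simp add: mm_ring) (simp add: matrix_mul_assoc)
 then have "trace (ginv K (comb A g)**(PI K**g i**PI K)) = (\<Sum>\<alpha>\<in>K. (if \<sigma> \<alpha> = i then 1 / A i else 0))"
  by (subst trace_ginv_adapted[OF A]) (auto simp: blk_def PI_mult mult_PI T_g dg_def intro!: sum.cong)
 also have "\<dots> = (\<Sum>\<alpha>\<in>{\<alpha>\<in>K. \<sigma> \<alpha> = i}. 1 / A i)" by (rule sum.inter_filter[symmetric]) simp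
 finally show ?thesis by simp
qed

text \<open>Such a product arises from differentiating the inverse metric. In the adapted frame all
  cross terms between summands vanish.\<close>

lemma ginv_g_ginv:
 assumes A: "\<And>i. A i > 0"
 shows "ginv K (comb A g)**(PI K**g i**PI K)**ginv K (comb A g) = (1 / (A i * A i)) *\<^sub>R eigp i"
proof -
 define X where "X = PI K**g i**PI K"
 have X: "blk K K X" by (auto simp: X_def blk_def PI_mult mult_PI)
 have z: "(mat 1 - PI K)**X = 0" "X**(mat 1 - PI K) = 0"
  using blk_left[OF X] blk_right[OF X] by (simp_all add: mm_ring)
 have tx: "transpose T**X**T = dg K (ind \<sigma> i)"
  unfolding T_g[symmetric] X_def using blk_left[OF T_blk] blk_right[OF blk_transpose[OF T_blk]]
  by (simp add: mm_ring) (simp add: matrix_mul_assoc)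
 have q: "eigp j**X**eigp k = (if j = i \<and> k = i then eigp i else 0)" for j k
 proof -
  have "eigp j**X**eigp k = T**(dg K (ind \<sigma> j)**(transpose T**X**T)**dg K (ind \<sigma> k))**transpose T"
   by (simp add: eigp_def mm_ring)
  also have "dg K (ind \<sigma> j)**(transpose T**X**T)**dg K (ind \<sigma> k)
   = dg K (\<lambda>\<alpha>. if j = i \<and> k = i then (if \<sigma> \<alpha> = i then 1 else 0) else 0)"
   unfolding tx dg_mult by (rule dg_cong) auto
  finally have e: "eigp j**X**eigp k = T**dg K (\<lambda>\<alpha>. if j = i \<and> k = i then (if \<sigma> \<alpha> = i then 1 else 0) else 0)**transpose T" .
  show ?thesis
  proof (cases "j = i \<and> k = i")
   case True
   then show ?thesis using e by (simp add: eigp_def)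
  next
   case False
   then have "eigp j**X**eigp k = T**dg K (\<lambda>\<alpha>. 0)**transpose T" using e by (simp only: if_False)
   moreover have "dg K (\<lambda>\<alpha>. 0) = 0" by (simp add: dg_def vec_eq_iff)
   ultimately show ?thesis using False by (simp only: if_False) (simp add: mm_ring)
  qed
 qed
 have "(\<Sum>j\<in>UNIV. (1 / A j) *\<^sub>R eigp j)**X**(\<Sum>k\<in>UNIV. (1 / A k) *\<^sub>R eigp k) = (\<Sum>j\<in>UNIV. \<Sum>k\<in>UNIV. (1 / (A j * A k)) *\<^sub>R (eigp j**X**eigp k))"
  by (simp add: mm_sum_left mm_sum_right mm_ring scaleR_sum_right) (subst sum.swap, simp add: mult.commute)
 also have "\<dots> = (\<Sum>j\<in>UNIV. \<Sum>k\<in>UNIV. if k = i then (if j = i then (1 / (A i * A i)) *\<^sub>R eigp i else 0) else 0)"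
  unfolding q by (intro sum.cong refl) auto
 also have "\<dots> = (1 / (A i * A i)) *\<^sub>R eigp i" by (simp add: sum.delta)
 finally show ?thesis unfolding X_def[symmetric] ginv_adapted(1)[OF A] using z by (simp add: mm_ring)
qed

end

text \<open>The trace of \<open>g i\<close> against the inverse metric is the constant d_i / A_i.
  Differentiating this for all positive weights shows that the derivative of \<open>g j\<close>,
  traced over the i-th summand, vanishes for i \<noteq> j. The weights then cancel in the
  logarithmic derivative of the volume density.\<close>

lemma trace_ginv_pd_indep:
 fixes g :: "'m::finite \<Rightarrow> real^'k \<Rightarrow> real^'k^'k"
 assumes V: "ropen K V" and g: "\<And>i. smooth K V (g i)"
  and ad: "\<And>z. z \<in> V \<Longrightarrow> \<exists>T \<sigma>. adapted K (\<lambda>i. g i z) T \<sigma> \<and> (\<forall>i. card {\<alpha>\<in>K. \<sigma> \<alpha> = i} = d i)"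
  and A: "\<And>i. A i > 0" and A': "\<And>i. A' i > 0" and z: "z \<in> V" and l: "l \<in> K"
 shows "trace (ginv K (combz A g z)**pd l (\<lambda>z. hat K (combz A g z)) z) =
  trace (ginv K (combz A' g z)**pd l (\<lambda>z. hat K (combz A' g z)) z)"
proof -
 obtain T \<sigma> where T: "adapted K (\<lambda>i. g i z) T \<sigma>" using ad[OF z] by blast
 define h where "h i z = PI K**g i z**PI K" for i z
 have c0: "pd l (\<lambda>z. c) z = 0" for c :: "real^'k^'k" by (rule pds_pd[OF pds_const])
 have c0': "pd l (\<lambda>z. c) z = 0" for c :: real by (rule pds_pd[OF pds_const])
 have sh: "smooth K V (h i)" for i unfolding h_def by (intro smooth_intros V g)
 define Qm where "Qm = eigp K T \<sigma>"
 define X where "X i j = trace (Qm i**pd l (h j) z)" for i j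
 have hatA: "hat K (combz A g z) = (combz A h z) + (mat 1 - PI K)" for A z
  unfolding hat_PI h_def by (simp add: mm_sum_left mm_sum_right mm_ring)
 have sA: "smooth K V (\<lambda>z. \<Sum>i\<in>UNIV. A i *\<^sub>R h i z)" for A by (intro smooth_intros V sh)
 have pdA: "pd l (\<lambda>z. hat K (combz A g z)) z = (\<Sum>i\<in>UNIV. A i *\<^sub>R pd l (h i) z)" for A
 proof -
  have "pd l (\<lambda>z. \<Sum>i\<in>UNIV. A i *\<^sub>R h i z) z = (\<Sum>i\<in>UNIV. pd l (\<lambda>z. A i *\<^sub>R h i z) z)"
   by (rule pd_sum[OF V smooth_scaleR[OF V smooth_const[OF V] sh] l z])
  also have "\<dots> = (\<Sum>i\<in>UNIV. A i *\<^sub>R pd l (h i) z)"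
   by (intro sum.cong refl) (use pd_scaleR[OF V smooth_const[OF V] sh l z] c0' in simp)
  finally show ?thesis unfolding hatA using pd_add[OF V sA smooth_const[OF V] l z] by (simp add: c0)
 qed
 have bph: "blk K K (pd l (h i) z)" for i
  by (rule pd_blk[OF V _ sh l z]) (auto simp: h_def blk_def PI_mult mult_PI)
 have tr: "trace (ginv K (combz A g z)**pd l (h k) z) = (\<Sum>j\<in>UNIV. X j k / A j)" if A: "\<And>i. A i > 0" for A k
  unfolding ginv_adapted(1)[OF T A] X_def Qm_def using blk_left[OF bph] by (simp add: mm_ring mm_sum_left trace_linear)
 \<comment> \<open>The derivative of the constant trace of \<open>g i\<close>. It is available for
   every positive \<open>A\<close>, hence as an identity in the weights.\<close>
 have key: "(\<Sum>k\<in>UNIV. A k * X i k) / (A i * A i) = (\<Sum>j\<in>UNIV. X j i / A j)" if A: "\<And>i. A i > 0" for A i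
 proof -
  let ?G = "\<lambda>z. ginv K (combz A g z)" and ?H = "\<lambda>z. hat K (combz A g z)"
  have inv: "invertible (?H z)" if z: "z \<in> V" for z
  proof -
   obtain T \<sigma> where "adapted K (\<lambda>i. g i z) T \<sigma>" using ad[OF z] by blast
   then show ?thesis by (rule ginv_adapted(3)[OF _ A])
  qed
  have sH: "smooth K V ?H" unfolding hatA by (intro smooth_intros V sA)
  have sG: "smooth K V ?G" unfolding ginv_hat by (rule smooth_matrix_inv[OF V sH inv])
  have pG: "pd l ?G z = - (?G z**pd l ?H z**?G z)" unfolding ginv_hat by (rule pd_matrix_inv[OF V sH inv z l])
  have "pd l (\<lambda>z. trace (?G z**h i z)) z = pd l (\<lambda>z. real (d i) / A i) z"
  proof (rule pd_cong[OF V z l])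
   fix z assume "z \<in> V"
   then obtain T \<sigma> where T: "adapted K (\<lambda>i. g i z) T \<sigma>" and d: "\<And>i. card {\<alpha>\<in>K. \<sigma> \<alpha> = i} = d i" using ad by blast
   show "trace (?G z**h i z) = real (d i) / A i" unfolding h_def using trace_ginv_g[OF T A] d by simp
  qed
  then have "trace (?G z**pd l (h i) z) - trace (?G z**pd l ?H z**?G z**h i z) = 0"
   using pd_trace[OF V smooth_mm[OF V sG sh] l z] pd_mm[OF V sG sh l z] by (simp add: c0' pG trace_linear mm_ring)
  moreover have "trace (?G z**pd l ?H z**?G z**h i z) = trace (pd l ?H z**(?G z**h i z**?G z))"
   using trace_mul_sym[of "?G z" "pd l ?H z**?G z**h i z"] by (simp add: mm_ring)
  moreover have "\<dots> = (\<Sum>k\<in>UNIV. A k * X i k) / (A i * A i)"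
  proof -
   have "trace (pd l (h k) z**Qm i) = X i k" for k unfolding X_def by (rule trace_mul_sym)
   then show ?thesis unfolding h_def ginv_g_ginv[OF T A] pdA Qm_def
    by (simp add: mm_ring mm_sum_left trace_linear sum_divide_distrib sum_distrib_left h_def[symmetric])
  qed
  ultimately show ?thesis using tr[OF A] by simp
 qed
 \<comment> \<open>Weight s at j and 1 elsewhere turns \<open>key\<close> into C + s X_ij = C' +
   X_ji / s; the three values s = 1, 2, 4 force X_ij = 0.\<close>
 have off: "X i j = 0" if "i \<noteq> j" for i j
 proof -
  define A where "A s = (\<lambda>k. if k = j then s else 1 :: real)" for s
  define C where "C = (\<Sum>k\<in>UNIV - {j}. X i k)"
  define C' where "C' = (\<Sum>k\<in>UNIV - {j}. X k i)"
  have e: "C + s * X i j = C' + X j i / s" if s: "s > 0" for s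
  proof -
   have 1: "(\<Sum>k\<in>UNIV. A s k * X i k) = s * X i j + C"
    unfolding C_def by (subst sum.remove[of _ j]) (auto simp: A_def intro!: sum.cong)
   have 2: "(\<Sum>k\<in>UNIV. X k i / A s k) = X j i / s + C'"
    unfolding C'_def by (subst sum.remove[of _ j]) (auto simp: A_def intro!: sum.cong)
   have "A s k > 0" for k using s by (simp add: A_def)
   then have "(\<Sum>k\<in>UNIV. A s k * X i k) / (A s i * A s i) = (\<Sum>k\<in>UNIV. X k i / A s k)" by (rule key)
   then show ?thesis unfolding 1 2 using \<open>i \<noteq> j\<close> by (simp add: A_def)
  qed
  show ?thesis using e[of 1] e[of 2] e[of 4] by simp
 qed
 have fin: "trace (ginv K (combz A g z)**pd l (\<lambda>z. hat K (combz A g z)) z) = (\<Sum>i\<in>UNIV. X i i)"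
  if A: "\<And>i. A i > 0" for A
 proof -
  have "trace (ginv K (combz A g z)**pd l (\<lambda>z. hat K (combz A g z)) z) = (\<Sum>k\<in>UNIV. A k * (\<Sum>j\<in>UNIV. X j k / A j))"
   unfolding pdA tr[OF A, symmetric] by (simp add: mm_sum_right mm_ring trace_linear)
  also have "\<dots> = (\<Sum>k\<in>UNIV. A k * (\<Sum>j\<in>UNIV. if j = k then X k k / A k else 0))"
   by (intro sum.cong refl arg_cong2[of _ _ _ _ "(*)"]) (auto simp: off)
  also have "\<dots> = (\<Sum>k\<in>UNIV. X k k)" using A by (simp add: less_imp_neq[THEN not_sym])
  finally show ?thesis .
 qed
 show ?thesis unfolding fin[OF A] fin[OF A'] ..
qed

subsection \<open>Orthonormal bases\<close>

text \<open>Bilinearity is asked for on \<open>V\<close> only, because the form needed on a summand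
  of the isotropy representation is evaluated on fundamental fields, whose linearity is known just
  there. The induction splits off a unit vector and passes to its complement for
  \<open>Q\<close>.\<close>

lemma gram_schmidt:
 fixes V :: "'a::euclidean_space set"
 assumes V: "subspace V" and lin: "\<And>X Y Z r s. \<lbrakk>X \<in> V; Y \<in> V; Z \<in> V\<rbrakk> \<Longrightarrow> Q (r *\<^sub>R X + s *\<^sub>R Y) Z = r * Q X Z + s * (Q Y Z :: real)"
  and sym: "\<And>X Y. X \<in> V \<Longrightarrow> Y \<in> V \<Longrightarrow> Q X Y = Q Y X" and pos: "\<And>X. X \<in> V \<Longrightarrow> X \<noteq> 0 \<Longrightarrow> Q X X > 0"
 shows "\<exists>e. (\<forall>i<dim V. e i \<in> V) \<and> (\<forall>i<dim V. \<forall>j<dim V. Q (e i) (e j) = (if i = j then 1 else 0))"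
 using assms
proof (induction "dim V" arbitrary: V)
 case 0
 then have d: "dim V = 0" by simp
 show ?case unfolding d by simp
next
 case (Suc n)
 note V = Suc.prems(1) and lin = Suc.prems(2) and sym = Suc.prems(3) and pos = Suc.prems(4)
 obtain v where v: "v \<in> V" "v \<noteq> 0"
 proof -
  have "\<not> V \<subseteq> {0}"
  proof
   assume "V \<subseteq> {0}"
   then have "dim V = 0" by simp
   then show False using Suc.hyps(2) by linarith
  qed
  then show ?thesis using that by blast
 qed
 define c where "c = 1 / sqrt (Q v v)"
 define w where "w = c *\<^sub>R v"
 have wV: "w \<in> V" unfolding w_def using V v by (simp add: subspace_scale)
 have s0: "Q (r *\<^sub>R X) Z = r * Q X Z" if "X \<in> V" "Z \<in> V" for r X Z
  using lin[OF that(1,1,2), of r 0] by simp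
 have "Q w w = 1"
 proof -
  have "Q w w = c * (c * Q v v)"
   using s0[OF v(1) wV, of c, folded w_def] s0[OF v(1) v(1), of c, folded w_def] sym[OF v(1) wV] by simp
  then show ?thesis using pos[OF v] by (simp add: c_def)
 qed
 define V' where "V' = {x\<in>V. Q x w = 0}"
 have V': "subspace V'"
  unfolding subspace_def V'_def
 proof (intro conjI allI impI ballI)
  show "0 \<in> {x\<in>V. Q x w = 0}" using V s0[OF wV wV, of 0] subspace_0 by auto
  fix x y r assume x: "x \<in> {x\<in>V. Q x w = 0}"
  show "r *\<^sub>R x \<in> {x\<in>V. Q x w = 0}" using x V s0[OF _ wV] by (simp add: subspace_scale)
  assume y: "y \<in> {x\<in>V. Q x w = 0}"
  show "x + y \<in> {x\<in>V. Q x w = 0}" using x y V lin[OF _ _ wV, of x y 1 1] by (simp add: subspace_add)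
 qed
 have "w \<notin> span V'" using \<open>Q w w = 1\<close> V' unfolding span_eq_iff[THEN iffD2, OF V'] by (simp add: V'_def)
 moreover have "span (insert w V') = V"
 proof
  show "span (insert w V') \<subseteq> V" by (rule span_minimal[OF _ V]) (use wV in \<open>auto simp: V'_def\<close>)
  show "V \<subseteq> span (insert w V')"
  proof
   fix x assume x: "x \<in> V"
   have "1 *\<^sub>R x + (- Q x w) *\<^sub>R w \<in> V'"
    unfolding V'_def using lin[OF x wV wV, of 1 "- Q x w"] x wV V \<open>Q w w = 1\<close>
    by (auto intro!: subspace_diff subspace_scale)
   then have "(1 *\<^sub>R x + (- Q x w) *\<^sub>R w) + Q x w *\<^sub>R w \<in> span (insert w V')"
    by (intro span_add span_scale span_base) auto
   then show "x \<in> span (insert w V')" by simp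
  qed
 qed
 ultimately have "dim V = dim V' + 1" using dim_insert[of w V'] dim_span[of "insert w V'"] by simp
 then have n: "n = dim V'" using Suc.hyps(2) by simp
 obtain e where e: "\<And>i. i < dim V' \<Longrightarrow> e i \<in> V'" "\<And>i j. i < dim V' \<Longrightarrow> j < dim V' \<Longrightarrow> Q (e i) (e j) = (if i = j then 1 else 0)"
 proof -
  have "\<exists>e. (\<forall>i<dim V'. e i \<in> V') \<and> (\<forall>i<dim V'. \<forall>j<dim V'. Q (e i) (e j) = (if i = j then 1 else 0))"
  proof (rule Suc.hyps(1)[OF n V'])
   have "x \<in> V" if "x \<in> V'" for x using that by (simp add: V'_def)
   then show "Q (r *\<^sub>R X + s *\<^sub>R Y) Z = r * Q X Z + s * Q Y Z" if "X \<in> V'" "Y \<in> V'" "Z \<in> V'" for X Y Z r s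
    using that by (intro lin)
   show "Q X Y = Q Y X" if "X \<in> V'" "Y \<in> V'" for X Y using that by (intro sym) (simp_all add: V'_def)
   show "Q X X > 0" if "X \<in> V'" "X \<noteq> 0" for X using that by (intro pos) (simp_all add: V'_def)
  qed
  then show ?thesis using that by auto
 qed
 define e' where "e' i = (case i of 0 \<Rightarrow> w | Suc k \<Rightarrow> e k)" for i
 have "e' i \<in> V" if "i < dim V" for i using that e(1) wV n Suc.hyps(2) by (auto simp: e'_def V'_def split: nat.splits)
 moreover have "Q (e' i) (e' j) = (if i = j then 1 else 0)" if "i < dim V" "j < dim V" for i j
 proof -
  have *: "Q (e k) w = 0" "Q w (e k) = 0" if "k < n" for k
   using e(1)[of k] that n sym[of w "e k"] wV by (auto simp: V'_def)
  show ?thesis using that e(2) n Suc.hyps(2) \<open>Q w w = 1\<close> * by (auto simp: e'_def split: nat.splits)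
 qed
 ultimately show ?case by (intro exI[of _ e']) blast
qed

lemma adaptedI:
 fixes w :: "'m::finite \<Rightarrow> nat \<Rightarrow> real^'k" and g :: "'m \<Rightarrow> real^'k^'k"
 assumes w: "\<And>i r. r < d i \<Longrightarrow> w i r \<in> coord K" and card: "card K = (\<Sum>i\<in>UNIV. d i)"
  and orth: "\<And>k i j r s. r < d i \<Longrightarrow> s < d j \<Longrightarrow> bil (g k) (w i r) (w j s) = (if i = k \<and> j = k \<and> r = s then 1 else 0)"
 obtains T \<sigma> \<rho> where "adapted K g T \<sigma>" "\<And>i. card {\<alpha>\<in>K. \<sigma> \<alpha> = i} = d i"
  "\<And>\<alpha>. \<alpha> \<in> K \<Longrightarrow> \<rho> \<alpha> < d (\<sigma> \<alpha>) \<and> T *v axis \<alpha> 1 = w (\<sigma> \<alpha>) (\<rho> \<alpha>)"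
proof -
 define S where "S = (SIGMA i:UNIV. {..<d i})"
 have "card S = card K" unfolding S_def card by (subst card_SigmaI) auto
 moreover have "finite S" unfolding S_def by auto
 \<comment> \<open>The columns of the frame are enumerated by pairs of a summand and a position in
   its basis.\<close>
 ultimately obtain \<beta> where \<beta>: "bij_betw \<beta> K S" using finite_same_card_bij[of K S] by auto
 define T where "T = (\<chi> i \<alpha>. if \<alpha> \<in> K then w (fst (\<beta> \<alpha>)) (snd (\<beta> \<alpha>))$i else 0)"
 define \<sigma> where "\<sigma> \<alpha> = fst (\<beta> \<alpha>)" for \<alpha>
 have \<beta>S: "snd (\<beta> \<alpha>) < d (\<sigma> \<alpha>)" if "\<alpha> \<in> K" for \<alpha>
  using bij_betwE[OF \<beta>] that unfolding S_def \<sigma>_def by force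
 have T: "T *v axis \<alpha> 1 = (if \<alpha> \<in> K then w (\<sigma> \<alpha>) (snd (\<beta> \<alpha>)) else 0)" for \<alpha>
  by (simp add: matrix_vector_mult_basis column_def T_def vec_eq_iff \<sigma>_def)
 have "T$i$\<alpha> = 0" if "i \<notin> K \<or> \<alpha> \<notin> K" for i \<alpha>
  using w[OF \<beta>S, of \<alpha>] that by (auto simp: T_def \<sigma>_def coord_def)
 then have "blk K K T" by (simp add: blk_def)
 moreover have "transpose T**g k**T = dg K (ind \<sigma> k)" for k
 proof -
  have "(transpose T**g k**T)$\<alpha>$\<alpha>' = dg K (ind \<sigma> k)$\<alpha>$\<alpha>'" for \<alpha> \<alpha>'
  proof -
   have e: "(transpose T**g k**T)$\<alpha>$\<alpha>' = bil (g k) (T *v axis \<alpha> 1) (T *v axis \<alpha>' 1)"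
    by (simp add: bil_congruence[symmetric] bil_axis)
   show ?thesis
   proof (cases "\<alpha> \<in> K \<and> \<alpha>' \<in> K")
    case True
    have "\<beta> \<alpha> = \<beta> \<alpha>' \<longleftrightarrow> \<alpha> = \<alpha>'" using \<beta> True unfolding bij_betw_def inj_on_def by blast
    then show ?thesis unfolding e T using True orth[OF \<beta>S \<beta>S, of \<alpha> \<alpha>' k]
     by (auto simp: dg_def \<sigma>_def prod_eq_iff)
   next
    case False
    then show ?thesis unfolding e T by (auto simp: dg_def bil_sum)
   qed
  qed
  then show ?thesis by (simp add: vec_eq_iff)
 qed
 ultimately have "adapted K g T \<sigma>" by (simp add: adapted_def)
 moreover have "card {\<alpha>\<in>K. \<sigma> \<alpha> = i} = d i" for i
 proof -
  have "\<beta> ` {\<alpha>\<in>K. \<sigma> \<alpha> = i} = {p \<in> \<beta> ` K. fst p = i}" by (auto simp: \<sigma>_def)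
  also have "\<dots> = {i} \<times> {..<d i}" unfolding bij_betw_imp_surj_on[OF \<beta>] by (auto simp: S_def)
  finally have "\<beta> ` {\<alpha>\<in>K. \<sigma> \<alpha> = i} = {i} \<times> {..<d i}" .
  moreover have "inj_on \<beta> {\<alpha>\<in>K. \<sigma> \<alpha> = i}" using bij_betw_imp_inj_on[OF \<beta>] by (rule inj_on_subset) auto
  ultimately show ?thesis using card_image[of \<beta> "{\<alpha>\<in>K. \<sigma> \<alpha> = i}"] by (simp add: card_cartesian_product)
 qed
 ultimately show thesis using that[of T \<sigma> "\<lambda>\<alpha>. snd (\<beta> \<alpha>)"] T \<beta>S by simp
qed

subsection \<open>Exterior derivative and pullback of 2-forms\<close>

definition ext3 :: "(real^'n \<Rightarrow> real^'n^'n) \<Rightarrow> 'n \<Rightarrow> 'n \<Rightarrow> 'n \<Rightarrow> real^'n \<Rightarrow> real" where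
 "ext3 \<omega> i j k y = pd i (\<lambda>z. \<omega> z$j$k) y + pd j (\<lambda>z. \<omega> z$k$i) y + pd k (\<lambda>z. \<omega> z$i$j) y"

lemma ext3_cong:
 assumes "ropen I U" "y \<in> U" "i \<in> I" "j \<in> I" "k \<in> I" "\<And>z i j. \<lbrakk>z \<in> U; i \<in> I; j \<in> I\<rbrakk> \<Longrightarrow> \<omega> z$i$j = \<omega>' z$i$j"
 shows "ext3 \<omega> i j k y = ext3 \<omega>' i j k y"
 unfolding ext3_def
 using pd_cong[OF assms(1,2,3), of "\<lambda>z. \<omega> z$j$k" "\<lambda>z. \<omega>' z$j$k"] pd_cong[OF assms(1,2,4), of "\<lambda>z. \<omega> z$k$i" "\<lambda>z. \<omega>' z$k$i"]
  pd_cong[OF assms(1,2,5), of "\<lambda>z. \<omega> z$i$j" "\<lambda>z. \<omega>' z$i$j"] assms(3-6) by simp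

lemma trilinear_zero:
 assumes "\<And>v w. linear (\<lambda>u. F u v w)" "\<And>u w. linear (\<lambda>v. F u v w)" "\<And>u v. linear (\<lambda>w. F u v w)"
  and "\<And>i j k. \<lbrakk>i \<in> I; j \<in> I; k \<in> I\<rbrakk> \<Longrightarrow> F (P i) (P j) (P k) = 0"
 shows "F (\<Sum>i\<in>I. r i *\<^sub>R P i) (\<Sum>i\<in>I. s i *\<^sub>R P i) (\<Sum>i\<in>I. t i *\<^sub>R P i) = 0"
 unfolding linear_sum[OF assms(1)] linear_sum[OF assms(2)] linear_sum[OF assms(3)] linear_scale[OF assms(1)] linear_scale[OF assms(2)] linear_scale[OF assms(3)]
 by (simp add: assms(4))

text \<open>\<open>d\<omega>\<close> as a trilinear form.\<close>

definition ext3v :: "'k::finite set \<Rightarrow> (real^'k \<Rightarrow> real^'k^'k) \<Rightarrow> real^'k \<Rightarrow> real^'k \<Rightarrow> real^'k \<Rightarrow> real^'k \<Rightarrow> real" where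
 "ext3v K \<omega> z u v w = (\<Sum>c\<in>K. u$c * bil (pd c \<omega> z) v w + v$c * bil (pd c \<omega> z) w u + w$c * bil (pd c \<omega> z) u v)"

lemma ext3v_linear: "linear (\<lambda>u. ext3v K \<omega> z u v w)" "linear (\<lambda>v. ext3v K \<omega> z u v w)" "linear (ext3v K \<omega> z u v)"
 unfolding linear_iff ext3v_def
 by (simp_all add: bil_def inner_add_left inner_add_right matrix_vector_right_distrib matrix_vector_mult_scaleR sum.distrib sum_distrib_left algebra_simps)

lemma ext3v_axis:
 assumes V: "ropen K V" "smooth K V \<omega>" "z \<in> V" and "a \<in> K" "b \<in> K" "c \<in> K"
 shows "ext3v K \<omega> z (axis a 1) (axis b 1) (axis c 1) = ext3 \<omega> a b c z"
 using assms(4-6) unfolding ext3v_def ext3_def sum.distrib bil_axis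
 by (simp add: axis_def if_distrib[of "\<lambda>x. x * _"] pd_nth2[OF V(1,2) _ V(3)] cong: if_cong)

lemma ext3v_zero:
 assumes V: "ropen K V" "smooth K V \<omega>" "z \<in> V" and "\<And>a b c. \<lbrakk>a \<in> K; b \<in> K; c \<in> K\<rbrakk> \<Longrightarrow> ext3 \<omega> a b c z = 0" "u \<in> coord K" "v \<in> coord K" "w \<in> coord K"
 shows "ext3v K \<omega> z u v w = 0"
 using trilinear_zero[of "ext3v K \<omega> z" K "\<lambda>i. axis i 1" "\<lambda>i. u$i" "\<lambda>i. v$i" "\<lambda>i. w$i"] ext3v_linear[of K \<omega> z] ext3v_axis[OF V] assms(4)
 unfolding coord_expand[OF assms(5), symmetric] coord_expand[OF assms(6), symmetric] coord_expand[OF assms(7), symmetric] by simp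

text \<open>Exterior differentiation commutes with pullback: the terms \<open>S i j\<close> with
  second derivatives of \<open>f\<close> cancel in the cyclic sum by antisymmetry of
  \<omega>.\<close>

lemma ext3_pullback:
 fixes f :: "real^'n \<Rightarrow> real^'k"
 assumes U: "ropen I U" and V: "ropen K V" and f: "smooth I U f" and fU: "f ` U \<subseteq> V" and \<omega>: "smooth K V \<omega>"
  and anti: "\<And>z a b. \<lbrakk>z \<in> V; a \<in> K; b \<in> K\<rbrakk> \<Longrightarrow> \<omega> z$a$b = - \<omega> z$b$a"
  and y: "y \<in> U" and ijk: "i \<in> I" "j \<in> I" "k \<in> I"
 shows "ext3 (\<lambda>y. transpose (jac I f y)**\<omega> (f y)**jac I f y) i j k y = ext3v K \<omega> (f y) (pd i f y) (pd j f y) (pd k f y)"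
proof -
 define P where "P = jac I f"
 define S where "S i j = pd i (pd j f) y" for i j
 have fc: "f ` U \<subseteq> coord K" using fU openin_imp_subset[OF V] by blast
 have fy: "f y \<in> V" using fU y by auto
 have sP: "smooth I U P" unfolding P_def by (rule smooth_jac[OF U f])
 have s\<omega>: "smooth I U (\<lambda>y. \<omega> (f y))" by (rule smooth_compose[OF U V fU f \<omega>])
 have Pa: "P y *v axis j 1 = pd j f y" if "j \<in> I" for j
  using that by (simp add: P_def matrix_vector_mult_basis column_def jac_nth)
 have dP: "pd i P y *v axis j 1 = S i j" if "i \<in> I" "j \<in> I" for i j
  using pd_nth2[OF U sP that(1) y, symmetric] pd_nth[OF U smooth_pd[OF f that(2)] that(1) y] that
  by (simp add: vec_eq_iff matrix_vector_mult_basis column_def P_def jac_nth S_def)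
 have c: "pd j f y \<in> coord K" "S i j \<in> coord K" if "i \<in> I" "j \<in> I" for i j
  unfolding Pa[OF that(2), symmetric] dP[OF that, symmetric] P_def
  by (rule blk_mv_coord, rule blk_jac[OF U f fc y], rule blk_mv_coord, rule pd_blk[OF U blk_jac[OF U f fc] smooth_jac[OF U f] that(1) y])
 have a: "bil (\<omega> (f y)) v w = - bil (\<omega> (f y)) w v" if "v \<in> coord K" "w \<in> coord K" for v w
  unfolding bil_coord[OF that] bil_coord[OF that(2,1)] sum_negf[symmetric]
  by (subst sum.swap, intro sum.cong refl, subst anti[OF fy]) simp_all
 have S: "S i j = S j i" if "i \<in> I" "j \<in> I" for i j unfolding S_def by (rule smooth_pd_commute[OF U f that y])
 have d: "pd i (\<lambda>y. (transpose (P y)**\<omega> (f y)**P y)$j$k) y = bil (\<omega> (f y)) (S i j) (pd k f y) - bil (\<omega> (f y)) (S i k) (pd j f y)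
  + (\<Sum>c\<in>K. pd i f y$c * bil (pd c \<omega> (f y)) (pd j f y) (pd k f y))" if "i \<in> I" "j \<in> I" "k \<in> I" for i j k
 proof -
  note st = smooth_transpose[OF U sP] and sm = smooth_mm[OF U smooth_transpose[OF U sP] s\<omega>]
  have "pd i (\<lambda>y. (transpose (P y)**\<omega> (f y)**P y)$j$k) y = (transpose (P y)**\<omega> (f y)**pd i P y
   + (transpose (P y)**(\<Sum>c\<in>K. pd i f y$c *\<^sub>R pd c \<omega> (f y)) + transpose (pd i P y)**\<omega> (f y))**P y)$j$k"
   unfolding pd_nth2[OF U smooth_mm[OF U sm sP] that(1) y] pd_mm[OF U sm sP that(1) y] pd_mm[OF U st s\<omega> that(1) y]
    pd_transpose[OF U sP that(1) y] pd_compose[OF U V fU f \<omega> that(1) y] ..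
  also have "\<dots> = bil (\<omega> (f y)) (pd j f y) (S i k) + (\<Sum>c\<in>K. pd i f y$c * bil (pd c \<omega> (f y)) (pd j f y) (pd k f y)) + bil (\<omega> (f y)) (S i j) (pd k f y)"
   unfolding bil_axis[symmetric] mm_ring(1,2) bil_add bil_congruence bil_sum_scale Pa[OF that(2)] Pa[OF that(3)] dP[OF that(1,2)] dP[OF that(1,3)] by simp
  finally show ?thesis using a[OF c(1)[OF that(1,2)] c(2)[OF that(1,3)]] by simp
 qed
 show ?thesis
  unfolding ext3_def P_def[symmetric] d[OF ijk] d[OF ijk(2,3,1)] d[OF ijk(3,1,2)] ext3v_def sum.distrib
  using S[OF ijk(1,2)] S[OF ijk(2,3)] S[OF ijk(3,1)] by simp
qed

subsection \<open>Smooth functions of one variable\<close>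

text \<open>Real functions are viewed as functions on \<open>real ^ 1\<close>; the closure
  properties of \<open>smooth\<close> then pass to \<open>smooth1\<close>.\<close>

abbreviation strip :: "real set \<Rightarrow> (real ^ 1) set" where
 "strip S \<equiv> {y. y$1 \<in> S}"

lemma ropen_strip: "open S \<Longrightarrow> ropen UNIV (strip S)"
 using continuous_open_preimage[OF linear_continuous_on[OF bounded_linear_vec_nth] open_UNIV, of S 1]
 by (simp add: coord_def vimage_def)

lemma smooth1_strip: assumes S: "open S" shows "smooth1 S \<phi> \<longleftrightarrow> smooth UNIV (strip S) (\<lambda>y. \<phi> (y$1))"
proof
 have "smooth UNIV (strip S) (\<lambda>y. y$1)" unfolding smooth_def
 proof
  fix r show "Ck r UNIV (strip S) (\<lambda>y. y$1)"
  proof (cases r)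
   case (Suc n)
   show ?thesis unfolding Suc
    by (rule Ck_Suc[where f' = "\<lambda>_ _. 1", OF linear_continuous_on[OF bounded_linear_vec_nth] _ Ck_const[OF ropen_strip[OF S]] ropen_strip[OF S]])
     (auto simp: pds_def axis_def num1_eq1 intro!: derivative_eq_intros)
  qed (simp add: linear_continuous_on[OF bounded_linear_vec_nth])
 qed
 then show "smooth UNIV (strip S) (\<lambda>y. \<phi> (y$1))" if "smooth1 S \<phi>"
  using smooth_real_compose[OF ropen_strip[OF S] S _ _ that] by blast
next
 assume a: "smooth UNIV (strip S) (\<lambda>y. \<phi> (y$1))"
 show "smooth1 S \<phi>"
 proof (rule smooth1_coinduct[OF S, where R = "\<lambda>\<phi>. \<exists>F. smooth UNIV (strip S) F \<and> \<phi> = (\<lambda>t. F (shift 0 1 t))"])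
  show "\<exists>F. smooth UNIV (strip S) F \<and> \<phi> = (\<lambda>t. F (shift 0 1 t))" using a by (intro exI[of _ "\<lambda>y. \<phi> (y$1)"]) simp
  fix \<phi> :: "real \<Rightarrow> real" assume "\<exists>F. smooth UNIV (strip S) F \<and> \<phi> = (\<lambda>t. F (shift 0 1 t))"
  then obtain F where F: "smooth UNIV (strip S) F" "\<phi> = (\<lambda>t. F (shift 0 1 t))" by blast
  have "(\<phi> has_real_derivative pd 1 F (shift 0 1 t)) (at t)" if "t \<in> S" for t
   unfolding F(2) has_real_derivative_iff_has_vector_derivative using that by (intro pds_shift smooth_pds[OF F(1)]) auto
  then show "\<exists>\<phi>'. (\<exists>F. smooth UNIV (strip S) F \<and> \<phi>' = (\<lambda>t. F (shift 0 1 t))) \<and> (\<forall>t\<in>S. (\<phi> has_real_derivative \<phi>' t) (at t))"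
   using smooth_pd[OF F(1), of 1] by blast
 qed
qed

context
 fixes S :: "real set" assumes S: "open S"
begin

lemma smooth1_const: "smooth1 S (\<lambda>t. c)"
 unfolding smooth1_strip[OF S] by (rule smooth_const[OF ropen_strip[OF S]])

lemma smooth1_integral:
 assumes d: "\<And>t. t \<in> S \<Longrightarrow> (\<phi> has_real_derivative \<phi>' t) (at t)" and s: "smooth1 S \<phi>'"
 shows "smooth1 S \<phi>"
 by (rule smooth1_coinduct[OF S, where R = "\<lambda>\<psi>. \<psi> = \<phi> \<or> smooth1 S \<psi>"])
  (use d s smooth1_deriv smooth1_has_derivative[OF _ S] in blast)+

lemma smooth1_ident: "smooth1 S (\<lambda>t. t)"
 by (rule smooth1_integral[OF DERIV_ident smooth1_const])

lemma smooth1_add: "smooth1 S \<phi> \<Longrightarrow> smooth1 S \<psi> \<Longrightarrow> smooth1 S (\<lambda>t. \<phi> t + \<psi> t)"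
 unfolding smooth1_strip[OF S] by (rule smooth_add[OF ropen_strip[OF S]])

lemma smooth1_mult: "smooth1 S \<phi> \<Longrightarrow> smooth1 S \<psi> \<Longrightarrow> smooth1 S (\<lambda>t. \<phi> t * \<psi> t)"
 unfolding smooth1_strip[OF S] by (rule smooth_mult[OF ropen_strip[OF S]])

lemma smooth1_diff: "smooth1 S \<phi> \<Longrightarrow> smooth1 S \<psi> \<Longrightarrow> smooth1 S (\<lambda>t. \<phi> t - \<psi> t)"
 unfolding smooth1_strip[OF S] by (rule smooth_diff[OF ropen_strip[OF S]])

lemma smooth1_sum: "(\<And>i. i \<in> A \<Longrightarrow> smooth1 S (\<phi> i)) \<Longrightarrow> smooth1 S (\<lambda>t. \<Sum>i\<in>A. \<phi> i t)"
 unfolding smooth1_strip[OF S] by (rule smooth_sum[OF ropen_strip[OF S]])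

lemma smooth1_divide: "smooth1 S \<phi> \<Longrightarrow> smooth1 S \<psi> \<Longrightarrow> (\<And>t. t \<in> S \<Longrightarrow> \<psi> t \<noteq> 0) \<Longrightarrow> smooth1 S (\<lambda>t. \<phi> t / \<psi> t)"
 unfolding smooth1_strip[OF S] by (rule smooth_divide[OF ropen_strip[OF S]]) auto

lemma smooth1_compose: "\<lbrakk>open T; smooth1 T \<phi>; smooth1 S \<psi>; \<psi> ` S \<subseteq> T\<rbrakk> \<Longrightarrow> smooth1 S (\<lambda>t. \<phi> (\<psi> t))"
 unfolding smooth1_strip[OF S] by (rule smooth_real_compose[OF ropen_strip[OF S]]) auto

lemma smooth1_exp: assumes "smooth1 S \<phi>" shows "smooth1 S (\<lambda>t. exp (\<phi> t))"
proof (rule smooth1_compose[OF open_UNIV _ assms])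
 show "smooth1 UNIV exp" by (rule smooth1_coinduct[where R = "\<lambda>\<phi>. \<phi> = exp"]) auto
qed simp

end

lemmas smooth1_intros = smooth1_const smooth1_ident smooth1_add smooth1_mult smooth1_diff smooth1_sum smooth1_exp smooth1_divide

lemma smooth1_subset: "smooth1 S \<phi> \<Longrightarrow> T \<subseteq> S \<Longrightarrow> smooth1 T \<phi>"
 unfolding smooth1_def using differentiable_on_subset by blast

lemma smooth_closed_interval_iff: "smooth_closed_interval l u h \<longleftrightarrow> (\<exists>S. open S \<and> {l..u} \<subseteq> S \<and> smooth1 S h)"
 unfolding smooth_closed_interval_def smooth1_def ..

lemma open_interval_nbhd:
 fixes l u :: real
 assumes "open S" "{l..u} \<subseteq> S" "l \<le> u"
 obtains p q where "p < l" "u < q" "{p..q} \<subseteq> S"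
proof -
 obtain e1 where e1: "e1 > 0" "ball l e1 \<subseteq> S" using assms by (meson atLeastAtMost_iff open_contains_ball order_refl subsetD)
 obtain e2 where e2: "e2 > 0" "ball u e2 \<subseteq> S" using assms by (meson atLeastAtMost_iff open_contains_ball order_refl subsetD)
 have "{l - e1/2..u + e2/2} \<subseteq> S"
 proof
  fix t assume t: "t \<in> {l - e1/2..u + e2/2}"
  consider "t < l" | "t \<in> {l..u}" | "t > u" by fastforce
  then show "t \<in> S"
  proof cases
   case 1
   then have "t \<in> ball l e1" using t e1 by (simp add: dist_real_def)
   then show ?thesis using e1 by blast
  next
   case 3
   then have "t \<in> ball u e2" using t e2 by (simp add: dist_real_def)
   then show ?thesis using e2 by blast
  qed (use assms in auto)
 qed
 then show thesis using that[of "l - e1/2" "u + e2/2"] e1 e2 by simp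
qed

lemma antiderivative_smooth1:
 assumes w: "continuous_on {p..q} w" "smooth1 {p<..<q} w" and c: "p < c" "c < q"
 obtains F where "continuous_on {p..q} F" "smooth1 {p<..<q} F" "\<And>t. t \<in> {p<..<q} \<Longrightarrow> (F has_real_derivative w t) (at t)" "F c = 0"
proof -
 define F where "F t = integral {p..t} w - integral {p..c} w" for t
 have F: "(F has_real_derivative w t) (at t within {p..q})" if "t \<in> {p..q}" for t
  unfolding F_def using integral_has_real_derivative[OF w(1) that] by (auto intro!: derivative_eq_intros)
 have d: "(F has_real_derivative w t) (at t)" if t: "t \<in> {p<..<q}" for t
  using DERIV_subset[OF F, of t "{p<..<q}"] t at_within_open[of t "{p<..<q}"] by fastforce
 have "continuous_on {p..q} F" using F by (meson DERIV_continuous continuous_on_eq_continuous_within)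
 then show thesis by (rule that[OF _ smooth1_integral[OF open_greaterThanLessThan d w(2)] d]) (simp_all add: F_def)
qed

subsection \<open>Division by a linear factor\<close>

text \<open>Each differentiation under the integral sign brings out a factor s. The class for the
  coinduction therefore contains all powers of s in front of \<open>F\<close>.\<close>

lemma smooth1_param_integral:
 assumes F: "smooth1 {p<..<q} F" and c: "c \<in> {p<..<q}"
 shows "smooth1 {p<..<q} (\<lambda>t. integral {0..1} (\<lambda>s. F (c + s * (t - c))))"
proof (rule smooth1_coinduct[where R = "\<lambda>\<phi>. \<exists>n F. smooth1 {p<..<q} F \<and> \<phi> = (\<lambda>t. integral {0..1} (\<lambda>s. s ^ n * F (c + s * (t - c))))"])
 show "\<exists>n F'. smooth1 {p<..<q} F' \<and> (\<lambda>t. integral {0..1} (\<lambda>s. F (c + s * (t - c)))) = (\<lambda>t. integral {0..1} (\<lambda>s. s ^ n * F' (c + s * (t - c))))"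
  using F by (intro exI[of _ 0] exI[of _ F]) simp
 fix \<phi> assume "\<exists>n F. smooth1 {p<..<q} F \<and> \<phi> = (\<lambda>t. integral {0..1} (\<lambda>s. s ^ n * F (c + s * (t - c))))"
 then obtain n F where F: "smooth1 {p<..<q} F" and \<phi>: "\<phi> = (\<lambda>t. integral {0..1} (\<lambda>s. s ^ n * F (c + s * (t - c))))" by blast
 have in_: "c + s * (t - c) \<in> {p<..<q}" if "s \<in> {0..1}" "t \<in> {p<..<q}" for s t
  using convexD_alt[OF convex_real_interval(8) c that(2), of s] that(1) by (simp add: algebra_simps)
 have D: "smooth1 {p<..<q} (deriv F)" by (rule smooth1_deriv[OF F])
 have "(\<phi> has_real_derivative integral {0..1} (\<lambda>s. s ^ Suc n * deriv F (c + s * (t - c)))) (at t)" if t: "t \<in> {p<..<q}" for t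
 proof -
  have "((\<lambda>t. integral (cbox 0 1) (\<lambda>s. s ^ n * F (c + s * (t - c)))) has_field_derivative
    integral (cbox 0 1) (\<lambda>s. s ^ Suc n * deriv F (c + s * (t - c)))) (at t within {p<..<q})"
  proof (rule leibniz_rule_field_derivative[OF _ _ _ t convex_real_interval(8)])
   fix x s :: real assume xs: "x \<in> {p<..<q}" "s \<in> cbox 0 1"
   have "(F has_real_derivative deriv F (c + s * (x - c))) (at (c + s * (x - c)))"
    using in_[of s x] xs by (intro smooth1_has_derivative[OF F open_greaterThanLessThan]) auto
   then have "((\<lambda>x. F (c + s * (x - c))) has_real_derivative deriv F (c + s * (x - c)) * s) (at x within {p<..<q})"
    by (rule DERIV_chain2) (auto intro!: derivative_eq_intros)
   then show "((\<lambda>x. s ^ n * F (c + s * (x - c))) has_field_derivative s ^ Suc n * deriv F (c + s * (x - c))) (at x within {p<..<q})"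
    by (auto intro!: derivative_eq_intros)
  next
   fix x :: real assume x: "x \<in> {p<..<q}"
   have "continuous_on (cbox 0 1) (\<lambda>s. s ^ n * F (c + s * (x - c)))"
    by (intro continuous_intros continuous_on_compose2[OF smooth1_continuous_on[OF F]]) (use in_ x in auto)
   then show "(\<lambda>s. s ^ n * F (c + s * (x - c))) integrable_on cbox 0 1" by (rule integrable_continuous)
  next
   show "continuous_on ({p<..<q} \<times> cbox 0 1) (\<lambda>(x, s). s ^ Suc n * deriv F (c + s * (x - c)))"
    unfolding split_beta
    by (intro continuous_intros continuous_on_compose2[OF smooth1_continuous_on[OF D]]) (use in_ in auto)
  qed
  then show ?thesis unfolding \<phi> using t at_within_open[of t "{p<..<q}"] by simp
 qed
 then show "\<exists>\<phi>'. (\<exists>n F. smooth1 {p<..<q} F \<and> \<phi>' = (\<lambda>t. integral {0..1} (\<lambda>s. s ^ n * F (c + s * (t - c))))) \<and>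
  (\<forall>t\<in>{p<..<q}. (\<phi> has_real_derivative \<phi>' t) (at t))"
  using D by (intro exI[of _ "\<lambda>t. integral {0..1} (\<lambda>s. s ^ Suc n * deriv F (c + s * (t - c)))"]) blast
qed simp

text \<open>The quotient is the mean of F' over the segment from c to t, by the fundamental theorem
  of calculus.\<close>

lemma hadamard:
 assumes F: "smooth1 {p<..<q} F" and c: "c \<in> {p<..<q}" and Fc: "F c = 0"
 obtains g where "smooth1 {p<..<q} g" "\<And>t. t \<in> {p<..<q} \<Longrightarrow> F t = (t - c) * g t"
proof -
 define g where "g t = integral {0..1} (\<lambda>s. deriv F (c + s * (t - c)))" for t
 have g: "smooth1 {p<..<q} g" unfolding g_def by (rule smooth1_param_integral[OF smooth1_deriv[OF F] c])
 have "F t = (t - c) * g t" if t: "t \<in> {p<..<q}" for t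
 proof -
  have "((\<lambda>s. (t - c) * deriv F (c + s * (t - c))) has_integral (F (c + 1 * (t - c)) - F (c + 0 * (t - c)))) {0..1}"
  proof (rule fundamental_theorem_of_calculus)
   fix s :: real assume s: "s \<in> {0..1}"
   have "c + s * (t - c) = (1 - s) * c + s * t" by (simp add: algebra_simps)
   then have "c + s * (t - c) \<in> {p<..<q}" using convexD_alt[OF convex_real_interval(8) c t, of s] s by simp
   then have "(F has_real_derivative deriv F (c + s * (t - c))) (at (c + s * (t - c)))"
    by (rule smooth1_has_derivative[OF F open_greaterThanLessThan])
   then have "((\<lambda>s. F (c + s * (t - c))) has_real_derivative deriv F (c + s * (t - c)) * (t - c)) (at s within {0..1})"
    by (rule DERIV_chain2) (auto intro!: derivative_eq_intros)
   then show "((\<lambda>s. F (c + s * (t - c))) has_vector_derivative (t - c) * deriv F (c + s * (t - c))) (at s within {0..1})"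
    by (simp add: has_real_derivative_iff_has_vector_derivative mult.commute)
  qed simp
  from integral_unique[OF this] show ?thesis using Fc by (simp add: g_def)
 qed
 then show thesis using that g by blast
qed

subsection \<open>Conjugating two momentum profiles\<close>

text \<open>\<open>Z\<close> conjugates the vector field \<open>h d/dt\<close> to \<open>2 z (1 - z) d/dz\<close>.  Since
 \<open>1 / h = 1 / (2 (t - l)) + 1 / (2 (u - t)) + r\<close> with \<open>r\<close> smooth, it is given by
 \<open>Z / (1 - Z) = (t - l) / (u - t) exp (2 \<integral> r)\<close>.\<close>

definition profile :: "real \<Rightarrow> real \<Rightarrow> (real \<Rightarrow> real) \<Rightarrow> bool" where
 "profile l u h \<longleftrightarrow> l < u \<and> smooth_closed_interval l u h \<and> (\<forall>t\<in>{l<..<u}. h t > 0) \<and>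
   h l = 0 \<and> h u = 0 \<and> deriv h l = 2 \<and> deriv h u = - 2"

lemma pos_nbhd:
 assumes H: "smooth1 {p<..<q} H" and lu: "l < u" "p < l" "u < q" and pos: "\<And>t. t \<in> {l..u} \<Longrightarrow> H t > 0"
 obtains p' q' where "p' < l" "u < q'" "{p'..q'} \<subseteq> {p<..<q}" "\<And>t. t \<in> {p'..q'} \<Longrightarrow> H t > 0"
proof -
 have "open ({p<..<q} \<inter> H -` {0<..})"
  using continuous_open_preimage[OF smooth1_continuous_on[OF H] open_greaterThanLessThan open_greaterThan] .
 moreover have "{l..u} \<subseteq> {p<..<q} \<inter> H -` {0<..}" using lu pos by auto
 ultimately obtain p' q' where "p' < l" "u < q'" "{p'..q'} \<subseteq> {p<..<q} \<inter> H -` {0<..}"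
  using open_interval_nbhd lu(1) less_imp_le by metis
 then show thesis by (intro that) auto
qed

lemma hadamard2:
 assumes F: "smooth1 {p<..<q} F" and lu: "l \<in> {p<..<q}" "u \<in> {p<..<q}" "l \<noteq> u" "F l = 0" "F u = 0"
 obtains g where "smooth1 {p<..<q} g" "\<And>t. t \<in> {p<..<q} \<Longrightarrow> F t = (t - l) * (u - t) * g t"
proof -
 obtain g where g: "smooth1 {p<..<q} g" "\<And>t. t \<in> {p<..<q} \<Longrightarrow> F t = (t - l) * g t" using hadamard[OF F lu(1,4)] by blast
 then have "g u = 0" using lu by fastforce
 then obtain k where k: "smooth1 {p<..<q} k" "\<And>t. t \<in> {p<..<q} \<Longrightarrow> g t = (t - u) * k t" using hadamard[OF g(1) lu(2)] by blast
 have "smooth1 {p<..<q} (\<lambda>t. 0 - k t)" by (intro smooth1_intros open_greaterThanLessThan k)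
 then show thesis by (rule that) (use g k in \<open>simp add: algebra_simps\<close>)
qed

lemma smooth1_strict_mono:
 assumes Z: "smooth1 {p<..<q} Z" and pos: "\<And>t. t \<in> {p<..<q} \<Longrightarrow> deriv Z t > 0"
  and st: "s < t" "s \<in> {p<..<q}" "t \<in> {p<..<q}"
 shows "Z s < Z t"
proof (rule DERIV_pos_imp_increasing[OF st(1)])
 fix x assume "s \<le> x" "x \<le> t"
 then have "x \<in> {p<..<q}" using st by auto
 then show "\<exists>y. (Z has_real_derivative y) (at x) \<and> 0 < y"
  using smooth1_has_derivative[OF Z open_greaterThanLessThan] pos by blast
qed

lemma profile_linearize:
 assumes "profile l u h"
 obtains p q Z where "p < l" "u < q" "smooth1 {p<..<q} Z" "Z l = 0" "Z u = 1"
  "\<And>t. t \<in> {p<..<q} \<Longrightarrow> deriv Z t > 0" "\<And>t. t \<in> {l..u} \<Longrightarrow> deriv Z t * h t = 2 * Z t * (1 - Z t)"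
proof -
 have lu: "l < u" and pos: "\<And>t. t \<in> {l<..<u} \<Longrightarrow> h t > 0" and h0: "h l = 0" "h u = 0"
  and dh: "deriv h l = 2" "deriv h u = - 2" using assms by (auto simp: profile_def)
 obtain S where S: "open S" "{l..u} \<subseteq> S" "smooth1 S h" using assms by (auto simp: profile_def smooth_closed_interval_iff)
 obtain p q where pq: "p < l" "u < q" "{p..q} \<subseteq> S" using open_interval_nbhd[OF S(1,2)] lu by auto
 have "{p<..<q} \<subseteq> S" using pq by auto
 then have sh: "smooth1 {p<..<q} h" by (rule smooth1_subset[OF S(3)])
 have O: "open {p<..<q}" by (rule open_greaterThanLessThan)
 have l: "l \<in> {p<..<q}" and u: "u \<in> {p<..<q}" using pq lu by auto
 obtain H where sH: "smooth1 {p<..<q} H" and h: "\<And>t. t \<in> {p<..<q} \<Longrightarrow> h t = (t - l) * (u - t) * H t"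
  using hadamard2[OF sh l u _ h0] lu by auto
 have dh': "deriv h t = (u - t) * H t - (t - l) * H t + (t - l) * (u - t) * deriv H t" if t: "t \<in> {p<..<q}" for t
 proof -
  have "((\<lambda>t. (t - l) * (u - t) * H t) has_real_derivative (u - t) * H t - (t - l) * H t + (t - l) * (u - t) * deriv H t) (at t)"
   by (auto intro!: derivative_eq_intros smooth1_has_derivative[OF sH O t] simp: algebra_simps)
  then have "(h has_real_derivative (u - t) * H t - (t - l) * H t + (t - l) * (u - t) * deriv H t) (at t)"
   by (rule has_field_derivative_transform_within_open[OF _ O t]) (simp add: h)
  then show ?thesis by (rule DERIV_imp_deriv)
 qed
 \<comment> \<open>The prescribed slopes 2 and -2 determine \<open>H\<close> at both ends; this is
   what lets the poles of 1/h be split off exactly.\<close>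
 have Hl: "(u - l) * H l = 2" and Hu: "(u - l) * H u = 2" using dh'[OF l] dh'[OF u] dh by (simp_all add: algebra_simps)
 have Hpos: "H t > 0" if t: "t \<in> {l..u}" for t
 proof -
  consider "t = l" | "t = u" | "t \<in> {l<..<u}" using t by fastforce
  then show ?thesis
  proof cases
   case 1 then show ?thesis using Hl lu zero_less_mult_pos[of "u - l" "H l"] by simp
  next
   case 2 then show ?thesis using Hu lu zero_less_mult_pos[of "u - l" "H u"] by simp
  next
   case 3
   then have "0 < (t - l) * (u - t) * H t" using pos[OF 3] h[of t] pq by simp
   then show ?thesis using zero_less_mult_pos[of "(t - l) * (u - t)" "H t"] 3 by simp
  qed
 qed
 \<comment> \<open>The numerator of 1/h minus its two polar parts. It vanishes at both ends, so it
   absorbs the poles, and the remainder \<open>r\<close> below is smooth.\<close>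
 obtain F where sF: "smooth1 {p<..<q} F" and F: "\<And>t. t \<in> {p<..<q} \<Longrightarrow> 2 - (u - l) * H t = (t - l) * (u - t) * F t"
 proof (rule hadamard2[OF _ l u])
  show "smooth1 {p<..<q} (\<lambda>t. 2 - (u - l) * H t)" by (intro smooth1_intros O sH)
 qed (use lu Hl Hu that in auto)
 obtain p1 q1 where pq1: "p1 < l" "u < q1" and sub2: "{p1..q1} \<subseteq> {p<..<q}" and H1: "\<And>t. t \<in> {p1..q1} \<Longrightarrow> H t > 0"
  using pos_nbhd[OF sH lu pq(1,2) Hpos] by metis
 have sub: "{p1<..<q1} \<subseteq> {p<..<q}" using sub2 by (meson greaterThanLessThan_subseteq_atLeastAtMost_iff order_refl order_trans)
 have O1: "open {p1<..<q1}" by simp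
 have Hn: "H t \<noteq> 0" if "p1 \<le> t" "t \<le> q1" for t using H1[of t] that by simp
 define r where "r t = F t / (2 * H t)" for t
 have r: "smooth1 {p1<..<q1} r" unfolding r_def
  by (intro smooth1_intros O1 smooth1_subset[OF sF] smooth1_subset[OF sH] sub) (simp add: Hn)
 have rc: "continuous_on {p1..q1} r" unfolding r_def
  by (intro continuous_intros continuous_on_subset[OF smooth1_continuous_on[OF sF]] continuous_on_subset[OF smooth1_continuous_on[OF sH]] sub2) (simp add: Hn)
 obtain R where R: "smooth1 {p1<..<q1} R" "\<And>t. t \<in> {p1<..<q1} \<Longrightarrow> (R has_real_derivative r t) (at t)"
  using antiderivative_smooth1[OF rc r pq1(1)] pq1 lu by (metis order_less_trans)
 define E where "E t = exp (2 * R t)" for t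
 have sE: "smooth1 {p1<..<q1} E" unfolding E_def by (intro smooth1_intros O1 R)
 \<comment> \<open>Solving Z / (1 - Z) = (t - l) E / (u - t) for Z gives the denominator D, positive
   on the whole closed interval.\<close>
 define D where "D t = (u - t) + (t - l) * E t" for t
 have sD: "smooth1 {p1<..<q1} D" unfolding D_def
  by (intro smooth1_intros O1 sE)
 have Dpos: "D t > 0" if t: "t \<in> {l..u}" for t
 proof (cases "t = l")
  case True then show ?thesis using lu by (simp add: D_def)
 next
  case False
  then have "(t - l) * E t > 0" using t by (simp add: E_def)
  then show ?thesis using t by (simp add: D_def add_nonneg_pos)
 qed
 obtain p2 q2 where pq2: "p2 < l" "u < q2" and "{p2..q2} \<subseteq> {p1<..<q1}" "\<And>t. t \<in> {p2..q2} \<Longrightarrow> D t > 0"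
  using pos_nbhd[OF sD lu pq1 Dpos] by metis
 then have sub2: "{p2<..<q2} \<subseteq> {p1<..<q1}" and D2: "\<And>t. t \<in> {p2<..<q2} \<Longrightarrow> D t > 0" by (auto simp: subset_iff)
 have O2: "open {p2<..<q2}" by simp
 define Z where "Z t = (t - l) * E t / D t" for t
 have sZ: "smooth1 {p2<..<q2} Z" unfolding Z_def
 proof (intro smooth1_intros O2
 smooth1_subset[OF sE] smooth1_subset[OF sD] sub2)
  fix t assume "t \<in> {p2<..<q2}" then show "D t \<noteq> 0" using D2 by force
 qed
 have dZ: "deriv Z t = 2 * E t / (H t * (D t)\<^sup>2)" if t: "t \<in> {p2<..<q2}" for t
 proof -
  have t1: "t \<in> {p1<..<q1}" using t sub2 by auto
  have t0: "t \<in> {p<..<q}" using t1 sub by auto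
  have Hn: "H t > 0" using H1[of t] t1 by simp
  have Dn: "D t > 0" using D2[OF t] .
  define e where "e = E t"
  define rr where "rr = r t"
  have dE: "(E has_real_derivative e * (2 * rr)) (at t)"
   unfolding E_def e_def rr_def by (rule derivative_eq_intros refl R(2)[OF t1])+ simp
  have dN: "((\<lambda>t. (t - l) * E t) has_real_derivative e + (t - l) * (e * (2 * rr))) (at t)"
   by (rule derivative_eq_intros refl dE)+ (simp add: e_def)
  have dD: "(D has_real_derivative - 1 + (e + (t - l) * (e * (2 * rr)))) (at t)"
   unfolding D_def by (rule derivative_eq_intros refl dN)+ simp
  have "(Z has_real_derivative ((e + (t - l) * (e * (2 * rr))) * D t - ((t - l) * E t) * (- 1 + (e + (t - l) * (e * (2 * rr))))) / (D t * D t)) (at t)"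
   unfolding Z_def by (rule DERIV_divide[OF dN dD]) (use Dn in simp)
  then have "deriv Z t = ((e + (t - l) * (e * (2 * rr))) * D t - ((t - l) * e) * (- 1 + (e + (t - l) * (e * (2 * rr))))) / (D t * D t)"
   unfolding e_def[symmetric] by (rule DERIV_imp_deriv)
  also have "(e + (t - l) * (e * (2 * rr))) * D t - ((t - l) * e) * (- 1 + (e + (t - l) * (e * (2 * rr)))) = e * ((u - l) + (t - l) * (u - t) * (2 * rr))"
   unfolding D_def e_def[symmetric] by (simp add: algebra_simps)
  also have "(u - l) + (t - l) * (u - t) * (2 * rr) = 2 / H t"
  proof -
   have "2 * rr = F t / H t" unfolding rr_def r_def using Hn by (simp add: field_simps)
   then have "(t - l) * (u - t) * (2 * rr) = ((t - l) * (u - t) * F t) / H t" by simp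
   also have "\<dots> = (2 - (u - l) * H t) / H t" using F[OF t0] by simp
   finally show ?thesis using Hn by (simp add: field_simps)
  qed
  finally show ?thesis by (simp add: e_def power2_eq_square)
 qed
 show thesis
 proof (rule that[OF pq2(1,2) sZ])
  show "Z l = 0" by (simp add: Z_def)
  show "Z u = 1" using Dpos[of u] lu by (simp add: Z_def D_def E_def)
  show "deriv Z t > 0" if t: "t \<in> {p2<..<q2}" for t
  proof -
   have "t \<in> {p1..q1}" using t sub2 by auto
   then show ?thesis unfolding dZ[OF t] using H1[of t] D2[OF t] by (simp add: E_def)
  qed
  show "deriv Z t * h t = 2 * Z t * (1 - Z t)" if t: "t \<in> {l..u}" for t
  proof -
   have t2: "t \<in> {p2<..<q2}" and t0: "t \<in> {p<..<q}" using t pq2 pq by auto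
   have Hn: "H t > 0" using Hpos[OF t] .
   have Dn: "D t > 0" using Dpos[OF t] .
   have e1: "1 - Z t = (u - t) / D t" using Dn by (simp add: Z_def field_simps D_def)
   show ?thesis unfolding dZ[OF t2] h[OF t0] e1 unfolding Z_def using Hn Dn by (simp add: power2_eq_square)
  qed
 qed
qed

lemma smooth1_inverse_function:
 assumes Z: "smooth1 {p<..<q} Z" and pos: "\<And>t. t \<in> {p<..<q} \<Longrightarrow> deriv Z t > 0"
 obtains W where "open (Z ` {p<..<q})" "smooth1 (Z ` {p<..<q}) W" "\<And>t. t \<in> {p<..<q} \<Longrightarrow> W (Z t) = t"
  "\<And>s. s \<in> Z ` {p<..<q} \<Longrightarrow> (W has_real_derivative inverse (deriv Z (W s))) (at s)"
proof -
 have O: "open {p<..<q}" by simp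
 note dZ = smooth1_has_derivative[OF Z O]
 note mono = smooth1_strict_mono[OF Z pos]
 have inj: "inj_on Z {p<..<q}"
 proof (rule inj_onI)
  fix x y assume "x \<in> {p<..<q}" "y \<in> {p<..<q}" "Z x = Z y"
  then show "x = y" using mono[of x y] mono[of y x] by (cases x y rule: linorder_cases) auto
 qed
 have opn: "open (Z ` T)" if "open T" "T \<subseteq> {p<..<q}" for T
  using injective_eq_1d_open_map_UNIV[OF smooth1_continuous_on[OF Z] is_interval_oo] inj that by blast
 define W where "W = inv_into {p<..<q} Z"
 have W: "W (Z t) = t" if "t \<in> {p<..<q}" for t unfolding W_def by (rule inv_into_f_f[OF inj that])
 have dW: "(W has_real_derivative inverse (deriv Z (W s))) (at s)" if s: "s \<in> Z ` {p<..<q}" for s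
 proof -
  obtain t where t: "t \<in> {p<..<q}" "s = Z t" using s by auto
  have os: "open (Z ` {p<..<q})" by (rule opn[OF O]) simp
  obtain e where e: "e > 0" "ball s e \<subseteq> Z ` {p<..<q}" using os s open_contains_ball by metis
  define d where "d = min (t - p) (q - t) / 2"
  have d: "d > 0" using t by (simp add: d_def)
  have near: "z \<in> {p<..<q}" if "\<bar>z - t\<bar> \<le> d" for z
  proof -
   have "d \<le> (t - p) / 2" "d \<le> (q - t) / 2" unfolding d_def by auto
   moreover have "z - t \<le> d" "t - z \<le> d" using that by (auto simp: abs_le_iff)
   ultimately have "p < z" "z < q" using t d by (simp_all add: field_simps)
   then show ?thesis by simp
  qed
  have cont: "isCont W s" unfolding t(2)
  proof (rule isCont_inverse_function[OF d, where f = Z and x = t])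
   show "W (Z z) = z" if "\<bar>z - t\<bar> \<le> d" for z using W near that by blast
   show "isCont Z z" if "\<bar>z - t\<bar> \<le> d" for z using DERIV_isCont[OF dZ[OF near[OF that]]] .
  qed
  have ds: "(Z has_real_derivative deriv Z (W s)) (at (W s))" using dZ t W by simp
  show ?thesis
  proof (rule DERIV_inverse_function[where f = Z and g = W and x = s and a = "s - e" and b = "s + e", OF ds])
   show "deriv Z (W s) \<noteq> 0" using pos[OF t(1)] t W by simp
   show "Z (W y) = y" if "s - e < y" "y < s + e" for y
   proof -
    have "y \<in> ball s e" using that by (simp add: dist_real_def)
    then have "y \<in> Z ` {p<..<q}" using e by blast
    then show ?thesis unfolding W_def by (rule f_inv_into_f)
   qed
  qed (use e cont in auto)
 qed
 have os: "open (Z ` {p<..<q})" by (rule opn[OF O]) simp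
 have "smooth1 (Z ` {p<..<q}) W"
 \<comment> \<open>The derivative of the inverse function is itself a smooth function of
   \<open>W\<close>, so composites with \<open>W\<close> are closed under differentiation.\<close>
 proof (rule smooth1_coinduct[OF os, where R = "\<lambda>\<phi>. \<exists>f. smooth1 {p<..<q} f \<and> \<phi> = (\<lambda>s. f (W s))"])
  show "\<exists>f. smooth1 {p<..<q} f \<and> W = (\<lambda>s. f (W s))" using smooth1_ident[OF O] by blast
  fix \<phi> assume "\<exists>f. smooth1 {p<..<q} f \<and> \<phi> = (\<lambda>s. f (W s))"
  then obtain f where f: "smooth1 {p<..<q} f" "\<phi> = (\<lambda>s. f (W s))" by blast
  have "smooth1 {p<..<q} (\<lambda>t. deriv f t / deriv Z t)" using pos
   by (intro smooth1_intros O smooth1_deriv f Z) force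
  moreover have "(\<phi> has_real_derivative deriv f (W s) / deriv Z (W s)) (at s)" if "s \<in> Z ` {p<..<q}" for s
   using DERIV_chain2[OF smooth1_has_derivative[OF f(1) O] dW[OF that]] W that unfolding f(2) divide_inverse by auto
  ultimately show "\<exists>\<phi>'. (\<exists>f. smooth1 {p<..<q} f \<and> \<phi>' = (\<lambda>s. f (W s))) \<and> (\<forall>s\<in>Z ` {p<..<q}. (\<phi> has_real_derivative \<phi>' s) (at s))" by blast
 qed
 then show thesis using that os W dW by blast
qed

text \<open>Both profiles are conjugate to 2 z (1 - z), so \<open>\<psi>\<close> is the
  linearization of one followed by the inverse of the linearization of the other.\<close>

lemma profile_conjugate:
 assumes h: "profile l u h" and k: "profile 0 1 k"
 obtains T \<psi> where "open T" "{l..u} \<subseteq> T" "smooth1 T \<psi>" "\<psi> l = 0" "\<psi> u = 1"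
  "\<And>t. t \<in> {l..u} \<Longrightarrow> deriv \<psi> t > 0" "\<And>t. t \<in> {l..u} \<Longrightarrow> k (\<psi> t) = deriv \<psi> t * h t"
proof -
 have lu: "l < u" using h by (simp add: profile_def)
 obtain p q Z where Z: "p < l" "u < q" "smooth1 {p<..<q} Z" "Z l = 0" "Z u = 1"
  "\<And>t. t \<in> {p<..<q} \<Longrightarrow> deriv Z t > 0" "\<And>t. t \<in> {l..u} \<Longrightarrow> deriv Z t * h t = 2 * Z t * (1 - Z t)"
  using profile_linearize[OF h] by metis
 obtain p' q' Y where Y: "p' < 0" "1 < q'" "smooth1 {p'<..<q'} Y" "Y 0 = 0" "Y 1 = 1"
  "\<And>t. t \<in> {p'<..<q'} \<Longrightarrow> deriv Y t > 0" "\<And>t. t \<in> {0..1} \<Longrightarrow> deriv Y t * k t = 2 * Y t * (1 - Y t)"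
  using profile_linearize[OF k] by metis
 obtain W where W: "open (Y ` {p'<..<q'})" "smooth1 (Y ` {p'<..<q'}) W" "\<And>t. t \<in> {p'<..<q'} \<Longrightarrow> W (Y t) = t"
  "\<And>s. s \<in> Y ` {p'<..<q'} \<Longrightarrow> (W has_real_derivative inverse (deriv Y (W s))) (at s)"
  using smooth1_inverse_function[OF Y(3,6)] by metis
 have O: "open {p<..<q}" "open {p'<..<q'}" by auto
 have onto: "\<exists>t\<in>{0..1}. Y t = s" if s: "s \<in> {0..1}" for s
  using IVT'[of Y 0 s 1] s Y(1,2,4,5) continuous_on_subset[OF smooth1_continuous_on[OF Y(3)], of "{0..1}"] by force
 note mono = smooth1_strict_mono[OF Z(3,6)]
 have Z01: "Z t \<in> {0..1}" if "t \<in> {l..u}" for t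
  using that mono[of l t] mono[of t u] Z(1,2,4,5) lu by (cases "t = l"; cases "t = u") auto
 have sub: "{0..1} \<subseteq> Y ` {p'<..<q'}" using onto Y(1,2) by force
 define T where "T = {t \<in> {p<..<q}. Z t \<in> Y ` {p'<..<q'}}"
 have T: "open T"
 proof -
  have "T = {p<..<q} \<inter> Z -` (Y ` {p'<..<q'})" by (auto simp: T_def)
  then show ?thesis using continuous_open_preimage[OF smooth1_continuous_on[OF Z(3)] O(1) W(1)] by simp
 qed
 have luT: "{l..u} \<subseteq> T"
 proof
  fix t assume t: "t \<in> {l..u}"
  then have "Z t \<in> Y ` {p'<..<q'}" by (rule subsetD[OF sub Z01])
  then show "t \<in> T" using t Z(1,2) by (simp add: T_def)
 qed
 define \<psi> where "\<psi> t = W (Z t)" for t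
 have s\<psi>: "smooth1 T \<psi>" unfolding \<psi>_def
  by (rule smooth1_compose[OF T W(1,2) smooth1_subset[OF Z(3)]]) (auto simp: T_def)
 have d\<psi>: "deriv \<psi> t = deriv Z t / deriv Y (\<psi> t)" if "t \<in> T" for t
 proof -
  have "(\<psi> has_real_derivative inverse (deriv Y (W (Z t))) * deriv Z t) (at t)"
   unfolding \<psi>_def by (rule DERIV_chain2[OF W(4) smooth1_has_derivative[OF Z(3) O(1)]]) (use that in \<open>auto simp: T_def\<close>)
  then show ?thesis using DERIV_imp_deriv by (fastforce simp: \<psi>_def field_simps)
 qed
 have Y\<psi>: "\<psi> t \<in> {0..1} \<and> Y (\<psi> t) = Z t" if t: "t \<in> {l..u}" for t
 proof -
  obtain s where "s \<in> {0..1}" "Y s = Z t" using onto[OF Z01[OF t]] by blast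
  moreover from this have "\<psi> t = s" using W(3)[of s] Y(1,2) by (simp add: \<psi>_def)
  ultimately show ?thesis by simp
 qed
 show thesis
 proof (rule that[OF T luT s\<psi>])
  show "\<psi> l = 0" using W(3)[of 0] Y Z by (simp add: \<psi>_def)
  show "\<psi> u = 1" using W(3)[of 1] Y Z by (simp add: \<psi>_def)
  fix t assume t: "t \<in> {l..u}"
  have Yp: "deriv Y (\<psi> t) > 0" using Y\<psi>[OF t] Y(1,2) by (intro Y(6)) auto
  have Zp: "deriv Z t > 0" using t Z(1,2) by (intro Z(6)) auto
  have tT: "t \<in> T" using t luT by auto
  show "deriv \<psi> t > 0" unfolding d\<psi>[OF tT] using Yp Zp by simp
  have "deriv Y (\<psi> t) * k (\<psi> t) = deriv Z t * h t" using Y(7)[of "\<psi> t"] Z(7)[OF t] Y\<psi>[OF t] by simp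
  then show "k (\<psi> t) = deriv \<psi> t * h t" unfolding d\<psi>[OF tT] using Yp by (simp add: field_simps)
 qed
qed

subsection \<open>The momentum profile of an extremal metric\<close>

text \<open>Integrating twice from 0 settles the two conditions at 0. Those at 1 are linear
  equations for \<alpha> and \<beta>, solvable since 1 and t are linearly independent in the inner
  product with weight Q.\<close>

lemma linear_ode_profile:
 fixes Q w0 :: "real \<Rightarrow> real"
 assumes p: "p < 0" and q: "1 < q" and Q: "smooth1 {p<..<q} Q" and Qc: "continuous_on {p..q} Q" and Qpos: "\<And>t. t \<in> {p<..<q} \<Longrightarrow> Q t > 0"
  and w0: "smooth1 {p<..<q} w0" and w0c: "continuous_on {p..q} w0"
 obtains f f1 \<alpha> \<beta> where "smooth1 {p<..<q} f" "smooth1 {p<..<q} f1"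
  "\<And>t. t \<in> {p<..<q} \<Longrightarrow> (f has_real_derivative f1 t) (at t)"
  "\<And>t. t \<in> {p<..<q} \<Longrightarrow> (f1 has_real_derivative w0 t - Q t * (\<alpha> * t + \<beta>)) (at t)"
  "f 0 = 0" "f 1 = 0" "f1 0 = r" "f1 1 = s"
proof -
 have O: "open {p<..<q}" by simp
 have sol: "\<exists>f f1. smooth1 {p<..<q} f \<and> smooth1 {p<..<q} f1 \<and> (\<forall>t\<in>{p<..<q}. (f has_real_derivative f1 t) (at t)) \<and>
   (\<forall>t\<in>{p<..<q}. (f1 has_real_derivative w t) (at t)) \<and> f 0 = 0 \<and> f1 0 = 0"
  if w: "smooth1 {p<..<q} w" "continuous_on {p..q} w" for w
 proof -
  have z: "p < 0" "0 < q" using p q by auto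
  obtain F1 where F1: "continuous_on {p..q} F1" "smooth1 {p<..<q} F1" "\<And>t. t \<in> {p<..<q} \<Longrightarrow> (F1 has_real_derivative w t) (at t)" "F1 0 = 0"
   using antiderivative_smooth1[OF w(2,1) z] by blast
  then show ?thesis using antiderivative_smooth1[OF F1(1,2) z] by metis
 qed
 obtain f0 f01 where f0: "smooth1 {p<..<q} f0" "smooth1 {p<..<q} f01" "\<And>t. t \<in> {p<..<q} \<Longrightarrow> (f0 has_real_derivative f01 t) (at t)"
  "\<And>t. t \<in> {p<..<q} \<Longrightarrow> (f01 has_real_derivative w0 t) (at t)" "f0 0 = 0" "f01 0 = 0"
  using sol[OF w0 w0c] by blast
 have sQt: "smooth1 {p<..<q} (\<lambda>t. Q t * t)" by (intro smooth1_intros O Q)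
 have cQt: "continuous_on {p..q} (\<lambda>t. Q t * t)" by (intro continuous_intros Qc)
 obtain g g1 where g: "smooth1 {p<..<q} g" "smooth1 {p<..<q} g1" "\<And>t. t \<in> {p<..<q} \<Longrightarrow> (g has_real_derivative g1 t) (at t)"
  "\<And>t. t \<in> {p<..<q} \<Longrightarrow> (g1 has_real_derivative Q t * t) (at t)" "g 0 = 0" "g1 0 = 0"
  using sol[OF sQt cQt] by blast
 obtain k k1 where k: "smooth1 {p<..<q} k" "smooth1 {p<..<q} k1" "\<And>t. t \<in> {p<..<q} \<Longrightarrow> (k has_real_derivative k1 t) (at t)"
  "\<And>t. t \<in> {p<..<q} \<Longrightarrow> (k1 has_real_derivative Q t) (at t)" "k 0 = 0" "k1 0 = 0"
  using sol[OF Q Qc] by blast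
 have k1pos: "k 1 > 0"
 proof -
  obtain x where x: "0 < x" "x < 1" "k 1 - k 0 = (1 - 0) * k1 x"
   using MVT2[of 0 1 k k1] k(3) p q by auto
  obtain x' where x': "0 < x'" "x' < x" "k1 x - k1 0 = (x - 0) * Q x'"
   using MVT2[of 0 x k1 Q] k(4) p q x by auto
  show ?thesis using x x' k(5,6) Qpos[of x'] p q by simp
 qed
 \<comment> \<open>With m_i the i-th moment of Q on the unit interval, this is m_1^2 - m_0 m_2,
   minus the Gram determinant of 1 and t.\<close>
 define \<Delta> where "\<Delta> = g 1 * k1 1 - k 1 * g1 1"
 have "\<Delta> \<noteq> 0"
 proof
  assume D0: "\<Delta> = 0"
  \<comment> \<open>\<open>N\<close> is a primitive of Q lf^2 that vanishes at 0, and at 1 if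
    \<Delta> = 0. The affine function \<open>lf\<close> would then be zero, although its slope
    \<open>k 1\<close> is positive.\<close>
  define lf where "lf t = k 1 * t - g 1" for t
  define N where "N t = (k 1 * g1 t - g 1 * k1 t) * lf t - (k 1 * g t - g 1 * k t) * k 1" for t
  have N: "(N has_real_derivative Q t * (lf t)\<^sup>2) (at t)" if t: "t \<in> {p<..<q}" for t
   unfolding N_def lf_def
   by (rule derivative_eq_intros refl g(3)[OF t] g(4)[OF t] k(3)[OF t] k(4)[OF t])+ (simp add: algebra_simps power2_eq_square)
  have N01: "N 0 = 0" "N 1 = 0" using D0 g(5,6) k(5,6) by (simp_all add: N_def lf_def \<Delta>_def algebra_simps)
  have z: "lf t = 0" if t: "0 < t" "t < 1" for t
  proof -
   have "N x = 0" if x: "0 \<le> x" "x \<le> 1" for x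
   proof -
    have inc: "N a \<le> N b" if "0 \<le> a" "a \<le> b" "b \<le> 1" for a b
    proof (rule DERIV_nonneg_imp_nondecreasing[OF that(2)])
     fix y assume "a \<le> y" "y \<le> b"
     then have "y \<in> {p<..<q}" using that p q by auto
     then show "\<exists>z. (N has_real_derivative z) (at y) \<and> 0 \<le> z" using N Qpos by (intro exI[of _ "Q y * (lf y)\<^sup>2"]) (simp add: less_imp_le)
    qed
    show ?thesis using inc[of 0 x] inc[of x 1] x N01 by simp
   qed
   then have "((\<lambda>x. 0) has_real_derivative Q t * (lf t)\<^sup>2) (at t)"
    using t p q by (intro has_field_derivative_transform_within_open[OF N, of t "{0<..<1}"]) auto
   then have "Q t * (lf t)\<^sup>2 = 0" using DERIV_unique[OF _ DERIV_const] by blast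
   then show ?thesis using Qpos[of t] t p q by simp
  qed
  show False using z[of "1/2"] z[of "1/4"] k1pos by (simp add: lf_def)
 qed
 text \<open>Cramer's rule for \<open>f(1) = 0\<close>, \<open>f'(1) = s\<close> with \<open>f = r t + f0 - \<alpha> g - \<beta> k\<close>.\<close>
 define A where "A = r + f0 1"
 define B where "B = r + f01 1 - s"
 define \<alpha> where "\<alpha> = (A * k1 1 - k 1 * B) / \<Delta>"
 define \<beta> where "\<beta> = (g 1 * B - A * g1 1) / \<Delta>"
 have e: "\<alpha> * g 1 + \<beta> * k 1 = A" "\<alpha> * g1 1 + \<beta> * k1 1 = B"
  using \<open>\<Delta> \<noteq> 0\<close> unfolding \<alpha>_def \<beta>_def by (simp_all add: add_divide_eq_iff divide_simps) (simp_all add: \<Delta>_def algebra_simps)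
 define f where "f t = r * t + f0 t - \<alpha> * g t - \<beta> * k t" for t
 define f1 where "f1 t = r + f01 t - \<alpha> * g1 t - \<beta> * k1 t" for t
 show thesis
 proof (rule that[of f f1 \<alpha> \<beta>])
  show "smooth1 {p<..<q} f" unfolding f_def
   by (intro smooth1_intros O f0 g k)
  show "smooth1 {p<..<q} f1" unfolding f1_def
   by (intro smooth1_intros O f0 g k)
  fix t assume t: "t \<in> {p<..<q}"
  show "(f has_real_derivative f1 t) (at t)" unfolding f_def f1_def
   by (rule derivative_eq_intros refl f0(3)[OF t] g(3)[OF t] k(3)[OF t])+ simp
  show "(f1 has_real_derivative w0 t - Q t * (\<alpha> * t + \<beta>)) (at t)" unfolding f1_def
   by (rule derivative_eq_intros refl f0(4)[OF t] g(4)[OF t] k(4)[OF t])+ (simp add: algebra_simps)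
 qed (use e f0(5,6) g(5,6) k(5,6) in \<open>simp_all add: f_def f1_def A_def B_def\<close>)
qed

text \<open>If \<open>f\<close> had a zero in between, \<open>f''\<close> would change sign from negative to positive and back,
 which is impossible since \<open>f''\<close> is a positive multiple of a convex function.\<close>

lemma convex_second_derivative_positive:
 fixes f f1 f2 \<phi> Q :: "real \<Rightarrow> real"
 assumes f: "\<And>t. t \<in> {0..1} \<Longrightarrow> (f has_real_derivative f1 t) (at t)" and f1: "\<And>t. t \<in> {0..1} \<Longrightarrow> (f1 has_real_derivative Q t * \<phi> t) (at t)"
  and Q: "\<And>t. t \<in> {0..1} \<Longrightarrow> Q t > 0" and \<phi>: "convex_on {0..1} \<phi>"
  and bc: "f 0 = 0" "f 1 = 0" "f1 0 > 0" "f1 1 < 0" and t: "0 < t" "t < 1"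
 shows "f t > 0"
proof (rule ccontr)
 assume "\<not> f t > 0"
 then have ft: "f t \<le> 0" by simp
 obtain d where d: "d > 0" "\<And>e. 0 < e \<Longrightarrow> e < d \<Longrightarrow> f 0 < f (0 + e)" using DERIV_pos_inc_right[OF f[of 0] bc(3)] by auto
 obtain d' where d': "d' > 0" "\<And>e. 0 < e \<Longrightarrow> e < d' \<Longrightarrow> f 1 < f (1 - e)" using DERIV_neg_dec_left[OF f[of 1] bc(4)] by auto
 \<comment> \<open>The signs of the boundary slopes give points near the two ends where f is
   positive. As f t is not positive in between, f' has the signs +, -, +, - at x1, x2, x3,
   x4.\<close>
 define a where "a = min d t / 2"
 have a: "0 < a" "a < t" "f a > 0" using d t bc(1) d(2)[of a] by (auto simp: a_def)
 define M where "M = min d' (1 - t)"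
 define b where "b = 1 - M / 2"
 have b: "t < b" "b < 1" "f b > 0"
 proof -
  have m: "0 < M" "M \<le> 1 - t" "M \<le> d'" using d' t by (auto simp: M_def)
  show "t < b" using m t unfolding b_def by linarith
  show "b < 1" using m unfolding b_def by linarith
  show "f b > 0" using d'(2)[of "M / 2"] m bc(2) unfolding b_def by simp
 qed
 have mvt: "\<exists>z. x < z \<and> z < y \<and> f y - f x = (y - x) * f1 z" if "0 \<le> x" "x < y" "y \<le> 1" for x y
  using MVT2[of x y f f1] f that by auto
 have mvt1: "\<exists>z. x < z \<and> z < y \<and> f1 y - f1 x = (y - x) * (Q z * \<phi> z)" if "0 \<le> x" "x < y" "y \<le> 1" for x y
  using MVT2[of x y f1 "\<lambda>z. Q z * \<phi> z"] f1 that by auto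
 obtain x1 where x1: "0 < x1" "x1 < a" "f a - f 0 = (a - 0) * f1 x1" using mvt[of 0 a] a t by auto
 obtain x2 where x2: "a < x2" "x2 < t" "f t - f a = (t - a) * f1 x2" using mvt[of a t] a t by auto
 obtain x3 where x3: "t < x3" "x3 < b" "f b - f t = (b - t) * f1 x3" using mvt[of t b] b t by auto
 obtain x4 where x4: "b < x4" "x4 < 1" "f 1 - f b = (1 - b) * f1 x4" using mvt[of b 1] b t by auto
 have pos: "x * y > 0 \<Longrightarrow> x > 0 \<Longrightarrow> y > 0" and neg: "x * y < 0 \<Longrightarrow> x > 0 \<Longrightarrow> y < 0" for x y :: real
  by (simp_all add: zero_less_mult_iff mult_less_0_iff)
 have s1: "f1 x1 > 0" by (rule pos[of "a - 0"]) (use x1(3) a bc(1) in linarith)+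
 have s2: "f1 x2 < 0" by (rule neg[of "t - a"]) (use x2(3) a ft in linarith)+
 have s3: "f1 x3 > 0" by (rule pos[of "b - t"]) (use x3(3) b ft in linarith)+
 have s4: "f1 x4 < 0" by (rule neg[of "1 - b"]) (use x4(3) b bc(2) in linarith)+
 obtain y1 where y1: "x1 < y1" "y1 < x2" "f1 x2 - f1 x1 = (x2 - x1) * (Q y1 * \<phi> y1)" using mvt1[of x1 x2] x1 x2 a t by auto
 obtain y2 where y2: "x2 < y2" "y2 < x3" "f1 x3 - f1 x2 = (x3 - x2) * (Q y2 * \<phi> y2)" using mvt1[of x2 x3] x1 x2 x3 a b t by auto
 obtain y3 where y3: "x3 < y3" "y3 < x4" "f1 x4 - f1 x3 = (x4 - x3) * (Q y3 * \<phi> y3)" using mvt1[of x3 x4] x3 x4 b t by auto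
 have i: "y1 \<in> {0..1}" "y2 \<in> {0..1}" "y3 \<in> {0..1}" using x1 x2 x3 x4 y1 y2 y3 by auto
 have "Q y1 * \<phi> y1 < 0" by (rule neg[of "x2 - x1"]) (use y1 s1 s2 in linarith)+
 then have "\<phi> y1 < 0" using Q[OF i(1)] by (rule neg)
 moreover have "Q y2 * \<phi> y2 > 0" by (rule pos[of "x3 - x2"]) (use y2 s2 s3 in linarith)+
 then have "\<phi> y2 > 0" using Q[OF i(2)] by (rule pos)
 moreover have "Q y3 * \<phi> y3 < 0" by (rule neg[of "x4 - x3"]) (use y3 s3 s4 in linarith)+
 then have "\<phi> y3 < 0" using Q[OF i(3)] by (rule neg)
 moreover have "\<phi> y2 \<le> max (\<phi> y1) (\<phi> y3)"
 proof -
  define m where "m = (y2 - y1) / (y3 - y1)"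
  have yy: "y1 < y2" "y2 < y3" using y1 y2 y3 by auto
  have m: "0 \<le> m" "m \<le> 1" using yy by (simp_all add: m_def)
  have mm: "m * (y3 - y1) = y2 - y1" using yy by (simp add: m_def)
  have "(1 - m) *\<^sub>R y1 + m *\<^sub>R y3 = y2" using mm by (simp add: algebra_simps)
  then have "\<phi> y2 \<le> (1 - m) * \<phi> y1 + m * \<phi> y3" using convex_onD[OF \<phi> m i(1,3)] by simp
  also have "\<dots> \<le> (1 - m) * max (\<phi> y1) (\<phi> y3) + m * max (\<phi> y1) (\<phi> y3)"
   using m by (intro add_mono mult_left_mono) auto
  finally show ?thesis by (simp add: algebra_simps)
 qed
 ultimately show False by simp
qed

lemma extremal_profile:
 fixes a b :: "real^'m" and d :: "'m \<Rightarrow> real"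
 assumes A: "\<And>i t. t \<in> {0..1} \<Longrightarrow> b$i * t + a$i > 0" and d: "\<And>i. d i \<ge> 0"
 obtains k u \<alpha> \<beta> where "profile 0 1 k" "smooth1 {0<..<1} k" "smooth1 {0<..<1} u"
  "\<And>t. t \<in> {0<..<1} \<Longrightarrow> u t = deriv k t + k t * ((1/2) * (\<Sum>i\<in>UNIV. b$i * d i / (b$i * t + a$i)))"
  "\<And>t. t \<in> {0<..<1} \<Longrightarrow> (\<Sum>i\<in>UNIV. d i / (b$i * t + a$i)) - deriv u t
    - u t * ((1/2) * (\<Sum>i\<in>UNIV. b$i * d i / (b$i * t + a$i))) = \<alpha> * t + \<beta>"
proof -
 define S where "S = (\<Inter>i. {t. b$i * t + a$i > 0})"
 have "open S" unfolding S_def by (intro open_INT ballI open_Collect_less continuous_intros) auto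
 moreover have "{0..1} \<subseteq> S" using A by (auto simp: S_def)
 ultimately obtain p q where pq: "p < 0" "1 < q" "{p..q} \<subseteq> S" using open_interval_nbhd[of S 0 1] by auto
 have A': "b$i * t + a$i > 0" if "t \<in> {p..q}" for i t using pq(3) that by (auto simp: S_def)
 have A'': "b$i * t + a$i > 0" if "t \<in> {p<..<q}" for i t using A'[of t i] that by auto
 have O: "open {p<..<q}" by simp
 have sA: "smooth1 {p<..<q} (\<lambda>t. b$i * t + a$i)" for i
  by (intro smooth1_intros O)
 define qq where "qq t = (1/2) * (\<Sum>i\<in>UNIV. b$i * d i / (b$i * t + a$i))" for t
 \<comment> \<open>The logarithm of the volume factor of the base, so that Q = exp L is the product
   of the powers A_i^(d_i/2).\<close>
 define L where "L t = (1/2) * (\<Sum>i\<in>UNIV. d i * ln (b$i * t + a$i))" for t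
 have dL: "(L has_real_derivative qq t) (at t)" if t: "t \<in> {p<..<q}" for t
 proof -
  have "((\<lambda>t. d i * ln (b$i * t + a$i)) has_real_derivative b$i * d i / (b$i * t + a$i)) (at t)" for i
   using A''[OF t, of i] by (auto intro!: derivative_eq_intros)
  then have "((\<lambda>t. \<Sum>i\<in>UNIV. d i * ln (b$i * t + a$i)) has_real_derivative (\<Sum>i\<in>UNIV. b$i * d i / (b$i * t + a$i))) (at t)"
   by (intro DERIV_sum) auto
  from DERIV_cmult[OF this, of "1/2"] show ?thesis unfolding L_def qq_def .
 qed
 have sqq: "smooth1 {p<..<q} qq" unfolding qq_def
  by (intro smooth1_intros O sA) (rule less_imp_neq[THEN not_sym], rule A'')
 have sL: "smooth1 {p<..<q} L" by (rule smooth1_integral[OF O dL sqq])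
 define Q where "Q t = exp (L t)" for t
 have sQ: "smooth1 {p<..<q} Q" unfolding Q_def by (rule smooth1_exp[OF O sL])
 have Qpos: "Q t > 0" for t by (simp add: Q_def)
 have dQ: "(Q has_real_derivative Q t * qq t) (at t)" if t: "t \<in> {p<..<q}" for t
  unfolding Q_def by (rule DERIV_fun_exp[OF dL[OF t]])
 have An: "b$i * t + a$i \<noteq> 0" if "t \<in> {p..q}" for i t using A'[OF that, of i] by simp
 have Lc: "continuous_on {p..q} L" unfolding L_def by (intro continuous_intros) (use An in auto)
 have Qc: "continuous_on {p..q} Q" unfolding Q_def by (intro continuous_intros Lc)
 define w0 where "w0 t = Q t * (\<Sum>i\<in>UNIV. d i / (b$i * t + a$i))" for t
 have sw0: "smooth1 {p<..<q} w0" unfolding w0_def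
  by (intro smooth1_intros O sA sQ) (rule less_imp_neq[THEN not_sym], rule A'')
 have cw0: "continuous_on {p..q} w0" unfolding w0_def by (intro continuous_intros Qc) (use An in auto)
 \<comment> \<open>Since f = Q k and k vanishes at the ends, the slopes 2 and -2 of k become 2 Q and
   -2 Q there.\<close>
 obtain f f1 \<alpha> \<beta> where f: "smooth1 {p<..<q} f" "smooth1 {p<..<q} f1"
  "\<And>t. t \<in> {p<..<q} \<Longrightarrow> (f has_real_derivative f1 t) (at t)"
  "\<And>t. t \<in> {p<..<q} \<Longrightarrow> (f1 has_real_derivative w0 t - Q t * (\<alpha> * t + \<beta>)) (at t)"
  "f 0 = 0" "f 1 = 0" "f1 0 = 2 * Q 0" "f1 1 = - 2 * Q 1"
  using linear_ode_profile[OF pq(1,2) sQ Qc Qpos sw0 cw0, of "2 * Q 0" "- 2 * Q 1"] by blast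
 define \<phi> where "\<phi> t = (\<Sum>i\<in>UNIV. d i / (b$i * t + a$i)) - (\<alpha> * t + \<beta>)" for t
 have f12: "(f1 has_real_derivative Q t * \<phi> t) (at t)" if t: "t \<in> {p<..<q}" for t
  using f(4)[OF t] by (simp add: w0_def \<phi>_def algebra_simps)
 have "convex_on {0..1} (\<lambda>t. d i / (b$i * t + a$i))" for i
 proof (rule convex_onI)
  fix s x y :: real assume s: "0 < s" "s < 1" and xy: "x \<in> {0..1}" "y \<in> {0..1}"
  have "inverse ((1 - s) *\<^sub>R (b$i * x + a$i) + s *\<^sub>R (b$i * y + a$i)) \<le> (1 - s) * inverse (b$i * x + a$i) + s * inverse (b$i * y + a$i)"
   by (rule convex_onD[OF convex_on_inverse[of "{0<..}"]]) (use s xy A in auto)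
  from mult_left_mono[OF this d[of i]] show "d i / (b$i * ((1 - s) *\<^sub>R x + s *\<^sub>R y) + a$i) \<le> (1 - s) * (d i / (b$i * x + a$i)) + s * (d i / (b$i * y + a$i))"
   by (simp add: divide_inverse algebra_simps)
 qed simp
 then have "convex_on {0..1} (\<lambda>t. \<Sum>i\<in>S. d i / (b$i * t + a$i))" for S
  by (induction S rule: infinite_finite_induct) (auto simp: convex_on_const)
 moreover have "concave_on {0..1} (\<lambda>t. \<alpha> * t + \<beta>)" by (simp add: concave_on_iff algebra_simps) (metis distrib_right mult_1 order_refl)
 ultimately have cv: "convex_on {0..1} \<phi>" unfolding \<phi>_def by (rule convex_on_diff)
 have i01: "t \<in> {p<..<q}" if "t \<in> {0..1}" for t using that pq by auto
 have fpos: "f t > 0" if "0 < t" "t < 1" for t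
  by (rule convex_second_derivative_positive[of f f1 Q \<phi>]) (use f f12 i01 Qpos cv that in auto)
 define k where "k t = f t / Q t" for t
 \<comment> \<open>From Q' = q Q one gets f' = Q (k' + q k), so this is the function u of the
   curvature formula, and in the same way f'' = Q (u' + q u).\<close>
 define u where "u t = f1 t / Q t" for t
 have sk: "smooth1 {p<..<q} k" unfolding k_def by (intro smooth1_intros O f(1) sQ) (simp add: Q_def)
 have su: "smooth1 {p<..<q} u" unfolding u_def by (intro smooth1_intros O f(2) sQ) (simp add: Q_def)
 have dq: "deriv (\<lambda>t. w t / Q t) t = w' / Q t - w t / Q t * qq t" if w: "(w has_real_derivative w') (at t)" and t: "t \<in> {p<..<q}" for w w' t
  by (rule DERIV_imp_deriv, rule DERIV_cong[OF DERIV_divide[OF w dQ[OF t]]]) (use Qpos[of t] in \<open>simp_all add: field_simps\<close>)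
 have dk: "deriv k t = u t - k t * qq t" and du: "deriv u t = \<phi> t - u t * qq t" if t: "t \<in> {p<..<q}" for t
  unfolding k_def u_def dq[OF f(3)[OF t] t] dq[OF f12[OF t] t] using Qpos[of t] by simp_all
 show thesis
 proof (rule that[of k u \<alpha> \<beta>])
  have "k t > 0" if "t \<in> {0<..<1}" for t using fpos[of t] Qpos[of t] that by (simp add: k_def)
  moreover have "k 0 = 0" "k 1 = 0" using f by (simp_all add: k_def)
  moreover have "deriv k 0 = 2" "deriv k 1 = - 2"
   using dk[of 0] dk[of 1] pq f(5-8) Qpos[of 0] Qpos[of 1] by (simp_all add: k_def u_def)
  moreover have "smooth_closed_interval 0 1 k"
   unfolding smooth_closed_interval_iff using sk pq by (intro exI[of _ "{p<..<q}"]) auto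
  ultimately show "profile 0 1 k" by (simp add: profile_def)
  show "smooth1 {0<..<1} k" by (rule smooth1_subset[OF sk]) (use pq in auto)
  show "smooth1 {0<..<1} u" by (rule smooth1_subset[OF su]) (use pq in auto)
  fix t :: real assume t: "t \<in> {0<..<1}"
  then have t': "t \<in> {p<..<q}" using pq by auto
  show "u t = deriv k t + k t * ((1/2) * (\<Sum>i\<in>UNIV. b$i * d i / (b$i * t + a$i)))"
   unfolding dk[OF t'] qq_def[symmetric] by simp
  show "(\<Sum>i\<in>UNIV. d i / (b$i * t + a$i)) - deriv u t
    - u t * ((1/2) * (\<Sum>i\<in>UNIV. b$i * d i / (b$i * t + a$i))) = \<alpha> * t + \<beta>"
   unfolding du[OF t'] qq_def[symmetric] by (simp add: \<phi>_def)
 qed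
qed

subsection \<open>Charts\<close>

lemma snd_crange: "p \<in> fst c \<Longrightarrow> snd c p \<in> crange c"
 unfolding crange_def by simp

lemma point_in: "y \<in> crange c \<Longrightarrow> point c y \<in> fst c" "y \<in> crange c \<Longrightarrow> snd c (point c y) = y"
 unfolding point_def crange_def by (auto intro: inv_into_into f_inv_into_f)

lemma crangeE:
 assumes "y \<in> crange c" obtains p where "p \<in> fst c" "y = snd c p"
 using assms unfolding crange_def by auto

context
 fixes M :: "('p, 'n::finite) mfd"
 assumes M: "closed_manifold M"
begin

lemma chart_facts:
 assumes "c \<in> atlas M"
 shows "openin (mtop M) (fst c)" "ropen (idx M) (crange c)"
  "homeomorphic_map (subtopology (mtop M) (fst c)) (top_of_set (crange c)) (snd c)"
 using M assms unfolding closed_manifold_def by auto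

lemma chart_cover: "p \<in> pts M \<Longrightarrow> \<exists>c\<in>atlas M. p \<in> fst c"
 using M unfolding closed_manifold_def by (metis UN_iff)

lemma chart_pts: "c \<in> atlas M \<Longrightarrow> p \<in> fst c \<Longrightarrow> p \<in> pts M"
 using chart_facts(1) openin_subset by blast

lemma chart_inj: assumes "c \<in> atlas M" shows "inj_on (snd c) (fst c)"
proof -
 have "inj_on (snd c) (topspace (subtopology (mtop M) (fst c)))"
  using chart_facts(3)[OF assms] by (rule homeomorphic_imp_injective_map)
 then show ?thesis using openin_subset[OF chart_facts(1)[OF assms]] by (simp add: Int_absorb1)
qed

lemma point_snd: "c \<in> atlas M \<Longrightarrow> p \<in> fst c \<Longrightarrow> point c (snd c p) = p"
 unfolding point_def by (rule inv_into_f_f[OF chart_inj])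

lemma chart_open_image:
 assumes c: "c \<in> atlas M" and W: "openin (mtop M) W"
 shows "ropen (idx M) (snd c ` (fst c \<inter> W))"
proof -
 have "openin (subtopology (mtop M) (fst c)) (fst c \<inter> W)"
  using W openin_subtopology_Int2[of "mtop M" W "fst c"] by (simp add: Int_commute)
 then have "openin (top_of_set (crange c)) (snd c ` (fst c \<inter> W))"
  using homeomorphic_imp_open_map[OF chart_facts(3)[OF c]] unfolding open_map_def by blast
 then show ?thesis using chart_facts(2)[OF c] openin_trans by blast
qed

lemma smooth_map_id: "smooth_map M M id"
 using M unfolding smooth_map_def closed_manifold_def by (simp add: Int_def)

end

lemma dmap_jac: "v \<in> coord I \<Longrightarrow> dmap I c c' f y v = jac I (snd c' \<circ> f \<circ> point c) y *v v"
 unfolding dmap_def vec_eq_iff mv_nth sum_component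
 by (intro allI sum.mono_neutral_cong_left) (auto simp: coord_def jac_nth)

lemma dmap_linear: "dmap I c c' f y (r *\<^sub>R v + s *\<^sub>R w) = r *\<^sub>R dmap I c c' f y v + s *\<^sub>R dmap I c c' f y w"
 unfolding dmap_def by (simp add: scaleR_sum_right sum.distrib algebra_simps)

lemma dmap_zero: "dmap I c c' f y 0 = 0"
 by (simp add: dmap_def)

context
 fixes M :: "('p, 'n::finite) mfd" and N :: "('q, 'k::finite) mfd" and f
 assumes M: "closed_manifold M" and N: "closed_manifold N" and f: "smooth_map M N f"
begin

lemma open_preimage: "openin (mtop N) W \<Longrightarrow> openin (mtop M) {p \<in> pts M. f p \<in> W}"
 using f openin_continuous_map_preimage unfolding smooth_map_def by blast

lemma map_pts: "p \<in> pts M \<Longrightarrow> f p \<in> pts N"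
 using f unfolding smooth_map_def continuous_map_def by blast

context
 fixes c c' W
 assumes c: "c \<in> atlas M" and c': "c' \<in> atlas N" and W: "openin (mtop M) W" and fW: "\<And>p. p \<in> fst c \<Longrightarrow> p \<in> W \<Longrightarrow> f p \<in> fst c'"
begin

lemma lrep_open: "ropen (idx M) (snd c ` (fst c \<inter> W))"
 by (rule chart_open_image[OF M c W])

lemma lrep_smooth: "smooth (idx M) (snd c ` (fst c \<inter> W)) (snd c' \<circ> f \<circ> point c)"
 by (rule smooth_subset[of _ "snd c ` {p\<in>fst c. f p \<in> fst c'}"])
  (use f c c' fW in \<open>auto simp: smooth_map_def\<close>)

lemma lrep_image: "(snd c' \<circ> f \<circ> point c) ` (snd c ` (fst c \<inter> W)) \<subseteq> crange c'"
 using fW point_snd[OF M c] by (auto simp: crange_def)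

end

lemma dmap_coord:
 assumes c: "c \<in> atlas M" and c': "c' \<in> atlas N" and p: "p \<in> fst c" "f p \<in> fst c'"
 shows "dmap (idx M) c c' f (snd c p) v \<in> coord (idx N)"
proof -
 define W where "W = {p \<in> pts M. f p \<in> fst c'}"
 have W: "openin (mtop M) W" unfolding W_def by (rule open_preimage[OF chart_facts(1)[OF N c']])
 have fW: "\<And>p. p \<in> fst c \<Longrightarrow> p \<in> W \<Longrightarrow> f p \<in> fst c'" by (simp add: W_def)
 have pW: "snd c p \<in> snd c ` (fst c \<inter> W)" using p chart_pts[OF M c] by (auto simp: W_def)
 have "pd i (snd c' \<circ> f \<circ> point c) (snd c p) \<in> coord (idx N)" if "i \<in> idx M" for i
  by (rule pd_in_coord[OF lrep_open[OF c c' W fW] smooth_Ck[OF lrep_smooth[OF c c' W fW]] _ pW that])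
   (use lrep_image[OF c c' W fW] openin_imp_subset[OF chart_facts(2)[OF N c']] in blast)+
 then show ?thesis unfolding dmap_def by (intro subspace_sum subspace_coord subspace_scale)
qed

end

lemma dmap_chain:
 fixes M :: "('p, 'n::finite) mfd" and N :: "('q, 'k::finite) mfd" and Q :: "('r, 'l::finite) mfd"
 assumes M: "closed_manifold M" and N: "closed_manifold N" and Q: "closed_manifold Q"
  and f: "smooth_map M N f" and g: "smooth_map N Q g"
  and c: "c \<in> atlas M" and c': "c' \<in> atlas N" and c'': "c'' \<in> atlas Q"
  and p: "p \<in> fst c" "f p \<in> fst c'" "g (f p) \<in> fst c''"
 shows "dmap (idx M) c c'' (g \<circ> f) (snd c p) v = dmap (idx N) c' c'' g (snd c' (f p)) (dmap (idx M) c c' f (snd c p) v)"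
proof -
 define W' where "W' = {q \<in> pts N. g q \<in> fst c''}"
 have W': "openin (mtop N) W'" unfolding W'_def by (rule open_preimage[OF N Q g chart_facts(1)[OF Q c'']])
 have gW: "\<And>q. q \<in> fst c' \<Longrightarrow> q \<in> W' \<Longrightarrow> g q \<in> fst c''" by (simp add: W'_def)
 define W where "W = {p \<in> pts M. f p \<in> fst c' \<inter> W'}"
 have W: "openin (mtop M) W" unfolding W_def by (intro open_preimage[OF M N f] openin_Int chart_facts(1)[OF N c'] W')
 have fW: "\<And>p. p \<in> fst c \<Longrightarrow> p \<in> W \<Longrightarrow> f p \<in> fst c'" by (simp add: W_def)
 define U where "U = snd c ` (fst c \<inter> W)"
 define V where "V = snd c' ` (fst c' \<inter> W')"
 define F where "F = snd c' \<circ> f \<circ> point c"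
 define H where "H = snd c'' \<circ> g \<circ> point c'"
 have U: "ropen (idx M) U" unfolding U_def by (rule lrep_open[OF M N f c c' W fW])
 have V: "ropen (idx N) V" unfolding V_def by (rule lrep_open[OF N Q g c' c'' W' gW])
 have sF: "smooth (idx M) U F" unfolding U_def F_def by (rule lrep_smooth[OF M N f c c' W fW])
 have sH: "smooth (idx N) V H" unfolding V_def H_def by (rule lrep_smooth[OF N Q g c' c'' W' gW])
 have FU: "F ` U \<subseteq> V" using point_snd[OF M c] by (auto simp: U_def V_def F_def W_def)
 have pU: "snd c p \<in> U" using p chart_pts[OF M c] chart_pts[OF N c'] by (auto simp: U_def W_def W'_def)
 have eq: "(snd c'' \<circ> (g \<circ> f) \<circ> point c) y = H (F y)" if "y \<in> U" for y
  using that point_snd[OF M c] point_snd[OF N c'] by (auto simp: U_def F_def H_def W_def)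
 have Fp: "F (snd c p) = snd c' (f p)" using point_snd[OF M c p(1)] by (simp add: F_def)
 have "pd i (snd c'' \<circ> (g \<circ> f) \<circ> point c) (snd c p) = (\<Sum>k\<in>idx N. pd i F (snd c p)$k *\<^sub>R pd k H (snd c' (f p)))" if i: "i \<in> idx M" for i
 proof -
  have "pd i (snd c'' \<circ> (g \<circ> f) \<circ> point c) (snd c p) = pd i (\<lambda>y. H (F y)) (snd c p)" by (rule pd_cong[OF U pU i]) (rule eq)
  then show ?thesis using pd_compose[OF U V FU sF sH i pU] by (simp add: Fp)
 qed
 then have "dmap (idx M) c c'' (g \<circ> f) (snd c p) v = (\<Sum>i\<in>idx M. \<Sum>k\<in>idx N. (v$i * pd i F (snd c p)$k) *\<^sub>R pd k H (snd c' (f p)))"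
  unfolding dmap_def by (simp add: scaleR_sum_right)
 also have "\<dots> = (\<Sum>k\<in>idx N. \<Sum>i\<in>idx M. (v$i * pd i F (snd c p)$k) *\<^sub>R pd k H (snd c' (f p)))" by (rule sum.swap)
 also have "\<dots> = dmap (idx N) c' c'' g (snd c' (f p)) (dmap (idx M) c c' f (snd c p) v)"
  unfolding dmap_def F_def[symmetric] H_def[symmetric] by (simp add: scaleR_sum_left sum_component)
 finally show ?thesis .
qed

subsection \<open>Kaehler manifolds in charts\<close>

lemma kaehler_chartI:
 fixes M :: "('p, 'n::finite) mfd"
 assumes M: "closed_manifold M" and K: "kaehler M g J" and c: "c \<in> atlas M"
 shows "kaehler_chart (idx M) (crange c) (g c) (J c)"
proof -
 have r: "riemannian M g" and cs: "complex_structure M J" using K by (auto simp: kaehler_def)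
 have st: "sym_tensor M g" using r by (simp add: riemannian_def)
 have ac: "almost_complex M J" using cs by (simp add: complex_structure_def)
 have ef: "endo_field M J" using ac by (simp add: almost_complex_def)
 have m: "metric_chart (idx M) (crange c) (g c)"
  by unfold_locales (use chart_facts(2)[OF M c] st r c in \<open>auto simp: sym_tensor_def riemannian_def\<close>)
 have bJ: "blk (idx M) (idx M) (J c y)" if "y \<in> crange c" for y
  using ef c that unfolding endo_field_def blk_def by blast
 have kf: "(\<lambda>z. kform g J c z$j$k) = (\<lambda>z. (transpose (J c z)**g c z)$j$k)" for j k
  by (simp add: kform_def)
 show ?thesis
 proof (intro kaehler_chart.intro m kaehler_chart_axioms.intro)
  show "smooth (idx M) (crange c) (J c)" using ef c by (auto simp: endo_field_def)
  fix y assume y: "y \<in> crange c"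
  show "blk (idx M) (idx M) (J c y)" by (rule bJ[OF y])
  show "J c y**J c y = - PI (idx M)"
  proof -
   have "(J c y**J c y) *v v = (- PI (idx M)) *v v" for v
   proof -
    have "(J c y**J c y) *v v = (J c y**(J c y**PI (idx M))) *v v" using blk_right[OF bJ[OF y]] by simp
    also have "\<dots> = J c y *v (J c y *v (PI (idx M) *v v))" by (simp add: matrix_vector_mul_assoc matrix_mul_assoc)
    also have "\<dots> = - (PI (idx M) *v v)"
     using ac c y PI_mv_coord[of "idx M" v] by (auto simp: almost_complex_def)
    finally show ?thesis by (simp add: bounded_bilinear.minus_left[OF bounded_bilinear_mv])
   qed
   then show ?thesis by (simp add: matrix_eq)
  qed
  show "bil (g c y) (J c y *v v) (J c y *v w) = bil (g c y) v w" if "v \<in> coord (idx M)" "w \<in> coord (idx M)" for v w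
   using K c y that by (auto simp: kaehler_def)
  fix i j k assume "i \<in> idx M" "j \<in> idx M" "k \<in> idx M"
  then show "(\<Sum>l\<in>idx M. J c y$l$i * pd l (\<lambda>z. J c z$k$j) y - J c y$l$j * pd l (\<lambda>z. J c z$k$i) y
      - J c y$k$l * (pd i (\<lambda>z. J c z$l$j) y - pd j (\<lambda>z. J c z$l$i) y)) = 0"
   "pd i (\<lambda>z. (transpose (J c z)**g c z)$j$k) y + pd j (\<lambda>z. (transpose (J c z)**g c z)$k$i) y
    + pd k (\<lambda>z. (transpose (J c z)**g c z)$i$j) y = 0"
   by (rule cs[unfolded complex_structure_def, THEN conjunct2, rule_format, OF c y],
     (assumption | rule K[unfolded kaehler_def, THEN conjunct2, THEN conjunct2, THEN conjunct2, rule_format, OF c y, unfolded kf])+)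
 qed
qed

lemma kaehler_chart_subset:
 assumes "kaehler_chart I U G J" "ropen I V" "V \<subseteq> U"
 shows "kaehler_chart I V G J"
proof -
 interpret kaehler_chart I U G J by fact
 show ?thesis
  by unfold_locales
   (use assms(2,3) smooth_subset[OF smooth_G assms(3)] smooth_subset[OF smooth_J assms(3)] sym_G pos_G blk_J J_sq J_orth nijenhuis closed
    in \<open>simp_all add: subset_iff\<close>)
qed

text \<open>This carries statements from the principal part over the special orbits. A general
  closed \<open>C\<close> serves both equations, with \<open>C\<close> = {0}, and weak inequalities,
  with a half-line.\<close>

lemma dense_chart_zero:
 fixes M :: "('p, 'n::finite) mfd" and F :: "real^'n \<Rightarrow> real"
 assumes M: "closed_manifold M" and c: "c \<in> atlas M" and D: "mtop M closure_of D = pts M"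
  and F: "continuous_on (crange c) F" and z: "\<And>p. p \<in> fst c \<Longrightarrow> p \<in> D \<Longrightarrow> F (snd c p) \<in> C" and C: "closed C" and y: "y \<in> crange c"
 shows "F y \<in> C"
proof (rule ccontr)
 assume n: "F y \<notin> C"
 obtain p where p: "p \<in> fst c" "y = snd c p" using y by (rule crangeE)
 have cm: "continuous_map (subtopology (mtop M) (fst c)) (top_of_set (crange c)) (snd c)"
  using homeomorphic_imp_continuous_map[OF chart_facts(3)[OF M c]] .
 define W where "W = {q \<in> topspace (subtopology (mtop M) (fst c)). snd c q \<in> crange c \<inter> F -` (- C)}"
 have "openin (top_of_set (crange c)) (crange c \<inter> F -` (- C))"
  using continuous_openin_preimage_gen[OF F open_Compl[OF C]] .
 then have "openin (subtopology (mtop M) (fst c)) W"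
  unfolding W_def by (rule openin_continuous_map_preimage[OF cm])
 then have o: "openin (mtop M) W" by (rule openin_trans_full[OF _ chart_facts(1)[OF M c]])
 have pt: "p \<in> W" using p n y chart_pts[OF M c] by (auto simp: W_def)
 have "p \<in> mtop M closure_of D" using D p chart_pts[OF M c] by simp
 then have "\<exists>q. q \<in> D \<and> q \<in> W" using o pt unfolding in_closure_of by auto
 then obtain q where "q \<in> D" "q \<in> W" by auto
 then show False using z[of q] by (simp add: W_def)
qed

subsection \<open>Gradients and scalar curvature\<close>

text \<open>A component of the Lie derivative of J, as a function of the point, so that its
  vanishing can be extended by continuity.\<close>

definition lie_J :: "'n::finite set \<Rightarrow> (real^'n \<Rightarrow> real^'n^'n) \<Rightarrow> (real^'n \<Rightarrow> real^'n) \<Rightarrow> 'n \<Rightarrow> 'n \<Rightarrow> real^'n \<Rightarrow> real" where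
 "lie_J I J V j k y = (\<Sum>l\<in>I. V y$l * pd l (\<lambda>z. J z$k$j) y - J y$l$j * pd l (\<lambda>z. V z$k) y + J y$k$l * pd j (\<lambda>z. V z$l) y)"

lemma holomorphic_at_iff: "holomorphic_at I J V y \<longleftrightarrow> (\<forall>j\<in>I. \<forall>k\<in>I. lie_J I J V j k y = 0)"
 unfolding holomorphic_at_def lie_J_def ..

context metric_chart
begin

lemma gradient_mv: "gradient I G f y = PI I *v (Hi y *v (\<chi> i. if i \<in> I then pd i f y else 0))"
 unfolding vec_eq_iff PI_mv_nth by (simp add: gradient_def mv_nth if_distrib[of "\<lambda>x. _ * x"] sum_if_subset cong: if_cong)

lemma smooth_gradient: assumes f: "smooth I U f" shows "smooth I U (gradient I G f)"
proof -
 have "smooth I U (\<lambda>y. \<chi> i. if i \<in> I then pd i f y else 0)"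
 proof (rule smooth_vec_lambda[OF U])
  fix i show "smooth I U (\<lambda>y. if i \<in> I then pd i f y else 0)"
   by (cases "i \<in> I") (simp_all add: smooth_const[OF U] smooth_pd[OF f])
 qed
 then show ?thesis unfolding gradient_mv[abs_def] by (intro smooth_intros U smooth_Hi)
qed

lemma smooth_scalar_curvature: "smooth I U (scalar_curvature I G)"
proof -
 have R: "smooth I U (R i j)" if "i \<in> I" "j \<in> I" for i j
  unfolding riem_def[abs_def] by (intro smooth_intros U smooth_pd smooth_Gam that)
 have "smooth I U (\<lambda>y. \<Sum>j\<in>I. \<Sum>k\<in>I. Hi y$j$k * (\<Sum>i\<in>I. R i j y$i$k))"
  by (intro smooth_intros U smooth_Hi R)
 then show ?thesis
  by (rule smooth_cong[OF U]) (auto simp: scalar_curvature_def ricci_R intro!: sum.cong)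
qed

end

context ansatz_chart
begin

lemma gradient_x: assumes y: "y \<in> U" shows "gradient I G x y = \<Psi> y *v axis True 1"
proof -
 have "transpose (\<Phi> y) *v axis True 1 = (1 / h (x y)) *\<^sub>R X y"
  by (simp add: vec_eq_iff matrix_vector_mult_basis column_def transpose_def \<Phi>_nth)
 then have "\<Psi> y *v axis True 1 = Hi y *v X y"
  unfolding \<Psi>_def using hx[OF y]
  by (simp add: bounded_bilinear.scaleR_left[OF bounded_bilinear_mv] bounded_bilinear.scaleR_right[OF bounded_bilinear_mv] matrix_vector_mul_assoc[symmetric])
 moreover have "PI I *v (\<Psi> y *v axis True 1) = \<Psi> y *v axis True 1"
  by (simp add: matrix_vector_mul_assoc blk_left[OF blk_\<Psi>[OF y]])
 ultimately show ?thesis by (simp add: gradient_mv X_def)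
qed

text \<open>The gradient \<open>V\<close> of \<open>x\<close> preserves the coframe \<open>dx/h\<close>, \<open>\<theta>\<close>, \<open>df\<close>: in the frame connection this says
 \<open>\<nabla>\<^sub>V + DV = 0\<close>, and \<open>J\<close> is parallel.\<close>

lemma gradient_holomorphic:
 assumes y: "y \<in> U" shows "holomorphic_at I J (gradient I G x) y"
proof -
 define Z where "Z y = \<Psi> y *v axis True 1" for y
 define t where "t = x y"
 have t: "t \<in> S" unfolding t_def by (rule x_S[OF y])
 interpret B: kaehler_chart K V "\<gamma> t" Jb by (rule base[OF t])
 have sV: "smooth I U Z" unfolding Z_def[abs_def] by (intro smooth_intros U smooth_\<Psi>)
 have \<Phi>Z: "\<Phi> z *v Z z = axis True 1" and PV: "P z *v Z z = 0" if "z \<in> U" for z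
  using dual[OF that] by (simp_all add: Z_def matrix_vector_mul_assoc)
 have Vc: "Z z \<in> coord I" if "z \<in> U" for z unfolding Z_def by (rule blk_mv_coord[OF blk_\<Psi>[OF that]])
 define DV where "DV = jac I Z y"
 define A where "A = (\<Sum>l\<in>I. Z y$l *\<^sub>R Gp t l y) + DV"
 have bDV: "blk I I DV" unfolding DV_def by (rule blk_jac[OF U sV _ y]) (use Vc in auto)
 have bA: "blk I I A" unfolding A_def by (intro blk_add bDV blk_sum blk_scaleR blk_Gp t y)
 have \<Phi>DV: "(\<Phi> y**DV)$s$k = - (pd k \<Phi> y *v Z y)$s" if k: "k \<in> I" for s k
 proof -
  have "pd k (\<lambda>z. \<Phi> z *v Z z) y = pd k (\<lambda>z. axis True 1 :: real ^ bool) y" by (rule pd_cong[OF U y k \<Phi>Z])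
  then have "\<Phi> y *v pd k Z y + pd k \<Phi> y *v Z y = 0"
   by (simp add: pd_mv[OF U smooth_\<Phi> sV k y] pds_pd[OF pds_const])
  moreover have "(\<Phi> y**DV)$s$k = (\<Phi> y *v pd k Z y)$s" using k by (simp add: mm_nth mv_nth DV_def jac_nth)
  ultimately show ?thesis by (metis add_eq_0_iff2 vector_uminus_component)
 qed
 have PDV: "(P y**DV)$s$k = - (pd k P y *v Z y)$s" if k: "k \<in> I" for s k
 proof -
  have "pd k (\<lambda>z. P z *v Z z) y = pd k (\<lambda>z. 0 :: real^'k) y" by (rule pd_cong[OF U y k PV])
  then have "P y *v pd k Z y + pd k P y *v Z y = 0"
   by (simp add: pd_mv[OF U smooth_P sV k y] pds_pd[OF pds_const])
  moreover have "(P y**DV)$s$k = (P y *v pd k Z y)$s" using k by (simp add: mm_nth mv_nth DV_def jac_nth)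
  ultimately show ?thesis by (metis add_eq_0_iff2 vector_uminus_component)
 qed
 have mvV: "(C *v Z y)$s = (\<Sum>l\<in>I. Z y$l * C$s$l)" for C :: "real^'n^'c" and s
  unfolding mv_nth by (rule sum.mono_neutral_cong_right) (use Vc[OF y] in \<open>auto simp: coord_def mult.commute\<close>)
 have "(\<Phi> y**A)$s$k = 0" if k: "k \<in> I" for s k
 proof -
  have "(\<Phi> y**A)$s$k = (\<Sum>l\<in>I. Z y$l * (pd l \<Phi> y$s$k - pd k \<Phi> y$s$l))"
   unfolding A_def using par_\<Phi>[OF t _ y] \<Phi>DV[OF k, of s]
   by (simp add: mm_ring mm_sum_right sum_component mvV sum_subtractf right_diff_distrib)
  also have "\<dots> = 0"
  proof (cases s)
   case True then show ?thesis using pd_\<Phi>_antisym(1)[OF t y _ k] by simp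
  next
   case False
   \<comment> \<open>The contraction of d\<theta> with the gradient vanishes: d\<theta> is pulled
     back from the base and \<open>P\<close> kills the gradient.\<close>
   have "dth y = transpose (P y)**W y**P y" by (rule dth_def[OF t])
   then have "dth y *v Z y = 0" using PV[OF y] by (simp add: matrix_vector_mul_assoc[symmetric])
   then have "(\<Sum>l\<in>I. Z y$l * dth y$k$l) = 0" using mvV[of "dth y" k] by simp
   moreover have "dth y$l$k = - dth y$k$l" if "l \<in> I" for l
    using dth_nth[OF t y that k] dth_nth[OF t y k that] by simp
   ultimately show ?thesis using False pd_\<Phi>_antisym(2)[OF t y _ k] by (simp add: sum_negf)
  qed
  finally show ?thesis .
 qed
 moreover have "(\<Phi> y**A)$s$k = 0" if k: "k \<notin> I" for s k
  using blk_mm[OF blk_\<Phi> bA] k unfolding blk_def by blast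
 ultimately have \<Phi>A: "\<Phi> y**A = 0" by (metis (no_types) vec_eq_iff zero_index)
 have "(P y**A)$e$k = 0" if k: "k \<in> I" for e k
 proof -
  have s: "(pd l P y + om t l y**P y)$e$k = (pd k P y + om t k y**P y)$e$l" if "l \<in> I" for l
   unfolding P_def om_def using pd_jac_sym[OF U smooth_f y that k] B.pb_jac_sym[OF U smooth_f fU y that k] by simp
  have pp: "P y**Gp t l y = pd l P y + om t l y**P y" if "l \<in> I" for l using par_P[OF t that y] by simp
  have "(P y**A)$e$k = (\<Sum>l\<in>I. Z y$l * (pd l P y + om t l y**P y)$e$k) - (pd k P y *v Z y)$e"
   unfolding A_def using PDV[OF k, of e] by (simp add: mm_ring mm_sum_right sum_component pp)
  also have "(\<Sum>l\<in>I. Z y$l * (pd l P y + om t l y**P y)$e$k) = ((pd k P y + om t k y**P y) *v Z y)$e"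
   unfolding mvV using s by simp
  also have "(pd k P y + om t k y**P y) *v Z y = pd k P y *v Z y"
   by (simp add: bounded_bilinear.add_left[OF bounded_bilinear_mv] matrix_vector_mul_assoc[symmetric] PV[OF y])
  finally show ?thesis by simp
 qed
 moreover have "(P y**A)$s$k = 0" if k: "k \<notin> I" for s k
  using blk_mm[OF blk_P[OF y] bA] k unfolding blk_def by blast
 ultimately have PA: "P y**A = 0" by (metis (no_types) vec_eq_iff zero_index)
 have A0: "A = 0" using PI_decomp[OF y blk_left[OF bA]] \<Phi>A PA by (simp add: mm_ring)
 have eqV: "pd j (\<lambda>z. gradient I G x z$k) y = DV$k$j" if j: "j \<in> I" for j k
 proof -
  have "pd j (\<lambda>z. gradient I G x z$k) y = pd j (\<lambda>z. Z z$k) y"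
   by (rule pd_cong[OF U y j]) (simp add: gradient_x Z_def)
  then show ?thesis using j by (simp add: pd_nth[OF U sV j y] DV_def jac_nth)
 qed
 show ?thesis unfolding holomorphic_at_iff
 proof (intro ballI)
  fix j k assume j: "j \<in> I" and k: "k \<in> I"
  have m1: "(DV**J y)$k$j = (\<Sum>l\<in>I. J y$l$j * DV$k$l)"
   unfolding mm_nth by (rule sum.mono_neutral_cong_right) (use bDV in \<open>auto simp: blk_def mult.commute\<close>)
  have m2: "(J y**DV)$k$j = (\<Sum>l\<in>I. J y$k$l * DV$l$j)"
   unfolding mm_nth by (rule sum.mono_neutral_cong_right) (use bDV in \<open>auto simp: blk_def\<close>)
  have "lie_J I J (gradient I G x) j k y = (\<Sum>l\<in>I. Z y$l * (J y**Gp t l y - Gp t l y**J y)$k$j) - (DV**J y)$k$j + (J y**DV)$k$j"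
   unfolding m1 m2 lie_J_def gradient_x[OF y, folded Z_def] using j by (simp add: eqV pd_nth2[OF U smooth_J _ y] par_J[OF t _ y] sum.distrib sum_subtractf)
  also have "\<dots> = (J y**A - A**J y)$k$j"
   unfolding A_def by (simp add: mm_ring mm_sum_left mm_sum_right sum_component sum_subtractf right_diff_distrib)
  finally show "lie_J I J (gradient I G x) j k y = 0" by (simp add: A0 mm_ring)
 qed
qed

end

subsection \<open>Tensors pulled back from the base\<close>

lemma openin_chart_preimage:
 assumes M: "closed_manifold M" and c: "c \<in> atlas M" and F: "continuous_on (crange c) F" and C: "open C"
 shows "openin (mtop M) {p \<in> fst c. F (snd c p) \<in> C}"
proof -
 have cm: "continuous_map (subtopology (mtop M) (fst c)) (top_of_set (crange c)) (snd c)"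
  using homeomorphic_imp_continuous_map[OF chart_facts(3)[OF M c]] .
 have "openin (top_of_set (crange c)) (crange c \<inter> F -` C)" using continuous_openin_preimage_gen[OF F C] .
 then have "openin (subtopology (mtop M) (fst c)) {p \<in> topspace (subtopology (mtop M) (fst c)). snd c p \<in> crange c \<inter> F -` C}"
  by (rule openin_continuous_map_preimage[OF cm])
 moreover have "{p \<in> topspace (subtopology (mtop M) (fst c)). snd c p \<in> crange c \<inter> F -` C} = {p \<in> fst c. F (snd c p) \<in> C}"
  using chart_pts[OF M c] by (auto simp: crange_def)
 ultimately show ?thesis using openin_trans_full[OF _ chart_facts(1)[OF M c]] by metis
qed

lemma dmap_cong:
 assumes M: "closed_manifold M" and c: "c \<in> atlas M" and p: "p \<in> fst c" and e: "\<And>q. q \<in> pts M \<Longrightarrow> f q = f' q"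
 shows "dmap (idx M) c c' f (snd c p) v = dmap (idx M) c c' f' (snd c p) v"
proof -
 have "pd i (snd c' \<circ> f \<circ> point c) (snd c p) = pd i (snd c' \<circ> f' \<circ> point c) (snd c p)" if "i \<in> idx M" for i
  by (rule pd_cong[OF chart_facts(2)[OF M c] snd_crange[OF p] that]) (simp add: e chart_pts[OF M c point_in(1)])
 then show ?thesis by (simp add: dmap_def)
qed

lemma blk_congr: "blk I I (transpose (jac I f y)**A**jac I f y)"
 by (auto simp: blk_def mm_nth transpose_def jac_nth)

lemma is_pullbackD:
 "\<lbrakk>is_pullback M N f T' T; c \<in> atlas M; c' \<in> atlas N; p \<in> fst c; f p \<in> fst c'; v \<in> coord (idx M); w \<in> coord (idx M)\<rbrakk> \<Longrightarrow>
  bil (T c (snd c p)) v w = bil (T' c' (snd c' (f p))) (dmap (idx M) c c' f (snd c p) v) (dmap (idx M) c c' f (snd c p) w)"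
 unfolding is_pullback_def by simp

lemma bil_sym:
 assumes "\<And>i j. i \<in> I \<Longrightarrow> j \<in> I \<Longrightarrow> A$i$j = A$j$i" "v \<in> coord I" "w \<in> coord I"
 shows "bil A v w = bil A w v"
 unfolding bil_coord[OF assms(2,3)] bil_coord[OF assms(3,2)] by (subst sum.swap) (auto intro!: sum.cong simp: assms(1))

lemma matrix_eq_bil:
 assumes "blk I I A" "blk I I B" "\<And>v w. v \<in> coord I \<Longrightarrow> w \<in> coord I \<Longrightarrow> bil A v w = bil B v w"
 shows "A = B"
proof -
 have "A$i$j = B$i$j" for i j
  using assms(1,2) assms(3)[of "axis i 1" "axis j 1"] by (cases "i \<in> I \<and> j \<in> I") (auto simp: bil_axis blk_def)
 then show ?thesis by (simp add: vec_eq_iff)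
qed

text \<open>What follows from the form of the ansatz alone. Separating it from
  \<open>kaehler_ansatz\<close> allows the new metric to be an instance while its form is still
  being shown to be closed.\<close>

locale ansatz_mfd =
 fixes M :: "('p, 'n::finite) mfd" and g J :: "('p, 'n) tensor2" and E :: "('p, 'n, 'q, 'k::finite, 'm::finite) circle_bundle"
  and b :: "real^'m" and x :: "'p \<Rightarrow> real" and l u :: real and h :: "real \<Rightarrow> real" and a :: "real^'m"
 assumes M: "closed_manifold M" and cs: "complex_structure M J" and ans: "ansatz M g J E b x l u h a"
begin

abbreviation (input) "B \<equiv> base E"
abbreviation (input) "I \<equiv> idx M"
abbreviation (input) "K \<equiv> idx (base E)"
abbreviation "M0 \<equiv> principal_part M x l u"
abbreviation "\<pi> \<equiv> proj E"
abbreviation (input) "r\<pi> c c' \<equiv> snd c' \<circ> \<pi> \<circ> point c"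
abbreviation (input) "D\<pi> c c' p \<equiv> dmap I c c' \<pi> (snd c p)"
abbreviation (input) "dx c p \<equiv> dfun I c x (snd c p)"
abbreviation (input) "gB \<equiv> base_metric E a b"

lemma cp: "cp1_bundle M E b x l u" using ans by (simp add: ansatz_def)

lemma cp_facts: "l < u" "smooth_fun M x" "x ` pts M = {l..u}" "mtop M closure_of M0 = pts M" "closed_manifold B"
  "complex_structure B (bJ E)" "sym_tensor B (bg E i)" "card I = card K + 2" "smooth_map M B \<pi>" "one_form_on M M0 (conn E)"
  "t \<in> {l<..<u} \<Longrightarrow> q \<in> pts B \<Longrightarrow> \<exists>p\<in>M0. x p = t \<and> \<pi> p = q"
 using cp unfolding cp1_bundle_def Let_def by simp_all

lemmas lu = cp_facts(1) and dense = cp_facts(4) and clB = cp_facts(5) and sm\<pi> = cp_facts(9)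

lemmas chM = chart_facts(2)[OF M] and chB = chart_facts(2)[OF clB] and pointM = point_snd[OF M]

lemma x_pts: "p \<in> pts M \<Longrightarrow> x p \<in> {l..u}" using cp_facts(3) by blast

lemma M0_pts: "p \<in> M0 \<Longrightarrow> p \<in> pts M" and M0_x: "p \<in> M0 \<Longrightarrow> x p \<in> {l<..<u}" by (simp_all add: principal_part_def)

lemma smooth_xc: "c \<in> atlas M \<Longrightarrow> smooth I (crange c) (x \<circ> point c)"
 using cp_facts(2) by (simp add: smooth_fun_def)

lemma x_point: "c \<in> atlas M \<Longrightarrow> y \<in> crange c \<Longrightarrow> x (point c y) \<in> {l..u}"
 using x_pts chart_pts[OF M] point_in(1) by blast

lemma open_M0: "openin (mtop M) M0"
proof -
 have "openin (mtop M) {p \<in> fst c. x p \<in> {l<..<u}}" if c: "c \<in> atlas M" for c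
 proof -
  have "{p \<in> fst c. (x \<circ> point c) (snd c p) \<in> {l<..<u}} = {p \<in> fst c. x p \<in> {l<..<u}}" using pointM[OF c] by auto
  then show ?thesis using openin_chart_preimage[OF M c smooth_continuous[OF smooth_xc[OF c]], of "{l<..<u}"] by simp
 qed
 then have "openin (mtop M) (\<Union>c\<in>atlas M. {p \<in> fst c. x p \<in> {l<..<u}})" by (intro openin_Union) auto
 moreover have "(\<Union>c\<in>atlas M. {p \<in> fst c. x p \<in> {l<..<u}}) = M0"
  using chart_cover[OF M] chart_pts[OF M] by (auto simp: principal_part_def)
 ultimately show ?thesis by simp
qed

lemma \<pi>_pts: "p \<in> pts M \<Longrightarrow> \<pi> p \<in> pts B" by (rule map_pts[OF M clB sm\<pi>])

lemma base_chart: "p \<in> pts M \<Longrightarrow> \<exists>c'\<in>atlas B. \<pi> p \<in> fst c'" by (rule chart_cover[OF clB \<pi>_pts])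

lemma bg_smooth: "c' \<in> atlas B \<Longrightarrow> smooth K (crange c') (bg E i c')"
  and bg_sym: "\<lbrakk>c' \<in> atlas B; z \<in> crange c'; s \<in> K; t \<in> K\<rbrakk> \<Longrightarrow> bg E i c' z$s$t = bg E i c' z$t$s"
  and bg_pullback: "is_pullback B B id (bg E i) (bg E i)"
 using cp_facts(7)[of i] unfolding sym_tensor_def by simp_all

lemma d\<pi>_coord: "\<lbrakk>c \<in> atlas M; c' \<in> atlas B; p \<in> fst c; \<pi> p \<in> fst c'\<rbrakk> \<Longrightarrow> D\<pi> c c' p v \<in> coord K"
 by (rule dmap_coord[OF M clB sm\<pi>])

definition W where "W c c' = fst c \<inter> {p \<in> pts M. \<pi> p \<in> fst c'}"

lemma open_W: "c' \<in> atlas B \<Longrightarrow> openin (mtop M) {p \<in> pts M. \<pi> p \<in> fst c'}"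
 by (rule open_preimage[OF M clB sm\<pi> chart_facts(1)[OF clB]])

lemma open_cW: "c \<in> atlas M \<Longrightarrow> c' \<in> atlas B \<Longrightarrow> ropen I (snd c ` W c c')"
 unfolding W_def by (rule chart_open_image[OF M _ open_W])

lemma smooth_\<pi>: assumes "c \<in> atlas M" "c' \<in> atlas B" shows "smooth I (snd c ` W c c') (r\<pi> c c')"
 unfolding W_def by (rule lrep_smooth[OF M clB sm\<pi> assms open_W[OF assms(2)]]) simp

lemma image_\<pi>: assumes "c \<in> atlas M" "c' \<in> atlas B" shows "(r\<pi> c c') ` (snd c ` W c c') \<subseteq> crange c'"
 unfolding W_def by (rule lrep_image[OF M clB sm\<pi> assms open_W[OF assms(2)]]) simp

definition bchart where "bchart p = (SOME c'. c' \<in> atlas B \<and> \<pi> p \<in> fst c')"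

lemma bchart: "p \<in> pts M \<Longrightarrow> bchart p \<in> atlas B \<and> \<pi> p \<in> fst (bchart p)"
 unfolding bchart_def by (rule someI_ex) (use base_chart in blast)

text \<open>The base chart is a choice, but by \<open>pullT_bil\<close> the value does not depend on
  it. The coefficients are functions of x and no division by h occurs, so for smooth coefficients
  the tensor extends smoothly over the special orbits.\<close>

definition pullT :: "('m \<Rightarrow> real \<Rightarrow> real) \<Rightarrow> ('p, 'n) tensor2" where
 "pullT e c y = (let p = point c y; c' = bchart p; P = jac I (r\<pi> c c') y
   in transpose P**(\<Sum>i\<in>UNIV. e i (x p) *\<^sub>R bg E i c' (snd c' (\<pi> p)))**P)"

lemma d\<pi>_chart:
 assumes "c \<in> atlas M" "c' \<in> atlas B" "c'' \<in> atlas B" "p \<in> fst c" "\<pi> p \<in> fst c'" "\<pi> p \<in> fst c''"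
 shows "dmap I c c'' \<pi> (snd c p) v = dmap K c' c'' id (snd c' (\<pi> p)) (D\<pi> c c' p v)"
 using dmap_chain[OF M clB clB sm\<pi> smooth_map_id[OF clB] assms(1-5), of v] assms(6) by simp

lemma pullT_bil:
 assumes c: "c \<in> atlas M" "c' \<in> atlas B" and p: "p \<in> fst c" "\<pi> p \<in> fst c'" and vw: "v \<in> coord I" "w \<in> coord I"
 shows "bil (pullT e c (snd c p)) v w = (\<Sum>i\<in>UNIV. e i (x p) * bil (bg E i c' (snd c' (\<pi> p))) (D\<pi> c c' p v) (D\<pi> c c' p w))"
proof -
 define c'' where "c'' = bchart p"
 have c'': "c'' \<in> atlas B" "\<pi> p \<in> fst c''" using bchart[OF chart_pts[OF M c(1) p(1)]] by (simp_all add: c''_def)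
 have e: "bil (bg E i c'' (snd c'' (\<pi> p))) (dmap I c c'' \<pi> (snd c p) v) (dmap I c c'' \<pi> (snd c p) w)
  = bil (bg E i c' (snd c' (\<pi> p))) (D\<pi> c c' p v) (D\<pi> c c' p w)" for i
  unfolding d\<pi>_chart[OF c(1,2) c''(1) p c''(2)]
  using is_pullbackD[OF bg_pullback c(2) c''(1) p(2) _ d\<pi>_coord[OF c p] d\<pi>_coord[OF c p]] c''(2) by simp
 show ?thesis unfolding pullT_def Let_def pointM[OF c(1) p(1)] c''_def[symmetric] bil_congruence dmap_jac[OF vw(1), symmetric] dmap_jac[OF vw(2), symmetric]
  by (simp add: bil_sum_scale e)
qed

lemma blk_pullT: "blk I I (pullT e c y)"
 unfolding pullT_def Let_def by (rule blk_congr)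

lemma pullT_local:
 assumes c: "c \<in> atlas M" "c' \<in> atlas B" and y: "y \<in> snd c ` W c c'"
 shows "pullT e c y = transpose (jac I (r\<pi> c c') y)**(\<Sum>i\<in>UNIV. e i (x (point c y)) *\<^sub>R bg E i c' ((r\<pi> c c') y))**jac I (r\<pi> c c') y"
proof (rule matrix_eq_bil[OF blk_pullT])
 show "blk I I (transpose (jac I (r\<pi> c c') y)**(\<Sum>i\<in>UNIV. e i (x (point c y)) *\<^sub>R bg E i c' ((r\<pi> c c') y))**jac I (r\<pi> c c') y)"
  by (rule blk_congr)
 fix v w :: "real^'n" assume vw: "v \<in> coord I" "w \<in> coord I"
 obtain p where p: "p \<in> fst c" "\<pi> p \<in> fst c'" "y = snd c p" using y by (auto simp: W_def)
 show "bil (pullT e c y) v w = bil (transpose (jac I (r\<pi> c c') y)**(\<Sum>i\<in>UNIV. e i (x (point c y)) *\<^sub>R bg E i c' ((r\<pi> c c') y))**jac I (r\<pi> c c') y) v w"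
  unfolding p(3) pullT_bil[OF c p(1,2) vw] bil_congruence dmap_jac[OF vw(1), symmetric] dmap_jac[OF vw(2), symmetric] bil_sum_scale
  by (simp add: pointM[OF c(1) p(1)])
qed

lemma smooth_local:
 assumes c: "c \<in> atlas M" and T: "\<And>c'. c' \<in> atlas B \<Longrightarrow> smooth I (snd c ` W c c') f"
 shows "smooth I (crange c) f"
 unfolding smooth_def
proof (intro allI Ck_local)
 fix r y assume "y \<in> crange c"
 then obtain p where p: "p \<in> fst c" "y = snd c p" by (rule crangeE)
 obtain c' where c': "c' \<in> atlas B" "\<pi> p \<in> fst c'" using base_chart[OF chart_pts[OF M c p(1)]] by auto
 have "y \<in> snd c ` W c c'" using p c' chart_pts[OF M c] by (auto simp: W_def)
 moreover have "snd c ` W c c' \<subseteq> crange c" by (auto simp: W_def crange_def)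
 ultimately show "\<exists>V. ropen I V \<and> y \<in> V \<and> V \<subseteq> crange c \<and> Ck r I V f"
  using open_cW[OF c c'(1)] smooth_Ck[OF T[OF c'(1)]] by blast
qed

lemma smooth_pullT:
 assumes c: "c \<in> atlas M" and T: "open T" "{l..u} \<subseteq> T" "\<And>i. smooth1 T (e i)"
 shows "smooth I (crange c) (pullT e c)"
proof (rule smooth_local[OF c])
 fix c' assume c': "c' \<in> atlas B"
 note U = open_cW[OF c c']
 have sub: "snd c ` W c c' \<subseteq> crange c" by (auto simp: W_def crange_def)
 have sx: "smooth I (snd c ` W c c') (\<lambda>y. e i (x (point c y)))" for i
  by (rule smooth_real_compose[OF U T(1) smooth_subset[OF smooth_xc[OF c, unfolded comp_def] sub] _ T(3)])
   (use x_point[OF c] T(2) sub in blast)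
 show "smooth I (snd c ` W c c') (pullT e c)"
  by (rule smooth_cong[OF U _ pullT_local[OF c c', symmetric]], assumption?)
   (intro smooth_intros U smooth_jac[OF U] sx
 smooth_compose[OF U chB[OF c'] image_\<pi>[OF c c'] smooth_\<pi>[OF c c'] bg_smooth[OF c']] smooth_\<pi>[OF c c'])
qed

text \<open>Two uses: with identity maps it yields the transformation law between charts, with group
  elements the invariance of the new metrics.\<close>

lemma pullT_invariant:
 assumes f: "smooth_map M M f" and k: "smooth_map B B k" and fk: "\<And>p. p \<in> pts M \<Longrightarrow> \<pi> (f p) = k (\<pi> p)"
  and x: "\<And>p. p \<in> pts M \<Longrightarrow> x (f p) = x p" and bg: "\<And>i. is_pullback B B k (bg E i) (bg E i)"
 shows "is_pullback M M f (pullT e) (pullT e)"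
 unfolding is_pullback_def
proof (intro ballI impI)
 fix c c1 p v w assume c: "c \<in> atlas M" "c1 \<in> atlas M" and p: "p \<in> fst c" "f p \<in> fst c1" and vw: "v \<in> coord I" "w \<in> coord I"
 note pM = chart_pts[OF M c(1) p(1)]
 obtain c' where c': "c' \<in> atlas B" "\<pi> p \<in> fst c'" using base_chart[OF pM] by auto
 obtain c1' where c1': "c1' \<in> atlas B" "\<pi> (f p) \<in> fst c1'" using base_chart[OF chart_pts[OF M c(2) p(2)]] by auto
 have k1: "k (\<pi> p) \<in> fst c1'" using c1' fk[OF pM] by simp
 have e: "dmap I c1 c1' \<pi> (snd c1 (f p)) (dmap I c c1 f (snd c p) v) = dmap K c' c1' k (snd c' (\<pi> p)) (D\<pi> c c' p v)" for v
 proof -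
  have "dmap I c c1' (\<pi> \<circ> f) (snd c p) v = dmap I c c1' (k \<circ> \<pi>) (snd c p) v"
   by (rule dmap_cong[OF M c(1) p(1)]) (simp add: fk)
  then show ?thesis
   using dmap_chain[OF M M clB f sm\<pi> c c1'(1) p c1'(2), of v] dmap_chain[OF M clB clB sm\<pi> k c(1) c'(1) c1'(1) p(1) c'(2) k1, of v] by simp
 qed
 have "bil (bg E i c' (snd c' (\<pi> p))) (D\<pi> c c' p v) (D\<pi> c c' p w) =
  bil (bg E i c1' (snd c1' (\<pi> (f p)))) (dmap K c' c1' k (snd c' (\<pi> p)) (D\<pi> c c' p v)) (dmap K c' c1' k (snd c' (\<pi> p)) (D\<pi> c c' p w))" for i
  unfolding fk[OF pM] by (rule is_pullbackD[OF bg c'(1) c1'(1) c'(2) k1 d\<pi>_coord[OF c(1) c'(1) p(1) c'(2)] d\<pi>_coord[OF c(1) c'(1) p(1) c'(2)]])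
 then show "bil (pullT e c (snd c p)) v w = bil (pullT e c1 (snd c1 (f p))) (dmap I c c1 f (snd c p) v) (dmap I c c1 f (snd c p) w)"
  unfolding pullT_bil[OF c(1) c'(1) p(1) c'(2) vw] pullT_bil[OF c(2) c1'(1) p(2) c1'(2) dmap_coord[OF M M f c p] dmap_coord[OF M M f c p]] e x[OF pM]
  by simp
qed

end

subsection \<open>The Kaehler form of the ansatz\<close>

text \<open>The product rule, with the coefficients first held at their values at \<open>y\<close>
  and then differentiated.\<close>

lemma ext3_frozen:
 fixes A :: "'m::finite \<Rightarrow> real^'n \<Rightarrow> real" and \<Omega> :: "'m \<Rightarrow> real^'n \<Rightarrow> real^'n^'n"
 assumes U: "ropen I U" and y: "y \<in> U" and ijk: "i \<in> I" "j \<in> I" "k \<in> I" and A: "\<And>s. smooth I U (A s)" and \<Omega>: "\<And>s. smooth I U (\<Omega> s)"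
 shows "ext3 (\<lambda>z. \<Sum>s\<in>UNIV. A s z *\<^sub>R \<Omega> s z) i j k y = ext3 (\<lambda>z. \<Sum>s\<in>UNIV. A s y *\<^sub>R \<Omega> s z) i j k y
  + (\<Sum>s\<in>UNIV. pd i (A s) y * \<Omega> s y$j$k + pd j (A s) y * \<Omega> s y$k$i + pd k (A s) y * \<Omega> s y$i$j)"
proof -
 have e: "pd i (\<lambda>z. (\<Sum>s\<in>UNIV. B s z *\<^sub>R \<Omega> s z)$j$k) y = (\<Sum>s\<in>UNIV. B s y * pd i (\<Omega> s) y$j$k + pd i (B s) y * \<Omega> s y$j$k)"
  if "i \<in> I" "\<And>s. smooth I U (B s)" for i j k B
 proof -
  have sB: "smooth I U (\<lambda>z. B s z *\<^sub>R \<Omega> s z)" for s by (rule smooth_scaleR[OF U that(2) \<Omega>])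
  have "pd i (\<lambda>z. (\<Sum>s\<in>UNIV. B s z *\<^sub>R \<Omega> s z)$j$k) y = (\<Sum>s\<in>UNIV. pd i (\<lambda>z. B s z *\<^sub>R \<Omega> s z) y)$j$k"
   unfolding pd_sum[OF U sB that(1) y, symmetric] by (rule pd_nth2[OF U smooth_sum[OF U sB] that(1) y])
  then show ?thesis unfolding pd_scaleR[OF U that(2) \<Omega> that(1) y] by (simp add: sum_component)
 qed
 show ?thesis unfolding ext3_def e[OF ijk(1) A] e[OF ijk(2) A] e[OF ijk(3) A]
  e[OF ijk(1) smooth_const[OF U]] e[OF ijk(2) smooth_const[OF U]] e[OF ijk(3) smooth_const[OF U]]
  by (simp add: pds_pd[OF pds_const] sum.distrib algebra_simps)
qed

lemma bil_transpose_mm: "bil (transpose A**C) v w = bil C (A *v v) w"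
 unfolding bil_def by (metis inner_mv matrix_vector_mul_assoc transpose_transpose)

lemma bil_J_antisym:
 assumes sym: "\<And>i j. i \<in> K \<Longrightarrow> j \<in> K \<Longrightarrow> G$i$j = G$j$i" and J: "blk K K J" and sq: "\<And>v. v \<in> coord K \<Longrightarrow> J *v (J *v v) = - v"
  and orth: "\<And>v w. v \<in> coord K \<Longrightarrow> w \<in> coord K \<Longrightarrow> bil G (J *v v) (J *v w) = bil G v w" and ij: "i \<in> K" "j \<in> K"
 shows "(transpose J**G)$i$j = - (transpose J**G)$j$i"
proof -
 have a: "axis i 1 \<in> coord K" "axis j 1 \<in> coord K" using ij by simp_all
 have "bil G (- axis i 1) (J *v axis j 1) = bil G (J *v axis i 1) (axis j 1)"
  using orth[OF blk_mv_coord[OF J, of "axis i 1"] a(2)] sq[OF a(1)] by simp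
 moreover have "bil G (- axis i 1) (J *v axis j 1) = - bil G (J *v axis j 1) (axis i 1)"
  using bil_sym[OF sym a(1) blk_mv_coord[OF J]] by (simp add: bil_def)
 ultimately show ?thesis by (simp add: bil_axis[symmetric] bil_transpose_mm)
qed

lemma kform_antisym:
 assumes "kaehler N G j" "c \<in> atlas N" "z \<in> crange c" "s \<in> idx N" "t \<in> idx N"
 shows "kform G j c z$s$t = - kform G j c z$t$s"
 unfolding kform_def
 by (rule bil_J_antisym[of "idx N"]) (use assms in \<open>auto simp: kaehler_def riemannian_def sym_tensor_def complex_structure_def almost_complex_def endo_field_def blk_def\<close>)

lemma smooth_bil:
 assumes "ropen C U" "smooth C U A" "smooth C U v'" "smooth C U w'" shows "smooth C U (\<lambda>y. bil (A y) (v' y) (w' y))"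
 unfolding bil_def by (rule smooth_bilinear[OF assms(1) bounded_bilinear_inner assms(3) smooth_mv[OF assms(1,2,4)]])

lemma smooth_kform:
 assumes "closed_manifold N" "kaehler N G j" "c \<in> atlas N" shows "smooth (idx N) (crange c) (kform G j c)"
 unfolding kform_def[abs_def] using assms chart_facts(2)[OF assms(1,3)]
 by (intro smooth_mm smooth_transpose) (auto simp: kaehler_def riemannian_def sym_tensor_def complex_structure_def almost_complex_def endo_field_def)

lemma base_metric_bil: "bil (base_metric E a b t c y) v w = (\<Sum>i\<in>UNIV. (b$i * t + a$i) * bil (bg E i c y) v w)"
 unfolding base_metric_def bil_sum_scale ..

lemma sym_tensor_base_metric:
 fixes E :: "('p, 'n, 'q, 'k::finite, 'm::finite) circle_bundle"
 assumes B: "closed_manifold (base E)" and sg: "\<And>i. sym_tensor (base E) (bg E i)"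
 shows "sym_tensor (base E) (base_metric E a b t)"
 unfolding sym_tensor_def is_pullback_def
proof (intro conjI ballI impI)
 fix c assume c: "c \<in> atlas (base E)"
 note U = chart_facts(2)[OF B c]
 show "smooth (idx (base E)) (crange c) (base_metric E a b t c)"
  unfolding base_metric_def[abs_def] using sg c
  by (intro smooth_intros U) (simp add: sym_tensor_def)
 show "base_metric E a b t c y$i$j = base_metric E a b t c y$j$i" if "y \<in> crange c" "i \<in> idx (base E)" "j \<in> idx (base E)" for y i j
  unfolding base_metric_def sum_component using sg c that by (simp add: sym_tensor_def)
 fix c' p v w assume "c' \<in> atlas (base E)" "p \<in> fst c" "id p \<in> fst c'" "v \<in> coord (idx (base E))" "w \<in> coord (idx (base E))"
 then show "bil (base_metric E a b t c (snd c p)) v w = bil (base_metric E a b t c' (snd c' (id p))) (dmap (idx (base E)) c c' id (snd c p) v) (dmap (idx (base E)) c c' id (snd c p) w)"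
  unfolding base_metric_bil using is_pullbackD[of "base E" "base E" id _ _ c c' p v w] sg c unfolding sym_tensor_def by (intro sum.cong) auto
qed

context ansatz_mfd
begin

lemma J_smooth: "c \<in> atlas M \<Longrightarrow> smooth I (crange c) (J c)"
 and J_blk: "c \<in> atlas M \<Longrightarrow> y \<in> crange c \<Longrightarrow> blk I I (J c y)"
 and J_sq: "\<lbrakk>c \<in> atlas M; y \<in> crange c; w \<in> coord I\<rbrakk> \<Longrightarrow> J c y *v (J c y *v w) = - w"
 using cs unfolding complex_structure_def almost_complex_def endo_field_def blk_def by simp_all

lemmas J_facts = J_smooth blk_mv_coord[OF J_blk]

lemma bJ_smooth: "c \<in> atlas B \<Longrightarrow> smooth K (crange c) (bJ E c)"
 and bJ_blk: "c \<in> atlas B \<Longrightarrow> y \<in> crange c \<Longrightarrow> blk K K (bJ E c y)"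
 and bJ_sq: "\<lbrakk>c \<in> atlas B; y \<in> crange c; w \<in> coord K\<rbrakk> \<Longrightarrow> bJ E c y *v (bJ E c y *v w) = - w"
 using cp_facts(6) unfolding complex_structure_def almost_complex_def endo_field_def blk_def by simp_all

lemma ansatz_facts:
 assumes c: "c \<in> atlas M" "c' \<in> atlas B" and p: "p \<in> fst c" "p \<in> M0" "\<pi> p \<in> fst c'" and v: "v \<in> coord I"
 shows "w \<in> coord I \<Longrightarrow> bil (g c (snd c p)) v w = (1 / h (x p)) * dx c p v * dx c p w
   + h (x p) * (conn E c (snd c p) \<bullet> v) * (conn E c (snd c p) \<bullet> w)
   + bil (gB (x p) c' (snd c' (\<pi> p))) (D\<pi> c c' p v) (D\<pi> c c' p w)"
  and "conn E c (snd c p) \<bullet> (J c (snd c p) *v v) = (1 / h (x p)) * dx c p v"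
  and "dx c p (J c (snd c p) *v v) = - h (x p) * (conn E c (snd c p) \<bullet> v)"
  and "D\<pi> c c' p (J c (snd c p) *v v) = bJ E c' (snd c' (\<pi> p)) *v D\<pi> c c' p v"
 using ans c p v unfolding ansatz_def Let_def by blast+

lemma h_pos: "t \<in> {l<..<u} \<Longrightarrow> h t > 0" using ans by (simp add: ansatz_def)

definition U0 where "U0 c c' = snd c ` (fst c \<inter> (M0 \<inter> {p \<in> pts M. \<pi> p \<in> fst c'}))"

lemma U0: assumes "c \<in> atlas M" "c' \<in> atlas B"
 shows "ropen I (U0 c c')" "U0 c c' \<subseteq> crange c" "U0 c c' \<subseteq> snd c ` W c c'" "U0 c c' \<subseteq> snd c ` (fst c \<inter> M0)"
proof -
 show "ropen I (U0 c c')" unfolding U0_def by (rule chart_open_image[OF M assms(1) openin_Int[OF open_M0 open_W[OF assms(2)]]])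
qed (auto simp: U0_def crange_def W_def)

lemma U0E: assumes "y \<in> U0 c c'" obtains p where "p \<in> fst c" "p \<in> M0" "\<pi> p \<in> fst c'" "y = snd c p"
 using assms unfolding U0_def by blast

lemma U0I: "\<lbrakk>p \<in> fst c; p \<in> M0; \<pi> p \<in> fst c'\<rbrakk> \<Longrightarrow> snd c p \<in> U0 c c'"
 unfolding U0_def by (simp add: M0_pts)

lemma smooth_conn: "c \<in> atlas M \<Longrightarrow> smooth I (snd c ` (fst c \<inter> M0)) (conn E c)"
 using cp_facts(10) by (simp add: one_form_on_def)

lemma dconn:
 assumes "c \<in> atlas M" "c' \<in> atlas B" "p \<in> fst c" "p \<in> M0" "\<pi> p \<in> fst c'" "j \<in> I" "k \<in> I"
 shows "pd j (\<lambda>z. conn E c z$k) (snd c p) - pd k (\<lambda>z. conn E c z$j) (snd c p) =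
      (\<Sum>i\<in>UNIV. b$i * bil (kform (bg E i) (bJ E) c' (snd c' (\<pi> p))) (D\<pi> c c' p (axis j 1)) (D\<pi> c c' p (axis k 1)))"
 using cp assms unfolding cp1_bundle_def Let_def by blast

lemma kform_ansatz:
 assumes c: "c \<in> atlas M" "c' \<in> atlas B" and y: "y \<in> U0 c c'" and jk: "i \<in> I" "j \<in> I"
 shows "kform g J c y$i$j = pd i (x \<circ> point c) y * conn E c y$j - conn E c y$i * pd j (x \<circ> point c) y
  + (\<Sum>s\<in>UNIV. (b$s * (x \<circ> point c) y + a$s) *\<^sub>R (transpose (jac I (r\<pi> c c') y)**kform (bg E s) (bJ E) c' ((r\<pi> c c') y)**jac I (r\<pi> c c') y))$i$j"
proof -
 obtain p where p: "p \<in> fst c" "p \<in> M0" "\<pi> p \<in> fst c'" and yp: "y = snd c p" using y by (rule U0E)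
 have ax: "axis i 1 \<in> coord I" "axis j 1 \<in> coord I" using jk by simp_all
 have D: "dfun I c x y (axis i 1) = pd i (x \<circ> point c) y" if "i \<in> I" for i
  using that unfolding dfun_def by (simp add: axis_def if_distrib[of "\<lambda>x. x * _"] cong: if_cong)
 have k0: "h (x p) \<noteq> 0" using h_pos[OF M0_x[OF p(2)]] by simp
 have Jc: "J c y *v axis i 1 \<in> coord I" unfolding yp by (rule J_facts(2)[OF c(1) snd_crange[OF p(1)]])
 have ci: "conn E c y \<bullet> axis i 1 = conn E c y$i" for i by (simp add: inner_axis)
 have "kform g J c y$i$j = bil (g c y) (J c y *v axis i 1) (axis j 1)"
  unfolding bil_transpose_mm[symmetric] bil_axis kform_def ..
 also have "\<dots> = pd i (x \<circ> point c) y * conn E c y$j - conn E c y$i * pd j (x \<circ> point c) y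
  + bil (gB (x p) c' (snd c' (\<pi> p))) (bJ E c' (snd c' (\<pi> p)) *v D\<pi> c c' p (axis i 1)) (D\<pi> c c' p (axis j 1))"
  using ansatz_facts(1)[OF c p Jc[unfolded yp] ax(2)] ansatz_facts(2,3)[OF c p ax(1)] ansatz_facts(4)[OF c p ax(1)] k0
  by (simp add: yp[symmetric] D jk ci)
 also have "bil (gB (x p) c' (snd c' (\<pi> p))) (bJ E c' (snd c' (\<pi> p)) *v D\<pi> c c' p (axis i 1)) (D\<pi> c c' p (axis j 1))
  = (\<Sum>s\<in>UNIV. (b$s * x p + a$s) * bil (kform (bg E s) (bJ E) c' (snd c' (\<pi> p))) (D\<pi> c c' p (axis i 1)) (D\<pi> c c' p (axis j 1)))"
  unfolding base_metric_def bil_sum_scale kform_def bil_transpose_mm ..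
 finally show ?thesis using ax
  by (simp add: yp pointM[OF c(1) p(1)] sum_component dmap_jac bil_congruence[symmetric] bil_axis comp_def)
qed

text \<open>The form is dx \<and> \<theta> plus the pulled-back forms with coefficients A_i. The
  exterior derivative of the first summand is -dx \<and> d\<theta>, and dA_i = b_i dx produces
  exactly the opposite; this is why the slopes of the A_i are the coefficients of d\<theta>. What is
  left is the form of the base metric with x held fixed.\<close>

lemma ext3_kform:
 assumes c: "c \<in> atlas M" and c': "c' \<in> atlas B" "\<pi> p \<in> fst c'" and p: "p \<in> fst c" "p \<in> M0" and ijk: "i \<in> I" "j \<in> I" "k' \<in> I"
  and anti: "\<And>z s t. \<lbrakk>z \<in> crange c'; s \<in> K; t \<in> K\<rbrakk> \<Longrightarrow> kform (gB (x p)) (bJ E) c' z$s$t = - kform (gB (x p)) (bJ E) c' z$t$s"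
 shows "ext3 (kform g J c) i j k' (snd c p) = ext3v K (kform (gB (x p)) (bJ E) c') (snd c' (\<pi> p))
  (D\<pi> c c' p (axis i 1)) (D\<pi> c c' p (axis j 1)) (D\<pi> c c' p (axis k' 1))"
proof -
 define y where "y = snd c p"
 define U where "U = U0 c c'"
 note U = U0(1)[OF c c'(1), folded U_def]
 have y: "y \<in> U" unfolding U_def y_def by (rule U0I[OF p c'(2)])
 define f where "f = r\<pi> c c'"
 define \<omega> where "\<omega> s z = kform (bg E s) (bJ E) c' z" for s z
 define \<Omega> where "\<Omega> s z = transpose (jac I f z)**\<omega> s (f z)**jac I f z" for s z
 define X where "X = x \<circ> point c"
 define A where "A s z = b$s * X z + a$s" for s z
 define \<theta> where "\<theta> = conn E c"
 have V: "ropen K (crange c')" by (rule chB[OF c'(1)])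
 have sX: "smooth I U X" unfolding X_def U_def by (rule smooth_subset[OF smooth_xc[OF c] U0(2)[OF c c'(1)]])
 have sf: "smooth I U f" unfolding f_def U_def by (rule smooth_subset[OF smooth_\<pi>[OF c c'(1)] U0(3)[OF c c'(1)]])
 have fU: "f ` U \<subseteq> crange c'" unfolding f_def U_def using image_\<pi>[OF c c'(1)] U0(3)[OF c c'(1)] by blast
 have s\<theta>: "smooth I U \<theta>" unfolding \<theta>_def U_def by (rule smooth_subset[OF smooth_conn[OF c] U0(4)[OF c c'(1)]])
 have s\<omega>: "smooth K (crange c') (\<omega> s)" for s
  unfolding \<omega>_def[abs_def] kform_def by (intro smooth_intros V bg_smooth bJ_smooth c'(1))
 have s\<Omega>: "smooth I U (\<Omega> s)" for s unfolding \<Omega>_def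
  by (intro smooth_intros U smooth_jac[OF U sf] smooth_compose[OF U V fU sf s\<omega>])
 have sA: "smooth I U (A s)" for s unfolding A_def by (intro smooth_intros U sX)
 have pA: "pd i (A s) y = b$s * pd i X y" if "i \<in> I" for i s
  unfolding A_def using pd_add[OF U smooth_mult[OF U smooth_const[OF U] sX] smooth_const[OF U] that y]
   pd_mult[OF U smooth_const[OF U] sX that y] by (simp add: pds_pd[OF pds_const])
 define N where "N z = (\<chi> i j. pd i X z * \<theta> z$j - \<theta> z$i * pd j X z + (\<Sum>s\<in>UNIV. A s z *\<^sub>R \<Omega> s z)$i$j)" for z
 have "ext3 (kform g J c) i j k' y = ext3 N i j k' y"
 proof (rule ext3_cong[OF U y ijk])
  fix z i j assume "z \<in> U" "i \<in> I" "j \<in> I"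
  then show "kform g J c z$i$j = N z$i$j"
   using kform_ansatz[OF c c'(1), of z i j] unfolding U_def N_def X_def \<theta>_def \<Omega>_def \<omega>_def f_def A_def by simp
 qed
 also have "\<dots> = ext3 (\<lambda>z. \<Sum>s\<in>UNIV. A s z *\<^sub>R \<Omega> s z) i j k' y
  - (pd i X y * (pd j (\<lambda>z. \<theta> z$k') y - pd k' (\<lambda>z. \<theta> z$j) y) + pd j X y * (pd k' (\<lambda>z. \<theta> z$i) y - pd i (\<lambda>z. \<theta> z$k') y)
   + pd k' X y * (pd i (\<lambda>z. \<theta> z$j) y - pd j (\<lambda>z. \<theta> z$i) y))"
 proof -
  have e: "pd i (\<lambda>z. N z$j$k) y = pd i X y * 0 + pd j X y * pd i (\<lambda>z. \<theta> z$k) y + pd i (pd j X) y * \<theta> y$k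
   - (\<theta> y$j * pd i (pd k X) y + pd i (\<lambda>z. \<theta> z$j) y * pd k X y) + pd i (\<lambda>z. (\<Sum>s\<in>UNIV. A s z *\<^sub>R \<Omega> s z)$j$k) y"
   if i: "i \<in> I" and j: "j \<in> I" and k: "k \<in> I" for i j k
  proof -
   note q = smooth_mult[OF U smooth_pd[OF sX j] smooth_nth[OF U s\<theta>, of k]] smooth_mult[OF U smooth_nth[OF U s\<theta>, of j] smooth_pd[OF sX k]]
   have "smooth I U (\<lambda>z. (\<Sum>s\<in>UNIV. A s z *\<^sub>R \<Omega> s z)$j$k)"
    by (intro smooth_intros U sA s\<Omega>)
   then show ?thesis unfolding N_def using pd_add[OF U smooth_diff[OF U q] _ i y] pd_diff[OF U q i y]
    pd_mult[OF U smooth_pd[OF sX j] smooth_nth[OF U s\<theta>] i y, of k] pd_mult[OF U smooth_nth[OF U s\<theta>] smooth_pd[OF sX k] i y, of j] by simp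
  qed
  show ?thesis unfolding ext3_def e[OF ijk] e[OF ijk(2,3,1)] e[OF ijk(3,1,2)]
   using smooth_pd_commute[OF U sX ijk(1,2) y] smooth_pd_commute[OF U sX ijk(2,3) y] smooth_pd_commute[OF U sX ijk(3,1) y]
   by (simp add: algebra_simps)
 qed
 also have "\<dots> = ext3 (\<lambda>z. \<Sum>s\<in>UNIV. A s y *\<^sub>R \<Omega> s z) i j k' y"
 proof -
  have d: "pd i (\<lambda>z. \<theta> z$j) y - pd j (\<lambda>z. \<theta> z$i) y = (\<Sum>s\<in>UNIV. b$s * \<Omega> s y$i$j)" if ij: "i \<in> I" "j \<in> I" for i j
   unfolding \<theta>_def y_def dconn[OF c c'(1) p c'(2) ij] \<Omega>_def \<omega>_def f_def using ij
   by (simp add: dmap_jac bil_congruence[symmetric] bil_axis pointM[OF c p(1)])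
  have "(\<Sum>s\<in>UNIV. pd i (A s) y * \<Omega> s y$j$k' + pd j (A s) y * \<Omega> s y$k'$i + pd k' (A s) y * \<Omega> s y$i$j)
   = pd i X y * (\<Sum>s\<in>UNIV. b$s * \<Omega> s y$j$k') + pd j X y * (\<Sum>s\<in>UNIV. b$s * \<Omega> s y$k'$i) + pd k' X y * (\<Sum>s\<in>UNIV. b$s * \<Omega> s y$i$j)"
   unfolding pA[OF ijk(1)] pA[OF ijk(2)] pA[OF ijk(3)] by (simp add: sum.distrib sum_distrib_left ac_simps)
  then show ?thesis unfolding ext3_frozen[OF U y ijk sA s\<Omega>] d[OF ijk(1,2)] d[OF ijk(2,3)] d[OF ijk(3,1)] by simp
 qed
 also have "\<dots> = ext3v K (kform (gB (x p)) (bJ E) c') (f y) (pd i f y) (pd j f y) (pd k' f y)"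
 proof -
  define w where "w = kform (gB (x p)) (bJ E) c'"
  have Xy: "X y = x p" by (simp add: X_def y_def pointM[OF c p(1)])
  have w: "w z = (\<Sum>s\<in>UNIV. A s y *\<^sub>R \<omega> s z)" for z
   unfolding w_def by (simp add: kform_def base_metric_def \<omega>_def A_def Xy mm_sum_right mm_ring)
  have e: "(\<lambda>z. \<Sum>s\<in>UNIV. A s y *\<^sub>R \<Omega> s z) = (\<lambda>z. transpose (jac I f z)**w (f z)**jac I f z)"
   unfolding w \<Omega>_def by (simp add: fun_eq_iff mm_sum_left mm_sum_right mm_ring)
  have sw: "smooth K (crange c') w" unfolding w[abs_def] by (intro smooth_intros V s\<omega>)
  show ?thesis unfolding e w_def[symmetric] by (rule ext3_pullback[OF U V sf fU sw _ y ijk]) (rule anti[folded w_def])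
 qed
 finally show ?thesis using ijk
  by (simp add: y_def dmap_def axis_def if_distrib[of "\<lambda>x. x *\<^sub>R _"] f_def pointM[OF c p(1)] cong: if_cong)
qed

end

section \<open>Test vectors and the metrics induced on the base\<close>

locale kaehler_ansatz = ansatz_mfd M g J E b x l u h a
 for M :: "('p, 'n::finite) mfd" and g J :: "('p, 'n) tensor2" and E :: "('p, 'n, 'q, 'k::finite, 'm::finite) circle_bundle"
  and b :: "real^'m" and x :: "'p \<Rightarrow> real" and l u :: real and h :: "real \<Rightarrow> real" and a :: "real^'m" +
 assumes kae: "kaehler M g J"
begin

lemma dense_zero:
 assumes c: "c \<in> atlas M" and y: "y \<in> crange c" and F: "continuous_on (crange c) (F :: _ \<Rightarrow> real)" and C: "closed C"
  and z: "\<And>p c'. \<lbrakk>p \<in> fst c; p \<in> M0; c' \<in> atlas B; \<pi> p \<in> fst c'\<rbrakk> \<Longrightarrow> F (snd c p) \<in> C"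
 shows "F y \<in> C"
 by (rule dense_chart_zero[OF M c dense F _ C y]) (use z base_chart[OF M0_pts] in blast)

lemma g_facts: "c \<in> atlas M \<Longrightarrow> smooth I (crange c) (g c)" "is_pullback M M id g g"
  "\<lbrakk>c \<in> atlas M; y \<in> crange c; s \<in> I; t \<in> I\<rbrakk> \<Longrightarrow> g c y$s$t = g c y$t$s"
  "\<lbrakk>c \<in> atlas M; y \<in> crange c; w \<in> coord I; w \<noteq> 0\<rbrakk> \<Longrightarrow> bil (g c y) w w > 0"
 using kae unfolding kaehler_def riemannian_def sym_tensor_def by simp_all

text \<open>A vector killed by dx, \<theta> and d\<pi> has length zero by the ansatz, so these are
  jointly injective, and onto by dimension. Vectors chosen this way isolate one term of the metric
  at a time.\<close>

lemma frame_vector: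
 assumes c: "c \<in> atlas M" "c' \<in> atlas B" and p: "p \<in> fst c" "p \<in> M0" "\<pi> p \<in> fst c'" and w: "w \<in> coord K"
 shows "\<exists>v\<in>coord I. dx c p v = 0 \<and> conn E c (snd c p) \<bullet> v = s \<and> D\<pi> c c' p v = w"
proof -
 define y where "y = snd c p"
 define D where "D = jac I (r\<pi> c c') y"
 define Q :: "real^'n ^ (bool + 'k)" where "Q = (\<chi> s. case s of Inl r \<Rightarrow> (if r then (\<chi> i. if i \<in> I then pd i (x \<circ> point c) y else 0) else PI I *v conn E c y) | Inr r \<Rightarrow> D$r)"
 define e where "e = (\<chi> r. case r of Inl r \<Rightarrow> if r then 0 else s | Inr r \<Rightarrow> w$r)"
 define L where "L = (UNIV :: bool set) <+> K"
 note yc = snd_crange[OF p(1), folded y_def]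
 have Q: "(Q *v v)$Inl True = dfun I c x y v" "(Q *v v)$Inl False = conn E c y \<bullet> v" "(Q *v v)$Inr r = dmap I c c' \<pi> y v$r" if "v \<in> coord I" for v r
 proof -
  show "(Q *v v)$Inl True = dfun I c x y v"
   by (simp add: mv_nth Q_def dfun_def if_distrib[of "(*) _"] sum_if_subset mult.commute cong: if_cong)
  have "(Q *v v)$Inl False = (PI I *v conn E c y) \<bullet> v" by (simp add: mv_nth Q_def inner_vec_def)
  also have "\<dots> = conn E c y \<bullet> (PI I *v v)" unfolding inner_mv transpose_PI ..
  finally show "(Q *v v)$Inl False = conn E c y \<bullet> v" by (simp only: PI_mv[OF that])
  show "(Q *v v)$Inr r = dmap I c c' \<pi> y v$r" unfolding dmap_jac[OF that] D_def[symmetric] by (simp add: mv_nth Q_def)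
 qed
 have Dc: "dmap I c c' \<pi> y v \<in> coord K" for v unfolding y_def by (rule d\<pi>_coord[OF c p(1,3)])
 have bD: "D$r$j = 0" if "r \<notin> K \<or> j \<notin> I" for r j
 proof (cases "j \<in> I")
  case True
  then have "dmap I c c' \<pi> y (axis j 1) = D *v axis j 1" unfolding D_def by (intro dmap_jac) simp
  then show ?thesis using Dc[of "axis j 1"] that True by (simp add: matrix_vector_mult_basis column_def coord_def)
 qed (simp add: D_def jac_nth)
 have bQ: "blk L I Q"
  unfolding blk_def
 proof (intro allI impI)
  fix r i assume "r \<notin> L \<or> i \<notin> I"
  then show "Q$r$i = 0" using bD by (cases r) (auto simp: L_def Q_def PI_mv_nth)
 qed
 have "v = 0" if v: "v \<in> coord I" and z: "Q *v v = 0" for v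
 proof (rule ccontr)
  assume "v \<noteq> 0"
  then have "bil (g c y) v v > 0" by (rule g_facts(4)[OF c(1) yc v])
  moreover have "dfun I c x y v = 0" "conn E c y \<bullet> v = 0" "dmap I c c' \<pi> y v = 0"
   using Q[OF v] z by (simp_all add: vec_eq_iff)
  ultimately show False using ansatz_facts(1)[OF c p v v] by (simp add: y_def bil_def)
 qed
 moreover have "card I = card L" by (simp add: L_def cp_facts(8) card_Plus)
 moreover have "e \<in> coord L" using w by (auto simp: e_def coord_def L_def split: sum.splits)
 ultimately obtain v where v: "v \<in> coord I" "Q *v v = e" using coord_surj[OF bQ] by blast
 have "dfun I c x y v = 0" "conn E c y \<bullet> v = s" "dmap I c c' \<pi> y v = w"
  unfolding vec_eq_iff Q[OF v(1), symmetric] v(2) by (simp_all add: e_def)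
 then show ?thesis using v(1) unfolding y_def by blast
qed

text \<open>Every property descends from the total space by evaluation on lifts with dx = 0 and
  \<theta> = 0, closedness by \<open>ext3_kform\<close>.\<close>

lemma kaehler_base_metric:
 assumes t: "t \<in> {l<..<u}"
 shows "kaehler B (gB t) (bJ E)"
proof -
 have pt: "\<exists>p c. p \<in> M0 \<and> x p = t \<and> \<pi> p = q \<and> c \<in> atlas M \<and> p \<in> fst c" if "q \<in> pts B" for q
  using cp_facts(11)[OF t that] chart_cover[OF M M0_pts] by metis
 have herm: "bil (gB t c y) (bJ E c y *v v) (bJ E c y *v w) = bil (gB t c y) v w"
  and posd: "v \<noteq> 0 \<Longrightarrow> bil (gB t c y) v v > 0"
  and closed: "i \<in> K \<Longrightarrow> j \<in> K \<Longrightarrow> k \<in> K \<Longrightarrow> (\<And>z s r. z \<in> crange c \<Longrightarrow> s \<in> K \<Longrightarrow> r \<in> K \<Longrightarrow> kform (gB t) (bJ E) c z$s$r = - kform (gB t) (bJ E) c z$r$s)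
    \<Longrightarrow> ext3 (kform (gB t) (bJ E) c) i j k y = 0"
  if c: "c \<in> atlas B" and y: "y \<in> crange c" and v: "v \<in> coord K" and w: "w \<in> coord K" for c y v w i j k
 proof -
  obtain q where q: "q \<in> fst c" "y = snd c q" using y by (rule crangeE)
  obtain p d where p: "p \<in> M0" "x p = t" "\<pi> p = q" and d: "d \<in> atlas M" "p \<in> fst d" using pt[OF chart_pts[OF clB c q(1)]] by blast
  note V = chB[OF c]
  have sk: "smooth K (crange c) (kform (gB t) (bJ E) c)" unfolding kform_def[abs_def]
   using sym_tensor_base_metric[OF clB cp_facts(7)] c by (intro smooth_intros V bJ_smooth) (simp_all add: sym_tensor_def)
  note ctx = d(1) c d(2) p(1) q(1)[folded p(3)]
  note yp = snd_crange[OF d(2)]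
  obtain v' where v': "v' \<in> coord I" "dx d p v' = 0" "conn E d (snd d p) \<bullet> v' = 0" "D\<pi> d c p v' = v"
   using frame_vector[OF ctx v, of 0] by blast
  obtain w' where w': "w' \<in> coord I" "dx d p w' = 0" "conn E d (snd d p) \<bullet> w' = 0" "D\<pi> d c p w' = w"
   using frame_vector[OF ctx w, of 0] by blast
  note J = J_facts(2)[OF d(1) yp]
  have "bil (g d (snd d p)) (J d (snd d p) *v v') (J d (snd d p) *v w') = bil (g d (snd d p)) v' w'"
   using kae d(1) yp v'(1) w'(1) unfolding kaehler_def by simp
  then show "bil (gB t c y) (bJ E c y *v v) (bJ E c y *v w) = bil (gB t c y) v w"
   using ansatz_facts(1)[OF ctx J J, of v' w'] ansatz_facts(1)[OF ctx v'(1) w'(1)] ansatz_facts(2-4)[OF ctx v'(1)] ansatz_facts(2-4)[OF ctx w'(1)]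
   by (simp add: v' w' p q)
  show "bil (gB t c y) v v > 0" if "v \<noteq> 0"
  proof -
   have "v' \<noteq> 0" using that v'(4) by (auto simp: dmap_zero)
   then show ?thesis using g_facts(4)[OF d(1) yp v'(1)] ansatz_facts(1)[OF ctx v'(1) v'(1)] by (simp add: v' p q)
  qed
  assume ijk: "i \<in> K" "j \<in> K" "k \<in> K" and anti: "\<And>z s r. \<lbrakk>z \<in> crange c; s \<in> K; r \<in> K\<rbrakk> \<Longrightarrow> kform (gB t) (bJ E) c z$s$r = - kform (gB t) (bJ E) c z$r$s"
  define F where "F = ext3v K (kform (gB t) (bJ E) c) y"
  define D where "D = D\<pi> d c p"
  define P where "P i = pd i (r\<pi> d c) (snd d p)" for i
  have D: "D v = (\<Sum>i\<in>I. v$i *\<^sub>R P i)" for v unfolding D_def dmap_def P_def ..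
  have "D (axis i 1) = P i" if "i \<in> I" for i
   unfolding D using that by (simp add: axis_def if_distrib[of "\<lambda>x. x *\<^sub>R _"] cong: if_cong)
  then have z: "F (P i) (P j) (P k) = 0" if "i \<in> I" "j \<in> I" "k \<in> I" for i j k
   using ext3_kform[OF d(1) c q(1)[folded p(3)] d(2) p(1) that, unfolded p, OF anti] kae d(1) yp that
   unfolding q(2) F_def D_def by (simp add: ext3_def kaehler_def)
  have "\<exists>f. D f = axis s 1" if "s \<in> K" for s unfolding D_def using frame_vector[OF ctx axis_in_coord[OF that], of 0] by blast
  then obtain f where f: "\<And>s. s \<in> K \<Longrightarrow> D (f s) = axis s 1" by metis
  have "F (D (f i)) (D (f j)) (D (f k)) = 0" unfolding D by (rule trilinear_zero) (simp_all add: F_def ext3v_linear z[unfolded F_def])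
  then show "ext3 (kform (gB t) (bJ E) c) i j k y = 0"
   unfolding f[OF ijk(1)] f[OF ijk(2)] f[OF ijk(3)] F_def ext3v_axis[OF V sk y ijk] .
 qed
 have st: "sym_tensor B (gB t)" by (rule sym_tensor_base_metric[OF clB cp_facts(7)])
 have anti: "kform (gB t) (bJ E) c z$s$r = - kform (gB t) (bJ E) c z$r$s"
  if "c \<in> atlas B" "z \<in> crange c" "s \<in> K" "r \<in> K" for c z s r
  unfolding kform_def by (rule bil_J_antisym[OF _ bJ_blk[OF that(1,2)] bJ_sq[OF that(1,2)] herm[OF that(1,2)] that(3,4)])
   (use st that in \<open>simp_all add: sym_tensor_def\<close>)
 show ?thesis unfolding kaehler_def riemannian_def
  using st cp_facts(6) herm posd closed[OF _ _ _ _ _ _ _ anti, unfolded ext3_def, of _ _ 0 0] by (auto simp: coord_def)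
qed

end

subsection \<open>Change of the momentum profile\<close>

text \<open>The interface between the two constructions and the construction of the extremal metric.
  The numbers \<open>d\<close> are the dimensions of the summands.\<close>

definition good_base :: "('p, 'n, 'q, 'k::finite, 'm::finite) circle_bundle \<Rightarrow> real^'m \<Rightarrow> ('m \<Rightarrow> nat) \<Rightarrow> real^'m \<Rightarrow> bool" where
 "good_base E b d a \<longleftrightarrow> (\<forall>t\<in>{0..1}. kaehler (base E) (base_metric E a b t) (bJ E)) \<and>
   (\<forall>c\<in>atlas (base E). \<forall>z\<in>crange c.
    (\<exists>T \<sigma>. adapted (idx (base E)) (\<lambda>i. bg E i c z) T \<sigma> \<and> (\<forall>i. card {\<alpha>\<in>idx (base E). \<sigma> \<alpha> = i} = d i)) \<and>
    (\<forall>t\<in>{0<..<1}. scalar_curvature (idx (base E)) (base_metric E a b t c) z = (\<Sum>i\<in>UNIV. real (d i) / (b$i * t + a$i))))"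

text \<open>The inverse metric is diagonal in an adapted frame, so the trace sees only the diagonal
  entries of \<open>R\<close>, which is what the normalization of the g_i provides.\<close>

lemma trace_adapted:
 assumes ad: "adapted K g T \<sigma>" and d: "\<And>i. card {\<alpha>\<in>K. \<sigma> \<alpha> = i} = d i" and A: "\<And>i. A i > 0"
  and R: "\<And>\<alpha>. \<alpha> \<in> K \<Longrightarrow> (transpose T**R**T)$\<alpha>$\<alpha> = 1"
 shows "trace (ginv K (comb A g)**(PI K**R**PI K)) = (\<Sum>i\<in>UNIV. real (d i) / A i)"
proof -
 have bT: "blk K K T" using ad by (simp add: adapted_def)
 have "transpose T**PI K = transpose T" "PI K**T = T" using blk_right[OF blk_transpose[OF bT]] blk_left[OF bT] by simp_all
 then have e: "transpose T**(PI K**R**PI K)**T = transpose T**R**T" by (metis matrix_mul_assoc)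
 have "trace (ginv K (comb A g)**(PI K**R**PI K)) = (\<Sum>\<alpha>\<in>K. (transpose T**(PI K**R**PI K)**T)$\<alpha>$\<alpha> / A (\<sigma> \<alpha>))"
  by (rule trace_ginv_adapted[OF ad A]) (auto simp: blk_def PI_mult mult_PI)
 also have "\<dots> = (\<Sum>\<alpha>\<in>K. 1 / A (\<sigma> \<alpha>))" by (simp add: e R)
 also have "\<dots> = (\<Sum>i\<in>UNIV. \<Sum>\<alpha>\<in>{\<alpha>\<in>K. \<sigma> \<alpha> = i}. 1 / A (\<sigma> \<alpha>))" by (rule sum.group[symmetric]) auto
 also have "\<dots> = (\<Sum>i\<in>UNIV. real (d i) / A i)" by (simp add: d[symmetric])
 finally show ?thesis .
qed

text \<open>\<open>r\<close> is the function u of the curvature formula for the new profile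
  \<open>k\<close>. The assumptions on \<open>k\<close> and \<open>r\<close> come from
  \<open>extremal_profile\<close>, those on \<open>\<psi>\<close> from
  \<open>profile_conjugate\<close>.\<close>

locale momentum_change = kaehler_ansatz M g J E b x l u h a
 for M :: "('p, 'n::finite) mfd" and g J :: "('p, 'n) tensor2" and E :: "('p, 'n, 'q, 'k::finite, 'm::finite) circle_bundle"
  and b :: "real^'m" and x :: "'p \<Rightarrow> real" and l u :: real and h :: "real \<Rightarrow> real" and a :: "real^'m" +
 fixes a' :: "real^'m" and d :: "'m \<Rightarrow> nat" and k r :: "real \<Rightarrow> real" and \<alpha> \<beta> :: real and T :: "real set" and \<psi> :: "real \<Rightarrow> real"
 assumes good: "good_base E b d a'" and pos: "a' \<in> parameters b"
  and k: "profile 0 1 k" and sk: "smooth1 {0<..<1} k" and sv: "smooth1 {0<..<1} r"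
  and v_eq: "t \<in> {0<..<1} \<Longrightarrow> r t = deriv k t + k t * ((1/2) * (\<Sum>i\<in>UNIV. b$i * real (d i) / (b$i * t + a'$i)))"
  and scal_eq: "t \<in> {0<..<1} \<Longrightarrow> (\<Sum>i\<in>UNIV. real (d i) / (b$i * t + a'$i)) - deriv r t
    - r t * ((1/2) * (\<Sum>i\<in>UNIV. b$i * real (d i) / (b$i * t + a'$i))) = \<alpha> * t + \<beta>"
  and T: "open T" "{l..u} \<subseteq> T" and s\<psi>: "smooth1 T \<psi>" and \<psi>0: "\<psi> l = 0" and \<psi>1: "\<psi> u = 1"
  and d\<psi>: "t \<in> {l..u} \<Longrightarrow> deriv \<psi> t > 0" and k\<psi>: "t \<in> {l..u} \<Longrightarrow> k (\<psi> t) = deriv \<psi> t * h t"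
begin

abbreviation "x1 \<equiv> \<psi> \<circ> x"
abbreviation (input) "dx1 c p \<equiv> dfun I c x1 (snd c p)"
abbreviation (input) "gB' \<equiv> base_metric E a' b"

lemma \<psi>_mono: "\<lbrakk>l \<le> s; s < t; t \<le> u\<rbrakk> \<Longrightarrow> \<psi> s < \<psi> t"
 using DERIV_pos_imp_increasing[of s t \<psi>] smooth1_has_derivative[OF s\<psi> T(1)] d\<psi> T(2) by (meson atLeastAtMost_iff order_trans subsetD)

lemma \<psi>_eq: "s \<in> {l..u} \<Longrightarrow> t \<in> {l..u} \<Longrightarrow> \<psi> s = \<psi> t \<longleftrightarrow> s = t"
 using \<psi>_mono[of s t] \<psi>_mono[of t s] by (cases s t rule: linorder_cases) auto

lemma \<psi>_less: "s \<in> {l..u} \<Longrightarrow> t \<in> {l..u} \<Longrightarrow> \<psi> s < \<psi> t \<longleftrightarrow> s < t"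
 using \<psi>_mono[of s t] \<psi>_mono[of t s] by (cases s t rule: linorder_cases) auto

lemma \<psi>_in: "t \<in> {l..u} \<Longrightarrow> \<psi> t \<in> {0..1}" "t \<in> {l..u} \<Longrightarrow> \<psi> t \<in> {0<..<1} \<longleftrightarrow> t \<in> {l<..<u}"
 using \<psi>_less[of l t] \<psi>_less[of t u] \<psi>_less[of t l] \<psi>_less[of u t] lu by (auto simp: \<psi>0 \<psi>1 not_less)

lemma \<psi>_onto: assumes "t \<in> {0..1}" shows "\<exists>s\<in>{l..u}. \<psi> s = t"
 using IVT'[of \<psi> l t u] continuous_on_subset[OF smooth1_continuous_on[OF s\<psi>] T(2)] assms lu by (auto simp: \<psi>0 \<psi>1)

lemma M0_x1: "principal_part M x1 0 1 = M0"
 using \<psi>_in(2)[OF x_pts] by (auto simp: principal_part_def)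

lemma x1_M0: "p \<in> M0 \<Longrightarrow> x1 p \<in> {0<..<1}"
 using \<psi>_in(2)[OF x_pts[OF M0_pts]] M0_x by simp

lemma xT: "c \<in> atlas M \<Longrightarrow> (x \<circ> point c) ` crange c \<subseteq> T" using x_point T(2) by fastforce

lemma smooth_x1: "c \<in> atlas M \<Longrightarrow> smooth I (crange c) (x1 \<circ> point c)"
 unfolding comp_assoc
 using smooth_real_compose[OF chM T(1) smooth_xc xT s\<psi>] by (simp add: comp_def)

lemma dfun_x1:
 assumes c: "c \<in> atlas M" and y: "y \<in> crange c"
 shows "dfun I c x1 y w = deriv \<psi> (x (point c y)) * dfun I c x y w"
proof -
 have "pd i (x1 \<circ> point c) y = deriv \<psi> (x (point c y)) * pd i (x \<circ> point c) y" if "i \<in> I" for i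
  using pd_real_compose[OF chM[OF c] T(1) smooth_xc[OF c] xT[OF c] s\<psi> that y] by (simp add: comp_def)
 then show ?thesis by (simp add: dfun_def sum_distrib_left ac_simps)
qed

text \<open>The bundle structure depends on x only through its smoothness, its range and its level
  sets, and \<open>\<psi>\<close> merely relabels the latter.\<close>

lemma cp1: "cp1_bundle M E b x1 0 1"
proof -
 have i: "x1 ` pts M = {0..1}"
  unfolding image_comp[symmetric] cp_facts(3) using \<psi>_in(1) \<psi>_onto by blast
 have s: "smooth_fun M x1" using smooth_x1 by (simp add: smooth_fun_def)
 have 0: "{p \<in> pts M. x1 p = 0} = {p \<in> pts M. x p = l}" "{p \<in> pts M. x1 p = 1} = {p \<in> pts M. x p = u}"
  using \<psi>_eq[OF x_pts, of _ l] \<psi>_eq[OF x_pts, of _ u] lu by (auto simp: \<psi>0 \<psi>1)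
 have e: "x1 p = x1 q \<longleftrightarrow> x p = x q" if "p \<in> M0" "q \<in> M0" for p q
  using \<psi>_eq[OF x_pts x_pts] M0_pts that by simp
 have o: "\<exists>p\<in>M0. x1 p = t \<and> \<pi> p = q" if t: "t \<in> {0<..<1}" and q: "q \<in> pts B" for t q
 proof -
  obtain s where s: "s \<in> {l..u}" "\<psi> s = t" using \<psi>_onto[of t] t by auto
  then have "s \<in> {l<..<u}" using \<psi>_in(2)[of s] t by simp
  then show ?thesis using cp_facts(11)[OF _ q] s(2) by auto
 qed
 note C = cp[unfolded cp1_bundle_def Let_def]
 have p: "\<forall>p\<in>pts M. \<forall>t. rot E (t + 2 * pi) p = rot E t p \<and> x (rot E t p) = x p \<and> \<pi> (rot E t p) = \<pi> p"
  "\<forall>p\<in>M0. \<forall>q\<in>M0. x p = x q \<and> \<pi> p = \<pi> q \<longrightarrow> (\<exists>t. q = rot E t p)"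
  by (insert C, elim conjE, assumption)+
 have p': "\<forall>p\<in>M0. \<forall>q\<in>M0. x1 p = x1 q \<and> \<pi> p = \<pi> q \<longrightarrow> (\<exists>t. q = rot E t p)" using p(2) e by blast
 show ?thesis unfolding cp1_bundle_def Let_def M0_x1 0
  by (intro conjI; (rule p' | (insert C, elim conjE, assumption) | (insert s i p(1) o, simp)))
qed

text \<open>Multiplying g by \<psi>' corrects both fibre terms at once: with k = \<psi>' h it turns
  h \<theta>^2 into k \<theta>^2 and dx^2/h into dx1^2/k. Only the base part is then wrong, and
  \<open>eps i\<close> is its defect in the i-th summand.\<close>

definition eps where "eps i t = b$i * \<psi> t + a'$i - deriv \<psi> t * (b$i * t + a$i)"
definition newg :: "('p, 'n) tensor2" where
 "newg c y = deriv \<psi> (x (point c y)) *\<^sub>R g c y + pullT eps c y"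

lemma smooth1_eps: "smooth1 T (eps i)"
 unfolding eps_def[abs_def] using T(1)
 by (intro smooth1_add smooth1_diff smooth1_mult smooth1_const smooth1_ident s\<psi> smooth1_deriv[OF s\<psi>])

lemma newg_bil:
 assumes c: "c \<in> atlas M" "c' \<in> atlas B" and p: "p \<in> fst c" "\<pi> p \<in> fst c'" and vw: "v \<in> coord I" "w \<in> coord I"
 shows "bil (newg c (snd c p)) v w = deriv \<psi> (x p) * bil (g c (snd c p)) v w +
  bil (gB' (x1 p) c' (snd c' (\<pi> p))) (D\<pi> c c' p v) (D\<pi> c c' p w) -
  deriv \<psi> (x p) * bil (gB (x p) c' (snd c' (\<pi> p))) (D\<pi> c c' p v) (D\<pi> c c' p w)"
 unfolding newg_def bil_add pullT_bil[OF assms] base_metric_def bil_sum_scale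
 by (simp add: pointM[OF c(1) p(1)] eps_def sum_subtractf sum_distrib_left algebra_simps)

lemma new_facts:
 assumes c: "c \<in> atlas M" "c' \<in> atlas B" and p: "p \<in> fst c" "p \<in> M0" "\<pi> p \<in> fst c'" and v: "v \<in> coord I"
 shows "w \<in> coord I \<Longrightarrow> bil (newg c (snd c p)) v w = (1 / k (x1 p)) * dx1 c p v * dx1 c p w
   + k (x1 p) * (conn E c (snd c p) \<bullet> v) * (conn E c (snd c p) \<bullet> w)
   + bil (gB' (x1 p) c' (snd c' (\<pi> p))) (D\<pi> c c' p v) (D\<pi> c c' p w)"
  and "conn E c (snd c p) \<bullet> (J c (snd c p) *v v) = (1 / k (x1 p)) * dx1 c p v"
  and "dx1 c p (J c (snd c p) *v v) = - k (x1 p) * (conn E c (snd c p) \<bullet> v)"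
proof -
 have xp: "x p \<in> {l..u}" by (rule x_pts[OF M0_pts[OF p(2)]])
 have nz: "h (x p) \<noteq> 0" "deriv \<psi> (x p) \<noteq> 0" using h_pos[OF M0_x[OF p(2)]] d\<psi>[OF xp] by auto
 have k: "k (x1 p) = deriv \<psi> (x p) * h (x p)" using k\<psi>[OF xp] by simp
 note D = dfun_x1[OF c(1) snd_crange[OF p(1)], unfolded pointM[OF c(1) p(1)]]
 show "w \<in> coord I \<Longrightarrow> bil (newg c (snd c p)) v w = (1 / k (x1 p)) * dx1 c p v * dx1 c p w
   + k (x1 p) * (conn E c (snd c p) \<bullet> v) * (conn E c (snd c p) \<bullet> w)
   + bil (gB' (x1 p) c' (snd c' (\<pi> p))) (D\<pi> c c' p v) (D\<pi> c c' p w)"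
  unfolding D k using newg_bil[OF c p(1,3) v, of w] ansatz_facts(1)[OF c p v, of w] nz by (simp add: field_simps)
 show "conn E c (snd c p) \<bullet> (J c (snd c p) *v v) = (1 / k (x1 p)) * dx1 c p v"
  "dx1 c p (J c (snd c p) *v v) = - k (x1 p) * (conn E c (snd c p) \<bullet> v)"
  unfolding D k using ansatz_facts(2,3)[OF c p v] nz by simp_all
qed

lemma ansatz_new: "ansatz M newg J E b x1 0 1 k a'"
 unfolding ansatz_def M0_x1 Let_def
 using k pos new_facts ansatz_facts(4) ans cp1
 by (simp add: profile_def parameters_def ansatz_def)

lemma newg_invariant:
 assumes f: "smooth_map M M f" and j: "smooth_map B B j" and fk: "\<And>p. p \<in> pts M \<Longrightarrow> \<pi> (f p) = j (\<pi> p)"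
  and x: "\<And>p. p \<in> pts M \<Longrightarrow> x (f p) = x p" and bg: "\<And>i. is_pullback B B j (bg E i) (bg E i)" and g: "is_pullback M M f g g"
 shows "is_pullback M M f newg newg"
 unfolding is_pullback_def newg_def bil_add
 using is_pullbackD[OF g] is_pullbackD[OF pullT_invariant[OF f j fk x bg]]
 by (simp add: pointM x chart_pts[OF M])

lemma smooth_dpsi: "c \<in> atlas M \<Longrightarrow> smooth I (crange c) (\<lambda>y. deriv \<psi> (x (point c y)))"
 using smooth_real_compose[OF chM T(1) smooth_xc xT smooth1_deriv[OF s\<psi>]] by (simp add: comp_def)

lemma smooth_newg: "c \<in> atlas M \<Longrightarrow> smooth I (crange c) (newg c)"
 unfolding newg_def[abs_def]
 using smooth_add[OF chM smooth_scaleR[OF chM smooth_dpsi g_facts(1)] smooth_pullT[OF _ T smooth1_eps]] by simp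

lemma sym_pullT:
 assumes c: "c \<in> atlas M" and y: "y \<in> crange c" and st: "s \<in> I" "t \<in> I"
 shows "pullT e c y$s$t = pullT e c y$t$s"
proof -
 obtain p where p: "p \<in> fst c" "y = snd c p" using y by (rule crangeE)
 obtain c' where c': "c' \<in> atlas B" "\<pi> p \<in> fst c'" using base_chart[OF chart_pts[OF M c p(1)]] by auto
 have vw: "axis s 1 \<in> coord I" "axis t 1 \<in> coord I" using st by simp_all
 have "bil (pullT e c y) (axis s 1) (axis t 1) = bil (pullT e c y) (axis t 1) (axis s 1)"
  unfolding p(2) pullT_bil[OF c c'(1) p(1) c'(2) vw] pullT_bil[OF c c'(1) p(1) c'(2) vw(2,1)]
  using bil_sym[OF bg_sym[OF c'(1) snd_crange[OF c'(2)]] d\<pi>_coord[OF c c'(1) p(1) c'(2)] d\<pi>_coord[OF c c'(1) p(1) c'(2)]] by simp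
 then show ?thesis by (simp add: bil_axis)
qed

lemma sym_tensor_newg: "sym_tensor M newg"
 unfolding sym_tensor_def
 using smooth_newg g_facts(3) sym_pullT newg_invariant[OF smooth_map_id[OF M] smooth_map_id[OF clB] _ _ bg_pullback g_facts(2)]
 by (simp add: newg_def)

lemma kaehler_base: "t \<in> {0..1} \<Longrightarrow> kaehler B (gB' t) (bJ E)"
 using good by (simp add: good_base_def)

lemma k_pos: "t \<in> {0<..<1} \<Longrightarrow> k t > 0" using k by (simp add: profile_def)

lemma newg_hermitian:
 assumes c: "c \<in> atlas M" and y: "y \<in> crange c" and vw: "v \<in> coord I" "w \<in> coord I"
 shows "bil (newg c y) (J c y *v v) (J c y *v w) = bil (newg c y) v w"
proof -
 define f where "f y = bil (newg c y) (J c y *v v) (J c y *v w) - bil (newg c y) v w" for y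
 have "continuous_on (crange c) f" unfolding f_def[abs_def]
  by (intro smooth_continuous[of I] smooth_diff[OF chM[OF c]] smooth_bil[OF chM[OF c]] smooth_newg c
   smooth_mv[OF chM[OF c]] J_facts smooth_const[OF chM[OF c]])
 then have "f y \<in> {0}"
 proof (rule dense_zero[OF c y _ closed_singleton])
  fix p c' assume p: "p \<in> fst c" "p \<in> M0" and c': "c' \<in> atlas B" "\<pi> p \<in> fst c'"
  note yp = snd_crange[OF p(1)]
  note F = new_facts[OF c c'(1) p c'(2)] and G = ansatz_facts(4)[OF c c'(1) p c'(2)]
  note Jv = J_facts(2)[OF c yp, of v] J_facts(2)[OF c yp, of w]
  have k0: "k (x1 p) \<noteq> 0" using k_pos[OF x1_M0[OF p(2)]] by simp
  have "bil (gB' (x1 p) c' (snd c' (\<pi> p))) (bJ E c' (snd c' (\<pi> p)) *v D\<pi> c c' p v) (bJ E c' (snd c' (\<pi> p)) *v D\<pi> c c' p w)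
   = bil (gB' (x1 p) c' (snd c' (\<pi> p))) (D\<pi> c c' p v) (D\<pi> c c' p w)"
   using kaehler_base[of "x1 p"] x1_M0[OF p(2)] c' snd_crange[OF c'(2)] d\<pi>_coord[OF c c'(1) p(1) c'(2)] unfolding kaehler_def by simp
  then show "f (snd c p) \<in> {0}"
   unfolding f_def F(1)[OF Jv] F(1)[OF vw] F(2)[OF vw(1)] F(2)[OF vw(2)] F(3)[OF vw(1)] F(3)[OF vw(2)] G[OF vw(1)] G[OF vw(2)]
   using k0 by (simp add: field_simps)
 qed
 then show ?thesis by (simp add: f_def)
qed

text \<open>\<open>newg = \<psi>' (g - \<pi>\<^sup>*\<gamma>) + \<pi>\<^sup>*\<gamma>'\<close> with \<open>g - \<pi>\<^sup>*\<gamma> \<ge> 0\<close>; on vertical vectors \<open>newg = \<psi>' g\<close>.\<close>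

lemma newg_pos:
 assumes c: "c \<in> atlas M" and y: "y \<in> crange c" and w: "w \<in> coord I" "w \<noteq> 0"
 shows "bil (newg c y) w w > 0"
proof -
 define A where "A i t = b$i * t + a$i" for i t
 obtain p where p: "p \<in> fst c" "y = snd c p" using y by (rule crangeE)
 obtain c' where c': "c' \<in> atlas B" "\<pi> p \<in> fst c'" using base_chart[OF chart_pts[OF M c p(1)]] by auto
 define f where "f y = bil (g c y) w w - bil (pullT A c y) w w" for y
 have sA: "smooth1 T (A i)" for i unfolding A_def[abs_def] using T(1) by (intro smooth1_add smooth1_mult smooth1_const smooth1_ident)
 have pA: "bil (pullT A c (snd c q)) w w = bil (gB (x q) c' (snd c' (\<pi> q))) (D\<pi> c c' q w) (D\<pi> c c' q w)"
  if "q \<in> fst c" "c' \<in> atlas B" "\<pi> q \<in> fst c'" for q c'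
  unfolding pullT_bil[OF c that(2,1,3) w(1) w(1)] base_metric_def bil_sum_scale A_def ..
 have "continuous_on (crange c) f" unfolding f_def[abs_def]
  by (intro smooth_continuous[of I] smooth_diff[OF chM[OF c]] smooth_bil[OF chM[OF c]] g_facts(1) c
   smooth_pullT[OF c T sA] smooth_const[OF chM[OF c]])
 then have "f y \<in> {0..}"
 proof (rule dense_zero[OF c y _ closed_atLeast])
  fix p c' assume p: "p \<in> fst c" "p \<in> M0" and c': "c' \<in> atlas B" "\<pi> p \<in> fst c'"
  show "f (snd c p) \<in> {0..}"
   unfolding f_def pA[OF p(1) c'] ansatz_facts(1)[OF c c'(1) p c'(2) w(1) w(1)]
   using h_pos[OF M0_x[OF p(2)]] by (simp add: mult.assoc)
 qed
 then have 1: "bil (g c y) w w - bil (gB (x p) c' (snd c' (\<pi> p))) (dmap I c c' \<pi> y w) (dmap I c c' \<pi> y w) \<ge> 0"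
  unfolding f_def p(2) pA[OF p(1) c'] by simp
 have s: "deriv \<psi> (x p) > 0" by (rule d\<psi>[OF x_pts[OF chart_pts[OF M c p(1)]]])
 have e: "bil (newg c y) w w = deriv \<psi> (x p) * (bil (g c y) w w - bil (gB (x p) c' (snd c' (\<pi> p))) (dmap I c c' \<pi> y w) (dmap I c c' \<pi> y w))
  + bil (gB' (x1 p) c' (snd c' (\<pi> p))) (dmap I c c' \<pi> y w) (dmap I c c' \<pi> y w)"
  unfolding p(2) newg_bil[OF c c'(1) p(1) c'(2) w(1) w(1)] by (simp add: algebra_simps)
 show ?thesis
 proof (cases "dmap I c c' \<pi> y w = 0")
  case True
  then show ?thesis unfolding e using s g_facts(4)[OF c y w] by (simp add: bil_def)
 next
  case False
  have "x1 p \<in> {0..1}" using \<psi>_in(1)[OF x_pts[OF chart_pts[OF M c p(1)]]] by simp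
  then have "bil (gB' (x1 p) c' (snd c' (\<pi> p))) (dmap I c c' \<pi> y w) (dmap I c c' \<pi> y w) > 0"
   using kaehler_base[of "x1 p"] False c' snd_crange[OF c'(2)] d\<pi>_coord[OF c c'(1) p(1) c'(2), of w] unfolding kaehler_def riemannian_def p(2) by simp
  then show ?thesis unfolding e using mult_nonneg_nonneg[OF less_imp_le[OF s] 1] by linarith
 qed
qed

lemma newg_closed:
 assumes c: "c \<in> atlas M" and y: "y \<in> crange c" and ijk: "i \<in> I" "j \<in> I" "k' \<in> I"
 shows "ext3 (kform newg J c) i j k' y = 0"
proof -
 interpret N: ansatz_mfd M newg J E b x1 0 1 k a' by (intro ansatz_mfd.intro M cs ansatz_new)
 note C = chM[OF c]
 have sk: "smooth I (crange c) (kform newg J c)"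
  unfolding kform_def[abs_def] by (intro smooth_intros C J_smooth[OF c] smooth_newg[OF c])
 have "continuous_on (crange c) (ext3 (kform newg J c) i j k')" unfolding ext3_def[abs_def]
  by (intro smooth_continuous[of I] smooth_intros C smooth_pd[OF smooth_nth[OF C smooth_nth[OF C sk]]] ijk)
 then have "ext3 (kform newg J c) i j k' y \<in> {0}"
 proof (rule dense_zero[OF c y _ closed_singleton])
  fix p c' assume p: "p \<in> fst c" "p \<in> M0" and c': "c' \<in> atlas B" "\<pi> p \<in> fst c'"
  have kb: "kaehler B (gB' (x1 p)) (bJ E)" using kaehler_base[of "x1 p"] x1_M0[OF p(2)] by simp
  have "ext3 (kform (gB' (x1 p)) (bJ E) c') r s t (snd c' (\<pi> p)) = 0" if "r \<in> K" "s \<in> K" "t \<in> K" for r s t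
   using kb c'(1) snd_crange[OF c'(2)] that unfolding ext3_def kaehler_def by simp
  from ext3v_zero[OF chB[OF c'(1)] smooth_kform[OF clB kb c'(1)] snd_crange[OF c'(2)] this]
  show "ext3 (kform newg J c) i j k' (snd c p) \<in> {0}"
   using N.ext3_kform[OF c c' p(1) _ ijk kform_antisym[OF kb c'(1)]] p(2) d\<pi>_coord[OF c c'(1) p(1) c'(2)] by (simp add: M0_x1)
 qed
 then show ?thesis by simp
qed

lemma kaehler_new: "kaehler M newg J"
 unfolding kaehler_def riemannian_def
proof (intro conjI ballI impI)
 show "sym_tensor M newg" by (rule sym_tensor_newg)
 show "complex_structure M J" using kae by (simp add: kaehler_def)
 fix c y assume c: "c \<in> atlas M" and y: "y \<in> crange c"
 show "bil (newg c y) v v > 0" if "v \<in> coord I" "v \<noteq> 0" for v by (rule newg_pos[OF c y that])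
 show "bil (newg c y) (J c y *v v) (J c y *v w) = bil (newg c y) v w" if "v \<in> coord I" "w \<in> coord I" for v w
  by (rule newg_hermitian[OF c y that])
 show "pd i (\<lambda>z. kform newg J c z$j$k) y + pd j (\<lambda>z. kform newg J c z$k$i) y + pd k (\<lambda>z. kform newg J c z$i$j) y = 0"
  if "i \<in> I" "j \<in> I" "k \<in> I" for i j k using newg_closed[OF c y that] by (simp add: ext3_def)
qed

lemma A_pos: "t \<in> {0..1} \<Longrightarrow> b$i * t + a'$i > 0" using pos by (simp add: parameters_def)

lemma chart_instance:
 assumes c: "c \<in> atlas M" and c': "c' \<in> atlas B"
 shows "ansatz_chart I (U0 c c') (newg c) (J c) K (crange c') (\<lambda>i. bg E i c') (bJ E c') a' b (x1 \<circ> point c) (conn E c)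
  (r\<pi> c c') k {0<..<1} (\<lambda>i. real (d i)) r"
proof (rule ansatz_chart.intro)
 note U = U0(1)[OF c c']
 note V = chB[OF c']
 show "kaehler_chart I (U0 c c') (newg c) (J c)"
  by (rule kaehler_chart_subset[OF kaehler_chartI[OF M kaehler_new c] U U0(2)[OF c c']])
 have sgb: "smooth K (crange c') (bg E i c')" for i by (rule bg_smooth[OF c'])
 have ad: "\<exists>T \<sigma>. adapted K (\<lambda>i. bg E i c' z) T \<sigma> \<and> (\<forall>i. card {\<alpha>\<in>K. \<sigma> \<alpha> = i} = d i)" if "z \<in> crange c'" for z
  using good c' that unfolding good_base_def by simp
 have At: "b$i * t + a'$i > 0" if "t \<in> {0<..<1}" for i t using A_pos[of t i] that by simp
 have P: "x1 (point c y) \<in> {0<..<1}" if "y \<in> U0 c c'" for y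
  using that by (rule U0E) (use x1_M0 in \<open>simp add: pointM[OF c]\<close>)
 show "ansatz_chart_axioms I (U0 c c') (newg c) (J c) K (crange c') (\<lambda>i. bg E i c') (bJ E c') a' b (x1 \<circ> point c) (conn E c)
  (r\<pi> c c') k {0<..<1} (\<lambda>i. real (d i)) r"
 proof (rule ansatz_chart_axioms.intro)
  show "kaehler_chart K (crange c') (\<lambda>z. \<Sum>i\<in>UNIV. (b$i * t + a'$i) *\<^sub>R bg E i c' z) (bJ E c')" if "t \<in> {0<..<1}" for t
   using kaehler_chartI[OF clB kaehler_base c', of t] that by (simp add: base_metric_def[abs_def])
  show "smooth I (U0 c c') (x1 \<circ> point c)" by (rule smooth_subset[OF smooth_x1[OF c] U0(2)[OF c c']])
  show "(x1 \<circ> point c) ` U0 c c' \<subseteq> {0<..<1}" using P by auto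
  show "smooth I (U0 c c') (conn E c)" by (rule smooth_subset[OF smooth_conn[OF c] U0(4)[OF c c']])
  show "smooth I (U0 c c') (r\<pi> c c')" by (rule smooth_subset[OF smooth_\<pi>[OF c c'] U0(3)[OF c c']])
  show "(r\<pi> c c') ` U0 c c' \<subseteq> crange c'" using image_\<pi>[OF c c'] U0(3)[OF c c'] by blast
  show "trace (ginv K (\<Sum>i\<in>UNIV. (b$i * t + a'$i) *\<^sub>R bg E i c' z)**(PI K**bg E i c' z**PI K)) = real (d i) / (b$i * t + a'$i)"
   if "z \<in> crange c'" "t \<in> {0<..<1}" for z t i
   using ad[OF that(1)] trace_ginv_g[of K "\<lambda>i. bg E i c' z" _ _ "\<lambda>i. b$i * t + a'$i", OF _ At[OF that(2)]] by auto
  show "trace (ginv K (\<Sum>i\<in>UNIV. (b$i * t + a'$i) *\<^sub>R bg E i c' z)**pd l (\<lambda>z. hat K (\<Sum>i\<in>UNIV. (b$i * t + a'$i) *\<^sub>R bg E i c' z)) z) =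
   trace (ginv K (\<Sum>i\<in>UNIV. (b$i * s + a'$i) *\<^sub>R bg E i c' z)**pd l (\<lambda>z. hat K (\<Sum>i\<in>UNIV. (b$i * s + a'$i) *\<^sub>R bg E i c' z)) z)"
   if "z \<in> crange c'" "t \<in> {0<..<1}" "s \<in> {0<..<1}" "l \<in> K" for z t s l
   by (rule trace_ginv_pd_indep[OF V sgb ad At At that(1,4)]) (use that in simp_all)
  show "card I = card K + 2" by (rule cp_facts(8))
  show "k t > 0" if "t \<in> {0<..<1}" for t by (rule k_pos[OF that])
  show "r t = deriv k t + k t * (1 / 2 * (\<Sum>i\<in>UNIV. b$i * real (d i) / (b$i * t + a'$i)))" if "t \<in> {0<..<1}" for t by (rule v_eq[OF that])
 next
  fix y v assume "y \<in> U0 c c'" and v: "v \<in> coord I"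
  then obtain p where p: "p \<in> fst c" "p \<in> M0" "\<pi> p \<in> fst c'" and yp: "y = snd c p" by (auto elim: U0E)
  note pt = pointM[OF c p(1)]
  show "conn E c y \<bullet> (J c y *v v) = 1 / k ((x1 \<circ> point c) y) * (\<Sum>i\<in>I. v$i * pd i (x1 \<circ> point c) y)"
   "(\<Sum>i\<in>I. (J c y *v v)$i * pd i (x1 \<circ> point c) y) = - k ((x1 \<circ> point c) y) * (conn E c y \<bullet> v)"
   "(\<Sum>i\<in>I. (J c y *v v)$i *\<^sub>R pd i (r\<pi> c c') y) = bJ E c' ((r\<pi> c c') y) *v (\<Sum>i\<in>I. v$i *\<^sub>R pd i (r\<pi> c c') y)"
   using new_facts(2,3)[OF c c' p v] ansatz_facts(4)[OF c c' p v] by (simp_all add: yp pt dfun_def dmap_def)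
  show "bil (newg c y) v w = 1 / k ((x1 \<circ> point c) y) * (\<Sum>i\<in>I. v$i * pd i (x1 \<circ> point c) y) * (\<Sum>i\<in>I. w$i * pd i (x1 \<circ> point c) y)
   + k ((x1 \<circ> point c) y) * (conn E c y \<bullet> v) * (conn E c y \<bullet> w)
   + bil (\<Sum>i\<in>UNIV. (b$i * (x1 \<circ> point c) y + a'$i) *\<^sub>R bg E i c' ((r\<pi> c c') y))
    (\<Sum>i\<in>I. v$i *\<^sub>R pd i (r\<pi> c c') y) (\<Sum>i\<in>I. w$i *\<^sub>R pd i (r\<pi> c c') y)" if "w \<in> coord I" for w
   using new_facts(1)[OF c c' p v that] by (simp add: yp pt dfun_def dmap_def base_metric_def)
 next
  fix y j m assume "y \<in> U0 c c'" and jm: "j \<in> I" "m \<in> I"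
  then obtain p where p: "p \<in> fst c" "p \<in> M0" "\<pi> p \<in> fst c'" and yp: "y = snd c p" by (auto elim: U0E)
  show "pd j (\<lambda>z. conn E c z$m) y - pd m (\<lambda>z. conn E c z$j) y = (\<Sum>i\<in>UNIV. b$i * bil (transpose (bJ E c' ((r\<pi> c c') y))**bg E i c' ((r\<pi> c c') y))
    (\<Sum>l\<in>I. axis j 1$l *\<^sub>R pd l (r\<pi> c c') y) (\<Sum>l\<in>I. axis m 1$l *\<^sub>R pd l (r\<pi> c c') y))"
   using dconn[OF c c' p jm] by (simp add: yp pointM[OF c p(1)] dmap_def kform_def)
 qed (simp_all add: sgb V sk sv)
qed

end

lemma holomorphic_at_cong:
 assumes U: "ropen I U" and y: "y \<in> U" and V: "smooth I U V" and e: "\<And>z. z \<in> U \<Longrightarrow> V' z = r *\<^sub>R V z" and h: "holomorphic_at I J V y"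
 shows "holomorphic_at I J V' y"
proof -
 have p: "pd l (\<lambda>z. V' z$k) y = r * pd l (\<lambda>z. V z$k) y" if "l \<in> I" for l k
 proof -
  have "pd l (\<lambda>z. V' z$k) y = pd l (\<lambda>z. r * V z$k) y" by (rule pd_cong[OF U y that]) (simp add: e)
  then show ?thesis using pd_mult[OF U smooth_const[OF U] smooth_nth[OF U V] that y] by (simp add: pds_pd[OF pds_const])
 qed
 have "lie_J I J V' j k y = r * lie_J I J V j k y" if "j \<in> I" for j k
  unfolding lie_J_def sum_distrib_left by (rule sum.cong) (simp_all add: p that e[OF y] algebra_simps)
 then show ?thesis using h by (simp add: holomorphic_at_iff)
qed

section \<open>Scalar curvature and extremality of the new metric\<close>

context momentum_change
begin

lemma scalar_curvature_new:
 assumes c: "c \<in> atlas M" and y: "y \<in> crange c"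
 shows "scalar_curvature I (newg c) y = \<alpha> * (x1 \<circ> point c) y + \<beta>"
proof -
 interpret kaehler_chart I "crange c" "newg c" "J c" by (rule kaehler_chartI[OF M kaehler_new c])
 define f where "f y = scalar_curvature I (newg c) y - (\<alpha> * (x1 \<circ> point c) y + \<beta>)" for y
 have "continuous_on (crange c) f" unfolding f_def[abs_def]
  by (intro smooth_continuous[of I] smooth_intros U smooth_scalar_curvature smooth_x1 c)
 then have "f y \<in> {0}"
 proof (rule dense_zero[OF c y _ closed_singleton])
  fix p c' assume p: "p \<in> fst c" "p \<in> M0" and c': "c' \<in> atlas B" "\<pi> p \<in> fst c'"
  have t: "x1 p \<in> {0<..<1}" by (rule x1_M0[OF p(2)])
  have A: "b$i * x1 p + a'$i > 0" for i using A_pos[of "x1 p" i] t by simp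
  have "scalar_curvature I (newg c) (snd c p) = scalar_curvature K (gB' (x1 p) c') (snd c' (\<pi> p)) - deriv r (x1 p)
    - r (x1 p) * ((1/2) * (\<Sum>i\<in>UNIV. b$i * real (d i) / (b$i * x1 p + a'$i)))"
   using ansatz_chart.scalar_curvature_ansatz[OF chart_instance[OF c c'(1)] U0I[OF p c'(2)]]
   by (simp add: pointM[OF c p(1)] base_metric_def[abs_def])
  also have "\<dots> = \<alpha> * x1 p + \<beta>"
   using scal_eq[OF t] good c' snd_crange[OF c'(2)] t by (simp add: good_base_def)
  finally show "f (snd c p) \<in> {0}" by (simp add: f_def pointM[OF c p(1)])
 qed
 then show ?thesis by (simp add: f_def)
qed

lemma extremal_new: "extremal M newg J"
 unfolding extremal_def
proof (intro ballI)
 fix c y assume c: "c \<in> atlas M" and y: "y \<in> crange c"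
 interpret kaehler_chart I "crange c" "newg c" "J c" by (rule kaehler_chartI[OF M kaehler_new c])
 define X where "X = x1 \<circ> point c"
 define V where "V = gradient I (newg c) X"
 have sX: "smooth I (crange c) X" unfolding X_def by (rule smooth_x1[OF c])
 have sV: "smooth I (crange c) V" unfolding V_def by (rule smooth_gradient[OF sX])
 have "lie_J I (J c) V j k y = 0" if j: "j \<in> I" and k: "k \<in> I" for j k
 proof -
  have "continuous_on (crange c) (lie_J I (J c) V j k)" unfolding lie_J_def[abs_def]
   by (intro smooth_continuous[of I] smooth_intros U sV smooth_J smooth_pd j)
  then have "lie_J I (J c) V j k y \<in> {0}"
  proof (rule dense_zero[OF c y _ closed_singleton])
   fix p c' assume p: "p \<in> fst c" "p \<in> M0" and c': "c' \<in> atlas B" "\<pi> p \<in> fst c'"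
   show "lie_J I (J c) V j k (snd c p) \<in> {0}"
    using ansatz_chart.gradient_holomorphic[OF chart_instance[OF c c'(1)] U0I[OF p c'(2)]] j k
    unfolding holomorphic_at_iff V_def X_def by simp
  qed
  then show ?thesis by simp
 qed
 then have hol: "holomorphic_at I (J c) V y" by (simp add: holomorphic_at_iff)
 \<comment> \<open>The scalar curvature is affine in the momentum, so its gradient is a constant
   multiple of \<open>V\<close>.\<close>
 have e: "gradient I (newg c) (scalar_curvature I (newg c)) z = \<alpha> *\<^sub>R V z" if z: "z \<in> crange c" for z
 proof -
  have "pd i (scalar_curvature I (newg c)) z = \<alpha> * pd i X z" if i: "i \<in> I" for i
  proof -
   have "pd i (scalar_curvature I (newg c)) z = pd i (\<lambda>y. \<alpha> * X y + \<beta>) z"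
    by (rule pd_cong[OF U z i]) (simp add: scalar_curvature_new[OF c] X_def)
   then show ?thesis using pd_add[OF U smooth_mult[OF U smooth_const[OF U] sX] smooth_const[OF U] i z]
    pd_mult[OF U smooth_const[OF U] sX i z] by (simp add: pds_pd[OF pds_const])
  qed
  then show ?thesis by (simp add: gradient_def V_def vec_eq_iff sum_distrib_left ac_simps)
 qed
 show "holomorphic_at I (J c) (gradient I (newg c) (scalar_curvature I (newg c))) y"
  by (rule holomorphic_at_cong[OF U y sV e hol])
qed

lemma test_value:
 assumes c: "c \<in> atlas M" "c' \<in> atlas B" and p: "p \<in> fst c" "p \<in> M0" "\<pi> p \<in> fst c'"
  and v: "v \<in> coord I" "dx c p v = 0"
 shows "bil (newg c (snd c p)) v v = k (x1 p) * (conn E c (snd c p) \<bullet> v)\<^sup>2 +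
   bil (gB' (x1 p) c' (snd c' (\<pi> p))) (D\<pi> c c' p v) (D\<pi> c c' p v)"
 using new_facts(1)[OF c p v(1,1)] dfun_x1[OF c(1) snd_crange[OF p(1)]] v(2) by (simp add: power2_eq_square)

end

section \<open>Existence and distinctness of the family\<close>

context kaehler_ansatz
begin

lemma profile_h: "profile l u h"
 using ans cp_facts(1) by (simp add: ansatz_def profile_def)

lemma momentum_change_exists:
 assumes "good_base E b d a'" "a' \<in> parameters b"
 shows "\<exists>\<psi>. \<exists>k r \<alpha> \<beta> T. momentum_change M g J E b x l u h a a' d k r \<alpha> \<beta> T \<psi>"
proof -
 have A: "b$i * t + a'$i > 0" if "t \<in> {0..1}" for i t using assms(2) that by (simp add: parameters_def)
 obtain k r \<alpha> \<beta> where k: "profile 0 1 k" "smooth1 {0<..<1} k" "smooth1 {0<..<1} r"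
  "\<And>t. t \<in> {0<..<1} \<Longrightarrow> r t = deriv k t + k t * ((1/2) * (\<Sum>i\<in>UNIV. b$i * real (d i) / (b$i * t + a'$i)))"
  "\<And>t. t \<in> {0<..<1} \<Longrightarrow> (\<Sum>i\<in>UNIV. real (d i) / (b$i * t + a'$i)) - deriv r t
    - r t * ((1/2) * (\<Sum>i\<in>UNIV. b$i * real (d i) / (b$i * t + a'$i))) = \<alpha> * t + \<beta>"
  by (rule extremal_profile[of b a' "\<lambda>i. real (d i)"]) (erule A, simp, (rule that; assumption))
 obtain T \<psi> where \<psi>: "open T" "{l..u} \<subseteq> T" "smooth1 T \<psi>" "\<psi> l = 0" "\<psi> u = 1"
  "\<And>t. t \<in> {l..u} \<Longrightarrow> deriv \<psi> t > 0" "\<And>t. t \<in> {l..u} \<Longrightarrow> k (\<psi> t) = deriv \<psi> t * h t"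
  by (rule profile_conjugate[OF profile_h k(1)]) (rule that; assumption)
 have "momentum_change M g J E b x l u h a a' d k r \<alpha> \<beta> T \<psi>"
  by (intro momentum_change.intro kaehler_ansatz_axioms momentum_change_axioms.intro assms k \<psi>)
 then show ?thesis by blast
qed

text \<open>On the vertical vector with \<theta> = 1 the metrics take the values \<psi>' h, so
  \<psi>1' = s \<psi>2'. Both functions run from 0 to 1, hence s = 1 and they coincide. A lift of a
  frame vector of the i-th summand, which exists because \<open>d i\<close> is positive, then
  compares the i-th parameters.\<close>

lemma newg_distinct:
 assumes 1: "momentum_change M g J E b x l u h a a1 d k1 r1 \<alpha>1 \<beta>1 T1 \<psi>1"
  and 2: "momentum_change M g J E b x l u h a a2 d k2 r2 \<alpha>2 \<beta>2 T2 \<psi>2" and d: "\<And>i. d i \<ge> 1" and s: "s > 0"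
  and e: "\<And>c y i j. \<lbrakk>c \<in> atlas M; y \<in> crange c; i \<in> I; j \<in> I\<rbrakk> \<Longrightarrow>
    momentum_change.newg M g E b x a a1 \<psi>1 c y$i$j = s * momentum_change.newg M g E b x a a2 \<psi>2 c y$i$j"
 shows "a1 = a2"
proof -
 interpret m1: momentum_change M g J E b x l u h a a1 d k1 r1 \<alpha>1 \<beta>1 T1 \<psi>1 by fact
 interpret m2: momentum_change M g J E b x l u h a a2 d k2 r2 \<alpha>2 \<beta>2 T2 \<psi>2 by fact
 have b: "bil (m1.newg c y) v v = s * bil (m2.newg c y) v v" if "c \<in> atlas M" "y \<in> crange c" "v \<in> coord I" for c y v
  unfolding bil_coord[OF that(3,3)] sum_distrib_left using e[OF that(1,2)] by (intro sum.cong) simp_all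
 have "pts B \<noteq> {}" using clB unfolding closed_manifold_def by blast
 then obtain q where q: "q \<in> pts B" by blast
 obtain c' where c': "c' \<in> atlas B" "q \<in> fst c'" using chart_cover[OF clB q] by auto
 have ex: "\<exists>p c. p \<in> M0 \<and> x p = t \<and> \<pi> p = q \<and> c \<in> atlas M \<and> p \<in> fst c" if "t \<in> {l<..<u}" for t
  using cp_facts(11)[OF that q] chart_cover[OF M M0_pts] by metis
 have "deriv \<psi>1 t = s * deriv \<psi>2 t" if t: "t \<in> {l<..<u}" for t
 proof -
  obtain p c where p: "p \<in> M0" "x p = t" "\<pi> p = q" and c: "c \<in> atlas M" "p \<in> fst c" using ex[OF t] by auto
  have \<pi>p: "\<pi> p \<in> fst c'" using c' p by simp
  obtain v where v: "v \<in> coord I" "dx c p v = 0" "conn E c (snd c p) \<bullet> v = 1" "D\<pi> c c' p v = 0"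
   using frame_vector[OF c(1) c'(1) c(2) p(1) \<pi>p, of 0 1] by (auto simp: coord_def)
  have t': "t \<in> {l..u}" using t by simp
  have "k1 (\<psi>1 t) = s * k2 (\<psi>2 t)"
   using b[OF c(1) snd_crange[OF c(2)] v(1)] m1.test_value[OF c(1) c'(1) c(2) p(1) \<pi>p v(1,2)] m2.test_value[OF c(1) c'(1) c(2) p(1) \<pi>p v(1,2)]
   by (simp add: v p(2) bil_def)
  then show ?thesis using m1.k\<psi>[OF t'] m2.k\<psi>[OF t'] h_pos[OF t] by (simp add: mult.assoc[symmetric])
 qed
 note dd = this
 have D: "((\<lambda>t. \<psi>1 t - s * \<psi>2 t) has_real_derivative 0) (at t)" if "l < t" "t < u" for t
 proof -
  have "t \<in> T1" "t \<in> T2" using that m1.T(2) m2.T(2) by auto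
  then show ?thesis using DERIV_diff[OF smooth1_has_derivative[OF m1.s\<psi> m1.T(1)] DERIV_cmult[OF smooth1_has_derivative[OF m2.s\<psi> m2.T(1)]], of t s]
   that by (simp add: dd)
 qed
 have cont: "continuous_on {l..u} (\<lambda>t. \<psi>1 t - s * \<psi>2 t)"
  by (intro continuous_intros continuous_on_subset[OF smooth1_continuous_on[OF m1.s\<psi>] m1.T(2)] continuous_on_subset[OF smooth1_continuous_on[OF m2.s\<psi>] m2.T(2)])
 have z: "\<psi>1 t - s * \<psi>2 t = 0" if "t \<in> {l..u}" for t
  using DERIV_isconst2[OF lu cont D, of t] that by (simp add: m1.\<psi>0 m2.\<psi>0)
 have s1: "s = 1" using z[of u] lu by (simp add: m1.\<psi>1 m2.\<psi>1)
 define t where "t = (l + u) / 2"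
 have t: "t \<in> {l<..<u}" using lu by (simp add: t_def)
 have eq: "\<psi>1 t = \<psi>2 t" using z[of t] t s1 by simp
 obtain p c where p: "p \<in> M0" "x p = t" "\<pi> p = q" and c: "c \<in> atlas M" "p \<in> fst c" using ex[OF t] by auto
 have \<pi>p: "\<pi> p \<in> fst c'" using c' p by simp
 have "\<exists>T \<sigma>. adapted K (\<lambda>i. bg E i c' (snd c' q)) T \<sigma> \<and> (\<forall>i. card {\<alpha>\<in>K. \<sigma> \<alpha> = i} = d i)"
  using m1.good c' snd_crange[OF c'(2)] unfolding good_base_def by simp
 then obtain T \<sigma> where T: "adapted K (\<lambda>i. bg E i c' (snd c' q)) T \<sigma>" "\<And>i. card {\<alpha>\<in>K. \<sigma> \<alpha> = i} = d i" by auto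
 have "a1$i = a2$i" for i
 proof -
  have "card {\<alpha>\<in>K. \<sigma> \<alpha> = i} > 0" using d[of i] T(2)[of i] by simp
  then obtain \<alpha> where \<alpha>: "\<alpha> \<in> K" "\<sigma> \<alpha> = i" by (metis (mono_tags, lifting) card_gt_0_iff ex_in_conv mem_Collect_eq)
  define w where "w = T *v axis \<alpha> 1"
  have w: "w \<in> coord K" unfolding w_def using T(1) by (intro blk_mv_coord[of K K]) (simp add: adapted_def)
  have "bil (bg E j c' (snd c' q)) w w = (if j = i then 1 else 0)" for j
   using T(1) \<alpha> unfolding w_def bil_congruence[symmetric] bil_axis by (auto simp: adapted_def dg_def)
  then have B: "bil (base_metric E a' b r c' (snd c' q)) w w = b$i * r + a'$i" for a' r
   unfolding base_metric_def bil_sum_scale by (simp add: if_distrib[of "\<lambda>x. _ * x"] cong: if_cong)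
  obtain v where v: "v \<in> coord I" "dx c p v = 0" "conn E c (snd c p) \<bullet> v = 0" "D\<pi> c c' p v = w"
   using frame_vector[OF c(1) c'(1) c(2) p(1) \<pi>p w, of 0] by auto
  show ?thesis
   using b[OF c(1) snd_crange[OF c(2)] v(1)] m1.test_value[OF c(1) c'(1) c(2) p(1) \<pi>p v(1,2)] m2.test_value[OF c(1) c'(1) c(2) p(1) \<pi>p v(1,2)]
   by (simp add: v p B s1 eq)
 qed
 then show ?thesis by (simp add: vec_eq_iff)
qed

text \<open>The second clause passes isometries on to the family. They have to preserve x, since the
  coefficients of the new metrics are functions of x, and to cover a map of the base preserving
  every summand.\<close>

theorem extremal_family_exists:
 assumes D: "D \<subseteq> parameters b" and good: "\<And>a'. a' \<in> D \<Longrightarrow> good_base E b d a'" and d: "\<And>i. d i \<ge> 1"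
 shows "\<exists>F. extremal_family M J E b D F \<and> (\<forall>f j. smooth_map M M f \<and> smooth_map B B j \<and> (\<forall>p\<in>pts M. \<pi> (f p) = j (\<pi> p) \<and> x (f p) = x p) \<and>
  (\<forall>i. is_pullback B B j (bg E i) (bg E i)) \<and> is_pullback M M f g g \<longrightarrow> (\<forall>a'\<in>D. is_pullback M M f (F a') (F a')))"
proof -
 have "\<forall>a'\<in>D. \<exists>\<psi>. \<exists>k r \<alpha> \<beta> T. momentum_change M g J E b x l u h a a' d k r \<alpha> \<beta> T \<psi>"
  using momentum_change_exists[OF good] D by blast
 then obtain \<Psi> where \<Psi>: "\<And>a'. a' \<in> D \<Longrightarrow> \<exists>k r \<alpha> \<beta> T. momentum_change M g J E b x l u h a a' d k r \<alpha> \<beta> T (\<Psi> a')"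
  unfolding bchoice_iff by blast
 define F where "F a' = momentum_change.newg M g E b x a a' (\<Psi> a')" for a'
 have 1: "kaehler M (F a') J \<and> extremal M (F a') J \<and> (\<exists>x h. ansatz M (F a') J E b x 0 1 h a')" if a': "a' \<in> D" for a'
 proof -
  obtain k r \<alpha> \<beta> T where m: "momentum_change M g J E b x l u h a a' d k r \<alpha> \<beta> T (\<Psi> a')" using \<Psi>[OF a'] by auto
  show ?thesis unfolding F_def
   using momentum_change.kaehler_new[OF m] momentum_change.extremal_new[OF m] momentum_change.ansatz_new[OF m] by blast
 qed
 have 2: "a1 = a2" if a: "a1 \<in> D" "a2 \<in> D" and s: "s > 0"
  and e: "\<forall>c\<in>atlas M. \<forall>y\<in>crange c. \<forall>i\<in>I. \<forall>j\<in>I. F a1 c y$i$j = s * F a2 c y$i$j" for a1 a2 s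
 proof -
  obtain k1 r1 \<alpha>1 \<beta>1 T1 where m1: "momentum_change M g J E b x l u h a a1 d k1 r1 \<alpha>1 \<beta>1 T1 (\<Psi> a1)" using \<Psi>[OF a(1)] by auto
  obtain k2 r2 \<alpha>2 \<beta>2 T2 where m2: "momentum_change M g J E b x l u h a a2 d k2 r2 \<alpha>2 \<beta>2 T2 (\<Psi> a2)" using \<Psi>[OF a(2)] by auto
  show ?thesis by (rule newg_distinct[OF m1 m2 d s]) (use e in \<open>simp add: F_def\<close>)
 qed
 have 3: "is_pullback M M f (F a') (F a')" if a': "a' \<in> D" and f: "smooth_map M M f" "smooth_map B B j" "\<forall>p\<in>pts M. \<pi> (f p) = j (\<pi> p) \<and> x (f p) = x p"
  "\<forall>i. is_pullback B B j (bg E i) (bg E i)" "is_pullback M M f g g" for a' f j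
 proof -
  obtain k r \<alpha> \<beta> T where m: "momentum_change M g J E b x l u h a a' d k r \<alpha> \<beta> T (\<Psi> a')" using \<Psi>[OF a'] by auto
  show ?thesis unfolding F_def by (rule momentum_change.newg_invariant[OF m f(1,2)]) (use f in simp_all)
 qed
 have "extremal_family M J E b D F" unfolding extremal_family_def using 1 2 by blast
 then show ?thesis using 3 by blast
qed

end

subsection \<open>Products of Kaehler-Einstein manifolds\<close>

lemma bil_block_eq:
 fixes A :: "'m::finite \<Rightarrow> real" and P :: "'m \<Rightarrow> real^'n^'j"
 assumes P: "\<And>i. blk (K i) I (P i)" and e: "\<And>v w. v \<in> coord I \<Longrightarrow> w \<in> coord I \<Longrightarrow> bil G v w = (\<Sum>i\<in>UNIV. A i * bil (g i) (P i *v v) (P i *v w))"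
 shows "PI I**hat I G = (\<Sum>i\<in>UNIV. A i *\<^sub>R (transpose (P i)**hat (K i) (g i)**P i))"
proof (rule matrix_eq_bil[OF hat_blk(2)])
 have "blk I I (transpose (P i)**X**P i)" for i X using P[of i] by (auto simp: blk_def mm_nth transpose_def)
 then show "blk I I (\<Sum>i\<in>UNIV. A i *\<^sub>R (transpose (P i)**hat (K i) (g i)**P i))" by (intro blk_sum blk_scaleR)
 fix v w :: "real^'n" assume v: "v \<in> coord I" and w: "w \<in> coord I"
 have "bil (PI I**hat I G) v w = bil G v w"
  unfolding bil_coord[OF v w] by (intro sum.cong) (simp_all add: PI_mult hat_nth)
 then show "bil (PI I**hat I G) v w = bil (\<Sum>i\<in>UNIV. A i *\<^sub>R (transpose (P i)**hat (K i) (g i)**P i)) v w"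
  unfolding bil_sum_scale bil_congruence bil_hat[OF blk_mv_coord[OF P] blk_mv_coord[OF P]] e[OF v w] .
qed

text \<open>The form used on products of Kaehler-Einstein manifolds. With a single factor it says
  that local isometries preserve the Ricci tensor, which is used on coadjoint orbits.\<close>

lemma pullback_ricci_bil:
 fixes G :: "real^'n \<Rightarrow> real^'n^'n" and g :: "'m::finite \<Rightarrow> real^'j \<Rightarrow> real^'j^'j"
  and f :: "'m \<Rightarrow> real^'n \<Rightarrow> real^'j" and A :: "'m \<Rightarrow> real"
 assumes G: "metric_chart I U G" and g: "\<And>i. metric_chart (K i) (V i) (g i)"
  and f: "\<And>i. smooth I U (f i)" and fU: "\<And>i. f i ` U \<subseteq> V i"
  and met: "\<And>y v w. \<lbrakk>y \<in> U; v \<in> coord I; w \<in> coord I\<rbrakk> \<Longrightarrow> bil (G y) v w = (\<Sum>i\<in>UNIV. A i * bil (g i (f i y)) (jac I (f i) y *v v) (jac I (f i) y *v w))"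
  and card: "card I = (\<Sum>i\<in>UNIV. card (K i))" and y: "y \<in> U" and v: "v \<in> coord I" and w: "w \<in> coord I"
 shows "bil (ricci I G y) v w = (\<Sum>i\<in>UNIV. bil (ricci (K i) (g i) (f i y)) (jac I (f i) y *v v) (jac I (f i) y *v w))"
proof -
 have fc: "f i ` U \<subseteq> coord (K i)" for i using fU openin_imp_subset[OF metric_chart.U[OF g]] by blast
 have P: "blk (K i) I (jac I (f i) y)" if "y \<in> U" for i y by (rule blk_jac[OF metric_chart.U[OF G] f fc that])
 have m: "PI I**hat I (G y) = (\<Sum>i\<in>UNIV. A i *\<^sub>R (transpose (jac I (f i) y)**hat (K i) (g i (f i y))**jac I (f i) y))" if "y \<in> U" for y
  by (rule bil_block_eq[OF P[OF that] met[OF that]])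
 define R where "R = (\<Sum>i\<in>UNIV. 1 *\<^sub>R (transpose (jac I (f i) y)**ricci (K i) (g i) (f i y)**jac I (f i) y))"
 have "ricci I G y$j$k = R$j$k" if "j \<in> I" "k \<in> I" for j k
 proof -
  have "bil (ricci (K i) (g i) (f i y)) (jac I (f i) y *v axis j 1) (jac I (f i) y *v axis k 1) =
   (\<Sum>b\<in>K i. \<Sum>c\<in>K i. pd j (f i) y$b * ricci (K i) (g i) (f i y)$b$c * pd k (f i) y$c)" for i
   unfolding bil_coord[OF blk_mv_coord[OF P[OF y]] blk_mv_coord[OF P[OF y]]] using that
   by (simp add: matrix_vector_mult_basis column_def jac_nth)
  moreover have "ricci I G y$j$k = (\<Sum>i\<in>UNIV. \<Sum>b\<in>K i. \<Sum>c\<in>K i. pd j (f i) y$b * ricci (K i) (g i) (f i y)$b$c * pd k (f i) y$c)"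
   by (rule pullback_ricci[OF G g f fU m card y that])
  ultimately show ?thesis unfolding R_def
   by (simp add: sum_component bil_congruence[symmetric] bil_axis)
 qed
 then have "bil (ricci I G y) v w = bil R v w" unfolding bil_coord[OF v w] by (intro sum.cong) simp_all
 then show ?thesis unfolding R_def bil_sum_scale bil_congruence by simp
qed

locale product_base =
 fixes E :: "('p, 'n, 'q, 'k::finite, 'm::finite) circle_bundle" and N :: "'m \<Rightarrow> ('r, 'j::finite) mfd" and gN JN pr
 assumes B: "closed_manifold (base E)" and cs: "complex_structure (base E) (bJ E)" and sg: "\<And>i. sym_tensor (base E) (bg E i)"
  and two: "construction_two E N gN JN pr"
begin

abbreviation (input) "K \<equiv> idx (base E)"
abbreviation (input) "L i \<equiv> idx (N i)"

lemma two_facts: "closed_manifold (N i)" "L i \<noteq> {}" "kaehler (N i) (gN i) (JN i)" "einstein (N i) (gN i) 1"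
  "smooth_map (base E) (N i) (pr i)" "card K = (\<Sum>i\<in>UNIV. card (L i))" "is_pullback (base E) (N i) (pr i) (gN i) (bg E i)"
 using two unfolding construction_two_def Let_def by simp_all

lemma two_inj:
 assumes "c \<in> atlas (base E)" "q \<in> fst c" "v \<in> coord K" "\<And>i c'. c' \<in> atlas (N i) \<Longrightarrow> pr i q \<in> fst c' \<Longrightarrow> dmap K c c' (pr i) (snd c q) v = 0"
 shows "v = 0"
 using two assms unfolding construction_two_def Let_def by blast

lemma two_J:
 assumes "c \<in> atlas (base E)" "c' \<in> atlas (N i)" "q \<in> fst c" "pr i q \<in> fst c'" "v \<in> coord K"
 shows "dmap K c c' (pr i) (snd c q) (bJ E c (snd c q) *v v) = JN i c' (snd c' (pr i q)) *v dmap K c c' (pr i) (snd c q) v"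
 using two assms unfolding construction_two_def Let_def intertwines_def by simp

lemma bJ_coord: "c \<in> atlas (base E) \<Longrightarrow> y \<in> crange c \<Longrightarrow> bJ E c y *v v \<in> coord K"
 using cs by (intro blk_mv_coord[of K K]) (auto simp: complex_structure_def almost_complex_def endo_field_def blk_def)

context
 fixes c q C assumes c: "c \<in> atlas (base E)" and q: "q \<in> fst c" and C: "\<And>i. C i \<in> atlas (N i)" "\<And>i. pr i q \<in> fst (C i)"
begin

definition W2 where "W2 = (\<Inter>i. {q \<in> pts (base E). pr i q \<in> fst (C i)}) \<inter> pts (base E)"
definition f2 where "f2 i = snd (C i) \<circ> pr i \<circ> point c"

lemma open_W2: "openin (mtop (base E)) W2"
 unfolding W2_def by (intro openin_INT) (auto intro: open_preimage[OF B two_facts(1,5) chart_facts(1)[OF two_facts(1) C(1)]])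

lemma U2: "ropen K (snd c ` (fst c \<inter> W2))" by (rule chart_open_image[OF B c open_W2])

lemma q_U2: "snd c q \<in> snd c ` (fst c \<inter> W2)"
 using q C(2) chart_pts[OF B c q] by (simp add: W2_def)

lemma U2_sub: "snd c ` (fst c \<inter> W2) \<subseteq> crange c" by (auto simp: crange_def)

lemma smooth_f2: "smooth K (snd c ` (fst c \<inter> W2)) (f2 i)"
 unfolding f2_def by (rule lrep_smooth[OF B two_facts(1,5) c C(1) open_W2]) (simp add: W2_def)

lemma f2_U: "f2 i ` (snd c ` (fst c \<inter> W2)) \<subseteq> crange (C i)"
 unfolding f2_def by (rule lrep_image[OF B two_facts(1,5) c C(1) open_W2]) (simp add: W2_def)

lemma jac_f2: "p \<in> fst c \<Longrightarrow> v \<in> coord K \<Longrightarrow> jac K (f2 i) (snd c p) *v v = dmap K c (C i) (pr i) (snd c p) v"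
 unfolding f2_def by (simp add: dmap_jac)

lemma bg_f2:
 assumes y: "y \<in> snd c ` (fst c \<inter> W2)" and v: "v \<in> coord K" and w: "w \<in> coord K"
 shows "bil (bg E i c y) v w = bil (gN i (C i) (f2 i y)) (jac K (f2 i) y *v v) (jac K (f2 i) y *v w)"
  and "jac K (f2 i) y *v (bJ E c y *v v) = JN i (C i) (f2 i y) *v (jac K (f2 i) y *v v)"
proof -
 obtain p where p: "p \<in> fst c" "pr i p \<in> fst (C i)" "y = snd c p" using y by (auto simp: W2_def)
 have f: "f2 i y = snd (C i) (pr i p)" using p by (simp add: f2_def point_snd[OF B c])
 show "bil (bg E i c y) v w = bil (gN i (C i) (f2 i y)) (jac K (f2 i) y *v v) (jac K (f2 i) y *v w)"
  unfolding f unfolding p(3) jac_f2[OF p(1) v] jac_f2[OF p(1) w] by (rule is_pullbackD[OF two_facts(7) c C(1) p(1,2) v w])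
 show "jac K (f2 i) y *v (bJ E c y *v v) = JN i (C i) (f2 i y) *v (jac K (f2 i) y *v v)"
  unfolding f unfolding p(3) jac_f2[OF p(1) v] jac_f2[OF p(1) bJ_coord[OF c snd_crange[OF p(1)]]] by (rule two_J[OF c C(1) p(1,2) v])
qed

lemma jac_f2_inj: assumes "v \<in> coord K" "\<And>i. jac K (f2 i) (snd c q) *v v = 0" shows "v = 0"
proof (rule two_inj[OF c q assms(1)])
 fix i c' assume c': "c' \<in> atlas (N i)" "pr i q \<in> fst c'"
 have "dmap K c (C i) (pr i) (snd c q) v = 0" using assms jac_f2[OF q assms(1)] by simp
 moreover have "dmap K c c' (pr i) (snd c q) v = dmap (L i) (C i) c' id (snd (C i) (pr i q)) (dmap K c (C i) (pr i) (snd c q) v)"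
  by (rule dmap_chain[OF B two_facts(1) two_facts(1) two_facts(5)[of i] smooth_map_id[OF two_facts(1)[of i]] c C(1) c'(1) q C(2), of v, unfolded id_comp]) (simp add: c'(2))
 ultimately show "dmap K c c' (pr i) (snd c q) v = 0" by (simp add: dmap_zero)
qed

lemma blk_jac_f2: "y \<in> snd c ` (fst c \<inter> W2) \<Longrightarrow> blk (L i) K (jac K (f2 i) y)"
 by (rule blk_jac[OF U2 smooth_f2]) (use f2_U openin_imp_subset[OF chart_facts(2)[OF two_facts(1) C(1)]] in blast)

lemma kN: "kaehler_chart (L i) (crange (C i)) (gN i (C i)) (JN i (C i))"
 by (rule kaehler_chartI[OF two_facts(1,3) C(1)])

end

lemma choose_C: assumes "c \<in> atlas (base E)" "q \<in> fst c" obtains C where "\<And>i. C i \<in> atlas (N i)" "\<And>i. pr i q \<in> fst (C i)"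
proof -
 have "\<forall>i. \<exists>C. C \<in> atlas (N i) \<and> pr i q \<in> fst C"
  using chart_cover[OF two_facts(1) map_pts[OF B two_facts(1,5) chart_pts[OF B assms]]] by blast
 from choice[OF this] show thesis using that by blast
qed

text \<open>Positivity holds because the projections jointly separate tangent vectors. Closedness
  holds summand by summand, as the coefficients are constant on the base and d commutes with
  pullback.\<close>

lemma kaehler_two:
 assumes A: "\<And>i. b$i * t + a$i > 0"
 shows "kaehler (base E) (base_metric E a b t) (bJ E)"
proof -
 define G where "G = base_metric E a b t"
 have Gb: "bil (G c y) v w = (\<Sum>i\<in>UNIV. (b$i * t + a$i) * bil (bg E i c y) v w)" for c y v w
  unfolding G_def base_metric_bil ..
 have st: "sym_tensor (base E) G" unfolding G_def by (rule sym_tensor_base_metric[OF B sg])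
 show ?thesis unfolding kaehler_def riemannian_def G_def[symmetric]
 proof (intro conjI ballI impI st cs)
  fix c y assume c: "c \<in> atlas (base E)" and "y \<in> crange c"
  then obtain q where q: "q \<in> fst c" and y: "y = snd c q" by (auto elim: crangeE)
  obtain C where C: "\<And>i. C i \<in> atlas (N i)" "\<And>i. pr i q \<in> fst (C i)" using choose_C[OF c q] by blast
  note ctx = c q C
  define U where "U = snd c ` (fst c \<inter> W2 C)"
  note U = U2[OF ctx, folded U_def] and sf = smooth_f2[OF ctx, folded U_def] and fU = f2_U[OF ctx, folded U_def]
   and bf = bg_f2[OF ctx, folded U_def] and yU = q_U2[OF ctx, folded U_def y]
  note jc = blk_mv_coord[OF blk_jac_f2[OF ctx, folded U_def]]
  note kN = kN[OF ctx]
  have fy: "f2 c C i y \<in> crange (C i)" for i using fU yU by blast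
  have J: "bJ E c y *v v \<in> coord K" for v unfolding y by (rule bJ_coord[OF c snd_crange[OF q]])
  show "bil (G c y) v v > 0" if v: "v \<in> coord K" "v \<noteq> 0" for v
  proof -
   obtain i where i: "jac K (f2 c C i) y *v v \<noteq> 0" using jac_f2_inj[OF ctx v(1)] v(2) unfolding y by blast
   have p: "bil (bg E j c y) v v > 0" if "jac K (f2 c C j) y *v v \<noteq> 0" for j
    unfolding bf(1)[OF yU v(1) v(1)] by (rule metric_chart.pos_G[OF kaehler_chart.axioms(1)[OF kN] fy jc[OF yU] that])
   have p': "bil (bg E j c y) v v \<ge> 0" for j
    using p[of j] bf(1)[OF yU v(1) v(1), of j] by (cases "jac K (f2 c C j) y *v v = 0") (auto simp: bil_def)
   show ?thesis unfolding Gb by (rule sum_pos2[of _ i]) (simp_all add: mult_pos_pos[OF A p[OF i]] mult_nonneg_nonneg[OF less_imp_le[OF A] p'])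
  qed
  show "bil (G c y) (bJ E c y *v v) (bJ E c y *v w) = bil (G c y) v w" if v: "v \<in> coord K" and w: "w \<in> coord K" for v w
  proof -
   have "bil (bg E i c y) (bJ E c y *v v) (bJ E c y *v w) = bil (bg E i c y) v w" for i
    unfolding bf(1)[OF yU J J] bf(1)[OF yU v w] bf(2)[OF yU v v] bf(2)[OF yU w w]
    by (rule kaehler_chart.J_orth[OF kN fy jc[OF yU] jc[OF yU]])
   then show ?thesis unfolding Gb by simp
  qed
  fix i j k assume ijk: "i \<in> K" "j \<in> K" "k \<in> K"
  define w where "w s z = transpose (JN s (C s) z)**gN s (C s) z" for s z
  define \<Omega> where "\<Omega> s z = transpose (jac K (f2 c C s) z)**w s (f2 c C s z)**jac K (f2 c C s) z" for s z
  have V: "ropen (L s) (crange (C s))" for s by (rule chart_facts(2)[OF two_facts(1) C(1)])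
  have sw: "smooth (L s) (crange (C s)) (w s)" for s
   unfolding w_def[abs_def] using kN[of s] by (intro smooth_intros V) (auto simp: kaehler_chart_def kaehler_chart_axioms_def metric_chart_def)
  have aw: "w s z$a$b = - w s z$b$a" if "z \<in> crange (C s)" "a \<in> L s" "b \<in> L s" for s z a b
   using kform_antisym[OF two_facts(3) C(1) that] by (simp add: kform_def w_def)
  have zw: "ext3 (w s) a b d z = 0" if "z \<in> crange (C s)" "a \<in> L s" "b \<in> L s" "d \<in> L s" for s z a b d
   using kaehler_chart.closed[OF kN that] by (simp add: ext3_def w_def)
  have s\<Omega>: "smooth K U (\<Omega> s)" for s unfolding \<Omega>_def
   by (intro smooth_intros U smooth_jac[OF U sf] smooth_compose[OF U V fU sf sw])
  have "ext3 (kform G (bJ E) c) i j k y = ext3 (\<lambda>z. \<Sum>s\<in>UNIV. (b$s * t + a$s) *\<^sub>R \<Omega> s z) i j k y"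
  proof (rule ext3_cong[OF U yU ijk])
   fix z i j assume z: "z \<in> U" and ij: "i \<in> K" "j \<in> K"
   then have zc: "z \<in> crange c" using U2_sub[OF ctx] by (auto simp: U_def)
   have ax: "axis i 1 \<in> coord K" "axis j 1 \<in> coord K" using ij by simp_all
   have "kform G (bJ E) c z$i$j = bil (G c z) (bJ E c z *v axis i 1) (axis j 1)"
    unfolding bil_transpose_mm[symmetric] bil_axis kform_def ..
   then show "kform G (bJ E) c z$i$j = (\<Sum>s\<in>UNIV. (b$s * t + a$s) *\<^sub>R \<Omega> s z)$i$j"
    unfolding Gb bf(1)[OF z bJ_coord[OF c zc] ax(2)] bf(2)[OF z ax(1) ax(1)]
    by (simp add: sum_component \<Omega>_def w_def bil_transpose_mm[symmetric] bil_congruence[symmetric] bil_axis)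
  qed
  also have "\<dots> = (\<Sum>s\<in>UNIV. (b$s * t + a$s) * ext3 (\<Omega> s) i j k y)"
  proof -
   have p: "pd i (\<lambda>z. (\<Sum>s\<in>UNIV. (b$s * t + a$s) *\<^sub>R \<Omega> s z)$j$k) y = (\<Sum>s\<in>UNIV. (b$s * t + a$s) * pd i (\<lambda>z. \<Omega> s z$j$k) y)"
    if "i \<in> K" for i j k
    using pd_sum[OF U smooth_mult[OF U smooth_const[OF U] smooth_nth[OF U smooth_nth[OF U s\<Omega>]]] that yU]
     pd_mult[OF U smooth_const[OF U] smooth_nth[OF U smooth_nth[OF U s\<Omega>]] that yU]
    by (simp add: sum_component pds_pd[OF pds_const])
   show ?thesis unfolding ext3_def p[OF ijk(1)] p[OF ijk(2)] p[OF ijk(3)] by (simp add: sum.distrib algebra_simps)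
  qed
  also have "\<dots> = 0"
  proof -
   have "ext3 (\<Omega> s) i j k y = ext3v (L s) (w s) (f2 c C s y) (pd i (f2 c C s) y) (pd j (f2 c C s) y) (pd k (f2 c C s) y)" for s
    unfolding \<Omega>_def by (rule ext3_pullback[OF U V sf fU sw _ yU ijk]) (rule aw)
   moreover have "pd i (f2 c C s) y \<in> coord (L s)" if "i \<in> K" for i s
    using jc[of y s "axis i 1", OF yU] that by (simp add: matrix_vector_mult_basis column_def jac_nth vec_lambda_eta)
   ultimately show ?thesis using ext3v_zero[OF V sw fy zw[OF fy]] ijk by simp
  qed
  finally show "pd i (\<lambda>z. kform G (bJ E) c z$j$k) y + pd j (\<lambda>z. kform G (bJ E) c z$k$i) y + pd k (\<lambda>z. kform G (bJ E) c z$i$j) y = 0"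
   by (simp add: ext3_def)
 qed
qed

text \<open>The Ricci tensor of the product is the sum of the pulled-back Ricci tensors, whatever
  the weights. By the Einstein condition with constant 1 it therefore equals 1 on every vector of an
  adapted frame.\<close>

lemma construction_two_good_base:
 assumes a: "a \<in> parameters b"
 shows "good_base E b (\<lambda>i. card (L i)) a"
 unfolding good_base_def
proof (intro conjI ballI)
 have A: "b$i * t + a$i > 0" if "t \<in> {0..1}" for i t using a that by (simp add: parameters_def)
 show k: "kaehler (base E) (base_metric E a b t) (bJ E)" if "t \<in> {0..1}" for t by (rule kaehler_two[OF A[OF that]])
 fix c z assume c: "c \<in> atlas (base E)" and "z \<in> crange c"
 then obtain q where q: "q \<in> fst c" and y: "z = snd c q" by (auto elim: crangeE)
 obtain C where C: "\<And>i. C i \<in> atlas (N i)" "\<And>i. pr i q \<in> fst (C i)" using choose_C[OF c q] by blast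
 note ctx = c q C
 define U where "U = snd c ` (fst c \<inter> W2 C)"
 note U = U2[OF ctx, folded U_def] and sf = smooth_f2[OF ctx, folded U_def] and fU = f2_U[OF ctx, folded U_def]
   and bf = bg_f2[OF ctx, folded U_def] and yU = q_U2[OF ctx, folded U_def y]
 note bj = blk_jac_f2[OF ctx yU[unfolded U_def]]
 interpret g: kaehler_chart "L i" "crange (C i)" "gN i (C i)" "JN i (C i)" for i by (rule kN[OF ctx])
 have fy: "f2 c C i z \<in> crange (C i)" for i using fU yU by blast
 have "\<exists>e. (\<forall>r<card (L i). e r \<in> coord (L i)) \<and> (\<forall>r<card (L i). \<forall>s<card (L i). bil (gN i (C i) (f2 c C i z)) (e r) (e s) = (if r = s then 1 else 0))" for i
  using gram_schmidt[OF subspace_coord, of "L i" "bil (gN i (C i) (f2 c C i z))"] bil_sym[OF g.sym_G[OF fy]] g.pos_G[OF fy]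
  unfolding dim_coord by (simp add: bil_def inner_add_left matrix_vector_right_distrib)
 then obtain e where e: "\<And>i r. r < card (L i) \<Longrightarrow> e i r \<in> coord (L i)"
  "\<And>i r s. r < card (L i) \<Longrightarrow> s < card (L i) \<Longrightarrow> bil (gN i (C i) (f2 c C i z)) (e i r) (e i s) = (if r = s then 1 else 0)"
  by metis
 \<comment> \<open>Lifts of the orthonormal basis of the i-th factor that the other projections
   annihilate.\<close>
 define w where "w i r = (SOME w. w \<in> coord K \<and> (\<forall>j. jac K (f2 c C j) z *v w = (if j = i then e i r else 0)))" for i r
 have "w i r \<in> coord K \<and> (\<forall>j. jac K (f2 c C j) z *v w i r = (if j = i then e i r else 0))" if "r < card (L i)" for i r
  unfolding w_def by (rule someI_ex) (use product_frame[OF bj jac_f2_inj[OF ctx, folded y] two_facts(6) e(1)[OF that]] in blast)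
 then have w: "\<And>i r. r < card (L i) \<Longrightarrow> w i r \<in> coord K" "\<And>i r j. r < card (L i) \<Longrightarrow> jac K (f2 c C j) z *v w i r = (if j = i then e i r else 0)"
  by simp_all
 obtain T \<sigma> \<rho> where T: "adapted K (\<lambda>i. bg E i c z) T \<sigma>" "\<And>i. card {\<alpha>\<in>K. \<sigma> \<alpha> = i} = card (L i)"
  "\<And>\<alpha>. \<alpha> \<in> K \<Longrightarrow> \<rho> \<alpha> < card (L (\<sigma> \<alpha>)) \<and> T *v axis \<alpha> 1 = w (\<sigma> \<alpha>) (\<rho> \<alpha>)"
 proof (rule adaptedI[of "\<lambda>i. card (L i)" w K "\<lambda>i. bg E i c z"])
  show "bil (bg E k c z) (w i r) (w j s) = (if i = k \<and> j = k \<and> r = s then 1 else 0)" if "r < card (L i)" "s < card (L j)" for k i j r s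
   unfolding bf(1)[OF yU w(1)[OF that(1)] w(1)[OF that(2)]] w(2)[OF that(1)] w(2)[OF that(2)] using e(2) that by (auto simp: bil_def)
 qed (use w two_facts(6) in auto)
 have R: "(transpose T**ricci K (base_metric E a b t c) z**T)$\<alpha>$\<alpha> = 1" if m: "metric_chart K U (base_metric E a b t c)" and \<alpha>: "\<alpha> \<in> K" for t \<alpha>
 proof -
  let ?s = "\<sigma> \<alpha>" and ?r = "\<rho> \<alpha>"
  note r = T(3)[OF \<alpha>]
  have "(transpose T**ricci K (base_metric E a b t c) z**T)$\<alpha>$\<alpha> = bil (ricci K (base_metric E a b t c) z) (w ?s ?r) (w ?s ?r)"
   unfolding bil_axis[symmetric] bil_congruence using r by simp
  also have "\<dots> = (\<Sum>i\<in>UNIV. bil (ricci (L i) (gN i (C i)) (f2 c C i z)) (jac K (f2 c C i) z *v w ?s ?r) (jac K (f2 c C i) z *v w ?s ?r))"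
   by (rule pullback_ricci_bil[OF m g.metric_chart_axioms sf fU _ two_facts(6) yU, where A = "\<lambda>i. b$i * t + a$i"])
    (use w r bf(1) in \<open>auto simp: base_metric_def bil_sum_scale\<close>)
  also have "\<dots> = (\<Sum>i\<in>UNIV. if i = ?s then bil (ricci (L i) (gN i (C i)) (f2 c C i z)) (e ?s ?r) (e ?s ?r) else 0)"
   using w(2) r by (intro sum.cong) (auto simp: bil_def)
  also have "\<dots> = bil (ricci (L ?s) (gN ?s (C ?s)) (f2 c C ?s z)) (e ?s ?r) (e ?s ?r)" by simp
  also have "\<dots> = bil (gN ?s (C ?s) (f2 c C ?s z)) (e ?s ?r) (e ?s ?r)"
   unfolding bil_coord[OF e(1)[OF conjunct1[OF r]] e(1)[OF conjunct1[OF r]]] using two_facts(4)[of ?s] C(1)[of ?s] fy[of ?s]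
   by (intro sum.cong) (simp_all add: einstein_def)
  finally show ?thesis using e(2) r by simp
 qed
 show "\<exists>T \<sigma>. adapted K (\<lambda>i. bg E i c z) T \<sigma> \<and> (\<forall>i. card {\<alpha>\<in>K. \<sigma> \<alpha> = i} = card (L i))" using T(1,2) by blast
 fix t :: real assume t: "t \<in> {0<..<1}"
 have "kaehler_chart K U (base_metric E a b t c) (bJ E c)"
  by (rule kaehler_chart_subset[OF kaehler_chartI[OF B k c] U]) (use t U2_sub[OF ctx] in \<open>auto simp: U_def\<close>)
 then have m: "metric_chart K U (base_metric E a b t c)" by (rule kaehler_chart.axioms(1))
 have At: "b$i * t + a$i > 0" for i using A[of t i] t by simp
 show "scalar_curvature K (base_metric E a b t c) z = (\<Sum>i\<in>UNIV. real (card (L i)) / (b$i * t + a$i))"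
  unfolding metric_chart.scalar_curvature_trace[OF m yU]
  using trace_adapted[of K "\<lambda>i. bg E i c z" T \<sigma> "\<lambda>i. card (L i)" "\<lambda>i. b$i * t + a$i", OF T(1,2) At R[OF m]] by (simp add: base_metric_def)
qed

end

subsection \<open>Coadjoint orbits\<close>

text \<open>The Ricci form depends only on \<open>J\<close> and the volume form, so it is the same for both metrics.\<close>

lemma scalar_curvature_compare:
 assumes "kaehler_chart K V G J" and "kaehler_chart K V G' J"
  and ind: "\<And>l z. l \<in> K \<Longrightarrow> z \<in> V \<Longrightarrow> trace (ginv K (G z)**pd l (\<lambda>z. hat K (G z)) z) = trace (ginv K (G' z)**pd l (\<lambda>z. hat K (G' z)) z)"
  and z: "z \<in> V"
 shows "scalar_curvature K G' z = trace (ginv K (G' z)**(PI K**ricci K G z**PI K))"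
proof -
 interpret A: kaehler_chart K V G J by fact
 interpret B: kaehler_chart K V G' J by fact
 define D where "D j y = B.\<Gamma> j y - A.\<Gamma> j y" for j y
 have bD: "blk K K (D j y)" for j y unfolding D_def by (intro blk_diff A.blk_Gam B.blk_Gam)
 have sD: "smooth K V (D j)" if "j \<in> K" for j unfolding D_def by (intro smooth_diff[OF A.U] A.smooth_Gam B.smooth_Gam that)
 have com: "J y**D j y = D j y**J y" if "j \<in> K" "y \<in> V" for j y
  using A.nabla_J[OF that(2,1)] B.nabla_J[OF that(2,1)] unfolding D_def by (simp add: mm_ring algebra_simps)
 have trD: "trace (D j y) = 0" if "j \<in> K" "y \<in> V" for j y
  using A.trace_Gam[OF that(2,1)] B.trace_Gam[OF that(2,1)] ind[OF that] unfolding D_def by (simp add: trace_linear)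
 have tJD: "trace (J y**D k y) = 0" if "k \<in> K" "y \<in> V" for k y
 proof -
  have "trace (J y**D k y) = (\<Sum>l\<in>K. J y$l$k * trace (D l y))"
  proof (rule trace_J_torsion[OF A.blk_J[OF that(2)] bD com[OF _ that(2)] _ _ _ that(1)])
   show "D j y$a$k - D k y$a$j = 0" for j k a using A.Gam_sym[OF that(2)] B.Gam_sym[OF that(2)] by (simp add: D_def)
  qed simp_all
  then show ?thesis using trD that by simp
 qed
 have "trace (J z**B.R j k z) = trace (J z**A.R j k z)" if "j \<in> K" "k \<in> K" for j k
 proof -
  have "pd j (\<lambda>y. trace (J y**D k y)) z = 0" if "j \<in> K" "k \<in> K" for j k
   using pd_cong[OF A.U z that(1) tJD[OF that(2)]] by (simp add: pds_pd[OF pds_const])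
  moreover have "trace (J z**B.R j k z) = trace (J z**A.R j k z) + pd j (\<lambda>y. trace (J y**D k y)) z - pd k (\<lambda>y. trace (J y**D j y)) z"
   by (rule trace_riem_difference[OF A.U A.smooth_J A.smooth_Gam sD _ A.nabla_J com z that]) (simp_all add: D_def)
  ultimately show ?thesis using that by simp
 qed
 then have rf: "B.rform z = A.rform z" by (simp add: A.rform_def B.rform_def vec_eq_iff)
 have "2 * scalar_curvature K G' z = 2 * trace (B.Hi z**A.Rc z)"
  unfolding B.scalar_curvature_rform[OF z] rf A.rform_Rc[OF z] by (rule B.trace_J_form[OF z A.blk_Rc])
 then show ?thesis by (simp add: A.Rc_def)
qed

locale coadjoint_base = kaehler_ansatz M g J E b x l u h a
 for M :: "('p, 'n::finite) mfd" and g J :: "('p, 'n) tensor2" and E :: "('p, 'n, 'q, 'k::finite, 'm::finite) circle_bundle"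
  and b :: "real^'m" and x :: "'p \<Rightarrow> real" and l u :: real and h :: "real \<Rightarrow> real" and a :: "real^'m" +
 fixes G :: "(real^'s^'s) set" and act actB \<mu> p0 T P
 assumes one: "construction_one M g J E b x l u a G act actB \<mu> p0 T P"
begin

abbreviation "flow X \<equiv> \<lambda>t. act (mexp (t *\<^sub>R X))"
abbreviation "q0 \<equiv> \<pi> p0"

lemma one_facts: "matrix_group G" "lie_action G act M" "moment_map G act M (kform g J) \<mu>" "lie_action G actB B" "p0 \<in> M0"
  "isotropy_splitting G (stab G act p0) T P" "card K = (\<Sum>i\<in>UNIV. dim (P i))"
  "A \<in> G \<Longrightarrow> is_pullback M M (act A) g g" "A \<in> G \<Longrightarrow> is_pullback B B (actB A) (bg E i) (bg E i)"
  "p \<in> pts M \<Longrightarrow> (\<lambda>A. act A p) ` G = {q\<in>pts M. x q = x p}"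
  "A \<in> G \<Longrightarrow> p \<in> pts M \<Longrightarrow> \<pi> (act A p) = actB A (\<pi> p)"
 using one unfolding construction_one_def Let_def by simp_all

lemma one_chart:
 assumes "c \<in> atlas B" "q0 \<in> fst c"
 shows "\<lbrakk>X \<in> P j; Y \<in> P k; \<not> (j = i \<and> k = i)\<rbrakk> \<Longrightarrow> bil (bg E i c (snd c q0)) (fundamental actB X c q0) (fundamental actB Y c q0) = 0"
  and "X \<in> P i \<Longrightarrow> X \<noteq> 0 \<Longrightarrow> bil (bg E i c (snd c q0)) (fundamental actB X c q0) (fundamental actB X c q0) > 0"
  and "\<lbrakk>t \<in> {l<..<u}; X \<in> P i; bil (bg E i c (snd c q0)) (fundamental actB X c q0) (fundamental actB X c q0) = 1\<rbrakk> \<Longrightarrow>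
   bil (ricci K (gB t c) (snd c q0)) (fundamental actB X c q0) (fundamental actB X c q0) = 1"
proof -
 have "\<forall>c\<in>atlas B. q0 \<in> fst c \<longrightarrow>
    (let q = q0; y = snd c q; F = (\<lambda>X. fundamental actB X c q) in
    (\<forall>i j k. \<forall>X\<in>P j. \<forall>Y\<in>P k. \<not> (j = i \<and> k = i) \<longrightarrow> bil (bg E i c y) (F X) (F Y) = 0) \<and>
    (\<forall>i. \<forall>X\<in>P i. X \<noteq> 0 \<longrightarrow> bil (bg E i c y) (F X) (F X) > 0) \<and>
    (\<forall>t\<in>{l<..<u}. \<forall>i. \<forall>Y\<in>P i. bil (bg E i c y) (F Y) (F Y) = 1 \<longrightarrow>
      bil (ricci K (gB t c) y) (F Y) (F Y) = 1))"
  by (insert one[unfolded construction_one_def Let_def], unfold Let_def, elim conjE, assumption)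
 note C = this[rule_format, OF assms, unfolded Let_def]
 show "\<lbrakk>X \<in> P j; Y \<in> P k; \<not> (j = i \<and> k = i)\<rbrakk> \<Longrightarrow> bil (bg E i c (snd c q0)) (fundamental actB X c q0) (fundamental actB Y c q0) = 0"
  using C by blast
 show "X \<in> P i \<Longrightarrow> X \<noteq> 0 \<Longrightarrow> bil (bg E i c (snd c q0)) (fundamental actB X c q0) (fundamental actB X c q0) > 0" using C by blast
 show "\<lbrakk>t \<in> {l<..<u}; X \<in> P i; bil (bg E i c (snd c q0)) (fundamental actB X c q0) (fundamental actB X c q0) = 1\<rbrakk> \<Longrightarrow>
   bil (ricci K (gB t c) (snd c q0)) (fundamental actB X c q0) (fundamental actB X c q0) = 1" using C by blast
qed

lemma P_lie: "subspace (P i)" "P i \<subseteq> lie_alg G" "P i \<noteq> {0}"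
 using one_facts(6) unfolding isotropy_splitting_def by simp_all

lemma act_smooth: "A \<in> G \<Longrightarrow> smooth_map M M (act A)" and actB_smooth: "A \<in> G \<Longrightarrow> smooth_map B B (actB A)"
 using one_facts(2,4) unfolding lie_action_def by simp_all

lemma x_act: "A \<in> G \<Longrightarrow> p \<in> pts M \<Longrightarrow> x (act A p) = x p"
 using one_facts(10)[of p] by blast

text \<open>The equivariant projection carries the flow on M to the flow on the base; differentiate
  at time 0. It moves questions about fundamental fields to M, where the moment map controls
  them.\<close>

lemma fundamental_eq:
 assumes X: "X \<in> lie_alg G" and V: "is_flow M (flow X) V" and c: "c \<in> atlas M" "c' \<in> atlas B" and p: "p \<in> fst c" "\<pi> p \<in> fst c'"
 shows "fundamental actB X c' (\<pi> p) = D\<pi> c c' p (V c (snd c p))"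
proof -
 note pM = chart_pts[OF M c(1) p(1)]
 define f where "f = r\<pi> c c'"
 define \<gamma> where "\<gamma> t = snd c (flow X t p)" for t
 define S where "S = {t. flow X t p \<in> W c c'}"
 have G: "mexp (t *\<^sub>R X) \<in> G" for t using X by (simp add: lie_alg_def)
 have f0: "flow X 0 p = p" and cont: "continuous_map euclideanreal (mtop M) (\<lambda>t. flow X t p)"
  and der: "(\<gamma> has_vector_derivative V c (snd c p)) (at 0)"
  using V pM c(1) p(1) unfolding is_flow_def \<gamma>_def by simp_all
 have "openin (mtop M) (W c c')" unfolding W_def by (intro openin_Int chart_facts(1)[OF M c(1)] open_W[OF c(2)])
 then have S: "open S" using openin_continuous_map_preimage[OF cont] by (simp add: S_def)
 have pW: "p \<in> W c c'" using p pM by (simp add: W_def)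
 then have S0: "0 \<in> S" using f0 by (simp add: S_def)
 have \<gamma>S: "\<gamma> ` S \<subseteq> snd c ` W c c'" by (auto simp: \<gamma>_def S_def)
 have \<gamma>0: "\<gamma> 0 = snd c p" using f0 by (simp add: \<gamma>_def)
 have "(f has_derivative (\<lambda>v. \<Sum>j\<in>I. v$j *\<^sub>R pd j f (\<gamma> 0))) (at (\<gamma> 0) within snd c ` W c c')"
  unfolding \<gamma>0 by (rule Ck_has_derivative[OF open_cW[OF c] smooth_Ck]) (use smooth_\<pi>[OF c] pW in \<open>simp_all add: f_def\<close>)
 then have "(f has_derivative (\<lambda>v. \<Sum>j\<in>I. v$j *\<^sub>R pd j f (\<gamma> 0))) (at (\<gamma> 0) within \<gamma> ` S)"
  using \<gamma>S by (rule has_derivative_subset)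
 moreover have "(\<gamma> has_derivative (\<lambda>s. s *\<^sub>R V c (snd c p))) (at 0 within S)"
  using der by (simp add: has_vector_derivative_def has_derivative_at_withinI)
 ultimately have "(f \<circ> \<gamma> has_derivative (\<lambda>v. \<Sum>j\<in>I. v$j *\<^sub>R pd j f (\<gamma> 0)) \<circ> (\<lambda>s. s *\<^sub>R V c (snd c p))) (at 0 within S)"
  by (rule diff_chain_within[rotated])
 then have "(f \<circ> \<gamma> has_vector_derivative D\<pi> c c' p (V c (snd c p))) (at 0)"
  unfolding at_within_open[OF S0 S] has_vector_derivative_def
  by (simp add: comp_def dmap_def \<gamma>0 f_def scaleR_sum_right)
 then have "((\<lambda>t. snd c' (actB (mexp (t *\<^sub>R X)) (\<pi> p))) has_vector_derivative D\<pi> c c' p (V c (snd c p))) (at 0)"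
  by (rule has_vector_derivative_transform_within_open[OF _ S S0])
   (use one_facts(11)[OF G pM] pointM[OF c(1)] in \<open>simp add: S_def W_def f_def \<gamma>_def\<close>)
 then show ?thesis unfolding fundamental_def by (rule vector_derivative_at)
qed

text \<open>The generator is chosen to satisfy the moment map equation, so that linearity of
  \<open>\<mu>\<close> can be brought to bear on it.\<close>

definition V where "V X = (SOME V. is_flow M (flow X) V \<and> (\<forall>c\<in>atlas M. \<forall>y\<in>crange c. \<forall>w\<in>coord I.
  dfun I c (\<lambda>p. \<mu> p X) y w = bil (kform g J c y) (V c y) w))"

lemma V: assumes "X \<in> lie_alg G"
 shows "is_flow M (flow X) (V X)" "\<lbrakk>c \<in> atlas M; y \<in> crange c; w \<in> coord I\<rbrakk> \<Longrightarrow> dfun I c (\<lambda>p. \<mu> p X) y w = bil (kform g J c y) (V X c y) w"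
proof -
 have "\<exists>V. is_flow M (flow X) V \<and> (\<forall>c\<in>atlas M. \<forall>y\<in>crange c. \<forall>w\<in>coord I. dfun I c (\<lambda>p. \<mu> p X) y w = bil (kform g J c y) (V c y) w)"
  using one_facts(3) assms by (simp add: moment_map_def)
 from someI_ex[OF this, folded V_def]
 show "is_flow M (flow X) (V X)" "\<lbrakk>c \<in> atlas M; y \<in> crange c; w \<in> coord I\<rbrakk> \<Longrightarrow> dfun I c (\<lambda>p. \<mu> p X) y w = bil (kform g J c y) (V X c y) w"
  by simp_all
qed

lemma V_coord: "\<lbrakk>X \<in> lie_alg G; c \<in> atlas M; y \<in> crange c\<rbrakk> \<Longrightarrow> V X c y \<in> coord I"
 using V(1)[of X] by (auto simp: is_flow_def vector_field_def)

text \<open>Linearity of the moment map transfers to the fundamental fields since the Kaehler form is nondegenerate.\<close>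

lemma V_linear:
 assumes X: "X \<in> lie_alg G" and Y: "Y \<in> lie_alg G" and XY: "r *\<^sub>R X + s *\<^sub>R Y \<in> lie_alg G" and c: "c \<in> atlas M" and y: "y \<in> crange c"
 shows "V (r *\<^sub>R X + s *\<^sub>R Y) c y = r *\<^sub>R V X c y + s *\<^sub>R V Y c y"
proof -
 note U = chM[OF c]
 have sm: "smooth I (crange c) (\<lambda>y. \<mu> (point c y) X)" if "X \<in> lie_alg G" for X
  using one_facts(3) c that unfolding moment_map_def smooth_fun_def comp_def by simp
 define v where "v = V (r *\<^sub>R X + s *\<^sub>R Y) c y - (r *\<^sub>R V X c y + s *\<^sub>R V Y c y)"
 have v: "v \<in> coord I" unfolding v_def by (intro subspace_diff subspace_add subspace_scale subspace_coord V_coord c y X Y XY)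
 have "pd i (\<lambda>y. \<mu> (point c y) (r *\<^sub>R X + s *\<^sub>R Y)) y = r * pd i (\<lambda>y. \<mu> (point c y) X) y + s * pd i (\<lambda>y. \<mu> (point c y) Y) y" if i: "i \<in> I" for i
 proof -
  have "pd i (\<lambda>y. \<mu> (point c y) (r *\<^sub>R X + s *\<^sub>R Y)) y = pd i (\<lambda>y. r * \<mu> (point c y) X + s * \<mu> (point c y) Y) y"
   by (rule pd_cong[OF U y i]) (use one_facts(3) X Y chart_pts[OF M c point_in(1)] in \<open>simp add: moment_map_def\<close>)
  then show ?thesis
   using pd_add[OF U smooth_mult[OF U smooth_const[OF U] sm[OF X]] smooth_mult[OF U smooth_const[OF U] sm[OF Y]] i y, of r s]
    pd_mult[OF U smooth_const[OF U] sm[OF X] i y, of r] pd_mult[OF U smooth_const[OF U] sm[OF Y] i y, of s] by (simp add: pds_pd[OF pds_const])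
 qed
 then have "dfun I c (\<lambda>p. \<mu> p (r *\<^sub>R X + s *\<^sub>R Y)) y w = r * dfun I c (\<lambda>p. \<mu> p X) y w + s * dfun I c (\<lambda>p. \<mu> p Y) y w" for w
  by (simp add: dfun_def comp_def sum_distrib_left sum.distrib[symmetric] algebra_simps)
 then have "bil (kform g J c y) v w = 0" if "w \<in> coord I" for w
  using V(2)[OF X c y that] V(2)[OF Y c y that] V(2)[OF XY c y that] by (simp add: v_def bil_def inner_diff_left inner_add_left)
 then have "bil (g c y) (J c y *v v) (J c y *v v) = 0"
  unfolding kform_def bil_transpose_mm using J_facts(2)[OF c y] by simp
 then have "J c y *v v = 0" using g_facts(4)[OF c y J_facts(2)[OF c y]] by force
 then have "v = 0" using J_sq[OF c y v] by simp
 then show ?thesis by (simp add: v_def)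
qed

text \<open>The map from \<open>P i\<close> to fundamental fields at \<open>q0\<close> is linear by
  \<open>V_linear\<close>, so Gram-Schmidt on each \<open>P i\<close> yields vectors on which the
  hypotheses about \<open>bg\<close> and Ricci can be evaluated.\<close>

lemma adapted_q0:
 assumes c: "c \<in> atlas B" and q: "q0 \<in> fst c"
 shows "\<exists>T \<sigma>. adapted K (\<lambda>i. bg E i c (snd c q0)) T \<sigma> \<and> (\<forall>i. card {\<alpha>\<in>K. \<sigma> \<alpha> = i} = dim (P i)) \<and>
  (\<forall>t\<in>{l<..<u}. \<forall>\<alpha>\<in>K. (transpose T**ricci K (gB t c) (snd c q0)**T)$\<alpha>$\<alpha> = 1)"
proof -
 obtain d where d: "d \<in> atlas M" "p0 \<in> fst d" using chart_cover[OF M M0_pts[OF one_facts(5)]] by blast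
 define F where "F X = fundamental actB X c q0" for X
 have F: "F X = D\<pi> d c p0 (V X d (snd d p0))" if "X \<in> lie_alg G" for X
  unfolding F_def by (rule fundamental_eq[OF that V(1)[OF that] d(1) c d(2) q])
 have Fc: "F X \<in> coord K" if "X \<in> lie_alg G" for X unfolding F[OF that] by (rule d\<pi>_coord[OF d(1) c d(2) q])
 have lin: "F (r *\<^sub>R X + s *\<^sub>R Y) = r *\<^sub>R F X + s *\<^sub>R F Y" if "X \<in> P i" "Y \<in> P i" for r s X Y i
 proof -
  have L: "X \<in> lie_alg G" "Y \<in> lie_alg G" "r *\<^sub>R X + s *\<^sub>R Y \<in> lie_alg G"
   using that P_lie[of i] subspace_add[OF P_lie(1) subspace_scale[OF P_lie(1)] subspace_scale[OF P_lie(1)]] by blast+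
  show ?thesis unfolding F[OF L(1)] F[OF L(2)] F[OF L(3)] V_linear[OF L d(1) snd_crange[OF d(2)]] dmap_linear ..
 qed
 define Q where "Q i X Y = bil (bg E i c (snd c q0)) (F X) (F Y)" for i X Y
 note O = one_chart[OF c q, folded F_def]
 have PL: "X \<in> P i \<Longrightarrow> X \<in> lie_alg G" for X i using P_lie(2) by blast
 have "\<exists>e. (\<forall>r<dim (P i). e r \<in> P i) \<and> (\<forall>r<dim (P i). \<forall>s<dim (P i). Q i (e r) (e s) = (if r = s then 1 else 0))" for i
 proof (rule gram_schmidt[OF P_lie(1)])
  show "Q i (r *\<^sub>R X + s *\<^sub>R Y) Z = r * Q i X Z + s * Q i Y Z" if "X \<in> P i" "Y \<in> P i" "Z \<in> P i" for X Y Z r s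
   unfolding Q_def lin[OF that(1,2)] by (simp add: bil_def inner_add_left)
  show "Q i X Y = Q i Y X" if "X \<in> P i" "Y \<in> P i" for X Y
   unfolding Q_def by (rule bil_sym[OF bg_sym[OF c snd_crange[OF q]] Fc[OF PL[OF that(1)]] Fc[OF PL[OF that(2)]]])
  show "Q i X X > 0" if "X \<in> P i" "X \<noteq> 0" for X unfolding Q_def by (rule O(2)[OF that])
 qed
 then obtain e where e: "\<And>i r. r < dim (P i) \<Longrightarrow> e i r \<in> P i"
  "\<And>i r s. r < dim (P i) \<Longrightarrow> s < dim (P i) \<Longrightarrow> Q i (e i r) (e i s) = (if r = s then 1 else 0)" by metis
 obtain A \<sigma> \<rho> where A: "adapted K (\<lambda>i. bg E i c (snd c q0)) A \<sigma>" "\<And>i. card {\<alpha>\<in>K. \<sigma> \<alpha> = i} = dim (P i)"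
  "\<And>\<alpha>. \<alpha> \<in> K \<Longrightarrow> \<rho> \<alpha> < dim (P (\<sigma> \<alpha>)) \<and> A *v axis \<alpha> 1 = F (e (\<sigma> \<alpha>) (\<rho> \<alpha>))"
 proof (rule adaptedI[of "\<lambda>i. dim (P i)" "\<lambda>i r. F (e i r)" K "\<lambda>i. bg E i c (snd c q0)"])
  show "F (e i r) \<in> coord K" if "r < dim (P i)" for i r by (rule Fc[OF PL[OF e(1)[OF that]]])
  show "card K = (\<Sum>i\<in>UNIV. dim (P i))" by (rule one_facts(7))
  show "bil (bg E k c (snd c q0)) (F (e i r)) (F (e j s)) = (if i = k \<and> j = k \<and> r = s then 1 else 0)" if "r < dim (P i)" "s < dim (P j)" for k i j r s
   using O(1)[OF e(1)[OF that(1)] e(1)[OF that(2)], of k] e(2)[of r k s] that by (cases "i = k \<and> j = k") (auto simp: Q_def)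
 qed (rule that; assumption)
 have "(transpose A**ricci K (gB t c) (snd c q0)**A)$\<alpha>$\<alpha> = 1" if "t \<in> {l<..<u}" "\<alpha> \<in> K" for t \<alpha>
  unfolding bil_axis[symmetric] bil_congruence
  using A(3)[OF that(2)] O(3)[OF that(1) e(1)] e(2) by (auto simp: Q_def)
 then show ?thesis using A(1,2) by blast
qed

text \<open>The orbits of G on M are the level sets of x, and each interior one meets every fibre of
  the projection.\<close>

lemma transitive: assumes q: "q \<in> pts B" shows "\<exists>A\<in>G. actB A q0 = q"
proof -
 have p0: "p0 \<in> pts M" by (rule M0_pts[OF one_facts(5)])
 obtain p where p: "p \<in> M0" "x p = x p0" "\<pi> p = q" using cp_facts(11)[OF M0_x[OF one_facts(5)] q] by blast
 then have "p \<in> (\<lambda>A. act A p0) ` G" using one_facts(10)[OF p0] M0_pts by blast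
 then show ?thesis using one_facts(11)[OF _ p0] p(3) by auto
qed

text \<open>The frame is transported from \<open>q0\<close> by an element of G, which preserves
  every summand tensor and therefore the base metrics and their Ricci tensors.\<close>

lemma adapted_all:
 assumes c: "c \<in> atlas B" and z: "z \<in> crange c"
 shows "\<exists>T \<sigma>. adapted K (\<lambda>i. bg E i c z) T \<sigma> \<and> (\<forall>i. card {\<alpha>\<in>K. \<sigma> \<alpha> = i} = dim (P i)) \<and>
  (\<forall>t\<in>{l<..<u}. \<forall>\<alpha>\<in>K. (transpose T**ricci K (gB t c) z**T)$\<alpha>$\<alpha> = 1)"
proof -
 obtain q where q: "q \<in> fst c" "z = snd c q" using z by (rule crangeE)
 obtain A where A: "A \<in> G" "actB A q0 = q" using transitive[OF chart_pts[OF clB c q(1)]] by blast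
 note p0 = M0_pts[OF one_facts(5)]
 obtain c0 where c0: "c0 \<in> atlas B" "q0 \<in> fst c0" using chart_cover[OF clB \<pi>_pts[OF p0]] by blast
 define y0 where "y0 = snd c0 q0"
 obtain C \<sigma> where C: "adapted K (\<lambda>i. bg E i c0 y0) C \<sigma>" "\<And>i. card {\<alpha>\<in>K. \<sigma> \<alpha> = i} = dim (P i)"
  "\<And>t \<alpha>. t \<in> {l<..<u} \<Longrightarrow> \<alpha> \<in> K \<Longrightarrow> (transpose C**ricci K (gB t c0) y0**C)$\<alpha>$\<alpha> = 1"
  using adapted_q0[OF c0] unfolding y0_def by blast
 define S where "S = {p \<in> pts B. actB A p \<in> fst c}"
 define f where "f = snd c \<circ> actB A \<circ> point c0"
 define U where "U = snd c0 ` (fst c0 \<inter> S)"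
 note sA = actB_smooth[OF A(1)]
 have S: "openin (mtop B) S" unfolding S_def by (rule open_preimage[OF clB clB sA chart_facts(1)[OF clB c]])
 have fS: "\<And>p. p \<in> fst c0 \<Longrightarrow> p \<in> S \<Longrightarrow> actB A p \<in> fst c" by (simp add: S_def)
 have U: "ropen K U" unfolding U_def by (rule chart_open_image[OF clB c0(1) S])
 have sf: "smooth K U f" unfolding U_def f_def by (rule lrep_smooth[OF clB clB sA c0(1) c S fS])
 have fU: "f ` U \<subseteq> crange c" unfolding U_def f_def by (rule lrep_image[OF clB clB sA c0(1) c S fS])
 have y0: "y0 \<in> U" using c0(2) \<pi>_pts[OF p0] A(2) q(1) by (auto simp: y0_def U_def S_def)
 have fy0: "f y0 = z" using A(2) point_snd[OF clB c0] q(2) by (simp add: f_def y0_def)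
 have bJ: "blk K K (jac K f y)" if "y \<in> U" for y
  by (rule blk_jac[OF U sf _ that]) (use fU openin_imp_subset[OF chB[OF c]] in blast)
 have pb: "bil (bg E i c0 y) v w = bil (bg E i c (f y)) (jac K f y *v v) (jac K f y *v w)" if y: "y \<in> U" and v: "v \<in> coord K" "w \<in> coord K" for i y v w
 proof -
  obtain p where p: "p \<in> fst c0" "p \<in> S" "y = snd c0 p" using y unfolding U_def by blast
  show ?thesis using is_pullbackD[OF one_facts(9)[OF A(1), of i] c0(1) c p(1) fS[OF p(1,2)] v]
   unfolding dmap_jac[OF v(1)] dmap_jac[OF v(2)] p(3) f_def[symmetric] using point_snd[OF clB c0(1) p(1)] by (simp add: f_def)
 qed
 define D where "D = jac K f y0"
 have bC: "blk K K C" using C(1) by (simp add: adapted_def)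
 note Cc = blk_mv_coord[OF bC]
 have "transpose (D**C)**bg E i c z**(D**C) = transpose C**bg E i c0 y0**C" for i
 proof -
  have "(transpose (D**C)**bg E i c z**(D**C))$r$s = (transpose C**bg E i c0 y0**C)$r$s" for r s
   unfolding bil_axis[symmetric] bil_congruence pb[OF y0 Cc Cc] fy0 D_def matrix_vector_mul_assoc ..
  then show ?thesis by (simp add: vec_eq_iff)
 qed
 then have ad: "adapted K (\<lambda>i. bg E i c z) (D**C) \<sigma>"
  using C(1) blk_mm[OF bJ[OF y0] bC] unfolding adapted_def D_def by simp
 have "(transpose (D**C)**ricci K (gB t c) z**(D**C))$\<alpha>$\<alpha> = 1" if t: "t \<in> {l<..<u}" and \<alpha>: "\<alpha> \<in> K" for t \<alpha>
 proof -
  note kb = kaehler_chartI[OF clB kaehler_base_metric[OF t]]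
  have m: "metric_chart K (crange c) (gB t c)" by (rule kaehler_chart.axioms(1)[OF kb[OF c]])
  have m0: "metric_chart K U (gB t c0)"
   by (rule kaehler_chart.axioms(1)[OF kaehler_chart_subset[OF kb[OF c0(1)] U]]) (auto simp: U_def crange_def)
  have "bil (ricci K (gB t c0) y0) (C *v axis \<alpha> 1) (C *v axis \<alpha> 1) =
   (\<Sum>i\<in>(UNIV :: unit set). bil (ricci K (gB t c) (f y0)) (jac K f y0 *v (C *v axis \<alpha> 1)) (jac K f y0 *v (C *v axis \<alpha> 1)))"
   by (rule pullback_ricci_bil[OF m0 m sf fU _ _ y0 Cc Cc, where A = "\<lambda>_. 1"]) (simp_all add: base_metric_bil pb)
  then show ?thesis using C(3)[OF t \<alpha>]
   unfolding bil_axis[symmetric] bil_congruence by (simp add: fy0 D_def matrix_vector_mul_assoc)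
 qed
 then show ?thesis using ad C(2) by blast
qed

text \<open>The Ricci tensor is normalized only for the metrics induced by the given
  \<open>a\<close>. The new metric has a proportional volume form, so by
  \<open>scalar_curvature_compare\<close> its scalar curvature is the trace of that same Ricci
  tensor.\<close>

lemma construction_one_good_base:
 assumes a': "a' \<in> kaehler_parameters E b"
 shows "good_base E b (\<lambda>i. dim (P i)) a'"
 unfolding good_base_def
proof (intro conjI ballI)
 have A': "b$i * t + a'$i > 0" if "t \<in> {0..1}" for i t using a' that by (simp add: kaehler_parameters_def parameters_def)
 show k: "kaehler B (base_metric E a' b t) (bJ E)" if "t \<in> {0..1}" for t using a' that by (simp add: kaehler_parameters_def)
 fix c z assume c: "c \<in> atlas B" and z: "z \<in> crange c"
 have ad: "\<exists>T \<sigma>. adapted K (\<lambda>i. bg E i c z) T \<sigma> \<and> (\<forall>i. card {\<alpha>\<in>K. \<sigma> \<alpha> = i} = dim (P i))" if "z \<in> crange c" for z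
  using adapted_all[OF c that] by blast
 show "\<exists>T \<sigma>. adapted K (\<lambda>i. bg E i c z) T \<sigma> \<and> (\<forall>i. card {\<alpha>\<in>K. \<sigma> \<alpha> = i} = dim (P i))" by (rule ad[OF z])
 fix t :: real assume t: "t \<in> {0<..<1}"
 \<comment> \<open>The reference metric is the one induced at the momentum of \<open>p0\<close>, an
   interior value of the given ansatz.\<close>
 define s where "s = x p0"
 have s: "s \<in> {l<..<u}" unfolding s_def by (rule M0_x[OF one_facts(5)])
 obtain C \<sigma> where C: "adapted K (\<lambda>i. bg E i c z) C \<sigma>" "\<And>i. card {\<alpha>\<in>K. \<sigma> \<alpha> = i} = dim (P i)"
  "\<And>\<alpha>. \<alpha> \<in> K \<Longrightarrow> (transpose C**ricci K (gB s c) z**C)$\<alpha>$\<alpha> = 1"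
  using adapted_all[OF c z] s by blast
 have As: "b$i * s + a$i > 0" for i using ans s by (simp add: ansatz_def)
 have At: "b$i * t + a'$i > 0" for i using A'[of t i] t by simp
 have "scalar_curvature K (base_metric E a' b t c) z = trace (ginv K (base_metric E a' b t c z)**(PI K**ricci K (gB s c) z**PI K))"
 proof (rule scalar_curvature_compare[OF kaehler_chartI[OF clB kaehler_base_metric[OF s] c] kaehler_chartI[OF clB k c] _ z])
  show "trace (ginv K (gB s c y)**pd l (\<lambda>z. hat K (gB s c z)) y) =
   trace (ginv K (base_metric E a' b t c y)**pd l (\<lambda>z. hat K (base_metric E a' b t c z)) y)" if "l \<in> K" "y \<in> crange c" for l y
   unfolding base_metric_def by (rule trace_ginv_pd_indep[OF chB[OF c] bg_smooth[OF c] ad As At that(2,1)])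
 qed (use t in simp)
 also have "\<dots> = (\<Sum>i\<in>UNIV. real (dim (P i)) / (b$i * t + a'$i))"
  unfolding base_metric_def[of E a' b t] by (rule trace_adapted[OF C(1,2) At C(3)])
 finally show "scalar_curvature K (base_metric E a' b t c) z = (\<Sum>i\<in>UNIV. real (dim (P i)) / (b$i * t + a'$i))" .
qed

end

theorem theorem8p9:
  fixes M :: "('p, 'n::finite) mfd" and g J :: "('p, 'n) tensor2"
    and E :: "('p, 'n, 'q, 'k::finite, 'm::finite) circle_bundle"
    and x :: "'p \<Rightarrow> real" and l u :: real and h :: "real \<Rightarrow> real" and a b :: "real ^ 'm"
  assumes "closed_manifold M" and "kaehler M g J" and "ansatz M g J E b x l u h a"
  shows
    "(\<forall>(N :: 'm \<Rightarrow> ('r, 'j::finite) mfd) gN JN pr.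
        construction_two E N gN JN pr \<longrightarrow>
        (\<exists>F. extremal_family M J E b (parameters b) F)) \<and>
     (\<forall>(G :: (real ^ 's ^ 's) set) act actB \<mu> p0 T P.
        construction_one M g J E b x l u a G act actB \<mu> p0 T P \<longrightarrow>
        (\<exists>F. extremal_family M J E b (kaehler_parameters E b) F \<and>
          (\<forall>a'\<in>kaehler_parameters E b. \<forall>A\<in>G. is_pullback M M (act A) (F a') (F a'))))"
proof (intro conjI allI impI)
  have "complex_structure M J" using assms(2) by (simp add: kaehler_def)
  then interpret kaehler_ansatz M g J E b x l u h a
    by (intro kaehler_ansatz.intro ansatz_mfd.intro kaehler_ansatz_axioms.intro assms)
  show "\<exists>F. extremal_family M J E b (parameters b) F" if two: "construction_two E N gN JN pr"
    for N :: "'m \<Rightarrow> ('r, 'j::finite) mfd" and gN JN pr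
  proof -
    interpret N: product_base E N gN JN pr by (rule product_base.intro[OF clB cp_facts(6,7) two])
    \<comment> \<open>Every factor has positive dimension, so each parameter is visible in the
      metric; this separates the members of the family.\<close>
    have "card (idx (N i)) \<ge> 1" for i using N.two_facts(2)[of i] by (simp add: Suc_le_eq card_gt_0_iff)
    then show ?thesis using extremal_family_exists[OF subset_refl N.construction_two_good_base] by blast
  qed
  fix G :: "(real ^ 's ^ 's) set" and act actB \<mu> p0 T P
  assume one: "construction_one M g J E b x l u a G act actB \<mu> p0 T P"
  interpret coadjoint_base M g J E b x l u h a G act actB \<mu> p0 T P
    by (intro coadjoint_base.intro kaehler_ansatz_axioms coadjoint_base_axioms.intro one)
  have d: "dim (P i) \<ge> 1" for i
    using P_lie(3)[of i] subspace_0[OF P_lie(1)[of i]] dim_eq_0[of "P i"] by (auto simp: Suc_le_eq)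
  have "kaehler_parameters E b \<subseteq> parameters b" by (auto simp: kaehler_parameters_def)
  from extremal_family_exists[OF this construction_one_good_base d]
  obtain F where F: "extremal_family M J E b (kaehler_parameters E b) F"
    "\<And>f j. smooth_map M M f \<and> smooth_map B B j \<and> (\<forall>p\<in>pts M. \<pi> (f p) = j (\<pi> p) \<and> x (f p) = x p) \<and>
    (\<forall>i. is_pullback B B j (bg E i) (bg E i)) \<and> is_pullback M M f g g \<Longrightarrow> \<forall>a'\<in>kaehler_parameters E b. is_pullback M M f (F a') (F a')"
    by blast
  \<comment> \<open>Group elements preserve x, because the level sets of x are the orbits, and they
    cover their action on the base.\<close>
  have "is_pullback M M (act A) (F a') (F a')" if "a' \<in> kaehler_parameters E b" "A \<in> G" for a' A
    using F(2)[of "act A" "actB A"] act_smooth actB_smooth one_facts(8,9,11) x_act that by simp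
  then show "\<exists>F. extremal_family M J E b (kaehler_parameters E b) F \<and>
          (\<forall>a'\<in>kaehler_parameters E b. \<forall>A\<in>G. is_pullback M M (act A) (F a') (F a'))" using F(1) by blast
qed

end
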